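(* Let $\Omega\subset\mathbb{R}^2$ be a bounded Lipschitz domain, $V\in L^\infty(\Omega)$, $\eta\in L^\infty(\partial\Omega)$ (possibly complex-valued), $q:=1+V$, and let $v,w\in H^1(\Omega)$ be a pair of conductive transmission eigenfunctions associated with $k\in\mathbb{R}_+$, i.e. a pair of nontrivial solutions of $$\Delta w+k^2(1+V)w=0 \text{ in }\Omega,\qquad \Delta v+k^2v=0\text{ in }\Omega,\qquad w=v,\ \ \partial_\nu v+\eta v=\partial_\nu w\ \text{ on }\partial\Omega .$$ Assume that $\Omega$ contains a corner with vertex $0\in\partial\Omega$, i.e. $\Omega\cap B_h=W\cap B_h=S_h$ for a sufficiently small $h\in\mathbb{R}_+$, and that for this $h$ and some $0<\alpha<1$ one has $qw\in C^\alpha(\overline{S_h})$, $\eta\in C^\alpha(\overline{\Gamma_h^\pm})$ and $v-w\in H^2(\Sigma_{\Lambda_h})$. Suppose that the following conditions are fulfilled: (a) $v$ can be approximated in $H^1(S_h)$ by Herglotz functions $v_j$, $j=1,2,\ldots$, with kernels $g_j$, satisfying $$\|v-v_j\|_{H^1(S_h)}\le j^{-1-\Upsilon},\qquad \|g_j\|_{L^2(\mathbb{S}^1)}\le C j^{\varrho}$$ for some constants $C>0$, $\Upsilon>0$ and $0<\varrho<1$; (b) $\eta(0)\neq 0$; (c) $-\pi<\theta_m<\theta_M<\pi$ and $\theta_M-\theta_m\neq\pi$. Then $$\lim_{\rho\to+0}\frac{1}{m(B(0,\rho)\cap\Omega)}\int_{B(0,\rho)\cap\Omega}|v(x)|\,\mathrm{d}x=0,$$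 where $m(B(0,\rho)\cap\Omega)$ is the area of $B(0,\rho)\cap\Omega$.
   Context: $\nu$ is the exterior unit normal to $\partial\Omega$. For $h>0$, $B_h=B(0,h)$ is the open disc of radius $h$ centered at $0$ in $\mathbb{R}^2$. The sector is $W=\{x\in\mathbb{R}^2: x\neq0,\ \theta_m<\arg(x_1+ix_2)<\theta_M\}$ with $-\pi<\theta_m<\theta_M<\pi$; its boundary rays are $\Gamma^+$ (polar angle $\theta_M$) and $\Gamma^-$ (polar angle $\theta_m$). Set $S_h=W\cap B_h$, $\Gamma_h^\pm=\Gamma^\pm\cap B_h$, $\Lambda_h=W\cap\partial B_h$, $\Sigma_{\Lambda_h}=S_h\setminus S_{h/2}$. The Herglotz wave function with kernel $g_j\in L^2(\mathbb{S}^1)$ is $v_j(x)=\int_{\mathbb{S}^1}e^{ik\xi\cdot x}g_j(\xi)\,\mathrm{d}\sigma(\xi)$, $x\in\mathbb{R}^2$. *)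

theory Defs
  imports "HOL-Analysis.Analysis"
begin

section \<open>Lebesgue and Sobolev spaces\<close>

definition square_integrable :: "'a measure \<Rightarrow> ('a \<Rightarrow> complex) \<Rightarrow> bool" where
  "square_integrable M f \<longleftrightarrow>
     f \<in> borel_measurable M \<and> integrable M (\<lambda>x. (cmod (f x))\<^sup>2)"

definition L2_norm :: "'a measure \<Rightarrow> ('a \<Rightarrow> complex) \<Rightarrow> real" where
  "L2_norm M f = sqrt (LINT x|M. (cmod (f x))\<^sup>2)"

definition ess_bounded :: "'a measure \<Rightarrow> ('a \<Rightarrow> complex) \<Rightarrow> bool" where
  "ess_bounded M f \<longleftrightarrow> f \<in> borel_measurable M \<and> (\<exists>B. AE x in M. cmod (f x) \<le> B)"

definition dir_deriv ::
  "'a::euclidean_space \<Rightarrow> ('a \<Rightarrow> complex) \<Rightarrow> 'a \<Rightarrow> complex" where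
  "dir_deriv b f x = frechet_derivative f (at x) b"

primrec C_diff :: "nat \<Rightarrow> ('a::euclidean_space \<Rightarrow> complex) \<Rightarrow> bool" where
  "C_diff 0 f \<longleftrightarrow> continuous_on UNIV f"
| "C_diff (Suc n) f \<longleftrightarrow>
     (\<forall>x. f differentiable (at x)) \<and> (\<forall>b\<in>Basis. C_diff n (dir_deriv b f))"

definition smooth :: "('a::euclidean_space \<Rightarrow> complex) \<Rightarrow> bool" where
  "smooth f \<longleftrightarrow> (\<forall>n. C_diff n f)"

definition test_function :: "'a::euclidean_space set \<Rightarrow> ('a \<Rightarrow> complex) \<Rightarrow> bool" where
  "test_function U \<phi> \<longleftrightarrow>
     smooth \<phi> \<and> compact (closure {x. \<phi> x \<noteq> 0}) \<and> closure {x. \<phi> x \<noteq> 0} \<subseteq> U"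

definition locally_integrable :: "'a::euclidean_space set \<Rightarrow> ('a \<Rightarrow> complex) \<Rightarrow> bool" where
  "locally_integrable U f \<longleftrightarrow>
     (\<forall>K. compact K \<longrightarrow> K \<subseteq> U \<longrightarrow> integrable (lebesgue_on K) f)"

definition has_weak_deriv ::
  "'a::euclidean_space set \<Rightarrow> 'a \<Rightarrow> ('a \<Rightarrow> complex) \<Rightarrow> ('a \<Rightarrow> complex) \<Rightarrow> bool" where
  "has_weak_deriv U b u g \<longleftrightarrow>
     locally_integrable U u \<and> locally_integrable U g \<and>
     (\<forall>\<phi>. test_function U \<phi> \<longrightarrow>
        (LINT x|lebesgue_on U. u x * dir_deriv b \<phi> x) = - (LINT x|lebesgue_on U. g x * \<phi> x))"

text \<open>The weak derivative is unique up to null sets of the open set \<open>U\<close>; every use below is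
  insensitive to the choice of the representative.\<close>

definition weak_deriv ::
  "'a::euclidean_space set \<Rightarrow> 'a \<Rightarrow> ('a \<Rightarrow> complex) \<Rightarrow> 'a \<Rightarrow> complex" where
  "weak_deriv U b u = (SOME g. has_weak_deriv U b u g)"

definition in_H1 :: "'a::euclidean_space set \<Rightarrow> ('a \<Rightarrow> complex) \<Rightarrow> bool" where
  "in_H1 U u \<longleftrightarrow>
     square_integrable (lebesgue_on U) u \<and>
     (\<forall>b\<in>Basis. \<exists>g. square_integrable (lebesgue_on U) g \<and> has_weak_deriv U b u g)"

definition in_H2 :: "'a::euclidean_space set \<Rightarrow> ('a \<Rightarrow> complex) \<Rightarrow> bool" where
  "in_H2 U u \<longleftrightarrow> in_H1 U u \<and> (\<forall>b\<in>Basis. in_H1 U (weak_deriv U b u))"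

definition H1_norm :: "'a::euclidean_space set \<Rightarrow> ('a \<Rightarrow> complex) \<Rightarrow> real" where
  "H1_norm U u = sqrt ((L2_norm (lebesgue_on U) u)\<^sup>2
     + (\<Sum>b\<in>Basis. (L2_norm (lebesgue_on U) (weak_deriv U b u))\<^sup>2))"

text \<open>\<open>\<Delta>u = f\<close> in the sense of distributions, for \<open>u \<in> H\<^sup>1(U)\<close> and \<open>f \<in> L\<^sup>2(U)\<close>.\<close>

definition has_weak_laplacian ::
  "'a::euclidean_space set \<Rightarrow> ('a \<Rightarrow> complex) \<Rightarrow> ('a \<Rightarrow> complex) \<Rightarrow> bool" where
  "has_weak_laplacian U u f \<longleftrightarrow>
     in_H1 U u \<and> square_integrable (lebesgue_on U) f \<and>
     (\<forall>\<phi>. test_function U \<phi> \<longrightarrow>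
        (\<Sum>b\<in>Basis. LINT x|lebesgue_on U. weak_deriv U b u x * dir_deriv b \<phi> x)
        = - (LINT x|lebesgue_on U. f x * \<phi> x))"

definition weak_laplacian ::
  "'a::euclidean_space set \<Rightarrow> ('a \<Rightarrow> complex) \<Rightarrow> 'a \<Rightarrow> complex" where
  "weak_laplacian U u = (SOME f. has_weak_laplacian U u f)"

definition holder_on :: "real \<Rightarrow> 'a::metric_space set \<Rightarrow> ('a \<Rightarrow> complex) \<Rightarrow> bool" where
  "holder_on \<alpha> S f \<longleftrightarrow>
     bounded (f ` S) \<and> (\<exists>C. \<forall>x\<in>S. \<forall>y\<in>S. cmod (f x - f y) \<le> C * dist x y powr \<alpha>)"

section \<open>Lipschitz domains and their boundaries\<close>

text \<open>Near each boundary point the domain is, in suitable Cartesian coordinates \<open>(x \<bullet> e\<^sub>1, x \<bullet> e\<^sub>2)\<close>,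
  the strict epigraph of a Lipschitz function; as \<open>U\<close> is open, \<open>frontier \<Omega> \<inter> U\<close> is then the
  part of the graph lying in \<open>U\<close>.\<close>

definition bounded_Lipschitz_domain :: "(real^2) set \<Rightarrow> bool" where
  "bounded_Lipschitz_domain \<Omega> \<longleftrightarrow>
     open \<Omega> \<and> connected \<Omega> \<and> \<Omega> \<noteq> {} \<and> bounded \<Omega> \<and>
     (\<forall>p\<in>frontier \<Omega>. \<exists>U e\<^sub>1 e\<^sub>2 L f.
        open U \<and> p \<in> U \<and> norm e\<^sub>1 = 1 \<and> norm e\<^sub>2 = 1 \<and> e\<^sub>1 \<bullet> e\<^sub>2 = 0 \<and>
        L-lipschitz_on UNIV (f :: real \<Rightarrow> real) \<and>
        \<Omega> \<inter> U = {x \<in> U. f (x \<bullet> e\<^sub>1) < x \<bullet> e\<^sub>2})"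

text \<open>The one-dimensional Hausdorff measure. With this normalisation (sums of diameters) it is
  arc length on rectifiable curves. Covering sets must be required to be bounded because
  \<^const>\<open>diameter\<close> is unspecified on unbounded sets.\<close>

definition hausdorff_pre :: "real \<Rightarrow> 'a::metric_space set \<Rightarrow> ennreal" where
  "hausdorff_pre \<delta> A =
     (INF C\<in>{C :: nat \<Rightarrow> 'a set. A \<subseteq> \<Union>(range C) \<and> (\<forall>i. bounded (C i) \<and> diameter (C i) \<le> \<delta>)}.
        (\<Sum>i. ennreal (diameter (C i))))"

definition hausdorff1 :: "'a::metric_space measure" where
  "hausdorff1 = measure_of UNIV (sets borel) (\<lambda>A. SUP \<delta>\<in>{0<..}. hausdorff_pre \<delta> A)"

definition boundary_measure :: "(real^2) set \<Rightarrow> (real^2) measure" where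
  "boundary_measure \<Omega> = completion (restrict_space hausdorff1 (frontier \<Omega>))"

text \<open>The trace operator is the continuous extension of \<open>\<phi> \<mapsto> \<phi>|\<^bsub>\<partial>\<Omega>\<^esub>\<close> from functions smooth up
  to the boundary to \<open>H\<^sup>1(\<Omega>)\<close>.\<close>

definition has_trace :: "(real^2) set \<Rightarrow> (real^2 \<Rightarrow> complex) \<Rightarrow> (real^2 \<Rightarrow> complex) \<Rightarrow> bool" where
  "has_trace \<Omega> u \<tau> \<longleftrightarrow>
     in_H1 \<Omega> u \<and> square_integrable (boundary_measure \<Omega>) \<tau> \<and>
     (\<exists>\<phi> :: nat \<Rightarrow> real^2 \<Rightarrow> complex. (\<forall>n. smooth (\<phi> n)) \<and>
        (\<lambda>n. H1_norm \<Omega> (\<lambda>x. u x - \<phi> n x)) \<longlonglongrightarrow> 0 \<and>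
        (\<lambda>n. L2_norm (boundary_measure \<Omega>) (\<lambda>x. \<tau> x - \<phi> n x)) \<longlonglongrightarrow> 0)"

text \<open>For \<open>u \<in> H\<^sup>1(\<Omega>)\<close> with \<open>\<Delta>u \<in> L\<^sup>2(\<Omega>)\<close> the exterior normal derivative \<open>\<partial>\<^sub>\<nu>u\<close> is an element of
  \<open>H\<^bsup>-1/2\<^esup>(\<partial>\<Omega>)\<close>, defined through Green's formula by its (bilinear) pairing with the trace of an
  arbitrary \<open>\<phi> \<in> H\<^sup>1(\<Omega>)\<close>:
  \<open>\<langle>\<partial>\<^sub>\<nu>u, \<phi>\<rangle> = \<integral>\<^sub>\<Omega> \<nabla>u \<cdot> \<nabla>\<phi> + \<integral>\<^sub>\<Omega> \<Delta>u \<phi>\<close>.\<close>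

definition normal_deriv_pairing ::
  "(real^2) set \<Rightarrow> (real^2 \<Rightarrow> complex) \<Rightarrow> (real^2 \<Rightarrow> complex) \<Rightarrow> complex" where
  "normal_deriv_pairing \<Omega> u \<phi> =
     (\<Sum>b\<in>Basis. LINT x|lebesgue_on \<Omega>. weak_deriv \<Omega> b u x * weak_deriv \<Omega> b \<phi> x)
     + (LINT x|lebesgue_on \<Omega>. weak_laplacian \<Omega> u x * \<phi> x)"

text \<open>The common trace \<open>\<tau>\<close> of \<open>v\<close> and \<open>w\<close> expresses \<open>w = v\<close> on \<open>\<partial>\<Omega>\<close>; the last conjunct is
  \<open>\<partial>\<^sub>\<nu>v + \<eta>v = \<partial>\<^sub>\<nu>w\<close> in \<open>H\<^bsup>-1/2\<^esup>(\<partial>\<Omega>)\<close>. Nontriviality: \<open>v\<close> and \<open>w\<close> do not both vanish.\<close>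

definition conductive_transmission_eigenfunctions ::
  "(real^2) set \<Rightarrow> (real^2 \<Rightarrow> complex) \<Rightarrow> (real^2 \<Rightarrow> complex) \<Rightarrow> real
    \<Rightarrow> (real^2 \<Rightarrow> complex) \<Rightarrow> (real^2 \<Rightarrow> complex) \<Rightarrow> bool" where
  "conductive_transmission_eigenfunctions \<Omega> V \<eta> k v w \<longleftrightarrow>
     in_H1 \<Omega> v \<and> in_H1 \<Omega> w \<and>
     \<not> ((AE x in lebesgue_on \<Omega>. v x = 0) \<and> (AE x in lebesgue_on \<Omega>. w x = 0)) \<and>
     has_weak_laplacian \<Omega> w (\<lambda>x. - (complex_of_real (k\<^sup>2) * (1 + V x) * w x)) \<and>
     has_weak_laplacian \<Omega> v (\<lambda>x. - (complex_of_real (k\<^sup>2) * v x)) \<and>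
     (\<exists>\<tau>. has_trace \<Omega> v \<tau> \<and> has_trace \<Omega> w \<tau> \<and>
        (\<forall>\<phi> \<psi>. has_trace \<Omega> \<phi> \<psi> \<longrightarrow>
           normal_deriv_pairing \<Omega> v \<phi> + (LINT x|boundary_measure \<Omega>. \<eta> x * \<tau> x * \<psi> x)
           = normal_deriv_pairing \<Omega> w \<phi>))"

section \<open>Corner geometry and Herglotz waves\<close>

definition polar :: "real \<Rightarrow> real \<Rightarrow> real^2" where
  "polar r \<theta> = vector [r * cos \<theta>, r * sin \<theta>]"

definition sector :: "real \<Rightarrow> real \<Rightarrow> (real^2) set" where
  "sector \<theta>m \<theta>M = {x. x \<noteq> 0 \<and> \<theta>m < Arg (Complex (x$1) (x$2)) \<and> Arg (Complex (x$1) (x$2)) < \<theta>M}"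

definition sector_disc :: "real \<Rightarrow> real \<Rightarrow> real \<Rightarrow> (real^2) set" where
  "sector_disc \<theta>m \<theta>M r = sector \<theta>m \<theta>M \<inter> ball 0 r"

definition ray :: "real \<Rightarrow> (real^2) set" where
  "ray \<theta> = {polar r \<theta> | r. r > 0}"

text \<open>Arc length on the unit circle.\<close>

definition circle_measure :: "(real^2) measure" where
  "circle_measure = completion (distr (restrict_space lborel {0..<2*pi}) borel (polar 1))"

definition herglotz :: "real \<Rightarrow> (real^2 \<Rightarrow> complex) \<Rightarrow> real^2 \<Rightarrow> complex" where
  "herglotz k g x = (LINT \<xi>|circle_measure. exp (\<i> * complex_of_real (k * (\<xi> \<bullet> x))) * g \<xi>)"

end

theory Submission
  imports Defs
begin

text \<open>The conductive condition is tested against \<open>\<phi>\<^sub>s(x) = \<chi>(x) (s z + d)\<^sup>-\<^sup>8\<close>, where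
  \<open>z = x\<^sub>1 + i x\<^sub>2\<close>, \<open>\<chi>\<close> is a cutoff function and \<open>d\<close> is chosen so that the pole stays outside the
  closed sector. This function is harmonic near \<open>0\<close> and concentrates on \<open>|x| \<lesssim> 1/s\<close>. Since
  \<open>v - w\<close> has zero trace, Green's formula turns the difference of the two normal derivatives into
  volume integrals. Along a boundary ray with unit direction \<open>e\<close> the integral of \<open>\<phi>\<^sub>s\<close> is
  \<open>d\<^sup>-\<^sup>7 / (7 s e) + O(s\<^sup>-\<^sup>2)\<close>, and the contributions of the two rays cannot cancel because the
  opening angle is not \<open>\<pi>\<close>. With \<open>s = j\<close> the boundary term is therefore of exact order
  \<open>\<eta>(0) v\<^sub>j(0) / j\<close>, whereas everything else is \<open>o(1/j)\<close> up to a small multiple of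
  \<open>|v\<^sub>j(0)| / j\<close>; hence \<open>v\<^sub>j(0) \<longlonglongrightarrow> 0\<close>. Finally the mean of \<open>|v|\<close> over \<open>B(0, \<rho>) \<inter> \<Omega>\<close>
  is compared with \<open>|v\<^sub>j(0)|\<close> for \<open>j\<close> close to \<open>1/\<rho>\<close>.\<close>

section \<open>Functions of class C^n and cutoff functions\<close>

text \<open>The function v is only in H^1 and has no value at the vertex, so the numbers v_j(0) take
  its place, although nothing bounds them in advance. They recur among the errors, but with a factor
  tending to 0, and are absorbed on the left. The choice s = j fits both rates of the approximation.
  An H^1 error e costs e s^(-1/2), because the L^2 norm of the test function along an edge is of
  order s^(-1/2); a Lipschitz constant G costs G s^(-2). Relative to 1/s these are e s^(1/2) and G /
  s, hence of order j^(-1/2 - \<Upsilon>) and j^(\<kappa> - 1). In the means, with \<rho> of order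
  1/j, they cost e / \<rho> and G \<rho>, of order j^(-\<Upsilon>) and j^(\<kappa> - 1). A negative
  power of an affine function of z is harmonic and has an elementary primitive on every ray. It
  decays in all directions and only needs room for its pole outside the closed sector, so openings
  below and above pi share one argument; they differ in the sign of the shift and in the divergence
  theorem, where a reentrant sector is the complement of a quadrant.\<close>

primrec C_diff_on :: "nat \<Rightarrow> 'a::euclidean_space set \<Rightarrow> ('a \<Rightarrow> complex) \<Rightarrow> bool" where
  "C_diff_on 0 U f \<longleftrightarrow> continuous_on U f"
| "C_diff_on (Suc n) U f \<longleftrightarrow>
     (\<forall>x\<in>U. f differentiable (at x)) \<and> (\<forall>b\<in>Basis. C_diff_on n U (dir_deriv b f))"

lemma C_diff_on_UNIV: "C_diff_on n UNIV f \<longleftrightarrow> C_diff n f"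
  by (induction n arbitrary: f) auto

lemma dir_deriv_eq: "(f has_derivative f') (at x) \<Longrightarrow> dir_deriv b f x = f' b"
  unfolding dir_deriv_def by (metis frechet_derivative_at)

lemma dir_deriv_cong_open:
  assumes "open U" "x \<in> U" "\<And>y. y \<in> U \<Longrightarrow> f y = g y" "f differentiable (at x)"
  shows "dir_deriv b f x = dir_deriv b g x"
  using frechet_derivative_transform_within_open[OF assms(4,1,2,3)] by (simp add: dir_deriv_def)

lemma has_derivative_dir_deriv:
  "f differentiable (at x) \<Longrightarrow> (f has_derivative (\<lambda>b. dir_deriv b f x)) (at x)"
  unfolding dir_deriv_def using frechet_derivative_works by fastforce

lemma dir_deriv_const [simp]: "dir_deriv b (\<lambda>x. c) = (\<lambda>x. 0)"
  by (rule ext) (rule dir_deriv_eq[where f'="\<lambda>_. 0"], simp)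

lemma dir_deriv_add:
  assumes "f differentiable (at x)" "g differentiable (at x)"
  shows "dir_deriv b (\<lambda>x. f x + g x) x = dir_deriv b f x + dir_deriv b g x"
  by (rule dir_deriv_eq) (intro has_derivative_add has_derivative_dir_deriv assms)

lemma dir_deriv_diff:
  assumes "f differentiable (at x)" "g differentiable (at x)"
  shows "dir_deriv b (\<lambda>x. f x - g x) x = dir_deriv b f x - dir_deriv b g x"
  by (rule dir_deriv_eq) (intro has_derivative_diff has_derivative_dir_deriv assms)

lemma dir_deriv_mult:
  assumes "f differentiable (at x)" "g differentiable (at x)"
  shows "dir_deriv b (\<lambda>x. f x * g x) x = f x * dir_deriv b g x + dir_deriv b f x * g x"
  by (rule dir_deriv_eq) (intro has_derivative_mult has_derivative_dir_deriv assms)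

lemma dir_deriv_inverse:
  assumes "f differentiable (at x)" "f x \<noteq> 0"
  shows "dir_deriv b (\<lambda>x. inverse (f x)) x = - (inverse (f x) * dir_deriv b f x * inverse (f x))"
  by (rule dir_deriv_eq) (intro Deriv.has_derivative_inverse has_derivative_dir_deriv assms)

lemma C_diff_on_cong:
  assumes "open U"
  shows "\<lbrakk>\<And>x. x \<in> U \<Longrightarrow> f x = g x; C_diff_on n U f\<rbrakk> \<Longrightarrow> C_diff_on n U g"
proof (induction n arbitrary: f g)
  case 0
  then show ?case using continuous_on_eq by fastforce
next
  case (Suc n)
  have d: "f differentiable (at x)" if "x \<in> U" for x using Suc.prems that by simp
  have "g differentiable (at x)" if "x \<in> U" for x
    using has_derivative_transform_within_open[OF has_derivative_dir_deriv[OF d[OF that]] assms that Suc.prems(1)]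
    by (auto simp: differentiable_def)
  moreover have "C_diff_on n U (dir_deriv b g)" if "b \<in> Basis" for b
    using Suc.IH[of "dir_deriv b f" "dir_deriv b g"] dir_deriv_cong_open[OF assms _ Suc.prems(1) d] Suc.prems(2) that
    by simp
  ultimately show ?case by simp
qed

text \<open>The product and quotient rules keep undifferentiated factors, so their inductions also
  need the hypothesis one order lower.\<close>

lemma C_diff_on_Suc_D: "open U \<Longrightarrow> C_diff_on (Suc n) U f \<Longrightarrow> C_diff_on n U f"
proof (induction n arbitrary: f)
  case 0
  then show ?case
    by (auto intro!: continuous_at_imp_continuous_on differentiable_imp_continuous_within)
qed auto

text \<open>Differentiability is local, so smoothness may be glued. This is how the test function,
  smooth away from its pole and zero near it, is shown to be smooth on the whole plane.\<close>

lemma C_diff_on_Un: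
  "open U \<Longrightarrow> open V \<Longrightarrow> C_diff_on n U f \<Longrightarrow> C_diff_on n V f \<Longrightarrow> C_diff_on n (U \<union> V) f"
  by (induction n arbitrary: f) (auto intro: continuous_on_open_Un)

lemma C_diff_on_subset: "C_diff_on n U f \<Longrightarrow> V \<subseteq> U \<Longrightarrow> C_diff_on n V f"
  by (induction n arbitrary: f) (auto intro: continuous_on_subset)

lemma C_diff_on_const [simp]: "C_diff_on n U (\<lambda>x. c)"
  by (induction n arbitrary: c) auto

lemma C_diff_on_bounded_linear:
  assumes "bounded_linear f" shows "C_diff_on n U f"
proof -
  have "(f has_derivative f) (at x)" for x by (simp add: assms bounded_linear_imp_has_derivative)
  then have "dir_deriv b f = (\<lambda>x. f b)" "f differentiable (at x)" for b x
    by (auto simp: dir_deriv_eq differentiable_def)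
  then show ?thesis using assms
    by (cases n) (auto simp: linear_continuous_on)
qed

lemma C_diff_on_add:
  assumes "open U"
  shows "C_diff_on n U f \<Longrightarrow> C_diff_on n U g \<Longrightarrow> C_diff_on n U (\<lambda>x. f x + g x)"
proof (induction n arbitrary: f g)
  case (Suc n)
  have "C_diff_on n U (dir_deriv b (\<lambda>x. f x + g x))" if "b \<in> Basis" for b
    by (rule C_diff_on_cong[OF assms, where f="\<lambda>x. dir_deriv b f x + dir_deriv b g x"])
      (use Suc that in \<open>auto simp: dir_deriv_add\<close>)
  then show ?case using Suc.prems by (auto intro: differentiable_add)
qed (auto intro: continuous_intros)

lemma C_diff_on_mult:
  assumes "open U"
  shows "C_diff_on n U f \<Longrightarrow> C_diff_on n U g \<Longrightarrow> C_diff_on n U (\<lambda>x. f x * g x)"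
proof (induction n arbitrary: f g)
  case (Suc n)
  have "C_diff_on n U (dir_deriv b (\<lambda>x. f x * g x))" if "b \<in> Basis" for b
    by (rule C_diff_on_cong[OF assms, where f="\<lambda>x. f x * dir_deriv b g x + dir_deriv b f x * g x"])
      (use Suc that C_diff_on_Suc_D[OF assms] in \<open>auto simp: dir_deriv_mult intro!: C_diff_on_add[OF assms]\<close>)
  then show ?case using Suc.prems by (auto intro: differentiable_mult)
qed (auto intro: continuous_intros)

lemma C_diff_on_uminus: "open U \<Longrightarrow> C_diff_on n U f \<Longrightarrow> C_diff_on n U (\<lambda>x. - f x)"
  using C_diff_on_mult[of U n "\<lambda>x. -1" f] by simp

lemma C_diff_on_diff: "open U \<Longrightarrow> C_diff_on n U f \<Longrightarrow> C_diff_on n U g \<Longrightarrow> C_diff_on n U (\<lambda>x. f x - g x)"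
  using C_diff_on_add[of U n f "\<lambda>x. - g x"] C_diff_on_uminus[of U n g] by simp

lemma C_diff_on_power: "open U \<Longrightarrow> C_diff_on n U f \<Longrightarrow> C_diff_on n U (\<lambda>x. f x ^ k)"
  by (induction k) (auto intro: C_diff_on_mult)

lemma C_diff_on_inverse:
  assumes "open U" and nz: "\<And>x. x \<in> U \<Longrightarrow> f x \<noteq> 0"
  shows "C_diff_on n U f \<Longrightarrow> C_diff_on n U (\<lambda>x. inverse (f x))"
proof (induction n)
  case 0
  then show ?case using nz by (auto intro: continuous_intros)
next
  case (Suc n)
  have "C_diff_on n U (\<lambda>x. inverse (f x))" using Suc C_diff_on_Suc_D[OF assms(1)] by blast
  then have "C_diff_on n U (\<lambda>x. - (inverse (f x) * dir_deriv b f x * inverse (f x)))" if "b \<in> Basis" for b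
    using that Suc.prems by (auto intro!: C_diff_on_uminus C_diff_on_mult assms)
  then have "C_diff_on n U (dir_deriv b (\<lambda>x. inverse (f x)))" if "b \<in> Basis" for b
    by (rule C_diff_on_cong[OF assms(1), rotated]) (use Suc.prems nz that in \<open>auto simp: dir_deriv_inverse\<close>)
  moreover have "(\<lambda>x. inverse (f x)) differentiable (at x)" if "x \<in> U" for x
    using Suc.prems nz that Deriv.has_derivative_inverse[OF _ has_derivative_dir_deriv, of f x]
    by (auto simp: differentiable_def)
  ultimately show ?case by simp
qed

text \<open>The powers of \<open>1 / t\<close> make the family closed under differentiation.\<close>

definition flat :: "nat \<Rightarrow> real \<Rightarrow> real" where
  "flat k t = (if t \<le> 0 then 0 else exp (- inverse t) * inverse t ^ k)"

text \<open>From the right, the substitution u = 1/t turns the limit into that of u^k / exp u at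
  infinity.\<close>

lemma flat_tendsto_0: "(flat k \<longlongrightarrow> 0) (at 0)"
proof -
  have "((\<lambda>t::real. t ^ k / exp t) \<longlongrightarrow> 0) at_top" by (rule tendsto_power_div_exp_0)
  then have "((\<lambda>t. inverse t ^ k / exp (inverse t)) \<longlongrightarrow> 0) (at_right (0::real))"
    by (rule filterlim_compose[OF _ filterlim_inverse_at_top_right])
  then have "(flat k \<longlongrightarrow> 0) (at_right 0)"
    by (rule Lim_transform_eventually)
      (auto simp: eventually_at_filter flat_def exp_minus divide_inverse)
  moreover have "(flat k \<longlongrightarrow> 0) (at_left 0)"
    by (rule tendsto_eventually) (auto simp: eventually_at_filter flat_def)
  ultimately show ?thesis by (simp add: filterlim_split_at)
qed

text \<open>The delicate point is t = 0. There the difference quotient of \<open>flat k\<close> is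
  \<open>flat (Suc k)\<close> itself, whose limit is 0 by \<open>flat_tendsto_0\<close>; this is the
  second benefit of carrying the index k.\<close>

lemma flat_has_derivative:
  "(flat k has_real_derivative (flat (k+2) t - real k * flat (k+1) t)) (at t)"
proof -
  consider "t > 0" | "t < 0" | "t = 0" by linarith
  then show ?thesis
  proof cases
    case 1
    have "((\<lambda>t. exp (- inverse t) * inverse t ^ k) has_real_derivative
        (flat (k+2) t - real k * flat (k+1) t)) (at t)"
    proof -
      have A: "((\<lambda>t. exp (- inverse t)) has_real_derivative exp (- inverse t) * inverse t ^ 2) (at t)"
        using 1 by (auto intro!: derivative_eq_intros simp: power2_eq_square)
      have I: "(inverse has_real_derivative - (inverse t ^ 2)) (at t)"
        using DERIV_inverse[of t UNIV] 1 by (simp add: numeral_2_eq_2)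
      have B: "((\<lambda>t. inverse t ^ k) has_real_derivative - (real k * inverse t ^ (k+1))) (at t)"
      proof (induction k)
        case (Suc k)
        show ?case using DERIV_mult[OF I Suc] 1 by (simp add: algebra_simps power2_eq_square)
      qed simp
      show ?thesis using DERIV_mult[OF A B] 1
        by (simp add: flat_def algebra_simps power_add power2_eq_square)
    qed
    then show ?thesis
      by (rule has_field_derivative_transform_within_open[of _ _ _ "{0<..}"]) (use 1 in \<open>auto simp: flat_def\<close>)
  next
    case 2
    have "((\<lambda>t. 0) has_real_derivative (flat (k+2) t - real k * flat (k+1) t)) (at t)"
      using 2 by (simp add: flat_def)
    then show ?thesis
      by (rule has_field_derivative_transform_within_open[of _ _ _ "{..<0}"]) (use 2 in \<open>auto simp: flat_def\<close>)
  next
    case 3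
    have "((\<lambda>y. (flat k y - flat k 0) / (y - 0)) \<longlongrightarrow> 0) (at 0)"
      by (rule Lim_transform_eventually[OF flat_tendsto_0[of "Suc k"]])
        (auto simp: eventually_at_filter flat_def divide_inverse)
    then show ?thesis using 3 by (simp add: has_field_derivative_iff flat_def)
  qed
qed

text \<open>The induction on the order leaves k arbitrary, because one derivative of
  \<open>flat k (p x)\<close> consists of \<open>flat (k+1)\<close> and \<open>flat (k+2)\<close>
  times a derivative of p.\<close>

lemma C_diff_on_flat:
  assumes "open U"
  shows "C_diff_on n U (\<lambda>x. complex_of_real (p x)) \<Longrightarrow> C_diff_on n U (\<lambda>x. complex_of_real (flat k (p x)))"
proof (induction n arbitrary: k)
  case 0
  have p: "continuous_on U p"
    using continuous_on_Re[of U "\<lambda>x. complex_of_real (p x)"] 0 by simp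
  have "continuous_on UNIV (flat k)"
    by (intro continuous_at_imp_continuous_on ballI DERIV_isCont[OF flat_has_derivative])
  then have "continuous_on U (\<lambda>x. flat k (p x))"
    by (rule continuous_on_compose2[OF _ p]) simp
  then show ?case by (simp only: C_diff_on.simps continuous_on_of_real)
next
  case (Suc n)
  have hd: "((\<lambda>x. complex_of_real (flat k (p x))) has_derivative
      (\<lambda>b. of_real (flat (k+2) (p x) - real k * flat (k+1) (p x)) * dir_deriv b (\<lambda>x. complex_of_real (p x)) x)) (at x)"
    if "x \<in> U" for x
  proof -
    let ?P = "\<lambda>x. complex_of_real (p x)" and ?c = "flat (k+2) (p x) - real k * flat (k+1) (p x)"
    have P: "(?P has_derivative (\<lambda>b. dir_deriv b ?P x)) (at x)"
      using Suc.prems that by (intro has_derivative_dir_deriv) simp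
    have p: "(p has_derivative (\<lambda>b. Re (dir_deriv b ?P x))) (at x)"
      using has_derivative_Re[OF P] by simp
    have P2: "(?P has_derivative (\<lambda>b. of_real (Re (dir_deriv b ?P x)))) (at x)"
      using has_derivative_of_real[OF p] by simp
    \<comment> \<open>p is real, but \<open>dir_deriv\<close> is defined for complex functions;
      uniqueness of the derivative shows that the derivative of the embedded p is real as
      well.\<close>
    have eq: "of_real (Re (dir_deriv b ?P x)) = dir_deriv b ?P x" for b
      using fun_cong[OF has_derivative_unique[OF P P2], of b] by (rule sym)
    have "((\<lambda>x. flat k (p x)) has_derivative (\<lambda>b. Re (dir_deriv b ?P x) * ?c)) (at x)"
      using has_derivative_compose[OF p flat_has_derivative[of k "p x", unfolded has_field_derivative_def]]
      by (simp only: mult.commute)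
    from has_derivative_of_real[OF this, where 'a=complex]
    have "((\<lambda>x. complex_of_real (flat k (p x))) has_derivative (\<lambda>b. of_real (Re (dir_deriv b ?P x)) * of_real ?c)) (at x)"
      by (simp only: of_real_mult)
    then show ?thesis by (simp only: eq mult.commute)
  qed
  have fl: "C_diff_on n U (\<lambda>x. complex_of_real (flat j (p x)))" for j
    by (rule Suc.IH[OF C_diff_on_Suc_D[OF assms Suc.prems]])
  have "C_diff_on n U (dir_deriv b (\<lambda>x. complex_of_real (flat k (p x))))" if b: "b \<in> Basis" for b
  proof -
    have "C_diff_on n U (\<lambda>x. (of_real (flat (k+2) (p x)) - of_nat k * of_real (flat (k+1) (p x))) * dir_deriv b (\<lambda>x. complex_of_real (p x)) x)"
      by (intro C_diff_on_mult C_diff_on_diff assms fl C_diff_on_const) (use Suc.prems b in simp)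
    then show ?thesis
      by (rule C_diff_on_cong[OF assms, rotated]) (simp add: dir_deriv_eq[OF hd])
  qed
  moreover have "(\<lambda>x. complex_of_real (flat k (p x))) differentiable (at x)" if "x \<in> U" for x
    using hd[OF that] by (auto simp: differentiable_def)
  ultimately show ?case by simp
qed

lemma flat_nonneg: "flat k t \<ge> 0" and flat_pos: "t > 0 \<Longrightarrow> flat k t > 0" and flat_zero: "t \<le> 0 \<Longrightarrow> flat k t = 0"
  by (auto simp: flat_def)

text \<open>The standard smooth step: with E(t) = exp(-1/t) for t > 0 and 0 otherwise, the quotient
  E(b - t) / (E(b - t) + E(t - a)) is 1 up to a and 0 from b on.\<close>

definition cutoff :: "real \<Rightarrow> real \<Rightarrow> real \<Rightarrow> real" where
  "cutoff a b t = flat 0 (b - t) * inverse (flat 0 (b - t) + flat 0 (t - a))"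

context fixes a b :: real assumes ab: "a < b" begin

lemma cutoff_denom: "flat 0 (b - t) + flat 0 (t - a) > 0"
  using flat_pos[of "b - t" 0] flat_pos[of "t-a" 0] flat_nonneg[of 0 "b-t"] flat_nonneg[of 0 "t-a"] ab
  by (cases "t < b") (auto simp: add_pos_nonneg add_nonneg_pos)

lemma cutoff_range: "0 \<le> cutoff a b t" "cutoff a b t \<le> 1"
  using cutoff_denom[of t] flat_nonneg[of 0 "b-t"] flat_nonneg[of 0 "t-a"]
  by (auto simp: cutoff_def field_simps)

lemma cutoff_eq_1: "t \<le> a \<Longrightarrow> cutoff a b t = 1"
  using cutoff_denom[of t] by (auto simp: cutoff_def flat_zero)

lemma cutoff_eq_0: "t \<ge> b \<Longrightarrow> cutoff a b t = 0"
  by (auto simp: cutoff_def flat_zero)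

lemma C_diff_on_cutoff:
  assumes "open U" "C_diff_on n U (\<lambda>x. complex_of_real (p x))"
  shows "C_diff_on n U (\<lambda>x. complex_of_real (cutoff a b (p x)))"
proof -
  have 1: "C_diff_on n U (\<lambda>x. complex_of_real (flat 0 (b - p x)))"
    using assms by (intro C_diff_on_flat) (auto intro!: C_diff_on_diff)
  have 2: "C_diff_on n U (\<lambda>x. complex_of_real (flat 0 (p x - a)))"
    using assms by (intro C_diff_on_flat) (auto intro!: C_diff_on_diff)
  have 3: "complex_of_real (flat 0 (b - t)) + complex_of_real (flat 0 (t - a)) \<noteq> 0" for t
    using cutoff_denom[of t] by (metis less_irrefl of_real_add of_real_eq_0_iff)
  show ?thesis unfolding cutoff_def of_real_mult of_real_inverse of_real_add
    using 1 2 3 by (intro C_diff_on_mult C_diff_on_inverse C_diff_on_add assms) auto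
qed

end

text \<open>The radial cutoff is applied to the squared norm, a polynomial, because the norm itself
  is not differentiable at the vertex.\<close>

lemma C_diff_on_norm_sq:
  assumes "open U" shows "C_diff_on n U (\<lambda>x::'a::euclidean_space. complex_of_real ((norm x)\<^sup>2))"
proof -
  have "(\<lambda>x::'a. complex_of_real ((norm x)\<^sup>2)) = (\<lambda>x. \<Sum>b\<in>Basis. complex_of_real (x \<bullet> b) * complex_of_real (x \<bullet> b))"
    by (rule ext, unfold power2_norm_eq_inner, subst euclidean_inner) simp
  moreover have "C_diff_on n U (\<lambda>x::'a. complex_of_real (x \<bullet> b))" for b
    by (intro C_diff_on_bounded_linear bounded_linear_compose[OF bounded_linear_of_real] bounded_linear_inner_left)
  note lin = this
  have "C_diff_on n U (\<lambda>x. \<Sum>b\<in>B. complex_of_real (x \<bullet> b) * complex_of_real (x \<bullet> b))"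
    if "finite B" for B :: "'a set" using that
    by (induction B rule: finite_induct) (auto intro!: C_diff_on_add C_diff_on_mult assms lin)
  ultimately show ?thesis by simp
qed

lemma smooth_iff: "smooth f \<longleftrightarrow> (\<forall>n. C_diff_on n UNIV f)"
  by (simp add: smooth_def C_diff_on_UNIV)

lemma smooth_mult: "smooth f \<Longrightarrow> smooth g \<Longrightarrow> smooth (\<lambda>x. f x * g x)"
  and smooth_add: "smooth f \<Longrightarrow> smooth g \<Longrightarrow> smooth (\<lambda>x. f x + g x)"
  and smooth_diff: "smooth f \<Longrightarrow> smooth g \<Longrightarrow> smooth (\<lambda>x. f x - g x)"
  by (auto simp: smooth_iff intro: C_diff_on_mult C_diff_on_add C_diff_on_diff)

lemma smooth_differentiable: "smooth f \<Longrightarrow> f differentiable (at x)"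
  unfolding smooth_def by (metis C_diff.simps(2))

lemma smooth_dir_deriv: "smooth f \<Longrightarrow> b \<in> Basis \<Longrightarrow> smooth (dir_deriv b f)"
  unfolding smooth_def by (metis C_diff.simps(2))

lemma smooth_continuous: "smooth f \<Longrightarrow> continuous_on UNIV f"
  unfolding smooth_def by (metis C_diff.simps(1))

lemma C_diff_mult: "C_diff n f \<Longrightarrow> C_diff n g \<Longrightarrow> C_diff n (\<lambda>x. f x * g x)"
  and C_diff_add: "C_diff n f \<Longrightarrow> C_diff n g \<Longrightarrow> C_diff n (\<lambda>x. f x + g x)"
  and C_diff_diff: "C_diff n f \<Longrightarrow> C_diff n g \<Longrightarrow> C_diff n (\<lambda>x. f x - g x)"
  by (auto simp: C_diff_on_UNIV[symmetric] intro: C_diff_on_mult C_diff_on_add C_diff_on_diff)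

text \<open>Conjugation is real linear and commutes with directional derivatives. It makes |F|^2 = F
  * cnj F accessible as a differentiable complex function in the trace inequality.\<close>

lemma C_diff_cnj: "C_diff n f \<Longrightarrow> C_diff n (\<lambda>x. cnj (f x))"
proof (induction n arbitrary: f)
  case 0 then show ?case by (auto intro: continuous_intros)
next
  case (Suc n)
  have hd: "((\<lambda>x. cnj (f x)) has_derivative (\<lambda>b. cnj (dir_deriv b f x))) (at x)" for x
    using Suc.prems by (intro has_derivative_cnj has_derivative_dir_deriv) simp
  then have "dir_deriv b (\<lambda>x. cnj (f x)) = (\<lambda>x. cnj (dir_deriv b f x))" for b
    using dir_deriv_eq by blast
  then show ?case using hd Suc by (auto simp: differentiable_def)
qed

section \<open>Lebesgue integration and test functions\<close>

lemma borel_measurable_lebesgue_on_continuous: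
  fixes f :: "'a::euclidean_space \<Rightarrow> 'b::euclidean_space"
  assumes "continuous_on UNIV f" shows "f \<in> borel_measurable (lebesgue_on S)"
  using borel_measurable_continuous_onI[OF assms]
  by (intro measurable_restrict_space1 measurable_completion) simp

lemma integrable_lebesgue_on_iff:
  fixes f :: "'a::euclidean_space \<Rightarrow> 'b::euclidean_space"
  assumes "S \<in> sets lebesgue"
  shows "integrable (lebesgue_on S) f \<longleftrightarrow> integrable lebesgue (\<lambda>x. indicator S x *\<^sub>R f x)"
  using assms by (subst integrable_restrict_space) auto

lemma integral_lebesgue_on_eq:
  fixes f :: "'a::euclidean_space \<Rightarrow> 'b::euclidean_space"
  assumes "S \<in> sets lebesgue"
  shows "integral\<^sup>L (lebesgue_on S) f = (LINT x|lebesgue. indicator S x *\<^sub>R f x)"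
  using assms by (subst integral_restrict_space) auto

lemma integral_lebesgue_on_subset:
  fixes f :: "'a::euclidean_space \<Rightarrow> 'b::euclidean_space"
  assumes "S \<in> sets lebesgue" "T \<in> sets lebesgue" "S \<subseteq> T" "\<And>x. x \<in> T - S \<Longrightarrow> f x = 0"
  shows "integral\<^sup>L (lebesgue_on S) f = integral\<^sup>L (lebesgue_on T) f"
    and "integrable (lebesgue_on S) f \<longleftrightarrow> integrable (lebesgue_on T) f"
proof -
  have "indicator S x *\<^sub>R f x = indicator T x *\<^sub>R f x" for x
    using assms(3,4) by (auto simp: indicator_def)
  then show "integral\<^sup>L (lebesgue_on S) f = integral\<^sup>L (lebesgue_on T) f"
    "integrable (lebesgue_on S) f \<longleftrightarrow> integrable (lebesgue_on T) f"
    unfolding integrable_lebesgue_on_iff[OF assms(1)] integrable_lebesgue_on_iff[OF assms(2)]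
      integral_lebesgue_on_eq[OF assms(1)] integral_lebesgue_on_eq[OF assms(2)] by (simp_all only:)
qed

lemma integrable_lebesgue_on_mono:
  fixes f :: "'a::euclidean_space \<Rightarrow> 'b::euclidean_space"
  assumes "integrable (lebesgue_on T) f" "S \<in> sets lebesgue" "T \<in> sets lebesgue" "S \<subseteq> T"
  shows "integrable (lebesgue_on S) f"
proof -
  have "integrable lebesgue (\<lambda>x. indicator S x *\<^sub>R (indicator T x *\<^sub>R f x))"
    using assms by (intro integrable_mult_indicator[of S]) (simp_all only: integrable_lebesgue_on_iff sets_completionI_sets)
  moreover have "(\<lambda>x. indicator S x *\<^sub>R (indicator T x *\<^sub>R f x)) = (\<lambda>x. indicator S x *\<^sub>R f x)"
    using assms(4) by (intro ext) (auto simp: indicator_def)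
  ultimately show ?thesis using assms by (simp add: integrable_lebesgue_on_iff)
qed

lemma integrable_mult_bounded_continuous:
  fixes f :: "'a::euclidean_space \<Rightarrow> complex"
  assumes "integrable (lebesgue_on S) f" "continuous_on UNIV \<phi>" "\<And>x. x \<in> S \<Longrightarrow> cmod (\<phi> x) \<le> B"
  shows "integrable (lebesgue_on S) (\<lambda>x. f x * \<phi> x)"
proof (rule Bochner_Integration.integrable_bound[where f="\<lambda>x. B * cmod (f x)"])
  show "integrable (lebesgue_on S) (\<lambda>x. B * cmod (f x))" using assms(1) by auto
  show "(\<lambda>x. f x * \<phi> x) \<in> borel_measurable (lebesgue_on S)"
    using assms(1) borel_measurable_lebesgue_on_continuous[OF assms(2)] by auto
  show "AE x in lebesgue_on S. norm (f x * \<phi> x) \<le> norm (B * cmod (f x))"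
  proof (rule AE_I2)
    fix x assume x: "x \<in> space (lebesgue_on S)"
    then have "cmod (\<phi> x) \<le> \<bar>B\<bar>" using assms(3)[of x] by (auto simp: space_restrict_space)
    then show "norm (f x * \<phi> x) \<le> norm (B * cmod (f x))"
      by (simp add: norm_mult abs_mult mult.commute[of _ "cmod (f x)"] mult_left_mono)
  qed
qed

lemma locally_integrable_mult_compact_support:
  assumes U: "open U" and g: "locally_integrable U g" and \<phi>: "continuous_on UNIV \<phi>"
    and K: "compact (closure {x. \<phi> x \<noteq> 0})" "closure {x. \<phi> x \<noteq> 0} \<subseteq> U"
  shows "integrable (lebesgue_on U) (\<lambda>x. g x * \<phi> x)"
proof -
  let ?K = "closure {x. \<phi> x \<noteq> 0}"
  have "bounded (\<phi> ` ?K)"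
    using K \<phi> by (intro compact_imp_bounded compact_continuous_image) (auto intro: continuous_on_subset)
  then obtain B where B: "\<And>x. x \<in> ?K \<Longrightarrow> cmod (\<phi> x) \<le> B" unfolding bounded_iff by blast
  have "integrable (lebesgue_on ?K) g" using g K by (simp add: locally_integrable_def)
  then have "integrable (lebesgue_on ?K) (\<lambda>x. g x * \<phi> x)"
    using \<phi> B by (rule integrable_mult_bounded_continuous)
  moreover have "g x * \<phi> x = 0" if "x \<in> U - ?K" for x
  proof -
    have "x \<notin> {x. \<phi> x \<noteq> 0}" using that subsetD[OF closure_subset, of x "{x. \<phi> x \<noteq> 0}"] by auto
    then show ?thesis by simp
  qed
  moreover have "?K \<in> sets lebesgue" "U \<in> sets lebesgue" using U by (auto simp: borel_closed)
  ultimately show ?thesis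
    using integral_lebesgue_on_subset(2)[of ?K U "\<lambda>x. g x * \<phi> x", OF _ _ K(2)] by blast
qed

lemma locally_integrable_diff:
  "locally_integrable U f \<Longrightarrow> locally_integrable U g \<Longrightarrow> locally_integrable U (\<lambda>x. f x - g x)"
  by (auto simp: locally_integrable_def)

lemma locally_integrable_continuous:
  assumes "continuous_on UNIV f" shows "locally_integrable U f"
proof -
  have "integrable (lebesgue_on K) f" if "compact K" for K
  proof -
    have "bounded (f ` K)"
      using that assms by (intro compact_imp_bounded compact_continuous_image) (auto intro: continuous_on_subset)
    then obtain B where "\<And>x. x \<in> K \<Longrightarrow> cmod (f x) \<le> B" by (auto simp: bounded_iff)
    moreover have "integrable (lebesgue_on K) (\<lambda>x. 1::complex)"
      using that by (simp add: integrable_on_const lmeasurable_compact integrable_restrict_space fmeasurable_compact finite_measure.integrable_const finite_measure_lebesgue_on)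
    ultimately have "integrable (lebesgue_on K) (\<lambda>x. 1 * f x)"
      using integrable_mult_bounded_continuous[OF _ assms] by blast
    then show ?thesis by simp
  qed
  then show ?thesis by (auto simp: locally_integrable_def)
qed

text \<open>A compact set has finite measure, so L^2 embeds into L^1 there.\<close>

lemma locally_integrable_L2:
  assumes "square_integrable (lebesgue_on U) f" "open U" shows "locally_integrable U f"
proof -
  have "integrable (lebesgue_on K) f" if K: "compact K" "K \<subseteq> U" for K
  proof -
    interpret finite_measure "lebesgue_on K" using K by (intro finite_measure_lebesgue_on lmeasurable_compact)
    have sets: "K \<in> sets lebesgue" "U \<in> sets lebesgue" using K assms by (auto simp: borel_compact)
    have int: "integrable (lebesgue_on K) (\<lambda>x. (cmod (f x))\<^sup>2)"
      by (rule integrable_lebesgue_on_mono[OF _ sets K(2)]) (use assms in \<open>simp add: square_integrable_def\<close>)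
    have meas: "f \<in> borel_measurable (lebesgue_on K)"
      using assms(1) by (intro measurable_restrict_mono[OF _ K(2)]) (simp add: square_integrable_def)
    then have "integrable (lebesgue_on K) (\<lambda>x. cmod (f x))"
      by (rule square_integrable_imp_integrable[OF measurable_compose[OF _ borel_measurable_norm] int])
    then show ?thesis using meas by (simp only: integrable_norm_iff)
  qed
  then show ?thesis by (auto simp: locally_integrable_def)
qed

lemma test_function_dir_deriv:
  assumes "test_function U \<phi>" "b \<in> Basis"
  shows "test_function U (dir_deriv b \<phi>)"
proof -
  let ?K = "closure {x. \<phi> x \<noteq> 0}"
  have "dir_deriv b \<phi> x = 0" if "x \<notin> ?K" for x
  proof -
    have "dir_deriv b (\<lambda>x. 0) x = dir_deriv b \<phi> x"
      by (rule dir_deriv_cong_open[of "- ?K"]) (use that subsetD[OF closure_subset, of _ "{x. \<phi> x \<noteq> 0}"] in auto)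
    then show ?thesis by simp
  qed
  then have sub: "closure {x. dir_deriv b \<phi> x \<noteq> 0} \<subseteq> ?K" by (intro closure_minimal) auto
  then have "compact (closure {x. dir_deriv b \<phi> x \<noteq> 0})"
    using assms(1) by (metis closed_Int_compact closed_closure inf.absorb1 test_function_def)
  then show ?thesis using sub assms smooth_dir_deriv by (auto simp: test_function_def)
qed

section \<open>Test functions approximating boxes, and the fundamental lemma\<close>

lemma box_test_function:
  fixes l u :: "'a::euclidean_space"
  assumes "cbox l u \<subseteq> U"
  obtains \<phi> :: "nat \<Rightarrow> 'a \<Rightarrow> complex" where "\<And>n. test_function U (\<phi> n)"
    "\<And>n x. cmod (\<phi> n x) \<le> 1" "\<And>n x. x \<notin> box l u \<Longrightarrow> \<phi> n x = 0"
    "\<And>x. (\<lambda>n. \<phi> n x) \<longlonglongrightarrow> indicator (box l u) x"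
proof
  \<comment> \<open>\<open>s\<close> rises smoothly from 0 at 0 to 1 at 1. The factor n moves the
    plateau to distance 1/n from the faces, so every point of the open box is eventually in
    it.\<close>
  define s where "s t = 1 - cutoff 0 1 t" for t
  define f where "f n b x = s (real n * (x \<bullet> b - l \<bullet> b)) * s (real n * (u \<bullet> b - x \<bullet> b))" for n b and x :: 'a
  define \<phi> where "\<phi> n x = (\<Prod>b\<in>Basis. complex_of_real (f n b x))" for n x
  have s: "0 \<le> s t" "s t \<le> 1" "t \<le> 0 \<Longrightarrow> s t = 0" "t \<ge> 1 \<Longrightarrow> s t = 1" for t
    using cutoff_range[of 0 1 t] cutoff_eq_1[of 0 1 t] cutoff_eq_0[of 0 1 t] by (auto simp: s_def)
  have f: "0 \<le> f n b x" "f n b x \<le> 1" for n b x using s by (auto simp: f_def mult_le_one)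
  show "cmod (\<phi> n x) \<le> 1" for n x
    using f by (simp add: \<phi>_def prod_norm[symmetric] prod_le_1)
  show zero: "\<phi> n x = 0" if "x \<notin> box l u" for n x
  proof -
    from that obtain b where "b \<in> Basis" "x \<bullet> b \<le> l \<bullet> b \<or> u \<bullet> b \<le> x \<bullet> b"
      by (force simp: mem_box)
    then have "f n b x = 0" using s(3) by (auto simp: f_def mult_nonneg_nonpos)
    with \<open>b \<in> Basis\<close> show ?thesis by (auto simp: \<phi>_def intro!: prod_zero)
  qed
  show "(\<lambda>n. \<phi> n x) \<longlonglongrightarrow> indicator (box l u) x" for x
  proof (cases "x \<in> box l u")
    case True
    have "\<forall>\<^sub>F n in sequentially. f n b x = 1" if "b \<in> Basis" for b
    proof -
      have "\<forall>\<^sub>F n in sequentially. real n * c \<ge> 1" if "c > 0" for c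
      proof -
        have "\<forall>\<^sub>F n in sequentially. 1 / c \<le> real n"
          using filterlim_real_sequentially unfolding filterlim_at_top by blast
        then show ?thesis by eventually_elim (use that in \<open>simp add: pos_divide_le_eq\<close>)
      qed
      then have "\<forall>\<^sub>F n in sequentially. real n * (x \<bullet> b - l \<bullet> b) \<ge> 1"
        "\<forall>\<^sub>F n in sequentially. real n * (u \<bullet> b - x \<bullet> b) \<ge> 1"
        using True that by (simp_all add: mem_box)
      then show ?thesis by eventually_elim (simp only: f_def s(4) mult_1)
    qed
    then have "\<forall>\<^sub>F n in sequentially. \<forall>b\<in>Basis. f n b x = 1" by (simp add: eventually_ball_finite)
    then have "\<forall>\<^sub>F n in sequentially. \<phi> n x = 1" by eventually_elim (simp add: \<phi>_def)
    then show ?thesis using True by (simp add: tendsto_eventually)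
  next
    case False
    then show ?thesis using zero by simp
  qed
  have sm: "C_diff_on k UNIV (\<lambda>x. complex_of_real (s (c * (d * (x \<bullet> b) - e))))" for k c d e b
  proof -
    have "C_diff_on k UNIV (\<lambda>x. complex_of_real (c * d * (x \<bullet> b)) - of_real (c * e))"
      by (intro C_diff_on_diff open_UNIV C_diff_on_const C_diff_on_bounded_linear bounded_linear_compose[OF bounded_linear_of_real]
         bounded_linear_compose[OF bounded_linear_mult_right] bounded_linear_inner_left)
    also have "(\<lambda>x. complex_of_real (c * d * (x \<bullet> b)) - of_real (c * e)) = (\<lambda>x. complex_of_real (c * (d * (x \<bullet> b) - e)))"
      by (simp add: algebra_simps)
    finally show ?thesis unfolding s_def of_real_diff by (intro C_diff_on_diff C_diff_on_cutoff C_diff_on_const) auto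
  qed
  have "C_diff_on k UNIV (\<lambda>x. complex_of_real (f n b x))" for k n b
    proof -
    have "C_diff_on k UNIV (\<lambda>x. complex_of_real (s (real n * (x \<bullet> b - l \<bullet> b))))"
      using sm[of k n 1 b "l \<bullet> b"] by simp
    moreover have "C_diff_on k UNIV (\<lambda>x. complex_of_real (s (real n * (u \<bullet> b - x \<bullet> b))))"
      using sm[of k n "-1" b "- (u \<bullet> b)"] by simp
    ultimately show ?thesis unfolding f_def of_real_mult by (intro C_diff_on_mult open_UNIV)
  qed
  note smf = this
  have "C_diff_on k UNIV (\<lambda>x. \<Prod>b\<in>B. complex_of_real (f n b x))" if "finite B" for k n and B :: "'a set"
    using that by (induction B rule: finite_induct) (auto intro!: C_diff_on_mult smf)
  then have "smooth (\<phi> n)" for n unfolding smooth_iff \<phi>_def[abs_def] using finite_Basis by blast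
  moreover have sub: "closure {x. \<phi> n x \<noteq> 0} \<subseteq> cbox l u" for n
    using zero[of _ n] box_subset_cbox by (intro closure_minimal) auto
  moreover have "compact (closure {x. \<phi> n x \<noteq> 0})" for n
    using bounded_subset[OF bounded_cbox, OF order_trans[OF closure_subset sub]] by (simp add: compact_closure)
  ultimately show "test_function U (\<phi> n)" for n unfolding test_function_def using assms by blast
qed

text \<open>Dominated convergence with the box test functions gives integral 0 over every box inside
  U. Lebesgue differentiation then recovers g at almost every point from its averages over small
  cubes.\<close>

theorem fundamental_lemma_calculus_of_variations:
  fixes g :: "'a::euclidean_space \<Rightarrow> complex"
  assumes U: "open U" and g: "locally_integrable U g"
    and zero: "\<And>\<phi>. test_function U \<phi> \<Longrightarrow> (LINT x|lebesgue_on U. g x * \<phi> x) = 0"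
  shows "AE x in lebesgue_on U. g x = 0"
proof -
  have int_box: "integrable (lebesgue_on (cbox l u)) g" if "cbox l u \<subseteq> U" for l u
    using g that by (auto simp: locally_integrable_def)
  have box0: "integral (cbox l u) g = 0" if lu: "cbox l u \<subseteq> U" for l u
  proof -
    obtain \<phi> :: "nat \<Rightarrow> 'a \<Rightarrow> complex" where \<phi>: "\<And>n. test_function U (\<phi> n)"
      "\<And>n x. cmod (\<phi> n x) \<le> 1" "\<And>n x. x \<notin> box l u \<Longrightarrow> \<phi> n x = 0"
      "\<And>x. (\<lambda>n. \<phi> n x) \<longlonglongrightarrow> indicator (box l u) x"
      using box_test_function[OF lu] by metis
    let ?M = "lebesgue_on (cbox l u)"
    have cont: "continuous_on UNIV (\<phi> n)" for n using \<phi>(1) smooth_continuous by (auto simp: test_function_def)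
    have "(\<lambda>n. LINT x|?M. g x * \<phi> n x) \<longlonglongrightarrow> (LINT x|?M. g x * indicator (box l u) x)"
    proof (rule integral_dominated_convergence[where w="\<lambda>x. cmod (g x)"])
      show "(\<lambda>x. g x * indicator (box l u) x) \<in> borel_measurable ?M"
        using int_box[OF lu] box_subset_cbox[of l u]
        by (intro borel_measurable_times borel_measurable_indicator) (auto simp: sets_restrict_space_iff)
      show "(\<lambda>x. g x * \<phi> n x) \<in> borel_measurable ?M" for n
        using int_box[OF lu] borel_measurable_lebesgue_on_continuous[OF cont] by auto
      show "integrable ?M (\<lambda>x. cmod (g x))" using int_box[OF lu] by auto
      show "AE x in ?M. (\<lambda>n. g x * \<phi> n x) \<longlonglongrightarrow> g x * indicator (box l u) x"
        using \<phi>(4) by (auto intro!: tendsto_mult_left)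
      show "AE x in ?M. cmod (g x * \<phi> n x) \<le> cmod (g x)" for n
        using \<phi>(2) by (auto simp: norm_mult mult_left_le)
    qed
    moreover have "(LINT x|?M. g x * \<phi> n x) = 0" for n
    proof -
      have "(LINT x|?M. g x * \<phi> n x) = (LINT x|lebesgue_on U. g x * \<phi> n x)"
        using lu U \<phi>(3)[of _ n] subsetD[OF box_subset_cbox[of l u]] by (intro integral_lebesgue_on_subset) auto
      then show ?thesis using zero[OF \<phi>(1)] by simp
    qed
    ultimately have "(LINT x|?M. g x * indicator (box l u) x) = 0" by (simp add: LIMSEQ_const_iff)
    moreover have "(LINT x|?M. g x * indicator (box l u) x) = (LINT x|lebesgue_on (box l u). g x * indicator (box l u) x)"
      using box_subset_cbox by (intro integral_lebesgue_on_subset[symmetric]) auto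
    moreover have "\<dots> = (LINT x|lebesgue_on (box l u). g x)"
      by (intro Bochner_Integration.integral_cong) (auto simp: space_restrict_space)
    moreover have "\<dots> = integral (box l u) g"
      using integrable_lebesgue_on_mono[OF int_box[OF lu], of "box l u"] box_subset_cbox
      by (intro lebesgue_integral_eq_integral) auto
    moreover have "integral (box l u) g = integral (cbox l u) g" by (simp add: integral_open_interval)
    ultimately show ?thesis by simp
  qed
  have box_AE: "AE x in lebesgue. x \<in> box p q \<longrightarrow> g x = 0" if pq: "cbox p q \<subseteq> U" for p q
  proof -
    \<comment> \<open>Extension by 0 yields a function that is integrable on every box, as the
      differentiation theorem asks; close to a point of the open box, G and g have the same
      averages.\<close>
    define G where "G x = (if x \<in> cbox p q then g x else 0)" for x
    have "integrable lebesgue G"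
      using int_box[OF pq] by (simp add: integrable_lebesgue_on_iff G_def[abs_def] indicator_scaleR_eq_if)
    then have "G integrable_on cbox a b" for a b
      by (metis integrable_on_lebesgue integrable_on_subcbox subset_UNIV)
    then obtain N where N: "negligible N" "\<And>x e. \<lbrakk>x \<notin> N; 0 < e\<rbrakk> \<Longrightarrow>
               \<exists>d>0. \<forall>h. 0 < h \<and> h < d \<longrightarrow> norm(integral (cbox x (x + h *\<^sub>R One)) G /\<^sub>R h ^ DIM('a) - G x) < e"
      using integrable_ccontinuous_explicit by metis
    have "g x = 0" if x: "x \<in> box p q" "x \<notin> N" for x
    proof -
      have "cmod (G x) < e" if e: "e > 0" for e
      proof -
        obtain d where d: "d > 0" "\<And>h. 0 < h \<and> h < d \<Longrightarrow> norm(integral (cbox x (x + h *\<^sub>R One)) G /\<^sub>R h ^ DIM('a) - G x) < e"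
          using N(2)[OF x(2) e] by auto
        obtain r where r: "r > 0" "\<And>y. dist y x < r \<Longrightarrow> y \<in> box p q"
          using x(1) open_box unfolding open_dist by metis
        \<comment> \<open>The farthest vertex of the cube is x + h One. The second bound keeps it
          within r/2 of x, hence in the box; the first keeps h below d.\<close>
        define h where "h = min (d/2) (r / (2 * norm (One::'a)))"
        have h: "h > 0" "h < d" using d r by (auto simp: h_def min_def)
        have "h * norm (One::'a) \<le> r/2" using r by (auto simp: h_def min_def field_simps)
        then have "x + h *\<^sub>R One \<in> cbox p q" using r h box_subset_cbox by (intro subsetD[OF box_subset_cbox]) (auto simp: dist_norm)
        moreover have "x \<in> cbox p q" using x box_subset_cbox by blast
        ultimately have sub: "cbox x (x + h *\<^sub>R One) \<subseteq> cbox p q"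
          unfolding subset_box by (simp add: mem_box)
        then have "integral (cbox x (x + h *\<^sub>R One)) G = integral (cbox x (x + h *\<^sub>R One)) g"
          by (intro integral_cong) (auto simp: G_def)
        then have "integral (cbox x (x + h *\<^sub>R One)) G = 0" using box0 sub pq by auto
        then show ?thesis using d(2)[of h] h by simp
      qed
      then have "G x = 0" by (metis less_irrefl norm_le_zero_iff not_less)
      then show ?thesis using x box_subset_cbox by (auto simp: G_def split: if_splits)
    qed
    moreover have "AE x in lebesgue. x \<notin> N" using N(1) by (simp add: AE_not_in negligible_iff_null_sets)
    ultimately show ?thesis by (auto elim: eventually_mono)
  qed
  \<comment> \<open>The boxes inside U are uncountably many; Lindelof's theorem extracts a countable
    subfamily with the same union, so that the exceptional null sets can be united.\<close>
  define \<D> where "\<D> = {box p q | p q. cbox p q \<subseteq> U}"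
  obtain \<D>' where D': "\<D>' \<subseteq> \<D>" "countable \<D>'" "\<Union>\<D>' = \<Union>\<D>"
    by (rule Lindelof[of \<D>]) (auto simp: \<D>_def open_box)
  have "AE x in lebesgue. x \<in> D \<longrightarrow> g x = 0" if "D \<in> \<D>'" for D
    using box_AE D'(1) that by (auto simp: \<D>_def)
  then have "\<forall>D\<in>\<D>'. AE x in lebesgue. x \<in> D \<longrightarrow> g x = 0" by (rule ballI)
  then have "AE x in lebesgue. \<forall>D\<in>\<D>'. x \<in> D \<longrightarrow> g x = 0"
    using AE_ball_countable[OF D'(2), of "\<lambda>x D. x \<in> D \<longrightarrow> g x = 0" lebesgue] by (rule iffD2[rotated])
  moreover have "\<exists>D\<in>\<D>'. x \<in> D" if xU: "x \<in> U" for x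
  proof -
    obtain e where e: "e > 0" "cball x e \<subseteq> U" using open_contains_cball_eq[OF U] xU by meson
    obtain p q where pq: "x \<in> box p q" "box p q \<subseteq> ball x e" using rational_boxes[OF e(1), of x] by meson
    have "cbox p q = closure (box p q)" by (rule closure_box[symmetric]) (use pq(1) in blast)
    also have "\<dots> \<subseteq> cball x e" using pq(2) by (intro closure_minimal) auto
    finally have "box p q \<in> \<D>" using e(2) unfolding \<D>_def by blast
    then have "x \<in> \<Union>\<D>" using pq(1) by (rule UnionI)
    then show ?thesis by (simp only: D'(3)[symmetric] Union_iff)
  qed
  ultimately show ?thesis using U
    by (subst AE_restrict_space_iff) (auto elim!: eventually_mono)
qed

section \<open>Derivatives of compactly supported functions integrate to zero\<close>

lemma integrable_lborel_compact_support:
  fixes F :: "'a::euclidean_space \<Rightarrow> 'b::euclidean_space"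
  assumes F: "continuous_on UNIV F" and K: "bounded {x. F x \<noteq> 0}"
  shows "integrable lborel F"
proof -
  obtain R where R: "{x. F x \<noteq> 0} \<subseteq> cball 0 R" using bounded_subset_ballD[OF K, of 0] ball_subset_cball[of "0::'a"] by (meson order_trans)
  have "integrable lborel (\<lambda>x. indicator (cball 0 R) x *\<^sub>R F x)"
    by (intro borel_integrable_compact) (auto intro: continuous_on_subset[OF F])
  also have "(\<lambda>x. indicator (cball 0 R) x *\<^sub>R F x) = F"
    using R by (intro ext) (auto simp: indicator_def)
  finally show ?thesis .
qed

lemma integral_lborel_translate:
  fixes F :: "'a::euclidean_space \<Rightarrow> 'b::euclidean_space"
  assumes F: "F \<in> borel_measurable borel"
  shows "(LINT x|lborel. F (c + x)) = (LINT x|lborel. F x)"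
proof -
  have "(LINT x|lborel. F x) = (LINT x|distr lborel borel ((+) c). F x)"
    by (simp only: lborel_distr_plus)
  also have "\<dots> = (LINT x|lborel. F (c + x))"
    by (rule integral_distr) (use F in auto)
  finally show ?thesis by simp
qed

text \<open>Mean value inequality on a segment; it supplies the uniform bound on difference
  quotients that the next lemma needs for domination.\<close>

lemma C1_increment_bound:
  fixes F :: "'a::euclidean_space \<Rightarrow> complex"
  assumes F: "\<And>x. F differentiable (at x)" and B: "\<And>x. cmod (dir_deriv b F x) \<le> B" and t: "0 \<le> t"
  shows "cmod (F (t *\<^sub>R b + x) - F x) \<le> B * t"
proof -
  have "((\<lambda>s. F (s *\<^sub>R b + x)) has_derivative (\<lambda>h. h *\<^sub>R dir_deriv b F (s *\<^sub>R b + x))) (at s within {0..t})" for s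
  proof -
    have "((\<lambda>s. s *\<^sub>R b + x) has_derivative (\<lambda>h. h *\<^sub>R b)) (at s within {0..t})"
      by (auto intro!: derivative_eq_intros)
    from has_derivative_compose[OF this has_derivative_dir_deriv[OF F]]
    have "((\<lambda>s. F (s *\<^sub>R b + x)) has_derivative (\<lambda>h. dir_deriv (h *\<^sub>R b) F (s *\<^sub>R b + x))) (at s within {0..t})" .
    moreover have "dir_deriv (h *\<^sub>R b) F y = h *\<^sub>R dir_deriv b F y" for h y
      using has_derivative_bounded_linear[OF has_derivative_dir_deriv[OF F]]
      by (rule bounded_linear.linear[THEN linear_cmul])
    ultimately show ?thesis by simp
  qed
  moreover have "onorm (\<lambda>h. h *\<^sub>R dir_deriv b F y) \<le> B" for y
    by (rule onorm_le) (use B[of y] in \<open>auto simp: mult.commute[of B] intro!: mult_left_mono\<close>)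
  ultimately have "norm (F (t *\<^sub>R b + x) - F (0 *\<^sub>R b + x)) \<le> B * norm (t - 0)"
    using t by (intro differentiable_bound[of "{0..t}"]) auto
  then show ?thesis using t by simp
qed

text \<open>Every difference quotient of F in direction b has integral 0 by translation invariance
  of Lebesgue measure, and dominated convergence passes to the derivative. The argument uses no
  iterated integrals and is the same in every dimension.\<close>

lemma integral_dir_deriv_compact_support:
  fixes F :: "'a::euclidean_space \<Rightarrow> complex"
  assumes F: "C_diff (Suc 0) F" and K: "bounded {x. F x \<noteq> 0}" and b: "b \<in> Basis"
  shows "(LINT x|lborel. dir_deriv b F x) = 0" and "bounded {x. dir_deriv b F x \<noteq> 0}"
    and "integrable lborel (dir_deriv b F)"
proof -
  have diff: "F differentiable (at x)" for x using F by simp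
  have contD: "continuous_on UNIV (dir_deriv b F)" using F b by simp
  have contF: "continuous_on UNIV F" using F C_diff_on_Suc_D[of UNIV 0 F] by (simp add: C_diff_on_UNIV)
  obtain R where R: "{x. F x \<noteq> 0} \<subseteq> cball 0 R" using bounded_subset_ballD[OF K, of 0] ball_subset_cball[of "0::'a"] by (meson order_trans)
  have D0: "dir_deriv b F x = 0" if "x \<notin> cball 0 R" for x
  proof -
    have "dir_deriv b (\<lambda>x. 0) x = dir_deriv b F x"
      by (rule dir_deriv_cong_open[of "- cball 0 R"]) (use that R in auto)
    then show ?thesis by simp
  qed
  then show bD: "bounded {x. dir_deriv b F x \<noteq> 0}"
    by (intro bounded_subset[OF bounded_cball[of 0 R]]) blast
  show "integrable lborel (dir_deriv b F)" by (intro integrable_lborel_compact_support contD bD)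
  have "bounded (dir_deriv b F ` cball 0 R)"
    by (intro compact_imp_bounded compact_continuous_image continuous_on_subset[OF contD]) auto
  then obtain B0 where B0: "\<And>x. x \<in> cball 0 R \<Longrightarrow> cmod (dir_deriv b F x) \<le> B0"
    unfolding bounded_iff by blast
  define B where "B = max 0 B0"
  have B: "cmod (dir_deriv b F x) \<le> B" for x
    using B0[of x] D0[of x] by (cases "x \<in> cball 0 R") (auto simp: B_def)
  define t where "t n = 1 / real (Suc n)" for n
  have t: "0 < t n" "t n \<le> 1" for n by (auto simp: t_def)
  have t0: "t \<longlonglongrightarrow> 0" unfolding t_def using LIMSEQ_Suc[OF lim_1_over_n] by simp
  define q where "q n x = (F (t n *\<^sub>R b + x) - F x) /\<^sub>R t n" for n x
  have intF: "integrable lborel F" by (intro integrable_lborel_compact_support contF K)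
  have mF: "F \<in> borel_measurable borel" by (rule borel_measurable_continuous_onI[OF contF])
  have int0: "(LINT x|lborel. q n x) = 0" for n
  proof -
    have "integrable (distr lborel borel ((+) (t n *\<^sub>R b))) F" using intF by (simp only: lborel_distr_plus)
    then have "integrable lborel (\<lambda>x. F (t n *\<^sub>R b + x))" by (subst (asm) integrable_distr_eq) (use mF in auto)
    then show ?thesis
      unfolding q_def using intF integral_lborel_translate[OF mF, of "t n *\<^sub>R b"] by simp
  qed
  have "(\<lambda>n. LINT x|lborel. q n x) \<longlonglongrightarrow> (LINT x|lborel. dir_deriv b F x)"
  \<comment> \<open>The steps \<open>t n\<close> have length at most 1, so all quotients vanish
    outside the ball of radius R + 1.\<close>
  proof (rule integral_dominated_convergence[where w="\<lambda>x. indicator (cball 0 (R + 1)) x * B"])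
    show "dir_deriv b F \<in> borel_measurable lborel" using borel_measurable_continuous_onI[OF contD] by simp
    show "q n \<in> borel_measurable lborel" for n unfolding q_def using mF by measurable
    show "integrable lborel (\<lambda>x. indicator (cball (0::'a) (R + 1)) x * B)" using emeasure_bounded_finite[OF bounded_cball[of "0::'a" "R+1"]] by (intro integrable_mult_left integrable_real_indicator) auto
    show "AE x in lborel. (\<lambda>n. q n x) \<longlonglongrightarrow> dir_deriv b F x"
    proof (rule AE_I2)
      fix x
      have "((\<lambda>s. s *\<^sub>R b + x) has_derivative (\<lambda>h. h *\<^sub>R b)) (at 0)"
        by (auto intro!: derivative_eq_intros)
      from has_derivative_compose[OF this has_derivative_dir_deriv[OF diff]]
      have "((\<lambda>s. F (s *\<^sub>R b + x)) has_derivative (\<lambda>h. dir_deriv (h *\<^sub>R b) F x)) (at 0)" by simp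
      moreover have "dir_deriv (h *\<^sub>R b) F x = h *\<^sub>R dir_deriv b F x" for h
        using has_derivative_bounded_linear[OF has_derivative_dir_deriv[OF diff]]
        by (rule bounded_linear.linear[THEN linear_cmul])
      ultimately have "((\<lambda>s. F (s *\<^sub>R b + x)) has_vector_derivative dir_deriv b F x) (at 0)"
        by (simp add: has_vector_derivative_def)
      then have "((\<lambda>s. (F (s *\<^sub>R b + x) - F x) /\<^sub>R s) \<longlongrightarrow> dir_deriv b F x) (at 0)"
      proof -
        assume "((\<lambda>s. F (s *\<^sub>R b + x)) has_vector_derivative dir_deriv b F x) (at 0)"
        then have l: "((\<lambda>s. norm (F (s *\<^sub>R b + x) - F x - s *\<^sub>R dir_deriv b F x) / \<bar>s\<bar>) \<longlongrightarrow> 0) (at 0)"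
          unfolding has_vector_derivative_def has_derivative_at by simp
        have e: "norm (F (s *\<^sub>R b + x) - F x - s *\<^sub>R dir_deriv b F x) / \<bar>s\<bar>
            = norm ((F (s *\<^sub>R b + x) - F x) /\<^sub>R s - dir_deriv b F x)" if "s \<noteq> 0" for s :: real
        proof -
          have "(F (s *\<^sub>R b + x) - F x) /\<^sub>R s - dir_deriv b F x = (F (s *\<^sub>R b + x) - F x - s *\<^sub>R dir_deriv b F x) /\<^sub>R s"
            using that by (simp add: scaleR_diff_right)
          then show ?thesis by (simp add: divide_inverse mult.commute)
        qed
        have "((\<lambda>s. norm ((F (s *\<^sub>R b + x) - F x) /\<^sub>R s - dir_deriv b F x)) \<longlongrightarrow> 0) (at 0)"
          by (rule Lim_transform_eventually[OF l]) (simp add: eventually_at_filter e)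
        then show ?thesis by (simp only: tendsto_norm_zero_iff LIM_zero_iff)
      qed
      moreover have "filterlim t (at 0) sequentially" using t0 t(1) by (auto simp: filterlim_at less_le)
      ultimately show "(\<lambda>n. q n x) \<longlonglongrightarrow> dir_deriv b F x" unfolding q_def by (rule filterlim_compose)
    qed
    show "AE x in lborel. norm (q n x) \<le> indicator (cball 0 (R + 1)) x * B" for n
    proof (rule AE_I2)
      fix x
      show "norm (q n x) \<le> indicator (cball 0 (R + 1)) x * B"
      proof (cases "x \<in> cball 0 (R+1)")
        case True
        have "norm (q n x) = norm (F (t n *\<^sub>R b + x) - F x) / t n"
          using t[of n] by (simp add: q_def divide_inverse mult.commute)
        also have "\<dots> \<le> B" using C1_increment_bound[OF diff B, of "t n" x] t[of n] by (simp add: pos_divide_le_eq)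
        finally show ?thesis using True by simp
      next
        case False
        have "norm (t n *\<^sub>R b + x) \<ge> norm x - norm (t n *\<^sub>R b)"
          using norm_triangle_ineq4[of "t n *\<^sub>R b + x" "t n *\<^sub>R b"] by simp
        then have "norm (t n *\<^sub>R b + x) > R" using False t[of n] b by simp
        then have "F (t n *\<^sub>R b + x) = 0" "F x = 0" using R False by fastforce+
        then show ?thesis using False by (simp add: q_def)
      qed
    qed
  qed
  then show "(LINT x|lborel. dir_deriv b F x) = 0" by (simp add: int0 LIMSEQ_const_iff)
qed

text \<open>Bridge from the completed measure of the definitions to \<open>lborel\<close>, where
  translation and product arguments are available.\<close>

lemma integral_lebesgue_on_continuous:
  fixes F :: "'a::euclidean_space \<Rightarrow> complex"
  assumes F: "continuous_on UNIV F" and S: "S \<in> sets borel"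
  shows "integral\<^sup>L (lebesgue_on S) F = (LINT x|lborel. indicator S x *\<^sub>R F x)"
    and "integrable (lebesgue_on S) F \<longleftrightarrow> integrable lborel (\<lambda>x. indicator S x *\<^sub>R F x)"
proof -
  have "(\<lambda>x. indicator S x *\<^sub>R F x) \<in> borel_measurable lborel"
    using borel_measurable_continuous_onI[OF F] S by simp
  then show "integral\<^sup>L (lebesgue_on S) F = (LINT x|lborel. indicator S x *\<^sub>R F x)"
    "integrable (lebesgue_on S) F \<longleftrightarrow> integrable lborel (\<lambda>x. indicator S x *\<^sub>R F x)"
    using S by (simp_all add: integral_lebesgue_on_eq integrable_lebesgue_on_iff integral_completion integrable_completion)
qed

lemma test_functionD:
  assumes "test_function U \<phi>"
  shows "smooth \<phi>" "continuous_on UNIV \<phi>" "C_diff n \<phi>" "bounded {x. \<phi> x \<noteq> 0}" "x \<notin> U \<Longrightarrow> \<phi> x = 0"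
    "\<phi> differentiable (at x)" "b \<in> Basis \<Longrightarrow> continuous_on UNIV (dir_deriv b \<phi>)"
proof -
  show s: "smooth \<phi>" using assms by (simp add: test_function_def)
  show "continuous_on UNIV \<phi>" "C_diff n \<phi>" "\<phi> differentiable (at x)"
    using s smooth_continuous smooth_differentiable by (auto simp: smooth_def)
  show "b \<in> Basis \<Longrightarrow> continuous_on UNIV (dir_deriv b \<phi>)" using s smooth_continuous smooth_dir_deriv by blast
  show "bounded {x. \<phi> x \<noteq> 0}"
    using assms by (auto simp: test_function_def compact_closure)
  have "{x. \<phi> x \<noteq> 0} \<subseteq> U" using assms closure_subset[of "{x. \<phi> x \<noteq> 0}"] by (auto simp: test_function_def)
  then show "x \<notin> U \<Longrightarrow> \<phi> x = 0" by auto
qed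

section \<open>Weak derivatives\<close>

text \<open>The product of f with a test function has compact support, so the integral of its
  derivative vanishes; the product rule turns this into integration by parts.\<close>

lemma has_weak_deriv_C1:
  assumes U: "open U" and f: "C_diff (Suc 0) f" and b: "b \<in> Basis"
  shows "has_weak_deriv U b f (dir_deriv b f)"
  unfolding has_weak_deriv_def
proof (intro conjI allI impI)
  have contf: "continuous_on UNIV f" using f C_diff_on_Suc_D[of UNIV 0 f] by (simp add: C_diff_on_UNIV)
  have contD: "continuous_on UNIV (dir_deriv b f)" using f b by simp
  show "locally_integrable U f" "locally_integrable U (dir_deriv b f)"
    by (intro locally_integrable_continuous contf contD)+
  fix \<phi> assume \<phi>: "test_function U \<phi>"
  note p = test_functionD[OF \<phi>] and dp = test_functionD[OF test_function_dir_deriv[OF \<phi> b]]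
  let ?F = "\<lambda>x. f x * \<phi> x"
  have diff: "f differentiable (at x)" for x using f by simp
  have eq: "dir_deriv b ?F x = f x * dir_deriv b \<phi> x + dir_deriv b f x * \<phi> x" for x
    by (rule dir_deriv_mult[OF diff p(6)])
  have bdd: "bounded {x. ?F x \<noteq> 0}" by (rule bounded_subset[OF p(4)]) auto
  have c1: "continuous_on UNIV (\<lambda>x. f x * dir_deriv b \<phi> x)" and c2: "continuous_on UNIV (\<lambda>x. dir_deriv b f x * \<phi> x)"
    by (intro continuous_on_mult contf contD dp p b)+
  have i1: "integrable lborel (\<lambda>x. f x * dir_deriv b \<phi> x)"
    by (rule integrable_lborel_compact_support[OF c1 bounded_subset[OF dp(4)]]) auto
  have i2: "integrable lborel (\<lambda>x. dir_deriv b f x * \<phi> x)"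
    by (rule integrable_lborel_compact_support[OF c2 bounded_subset[OF p(4)]]) auto
  have "(LINT x|lborel. dir_deriv b ?F x) = 0"
    by (rule integral_dir_deriv_compact_support[OF C_diff_mult[OF f p(3)] bdd b])
  then have "(LINT x|lborel. f x * dir_deriv b \<phi> x) + (LINT x|lborel. dir_deriv b f x * \<phi> x) = 0"
    by (simp only: eq Bochner_Integration.integral_add[OF i1 i2])
  moreover have "(LINT x|lebesgue_on U. f x * dir_deriv b \<phi> x) = (LINT x|lborel. f x * dir_deriv b \<phi> x)"
  proof -
    have "(\<lambda>x. indicator U x *\<^sub>R (f x * dir_deriv b \<phi> x)) = (\<lambda>x. f x * dir_deriv b \<phi> x)"
      using dp(5) by (intro ext) (auto simp: indicator_def)
    then show ?thesis using U by (subst integral_lebesgue_on_continuous(1)[OF c1]) auto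
  qed
  moreover have "(LINT x|lebesgue_on U. dir_deriv b f x * \<phi> x) = (LINT x|lborel. dir_deriv b f x * \<phi> x)"
  proof -
    have "(\<lambda>x. indicator U x *\<^sub>R (dir_deriv b f x * \<phi> x)) = (\<lambda>x. dir_deriv b f x * \<phi> x)"
      using p(5) by (intro ext) (auto simp: indicator_def)
    then show ?thesis using U by (subst integral_lebesgue_on_continuous(1)[OF c2]) auto
  qed
  ultimately show "(LINT x|lebesgue_on U. f x * dir_deriv b \<phi> x) = - (LINT x|lebesgue_on U. dir_deriv b f x * \<phi> x)"
    by (simp add: eq_neg_iff_add_eq_0)
qed

lemma has_weak_deriv_diff:
  assumes U: "open U" and b: "b \<in> Basis" and 1: "has_weak_deriv U b u1 g1" and 2: "has_weak_deriv U b u2 g2"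
  shows "has_weak_deriv U b (\<lambda>x. u1 x - u2 x) (\<lambda>x. g1 x - g2 x)"
  unfolding has_weak_deriv_def
proof (intro conjI allI impI)
  show "locally_integrable U (\<lambda>x. u1 x - u2 x)" "locally_integrable U (\<lambda>x. g1 x - g2 x)"
    using 1 2 by (auto simp: has_weak_deriv_def intro: locally_integrable_diff)
  fix \<phi> assume \<phi>: "test_function U \<phi>"
  have i: "integrable (lebesgue_on U) (\<lambda>x. f x * \<psi> x)" if "test_function U \<psi>" "locally_integrable U f" for f \<psi>
    using locally_integrable_mult_compact_support[OF U that(2) test_functionD(2)[OF that(1)]] that(1)
    by (simp add: test_function_def)
  note i1 = i[OF test_function_dir_deriv[OF \<phi> b]] and i2 = i[OF \<phi>]
  have l: "locally_integrable U u1" "locally_integrable U u2" "locally_integrable U g1" "locally_integrable U g2"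
    and e: "(LINT x|lebesgue_on U. u1 x * dir_deriv b \<phi> x) = - (LINT x|lebesgue_on U. g1 x * \<phi> x)"
      "(LINT x|lebesgue_on U. u2 x * dir_deriv b \<phi> x) = - (LINT x|lebesgue_on U. g2 x * \<phi> x)"
    using 1 2 \<phi> by (auto simp: has_weak_deriv_def)
  show "(LINT x|lebesgue_on U. (u1 x - u2 x) * dir_deriv b \<phi> x) = - (LINT x|lebesgue_on U. (g1 x - g2 x) * \<phi> x)"
    unfolding left_diff_distrib
    by (subst (1 2) Bochner_Integration.integral_diff) (use i1 i2 l e in auto)
qed

text \<open>Two weak derivatives of u differ by a weak derivative of u - u = 0, to which the
  fundamental lemma applies.\<close>

lemma has_weak_deriv_unique:
  assumes U: "open U" and b: "b \<in> Basis" and 1: "has_weak_deriv U b u g1" and 2: "has_weak_deriv U b u g2"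
  shows "AE x in lebesgue_on U. g1 x = g2 x"
proof -
  have h: "has_weak_deriv U b (\<lambda>x. u x - u x) (\<lambda>x. g1 x - g2 x)"
    by (rule has_weak_deriv_diff[OF U b 1 2])
  have "AE x in lebesgue_on U. g1 x - g2 x = 0"
  proof (rule fundamental_lemma_calculus_of_variations[OF U])
    show "locally_integrable U (\<lambda>x. g1 x - g2 x)" using h by (simp add: has_weak_deriv_def)
    show "(LINT x|lebesgue_on U. (g1 x - g2 x) * \<phi> x) = 0" if "test_function U \<phi>" for \<phi>
      using h that by (auto simp: has_weak_deriv_def)
  qed
  then show ?thesis by simp
qed

lemma weak_deriv_works: "has_weak_deriv U b u g \<Longrightarrow> has_weak_deriv U b u (weak_deriv U b u)"
  unfolding weak_deriv_def by (rule someI[where P="has_weak_deriv U b u"])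

text \<open>What makes the arbitrary choice in \<open>weak_deriv\<close> harmless: under an integral
  it may be replaced by any concrete weak derivative.\<close>

lemma weak_deriv_AE_eq:
  assumes "open U" "b \<in> Basis" "has_weak_deriv U b u g"
  shows "AE x in lebesgue_on U. weak_deriv U b u x = g x"
  using has_weak_deriv_unique[OF assms(1,2) weak_deriv_works[OF assms(3)] assms(3)] .

lemma test_function_mono: "test_function V \<phi> \<Longrightarrow> V \<subseteq> U \<Longrightarrow> test_function U \<phi>"
  by (auto simp: test_function_def)

text \<open>A test function of V is one of U and vanishes on U - V. The eigenfunctions live on the
  whole domain, whereas their approximation by Herglotz waves is measured on the sector
  disc.\<close>

lemma has_weak_deriv_subset:
  assumes U: "open U" "open V" "V \<subseteq> U" and b: "b \<in> Basis" and u: "has_weak_deriv U b u g"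
  shows "has_weak_deriv V b u g"
  unfolding has_weak_deriv_def
proof (intro conjI allI impI)
  show "locally_integrable V u" "locally_integrable V g"
    using u U(3) by (auto simp: has_weak_deriv_def locally_integrable_def)
  fix \<phi> assume \<phi>: "test_function V \<phi>"
  have sets: "V \<in> sets lebesgue" "U \<in> sets lebesgue" using U by auto
  have "(LINT x|lebesgue_on V. u x * dir_deriv b \<phi> x) = (LINT x|lebesgue_on U. u x * dir_deriv b \<phi> x)"
    by (rule integral_lebesgue_on_subset(1)[OF sets U(3)])
       (simp add: test_functionD(5)[OF test_function_dir_deriv[OF \<phi> b]])
  moreover have "(LINT x|lebesgue_on V. g x * \<phi> x) = (LINT x|lebesgue_on U. g x * \<phi> x)"
    by (rule integral_lebesgue_on_subset(1)[OF sets U(3)]) (simp add: test_functionD(5)[OF \<phi>])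
  ultimately show "(LINT x|lebesgue_on V. u x * dir_deriv b \<phi> x) = - (LINT x|lebesgue_on V. g x * \<phi> x)"
    using u test_function_mono[OF \<phi> U(3)] by (simp add: has_weak_deriv_def)
qed

text \<open>Completeness of Lebesgue measure. It serves representatives such as
  \<open>weak_deriv\<close>, which are identified only up to null sets.\<close>

lemma borel_measurable_lebesgue_on_AE:
  fixes f :: "'a::euclidean_space \<Rightarrow> 'b::euclidean_space"
  assumes f: "f \<in> borel_measurable (lebesgue_on U)" and U: "U \<in> sets lebesgue" and eq: "AE x in lebesgue_on U. f x = g x"
  shows "g \<in> borel_measurable (lebesgue_on U)"
proof -
  have "(\<lambda>x. indicator U x *\<^sub>R f x) \<in> borel_measurable lebesgue"
    using f U by (subst (asm) borel_measurable_restrict_space_iff) auto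
  moreover have "AE x in lebesgue. indicator U x *\<^sub>R f x = indicator U x *\<^sub>R g x"
    using eq U by (subst (asm) AE_restrict_space_iff) (auto elim!: eventually_mono)
  ultimately have "(\<lambda>x. indicator U x *\<^sub>R g x) \<in> borel_measurable lebesgue"
    by (rule borel_measurable_AE)
  then show ?thesis using U by (subst borel_measurable_restrict_space_iff) auto
qed

lemma square_integrable_AE_cong:
  assumes f: "square_integrable (lebesgue_on U) f" and U: "U \<in> sets lebesgue"
    and eq: "AE x in lebesgue_on U. f x = g x"
  shows "square_integrable (lebesgue_on U) g"
proof -
  have m: "f \<in> borel_measurable (lebesgue_on U)" "g \<in> borel_measurable (lebesgue_on U)"
    using f borel_measurable_lebesgue_on_AE[OF _ U eq] by (auto simp: square_integrable_def)
  have "integrable (lebesgue_on U) (\<lambda>x. (cmod (g x))\<^sup>2)"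
    by (rule Bochner_Integration.integrable_cong_AE_imp[where g="\<lambda>x. (cmod (f x))\<^sup>2"])
       (use f m eq in \<open>auto simp: square_integrable_def\<close>)
  then show ?thesis using m by (simp add: square_integrable_def)
qed

lemma in_H1_weak_deriv:
  assumes U: "open U" and u: "in_H1 U u" and b: "b \<in> Basis"
  shows "has_weak_deriv U b u (weak_deriv U b u)" "square_integrable (lebesgue_on U) (weak_deriv U b u)"
proof -
  obtain g where g: "square_integrable (lebesgue_on U) g" "has_weak_deriv U b u g"
    using u b by (auto simp: in_H1_def)
  show "has_weak_deriv U b u (weak_deriv U b u)" by (rule weak_deriv_works[OF g(2)])
  have "AE x in lebesgue_on U. g x = weak_deriv U b u x"
    using weak_deriv_AE_eq[OF U b g(2)] by eventually_elim simp
  then show "square_integrable (lebesgue_on U) (weak_deriv U b u)"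
    by (rule square_integrable_AE_cong[OF g(1), rotated]) (use U in simp)
qed

text \<open>Expresses the gradient that enters \<open>H1_norm\<close> over the small set V through
  the gradient over U, so that approximation on V and trace approximation on U can be
  compared.\<close>

lemma weak_deriv_subset_diff_C1:
  assumes U: "open U" "open V" "V \<subseteq> U" and b: "b \<in> Basis" and u: "in_H1 U u" and f: "C_diff (Suc 0) f"
  shows "AE x in lebesgue_on V. weak_deriv V b (\<lambda>x. u x - f x) x = weak_deriv U b u x - dir_deriv b f x"
proof -
  have "has_weak_deriv V b u (weak_deriv U b u)"
    using has_weak_deriv_subset[OF U b in_H1_weak_deriv(1)[OF U(1) u b]] .
  then have "has_weak_deriv V b (\<lambda>x. u x - f x) (\<lambda>x. weak_deriv U b u x - dir_deriv b f x)"
    by (intro has_weak_deriv_diff U b has_weak_deriv_C1 f)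
  then show ?thesis by (rule weak_deriv_AE_eq[OF U(2) b])
qed

lemma square_integrable_continuous:
  fixes f :: "'a::euclidean_space \<Rightarrow> complex"
  assumes f: "continuous_on UNIV f" and U: "bounded U" "U \<in> sets lebesgue"
  shows "square_integrable (lebesgue_on U) f"
proof -
  have "bounded (f ` closure U)"
    using U by (intro compact_imp_bounded compact_continuous_image continuous_on_subset[OF f]) (auto simp: compact_closure)
  then obtain B where B: "\<And>x. x \<in> closure U \<Longrightarrow> cmod (f x) \<le> B" unfolding bounded_iff by blast
  have lm: "U \<in> lmeasurable" using U by (simp add: bounded_set_imp_lmeasurable)
  interpret finite_measure "lebesgue_on U" using lm by (rule finite_measure_lebesgue_on)
  have m: "f \<in> borel_measurable (lebesgue_on U)" by (rule borel_measurable_lebesgue_on_continuous[OF f])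
  have "integrable (lebesgue_on U) (\<lambda>x. (cmod (f x))\<^sup>2)"
  proof (rule integrable_const_bound[where B="B\<^sup>2"])
    show "AE x in lebesgue_on U. norm ((cmod (f x))\<^sup>2) \<le> B\<^sup>2"
      using B subsetD[OF closure_subset[of U]] by (intro AE_I2) (auto simp: space_restrict_space intro!: power_mono)
    show "(\<lambda>x. (cmod (f x))\<^sup>2) \<in> borel_measurable (lebesgue_on U)" using m by measurable
  qed
  then show ?thesis using m by (simp add: square_integrable_def)
qed

lemma in_H1_C1:
  assumes "open U" "bounded U" "C_diff (Suc 0) f"
  shows "in_H1 U f"
proof -
  have "continuous_on UNIV f" using assms(3) C_diff_on_Suc_D[of UNIV 0 f] by (simp add: C_diff_on_UNIV)
  moreover have "continuous_on UNIV (dir_deriv b f)" if "b \<in> Basis" for b using assms(3) that by simp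
  ultimately show ?thesis using assms
    unfolding in_H1_def by (blast intro: square_integrable_continuous has_weak_deriv_C1 borel_open sets_completionI_sets lborelD)
qed

section \<open>Square-integrable functions and the Cauchy-Schwarz inequality\<close>

lemma square_integrable_imp_integrable_mult:
  assumes "square_integrable M f" "square_integrable M g"
  shows "integrable M (\<lambda>x. f x * g x)"
proof (rule Bochner_Integration.integrable_bound[where f="\<lambda>x. (cmod (f x))\<^sup>2 + (cmod (g x))\<^sup>2"])
  show "integrable M (\<lambda>x. (cmod (f x))\<^sup>2 + (cmod (g x))\<^sup>2)" using assms by (auto simp: square_integrable_def)
  show "(\<lambda>x. f x * g x) \<in> borel_measurable M" using assms by (auto simp: square_integrable_def)
  show "AE x in M. norm (f x * g x) \<le> norm ((cmod (f x))\<^sup>2 + (cmod (g x))\<^sup>2)"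
  proof (rule AE_I2)
    fix x
    have "cmod (f x) * cmod (g x) \<le> (cmod (f x))\<^sup>2 + (cmod (g x))\<^sup>2"
      using sum_squares_bound[of "cmod (f x)" "cmod (g x)"] mult_nonneg_nonneg[OF norm_ge_zero[of "f x"] norm_ge_zero[of "g x"]]
      unfolding mult.assoc by linarith
    then show "norm (f x * g x) \<le> norm ((cmod (f x))\<^sup>2 + (cmod (g x))\<^sup>2)" by (simp add: norm_mult)
  qed
qed

lemma square_integrable_add:
  assumes f: "square_integrable M f" and g: "square_integrable M g"
  shows "square_integrable M (\<lambda>x. f x + g x)"
    and "(LINT x|M. (cmod (f x + g x))\<^sup>2) \<le> 2 * (LINT x|M. (cmod (f x))\<^sup>2) + 2 * (LINT x|M. (cmod (g x))\<^sup>2)"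
proof -
  have i: "integrable M (\<lambda>x. 2 * (cmod (f x))\<^sup>2 + 2 * (cmod (g x))\<^sup>2)" using f g by (auto simp: square_integrable_def)
  have b: "(cmod (f x + g x))\<^sup>2 \<le> 2 * (cmod (f x))\<^sup>2 + 2 * (cmod (g x))\<^sup>2" for x
  proof -
    have "(cmod (f x + g x))\<^sup>2 \<le> (cmod (f x) + cmod (g x))\<^sup>2" by (intro power_mono norm_triangle_ineq) auto
    also have "\<dots> \<le> 2 * (cmod (f x))\<^sup>2 + 2 * (cmod (g x))\<^sup>2"
      using sum_squares_bound[of "cmod (f x)" "cmod (g x)"] by (simp add: power2_sum)
    finally show ?thesis .
  qed
  have i2: "integrable M (\<lambda>x. (cmod (f x + g x))\<^sup>2)"
    by (rule Bochner_Integration.integrable_bound[OF i]) (use f g b in \<open>auto simp: square_integrable_def\<close>)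
  then show "square_integrable M (\<lambda>x. f x + g x)" using f g by (auto simp: square_integrable_def)
  have "(LINT x|M. (cmod (f x + g x))\<^sup>2) \<le> (LINT x|M. 2 * (cmod (f x))\<^sup>2 + 2 * (cmod (g x))\<^sup>2)"
    using i i2 b by (intro integral_mono) auto
  then show "(LINT x|M. (cmod (f x + g x))\<^sup>2) \<le> 2 * (LINT x|M. (cmod (f x))\<^sup>2) + 2 * (LINT x|M. (cmod (g x))\<^sup>2)"
    using f g by (simp add: square_integrable_def)
qed

lemma square_integrable_uminus [simp]: "square_integrable M (\<lambda>x. - f x) \<longleftrightarrow> square_integrable M f"
  unfolding square_integrable_def by (simp add: borel_measurable_uminus_eq)

lemma square_integrable_diff:
  assumes f: "square_integrable M f" and g: "square_integrable M g"
  shows "square_integrable M (\<lambda>x. f x - g x)"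
    and "(LINT x|M. (cmod (f x - g x))\<^sup>2) \<le> 2 * (LINT x|M. (cmod (f x))\<^sup>2) + 2 * (LINT x|M. (cmod (g x))\<^sup>2)"
  using square_integrable_add[OF f, of "\<lambda>x. - g x"] g by simp_all

lemma L2_norm_sq: "(L2_norm M f)\<^sup>2 = (LINT x|M. (cmod (f x))\<^sup>2)"
  by (simp add: L2_norm_def)

lemma L2_norm_nonneg: "0 \<le> L2_norm M f"
  by (simp add: L2_norm_def)

text \<open>Integrating (|f| - t |g|)^2 \<ge> 0 gives \<open>key\<close> for all real t. The optimal
  choice is t = A / B; the degenerate cases A = 0 and B = 0 need other values of t.\<close>

lemma Cauchy_Schwarz_L2:
  assumes f: "square_integrable M f" and g: "square_integrable M g"
  shows "(LINT x|M. cmod (f x) * cmod (g x)) \<le> L2_norm M f * L2_norm M g"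
    and "integrable M (\<lambda>x. cmod (f x) * cmod (g x))"
proof -
  show i: "integrable M (\<lambda>x. cmod (f x) * cmod (g x))"
    using integrable_norm[OF square_integrable_imp_integrable_mult[OF f g]] by (simp add: norm_mult)
  define A where "A = L2_norm M f" define B where "B = L2_norm M g"
  define I where "I = (LINT x|M. cmod (f x) * cmod (g x))"
  have A0: "A \<ge> 0" "B \<ge> 0" by (auto simp: A_def B_def L2_norm_nonneg)
  have key: "2 * I * t \<le> A\<^sup>2 + t\<^sup>2 * B\<^sup>2" for t
  proof -
    have "2 * I * t = (LINT x|M. 2 * (cmod (f x) * cmod (g x)) * t)" by (simp add: I_def)
    also have "\<dots> \<le> (LINT x|M. (cmod (f x))\<^sup>2 + t\<^sup>2 * (cmod (g x))\<^sup>2)"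
    proof (rule integral_mono)
      show "2 * (cmod (f x) * cmod (g x)) * t \<le> (cmod (f x))\<^sup>2 + t\<^sup>2 * (cmod (g x))\<^sup>2" for x
        using sum_squares_bound[of "cmod (f x)" "t * cmod (g x)"] by (simp add: power_mult_distrib mult_ac)
    qed (use f g i in \<open>auto simp: square_integrable_def\<close>)
    also have "\<dots> = A\<^sup>2 + t\<^sup>2 * B\<^sup>2" using f g by (simp add: A_def B_def L2_norm_sq square_integrable_def)
    finally show ?thesis .
  qed
  have "I \<le> A * B"
  proof (cases "B = 0")
    case True
    have "I \<le> 0"
    proof (rule ccontr)
      assume "\<not> I \<le> 0"
      \<comment> \<open>With B = 0 the right side of \<open>key\<close> does not depend on t, and
        this t makes the left side exceed it by 1.\<close>
      then show False using key[of "(A\<^sup>2 + 1) / (2 * I)"] True by (simp add: field_simps)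
    qed
    then show ?thesis using True by simp
  next
    case False
    then have "B > 0" using A0 by simp
    then have "2 * I * (A / B) \<le> 2 * A\<^sup>2" using key[of "A / B"] by (simp add: power_divide)
    show ?thesis
    proof (cases "A = 0")
      case True
      have "I \<le> 0"
      proof (rule ccontr)
        assume n: "\<not> I \<le> 0"
        \<comment> \<open>With A = 0 this t makes the left side of \<open>key\<close> twice the
          right side, both being positive.\<close>
        then show False using key[of "I / B\<^sup>2"] True \<open>B > 0\<close>
          by (simp add: power_divide field_simps power2_eq_square)
      qed
      then show ?thesis using True by simp
    next
      case False
      then have "A > 0" using A0 by simp
      then show ?thesis using \<open>2 * I * (A / B) \<le> 2 * A\<^sup>2\<close> \<open>B > 0\<close> by (simp add: field_simps power2_eq_square)
    qed
  qed
  then show "(LINT x|M. cmod (f x) * cmod (g x)) \<le> L2_norm M f * L2_norm M g"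
    by (simp add: I_def A_def B_def)
qed

lemma H1_norm_sq:
  "(H1_norm U u)\<^sup>2 = (LINT x|lebesgue_on U. (cmod (u x))\<^sup>2)
     + (\<Sum>b\<in>Basis. LINT x|lebesgue_on U. (cmod (weak_deriv U b u x))\<^sup>2)"
  unfolding H1_norm_def by (subst real_sqrt_pow2) (auto simp: L2_norm_sq intro!: add_nonneg_nonneg sum_nonneg)

text \<open>Same principle as for \<open>weak_deriv\<close>: by the fundamental lemma the chosen
  Laplacian agrees almost everywhere with any known one, here the right-hand sides of the two
  equations.\<close>

lemma weak_laplacian_AE_eq:
  fixes U :: "'a::euclidean_space set"
  assumes U: "open U" and f: "has_weak_laplacian U u f"
  shows "AE x in lebesgue_on U. weak_laplacian U u x = f x"
proof -
  have w: "has_weak_laplacian U u (weak_laplacian U u)" unfolding weak_laplacian_def by (rule someI[where P="has_weak_laplacian U u", OF f])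
  have l: "locally_integrable U (weak_laplacian U u)" "locally_integrable U f"
    using w f U by (auto simp: has_weak_laplacian_def intro: locally_integrable_L2)
  have "AE x in lebesgue_on U. weak_laplacian U u x - f x = 0"
  proof (rule fundamental_lemma_calculus_of_variations[OF U locally_integrable_diff[OF l]])
    fix \<phi> assume \<phi>: "test_function U \<phi>"
    have i: "integrable (lebesgue_on U) (\<lambda>x. h x * \<phi> x)" if "locally_integrable U h" for h
      using locally_integrable_mult_compact_support[OF U that test_functionD(2)[OF \<phi>]] \<phi>
      by (simp add: test_function_def)
    have "(LINT x|lebesgue_on U. weak_laplacian U u x * \<phi> x) = (LINT x|lebesgue_on U. f x * \<phi> x)"
      using w f \<phi> by (auto simp: has_weak_laplacian_def)
    then show "(LINT x|lebesgue_on U. (weak_laplacian U u x - f x) * \<phi> x) = 0"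
      unfolding left_diff_distrib by (subst Bochner_Integration.integral_diff) (use i l in auto)
  qed
  then show ?thesis by simp
qed

section \<open>One-dimensional Hausdorff measure\<close>

text \<open>The set function inside \<open>hausdorff1\<close>, isolated because the Caratheodory
  construction treats it as an outer measure on all sets before it is known to be a measure on the
  Borel sets.\<close>

definition hausdorff_outer :: "'a::metric_space set \<Rightarrow> ennreal" where
  "hausdorff_outer A = (SUP \<delta>\<in>{0<..}. hausdorff_pre \<delta> A)"

lemma hausdorff_pre_mono: "A \<subseteq> B \<Longrightarrow> hausdorff_pre \<delta> A \<le> hausdorff_pre \<delta> B"
  unfolding hausdorff_pre_def by (intro INF_superset_mono) auto

lemma hausdorff_pre_antimono: "\<delta> \<le> \<epsilon> \<Longrightarrow> hausdorff_pre \<epsilon> A \<le> hausdorff_pre \<delta> A"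
  unfolding hausdorff_pre_def by (intro INF_superset_mono) (auto intro: order_trans)

lemma hausdorff_pre_le:
  assumes "A \<subseteq> \<Union>(range C)" "\<And>i. bounded (C i)" "\<And>i. diameter (C i) \<le> \<delta>"
  shows "hausdorff_pre \<delta> A \<le> (\<Sum>i. ennreal (diameter (C i)))"
  unfolding hausdorff_pre_def using assms by (intro INF_lower) auto

lemma le_hausdorff_pre:
  assumes "\<And>C::nat \<Rightarrow> _ set. A \<subseteq> \<Union>(range C) \<Longrightarrow> (\<And>i. bounded (C i)) \<Longrightarrow> (\<And>i. diameter (C i) \<le> \<delta>)
     \<Longrightarrow> x \<le> (\<Sum>i. ennreal (diameter (C i)))"
  shows "x \<le> hausdorff_pre \<delta> A"
  unfolding hausdorff_pre_def using assms by (intro INF_greatest) auto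

lemma hausdorff_pre_empty: "0 < \<delta> \<Longrightarrow> hausdorff_pre \<delta> {} = 0"
  using hausdorff_pre_le[of "{}" "\<lambda>_. {}" \<delta>] by simp

lemma hausdorff_pre_close:
  assumes "hausdorff_pre \<delta> A < e"
  obtains C :: "nat \<Rightarrow> 'a::metric_space set" where "A \<subseteq> \<Union>(range C)" "\<And>i. bounded (C i)" "\<And>i. diameter (C i) \<le> \<delta>"
    "(\<Sum>i. ennreal (diameter (C i))) < e"
proof -
  have "\<exists>C\<in>{C :: nat \<Rightarrow> 'a set. A \<subseteq> \<Union>(range C) \<and> (\<forall>i. bounded (C i) \<and> diameter (C i) \<le> \<delta>)}.
      (\<Sum>i. ennreal (diameter (C i))) < e"
    using assms unfolding hausdorff_pre_def INF_less_iff .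
  then show ?thesis using that by blast
qed

lemma hausdorff_pre_subadditive:
  fixes A :: "nat \<Rightarrow> 'a::metric_space set"
  shows "hausdorff_pre \<delta> (\<Union>i. A i) \<le> (\<Sum>i. hausdorff_pre \<delta> (A i))"
proof (rule ennreal_le_epsilon)
  fix e :: real assume e: "0 < e" and fin: "(\<Sum>n. hausdorff_pre \<delta> (A n)) < top"
  have lt: "hausdorff_pre \<delta> (A n) < hausdorff_pre \<delta> (A n) + e * (1/2)^Suc n" for n
    using fin e by (auto simp add: less_top dest!: ennreal_suminf_lessD)
  have "\<exists>C::nat \<Rightarrow> 'a set. A n \<subseteq> \<Union>(range C) \<and> (\<forall>i. bounded (C i) \<and> diameter (C i) \<le> \<delta>) \<and>
      (\<Sum>i. ennreal (diameter (C i))) \<le> hausdorff_pre \<delta> (A n) + e * (1/2)^Suc n" for n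
    by (rule hausdorff_pre_close[OF lt[of n]]) (metis less_imp_le)
  then obtain B :: "nat \<Rightarrow> nat \<Rightarrow> 'a set" where B: "\<And>n. A n \<subseteq> \<Union>(range (B n))" "\<And>n i. bounded (B n i)" "\<And>n i. diameter (B n i) \<le> \<delta>"
    "\<And>n. (\<Sum>i. ennreal (diameter (B n i))) \<le> hausdorff_pre \<delta> (A n) + e * (1/2)^Suc n"
    by metis
  \<comment> \<open>The covers of all \<open>A n\<close>, each optimal up to e / 2^(n+1), are
    renumbered into one sequence by the pairing function.\<close>
  define C where "C m = B (fst (prod_decode m)) (snd (prod_decode m))" for m
  have "(\<Union>i. A i) \<subseteq> \<Union>(range C)"
  proof
    fix x assume "x \<in> (\<Union>i. A i)"
    then obtain n i where "x \<in> B n i" using B(1) by blast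
    then have "x \<in> C (prod_encode (n, i))" by (simp add: C_def)
    then show "x \<in> \<Union>(range C)" by blast
  qed
  then have "hausdorff_pre \<delta> (\<Union>i. A i) \<le> (\<Sum>m. ennreal (diameter (C m)))"
    by (rule hausdorff_pre_le) (auto simp: C_def B)
  also have "\<dots> = (\<Sum>n. \<Sum>i. ennreal (diameter (B n i)))"
    unfolding C_def using suminf_ennreal_2dimen[of "\<lambda>n. (\<Sum>i. ennreal (diameter (B n i)))" "\<lambda>p. ennreal (diameter (B (fst p) (snd p)))"]
    by (simp add: comp_def)
  also have "\<dots> \<le> (\<Sum>n. hausdorff_pre \<delta> (A n) + e * (1/2) ^ Suc n)"
    using B(4) by (intro suminf_le) auto
  also have "\<dots> = (\<Sum>n. hausdorff_pre \<delta> (A n)) + (\<Sum>n. ennreal e * ennreal ((1/2) ^ Suc n))"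
    using e by (subst suminf_add[symmetric]) (auto simp del: ennreal_suminf_cmult simp add: ennreal_mult[symmetric])
  also have "\<dots> = (\<Sum>n. hausdorff_pre \<delta> (A n)) + e"
    unfolding ennreal_suminf_cmult
    by (subst suminf_ennreal_eq[OF zero_le_power power_half_series]) auto
  finally show "hausdorff_pre \<delta> (\<Union>i. A i) \<le> (\<Sum>n. hausdorff_pre \<delta> (A n)) + e" .
qed

lemma hausdorff_outer_mono: "A \<subseteq> B \<Longrightarrow> hausdorff_outer A \<le> hausdorff_outer B"
  unfolding hausdorff_outer_def by (intro SUP_mono) (auto intro: hausdorff_pre_mono)

lemma hausdorff_pre_le_outer: "0 < \<delta> \<Longrightarrow> hausdorff_pre \<delta> A \<le> hausdorff_outer A"
  unfolding hausdorff_outer_def by (intro SUP_upper) auto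

lemma hausdorff_outer_subadditive: "hausdorff_outer (\<Union>i. A i) \<le> (\<Sum>i. hausdorff_outer (A i))"
  for A :: "nat \<Rightarrow> 'a::metric_space set"
  unfolding hausdorff_outer_def[of "\<Union>i. A i"]
proof (rule SUP_least)
  fix \<delta> :: real assume "\<delta> \<in> {0<..}"
  then have "(\<Sum>i. hausdorff_pre \<delta> (A i)) \<le> (\<Sum>i. hausdorff_outer (A i))"
    by (intro suminf_le hausdorff_pre_le_outer) auto
  then show "hausdorff_pre \<delta> (\<Union>i. A i) \<le> (\<Sum>i. hausdorff_outer (A i))"
    using hausdorff_pre_subadditive[of \<delta> A] by order
qed

lemma hausdorff_outer_empty [simp]: "hausdorff_outer {} = 0"
proof -
  have "hausdorff_outer {} \<le> 0"
    unfolding hausdorff_outer_def by (rule SUP_least) (simp add: hausdorff_pre_empty)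
  then show ?thesis by simp
qed

lemma outer_measure_space_hausdorff: "outer_measure_space (Pow UNIV) hausdorff_outer"
  by (auto simp: outer_measure_space_def positive_def increasing_def countably_subadditive_def
      intro: hausdorff_outer_mono hausdorff_outer_subadditive)

lemma hausdorff_outer_Un: "hausdorff_outer (A \<union> B) \<le> hausdorff_outer A + hausdorff_outer B"
proof -
  have "hausdorff_outer (\<Union>i. if i = 0 then A else if i = Suc 0 then B else {}) \<le>
      (\<Sum>i. hausdorff_outer (if i = 0 then A else if i = Suc 0 then B else {}))"
    by (rule hausdorff_outer_subadditive)
  also have "\<dots> = (\<Sum>i\<in>{0, Suc 0}. hausdorff_outer (if i = 0 then A else if i = Suc 0 then B else {}))"
    by (rule suminf_finite) auto
  also have "(\<Union>i. if i = 0 then A else if i = Suc 0 then B else {}) = A \<union> B"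
    by (auto split: if_splits)
  finally show ?thesis by simp
qed

text \<open>A covering set of diameter at most \<delta> cannot meet both A and B, so every cover of
  the union splits into a cover of A and a cover of B.\<close>

lemma hausdorff_pre_separated:
  assumes sep: "\<And>x y. x \<in> A \<Longrightarrow> y \<in> B \<Longrightarrow> \<delta> < dist x y" and "0 < \<delta>"
  shows "hausdorff_pre \<delta> A + hausdorff_pre \<delta> B \<le> hausdorff_pre \<delta> (A \<union> B)"
proof (rule le_hausdorff_pre)
  fix C :: "nat \<Rightarrow> _ set"
  assume C: "A \<union> B \<subseteq> \<Union>(range C)" "\<And>i. bounded (C i)" "\<And>i. diameter (C i) \<le> \<delta>"
  define D where "D i = (if C i \<inter> A = {} then {} else C i)" for i
  define E where "E i = (if C i \<inter> A = {} then C i else {})" for i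
  have "B \<subseteq> \<Union>(range E)"
  proof
    fix y assume y: "y \<in> B"
    then obtain i where i: "y \<in> C i" using C(1) by blast
    have "C i \<inter> A = {}"
    proof (rule ccontr)
      assume "C i \<inter> A \<noteq> {}"
      then obtain x where "x \<in> A" "x \<in> C i" by blast
      then have "dist x y \<le> \<delta>" using diameter_bounded_bound[OF C(2) _ i, of x] C(3)[of i] by linarith
      then show False using sep[OF \<open>x \<in> A\<close> y] by linarith
    qed
    then show "y \<in> \<Union>(range E)" using i by (auto simp: E_def)
  qed
  then have 1: "hausdorff_pre \<delta> B \<le> (\<Sum>i. ennreal (diameter (E i)))"
    by (rule hausdorff_pre_le) (use C assms(2) in \<open>auto simp: E_def\<close>)
  have "A \<subseteq> \<Union>(range D)"
  proof
    fix y assume y: "y \<in> A"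
    then obtain i where i: "y \<in> C i" using C(1) by blast
    then have "y \<in> D i" using y by (auto simp: D_def)
    then show "y \<in> \<Union>(range D)" by blast
  qed
  then have 2: "hausdorff_pre \<delta> A \<le> (\<Sum>i. ennreal (diameter (D i)))"
    by (rule hausdorff_pre_le) (use C assms(2) in \<open>auto simp: D_def\<close>)
  have "(\<Sum>i. ennreal (diameter (D i))) + (\<Sum>i. ennreal (diameter (E i))) = (\<Sum>i. ennreal (diameter (D i)) + ennreal (diameter (E i)))"
    by (rule suminf_add) auto
  also have "\<dots> = (\<Sum>i. ennreal (diameter (C i)))"
    by (intro arg_cong[where f=suminf] ext) (auto simp: D_def E_def)
  finally show "hausdorff_pre \<delta> A + hausdorff_pre \<delta> B \<le> (\<Sum>i. ennreal (diameter (C i)))"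
    using add_mono[OF 2 1] by simp
qed

text \<open>Replaces the supremum over all \<delta> by one along an increasing sequence, for which
  suprema and sums commute.\<close>

lemma hausdorff_outer_eq_SUP_nat: "hausdorff_outer A = (SUP n. hausdorff_pre (1 / real (Suc n)) A)"
  unfolding hausdorff_outer_def
proof (rule antisym)
  show "(SUP \<delta>\<in>{0<..}. hausdorff_pre \<delta> A) \<le> (SUP n. hausdorff_pre (1 / real (Suc n)) A)"
  proof (rule SUP_least)
    fix \<delta> :: real assume "\<delta> \<in> {0<..}"
    then obtain n where "1 / real (Suc n) < \<delta>" using nat_approx_posE by auto
    then have "hausdorff_pre \<delta> A \<le> hausdorff_pre (1 / real (Suc n)) A" by (intro hausdorff_pre_antimono) simp
    then show "hausdorff_pre \<delta> A \<le> (SUP n. hausdorff_pre (1 / real (Suc n)) A)" by (intro SUP_upper2[of n]) auto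
  qed
  show "(SUP n. hausdorff_pre (1 / real (Suc n)) A) \<le> (SUP \<delta>\<in>{0<..}. hausdorff_pre \<delta> A)"
    by (rule SUP_least, rule SUP_upper) simp
qed

text \<open>This is the defining property of a metric outer measure; it is all that the
  measurability of closed sets uses beyond monotonicity and subadditivity.\<close>

lemma hausdorff_outer_separated:
  assumes sep: "\<And>x y. x \<in> A \<Longrightarrow> y \<in> B \<Longrightarrow> r \<le> dist x y" and r: "0 < r"
  shows "hausdorff_outer A + hausdorff_outer B \<le> hausdorff_outer (A \<union> B)"
proof -
  have inc: "incseq (\<lambda>n. hausdorff_pre (1 / real (Suc n)) X)" for X :: "'a set"
    by (intro incseq_SucI hausdorff_pre_antimono) (simp add: frac_le)
  have "hausdorff_pre (1 / real (Suc n)) A + hausdorff_pre (1 / real (Suc n)) B \<le> hausdorff_outer (A \<union> B)" for n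
  proof -
    define \<delta> where "\<delta> = min (1 / real (Suc n)) (r / 2)"
    have d: "0 < \<delta>" "\<delta> < r" "\<delta> \<le> 1 / real (Suc n)" using r by (auto simp: \<delta>_def min_def)
    have "hausdorff_pre (1 / real (Suc n)) A + hausdorff_pre (1 / real (Suc n)) B \<le> hausdorff_pre \<delta> A + hausdorff_pre \<delta> B"
      by (intro add_mono hausdorff_pre_antimono d)
    also have "\<dots> \<le> hausdorff_pre \<delta> (A \<union> B)" using sep d(1,2) by (intro hausdorff_pre_separated) force+
    also have "\<dots> \<le> hausdorff_outer (A \<union> B)" by (rule hausdorff_pre_le_outer[OF d(1)])
    finally show ?thesis .
  qed
  then have "(SUP n. hausdorff_pre (1 / real (Suc n)) A + hausdorff_pre (1 / real (Suc n)) B) \<le> hausdorff_outer (A \<union> B)"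
    by (rule SUP_least)
  then show ?thesis
    by (subst (asm) ennreal_SUP_add[OF inc inc]) (simp add: hausdorff_outer_eq_SUP_nat)
qed

lemma ennreal_suminf_tail:
  fixes f :: "nat \<Rightarrow> ennreal"
  assumes "(\<Sum>i. f i) < top" "0 < e"
  shows "\<exists>N. (\<Sum>i. f (i + N)) < ennreal e"
proof -
  have fin: "f i < top" for i using ennreal_suminf_lessD[OF assms(1)] .
  define g where "g i = enn2real (f i)" for i
  have fg: "f i = ennreal (g i)" for i using fin[of i] by (simp add: g_def)
  have g0: "0 \<le> g i" for i by (simp add: g_def)
  have s: "summable g" using assms(1) g0 unfolding fg by (intro summable_suminf_not_top) auto
  obtain N where N: "norm (\<Sum>i. g (i + N)) < e" using suminf_exist_split[OF assms(2) s] by blast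
  have "(\<Sum>i. f (i + N)) = ennreal (\<Sum>i. g (i + N))"
    unfolding fg using s g0 by (intro suminf_ennreal2) (auto simp: summable_iff_shift)
  also have "\<dots> < ennreal e" using N assms(2) by (intro ennreal_lessI) auto
  finally show ?thesis by blast
qed

text \<open>The shells \<open>R k\<close> accumulate at \<open>F\<close>; those with even (odd) index are pairwise separated, so
  the series of their measures converges and \<open>A n\<close> exhausts \<open>A - F\<close> in measure.\<close>

lemma closed_in_lambda_system_hausdorff:
  fixes F A :: "'a::metric_space set"
  assumes F: "closed F" "F \<noteq> {}"
  shows "hausdorff_outer (A \<inter> F) + hausdorff_outer (A - F) \<le> hausdorff_outer A"
proof (cases "hausdorff_outer A < top")
  case False
  then have "hausdorff_outer A = top" by (simp add: less_top[symmetric])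
  then show ?thesis by simp
next
  case True
  define S where "S n = {x \<in> A. 1 / real (Suc n) \<le> infdist x F}" for n
  define R where "R k = S (Suc k) - S k" for k
  have sep0: "infdist x F - infdist y F \<le> dist x y" for x y using infdist_triangle[of x F y] by linarith
  have SF: "hausdorff_outer (A \<inter> F) + hausdorff_outer (S n) \<le> hausdorff_outer A" for n
  proof -
    have "hausdorff_outer (A \<inter> F) + hausdorff_outer (S n) \<le> hausdorff_outer ((A \<inter> F) \<union> S n)"
    proof (rule hausdorff_outer_separated[where r="1 / real (Suc n)"])
      fix x y assume "x \<in> A \<inter> F" "y \<in> S n"
      then show "1 / real (Suc n) \<le> dist x y"
        using infdist_le[of x F y] by (auto simp: S_def dist_commute)
    qed simp
    also have "\<dots> \<le> hausdorff_outer A" by (rule hausdorff_outer_mono) (auto simp: S_def)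
    finally show ?thesis .
  qed
  have Sinc: "S m \<subseteq> S n" if "m \<le> n" for m n
  proof -
    have "1 / real (Suc n) \<le> 1 / real (Suc m)" using that by (simp add: frac_le)
    then show ?thesis by (auto simp: S_def)
  qed
  \<comment> \<open>The offset p selects the parity of the shells: p = 0 gives the odd indices, p =
    1 the even ones. \<open>S n\<close> and \<open>R (Suc n)\<close> are kept apart by the shell
    \<open>R n\<close> between them.\<close>
  have sums: "(\<Sum>k<N. hausdorff_outer (R (2 * k + Suc p))) \<le> hausdorff_outer (S (2 * N + p))" for N p
  proof (induction N)
    case (Suc N)
    let ?n = "2 * N + p"
    have "(\<Sum>k<Suc N. hausdorff_outer (R (2 * k + Suc p))) \<le> hausdorff_outer (S ?n) + hausdorff_outer (R (Suc ?n))"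
      using Suc by (simp add: add_right_mono)
    also have "\<dots> \<le> hausdorff_outer (S ?n \<union> R (Suc ?n))"
    proof (rule hausdorff_outer_separated[where r="1 / real (Suc ?n) - 1 / real (Suc (Suc ?n))"])
      fix x y assume "x \<in> S ?n" "y \<in> R (Suc ?n)"
      then have "1 / real (Suc ?n) \<le> infdist x F" "infdist y F < 1 / real (Suc (Suc ?n))"
        by (auto simp: S_def R_def)
      then show "1 / real (Suc ?n) - 1 / real (Suc (Suc ?n)) \<le> dist x y" using sep0[of x y] by linarith
    next
      have "1 / real (Suc (Suc ?n)) < 1 / real (Suc ?n)" by (intro divide_strict_left_mono) auto
      then show "0 < 1 / real (Suc ?n) - 1 / real (Suc (Suc ?n))" by simp
    qed
    also have "\<dots> \<le> hausdorff_outer (S (2 * Suc N + p))"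
      using Sinc[of ?n "2 * Suc N + p"] by (intro hausdorff_outer_mono) (auto simp: R_def)
    finally show ?case .
  qed simp
  define f where "f k = hausdorff_outer (R (Suc k))" for k
  have SA: "hausdorff_outer (S n) \<le> hausdorff_outer A" for n by (rule hausdorff_outer_mono) (auto simp: S_def)
  have "(\<Sum>i<2 * N. f i) = (\<Sum>k<N. hausdorff_outer (R (2 * k + Suc 0))) + (\<Sum>k<N. hausdorff_outer (R (2 * k + Suc 1)))" for N
    by (induction N) (simp_all add: f_def add_ac)
  then have "(\<Sum>i<2 * N. f i) \<le> hausdorff_outer A + hausdorff_outer A" for N
    by (simp only:) (rule add_mono[OF order_trans[OF sums SA] order_trans[OF sums SA]])
  moreover have "(\<Sum>i<N. f i) \<le> (\<Sum>i<2 * N. f i)" for N by (rule sum_mono2) auto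
  ultimately have "(\<Sum>i. f i) \<le> hausdorff_outer A + hausdorff_outer A"
    unfolding suminf_eq_SUP by (intro SUP_least) (metis order_trans)
  also have "\<dots> < top" using True by simp
  finally have fin: "(\<Sum>i. f i) < top" .
  show ?thesis
  proof (rule ennreal_le_epsilon)
    fix e :: real assume e: "0 < e"
    obtain N where N: "(\<Sum>i. f (i + N)) < ennreal e" using ennreal_suminf_tail[OF fin e] by blast
    have "A - F \<subseteq> S (Suc N) \<union> (\<Union>i. R (Suc (i + N)))"
    proof
      fix x assume x: "x \<in> A - F"
      then have "infdist x F > 0" using F by (simp add: infdist_pos_not_in_closed)
      then obtain n where "1 / real (Suc n) < infdist x F" using nat_approx_posE by auto
      then have n: "x \<in> S n" using x by (auto simp: S_def)
      show "x \<in> S (Suc N) \<union> (\<Union>i. R (Suc (i + N)))"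
      proof (cases "x \<in> S (Suc N)")
        case False
        \<comment> \<open>The first index at which x enters puts it into the shell
          \<open>R (m - 1)\<close>, which belongs to the tail of the series.\<close>
        define m where "m = (LEAST n. x \<in> S n)"
        have m: "x \<in> S m" "\<And>k. k < m \<Longrightarrow> x \<notin> S k" unfolding m_def using n by (auto intro: LeastI dest: not_less_Least)
        have "m > Suc N" using False m(1) Sinc[of m "Suc N"] by (metis not_le subsetD)
        then obtain i where "m = Suc (Suc (i + N))" by (metis less_natE add.commute add_Suc)
        then have "x \<in> R (Suc (i + N))" using m by (simp add: R_def)
        then show ?thesis by blast
      qed simp
    qed
    then have "hausdorff_outer (A - F) \<le> hausdorff_outer (S (Suc N)) + hausdorff_outer (\<Union>i. R (Suc (i + N)))"
      using hausdorff_outer_mono hausdorff_outer_Un order_trans by metis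
    also have "hausdorff_outer (\<Union>i. R (Suc (i + N))) \<le> (\<Sum>i. f (i + N))"
      unfolding f_def by (rule hausdorff_outer_subadditive)
    also have "\<dots> \<le> ennreal e" using N by simp
    finally have "hausdorff_outer (A \<inter> F) + hausdorff_outer (A - F) \<le> hausdorff_outer (A \<inter> F) + (hausdorff_outer (S (Suc N)) + ennreal e)"
      by (simp add: add_left_mono)
    also have "\<dots> \<le> hausdorff_outer A + ennreal e" using SF[of "Suc N"] by (simp add: add_right_mono flip: add.assoc)
    finally show "hausdorff_outer (A \<inter> F) + hausdorff_outer (A - F) \<le> hausdorff_outer A + ennreal e" .
  qed
qed

text \<open>Caratheodory's criterion: closed sets split every set additively, and the sets with this
  property form a sigma-algebra, which therefore contains the Borel sets.\<close>

lemma measure_space_hausdorff: "measure_space UNIV (sets borel) (hausdorff_outer :: 'a::metric_space set \<Rightarrow> ennreal)"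
proof -
  interpret P: sigma_algebra "UNIV :: 'a set" "Pow UNIV" by (rule sigma_algebra_Pow)
  let ?L = "lambda_system (UNIV :: 'a set) (Pow UNIV) hausdorff_outer"
  have L: "measure_space UNIV ?L (hausdorff_outer :: 'a set \<Rightarrow> ennreal)"
    by (rule P.caratheodory_lemma[OF outer_measure_space_hausdorff])
  have "F \<in> ?L" if F: "closed F" for F :: "'a set"
  proof -
    have "hausdorff_outer (A \<inter> F) + hausdorff_outer (A - F) = hausdorff_outer A" for A
    proof (rule antisym)
      show "hausdorff_outer (A \<inter> F) + hausdorff_outer (A - F) \<le> hausdorff_outer A"
        using closed_in_lambda_system_hausdorff[OF F] by (cases "F = {}") auto
      show "hausdorff_outer A \<le> hausdorff_outer (A \<inter> F) + hausdorff_outer (A - F)"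
        using hausdorff_outer_Un[of "A \<inter> F" "A - F"] by (simp add: Int_Diff_Un)
    qed
    then show ?thesis unfolding P.lambda_system_eq by blast
  qed
  then have "sigma_sets UNIV (Collect closed) \<subseteq> ?L"
    using L by (intro sigma_algebra.sigma_sets_subset) (auto simp: measure_space_def)
  then have "sets borel \<subseteq> ?L" by (simp add: borel_eq_closed)
  then show ?thesis
    by (rule measure_down[OF L, rotated]) (metis sets.sigma_algebra_axioms space_borel)
qed

lemma sets_hausdorff1 [simp, measurable_cong]: "sets hausdorff1 = sets borel"
  and space_hausdorff1 [simp]: "space hausdorff1 = UNIV"
  unfolding hausdorff1_def
   apply (subst sets_measure_of)
    apply simp
   apply (metis sets.sigma_sets_eq space_borel)
  by (subst space_measure_of) auto

text \<open>\<open>measure_of\<close> yields the zero measure unless the given set function is a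
  measure on the generated sigma-algebra; the preceding construction is what gives
  \<open>hausdorff1\<close> its intended values.\<close>

lemma emeasure_hausdorff1: "A \<in> sets borel \<Longrightarrow> emeasure hausdorff1 A = hausdorff_outer A"
proof -
  assume A: "A \<in> sets borel"
  have "measure_space UNIV (sigma_sets UNIV (sets borel)) hausdorff_outer"
    using measure_space_hausdorff by (metis sets.sigma_sets_eq space_borel)
  then show ?thesis
    unfolding hausdorff1_def hausdorff_outer_def[symmetric]
    by (intro emeasure_measure_of_sigma) (use A measure_space_hausdorff in \<open>auto simp: measure_space_def\<close>)
qed

section \<open>Hausdorff measure of curves and straight segments\<close>

lemma hausdorff_outer_lipschitz_curve:
  fixes \<gamma> :: "real \<Rightarrow> 'a::real_normed_vector"
  assumes lu: "l \<le> u" and L: "0 \<le> L"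
    and lip: "\<And>r s. dist (\<gamma> r) (\<gamma> s) \<le> L * \<bar>r - s\<bar>"
  shows "hausdorff_outer (\<gamma> ` {l..<u}) \<le> ennreal (L * (u - l))"
  unfolding hausdorff_outer_def
proof (rule SUP_least)
  fix \<delta> :: real assume "\<delta> \<in> {0<..}"
  then have \<delta>: "0 < \<delta>" by simp
  \<comment> \<open>Fine enough that the images of n equal parameter intervals, of length w below,
    have diameter at most L * w \<le> \<delta>.\<close>
  obtain n :: nat where n: "real n > L * (u - l) / \<delta>" using reals_Archimedean2 by blast
  have "0 \<le> L * (u - l) / \<delta>" using \<delta> lu L by simp
  then have n0: "n > 0" using n by (metis gr0I leD of_nat_0)
  define w where "w = (u - l) / real n"
  have w: "0 \<le> w" "L * w \<le> \<delta>" using \<delta> lu n n0 by (auto simp: w_def field_simps)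
  define C where "C i = (if i < n then \<gamma> ` {l + real i * w..l + real (Suc i) * w} else {})" for i
  have dC: "dist x y \<le> L * w" if xy: "x \<in> C i" "y \<in> C i" for x y i
  proof -
    obtain r s where r: "x = \<gamma> r" "l + real i * w \<le> r" "r \<le> l + real (Suc i) * w"
      and s: "y = \<gamma> s" "l + real i * w \<le> s" "s \<le> l + real (Suc i) * w"
      using xy by (auto simp: C_def split: if_splits)
    have "\<bar>r - s\<bar> \<le> w" using r s by (simp add: algebra_simps abs_le_iff)
    then have "L * \<bar>r - s\<bar> \<le> L * w" using L by (intro mult_left_mono)
    then show ?thesis using lip[of r s] r s by simp
  qed
  have d: "diameter (C i) \<le> L * w" for i
    using dC[of _ i] w L by (intro diameter_le) (auto simp: dist_norm)
  have "hausdorff_pre \<delta> (\<gamma> ` {l..<u}) \<le> (\<Sum>i. ennreal (diameter (C i)))"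
  proof (rule hausdorff_pre_le)
    show "bounded (C i)" for i
    proof (cases "C i = {}")
      case False
      then obtain x where "x \<in> C i" by blast
      then show ?thesis using dC[of x i] unfolding bounded_def by blast
    qed simp
    show "diameter (C i) \<le> \<delta>" for i using order_trans[OF d w(2)] .
    show "\<gamma> ` {l..<u} \<subseteq> \<Union>(range C)"
    proof clarify
      fix r assume r: "r \<in> {l..<u}"
      then have wp: "w > 0" using n0 by (simp add: w_def)
      define i where "i = nat \<lfloor>(r - l) / w\<rfloor>"
      have q: "0 \<le> (r - l) / w" using r wp by simp
      define z where "z = (r - l) / w"
      have ri: "real i = of_int \<lfloor>z\<rfloor>" using q by (simp add: i_def z_def)
      have "real i \<le> z" "z < real i + 1" unfolding ri by (rule of_int_floor_le, rule real_of_int_floor_add_one_gt)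
      then have i: "real i \<le> (r - l) / w" "(r - l) / w < real (Suc i)" unfolding z_def by simp_all
      have "(r - l) / w < real n" using r wp n0 by (simp add: w_def field_simps)
      then have "i < n" using i(1) by linarith
      moreover have "l + real i * w \<le> r" "r \<le> l + real (Suc i) * w" using i wp by (simp_all add: field_simps)
      ultimately have "\<gamma> r \<in> C i" by (auto simp: C_def)
      then show "\<gamma> r \<in> \<Union>(range C)" by blast
    qed
  qed
  also have "\<dots> = (\<Sum>i<n. ennreal (diameter (C i)))" by (rule suminf_finite) (auto simp: C_def)
  also have "\<dots> \<le> (\<Sum>i<n. ennreal (L * w))" using d by (intro sum_mono ennreal_leI)
  also have "\<dots> = ennreal (L * (u - l))" using w n0 L by (simp add: w_def ennreal_of_nat_eq_real_of_nat flip: ennreal_mult')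
  finally show "hausdorff_pre \<delta> (\<gamma> ` {l..<u}) \<le> ennreal (L * (u - l))" .
qed

context fixes e :: "'a::euclidean_space" assumes e: "norm e = 1" begin

lemma dist_line: "dist (r *\<^sub>R e) (s *\<^sub>R e) = \<bar>r - s\<bar>"
  using e by (simp add: dist_norm flip: scaleR_diff_left)

text \<open>A covering set, read in the parameter r, lies in the interval from its infimum to its
  supremum, whose length is at most the diameter; countable subadditivity of Lebesgue measure does
  the rest. Intervals are used because the preimages themselves need not be measurable.\<close>

lemma hausdorff_pre_segment_ge:
  assumes "l \<le> u"
  shows "ennreal (u - l) \<le> hausdorff_pre \<delta> ((\<lambda>r. r *\<^sub>R e) ` {l<..<u})"
proof (rule le_hausdorff_pre)
  fix C :: "nat \<Rightarrow> 'a set"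
  assume C: "(\<lambda>r. r *\<^sub>R e) ` {l<..<u} \<subseteq> \<Union>(range C)" "\<And>i. bounded (C i)"
  define D where "D i = {r. r *\<^sub>R e \<in> C i}" for i
  define I where "I i = (if D i = {} then {} else {Inf (D i)..Sup (D i)})" for i
  have DI: "D i \<subseteq> I i" "emeasure lborel (I i) \<le> ennreal (diameter (C i))" for i
  proof -
    have d: "r - s \<le> diameter (C i)" if "r \<in> D i" "s \<in> D i" for r s
      using diameter_bounded_bound[OF C(2)[of i], of "r *\<^sub>R e" "s *\<^sub>R e"] that dist_line[of r s] by (auto simp: D_def)
    have b: "bdd_above (D i)" "bdd_below (D i)"
    proof -
      show "bdd_above (D i)"
      proof (cases "D i = {}")
        case False
        then obtain s where "s \<in> D i" by blast
        then show ?thesis using d[of _ s] by (intro bdd_aboveI[of _ "diameter (C i) + s"]) force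
      qed simp
      show "bdd_below (D i)"
      proof (cases "D i = {}")
        case False
        then obtain s where "s \<in> D i" by blast
        then show ?thesis using d[of s] by (intro bdd_belowI[of _ "s - diameter (C i)"]) force
      qed simp
    qed
    show "D i \<subseteq> I i" using b by (auto simp: I_def intro: cInf_lower cSup_upper)
    show "emeasure lborel (I i) \<le> ennreal (diameter (C i))"
    proof (cases "D i = {}")
      case False
      have "Sup (D i) - diameter (C i) \<le> s" if s: "s \<in> D i" for s
      proof -
        have "Sup (D i) \<le> diameter (C i) + s" using False d[OF _ s] by (intro cSup_least) force+
        then show ?thesis by simp
      qed
      then have "Sup (D i) - diameter (C i) \<le> Inf (D i)" using False by (intro cInf_greatest)
      moreover have "Inf (D i) \<le> Sup (D i)" using False b by (rule cInf_le_cSup)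
      ultimately show ?thesis using False by (simp add: I_def ennreal_leI)
    qed (simp add: I_def)
  qed
  have "ennreal (u - l) = emeasure lborel {l<..<u}" using assms by simp
  also have "\<dots> \<le> emeasure lborel (\<Union>i. I i)"
  proof (rule emeasure_mono)
    show "{l<..<u} \<subseteq> (\<Union>i. I i)" using C(1) DI(1) by (fastforce simp: D_def)
    show "(\<Union>i. I i) \<in> sets lborel" by (auto simp: I_def)
  qed
  also have "\<dots> \<le> (\<Sum>i. emeasure lborel (I i))"
    by (rule emeasure_subadditive_countably) (auto simp: I_def)
  also have "\<dots> \<le> (\<Sum>i. ennreal (diameter (C i)))" using DI(2) by (intro suminf_le) auto
  finally show "ennreal (u - l) \<le> (\<Sum>i. ennreal (diameter (C i)))" .
qed

lemma hausdorff_outer_segment: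
  assumes "l \<le> u"
  shows "hausdorff_outer ((\<lambda>r. r *\<^sub>R e) ` {l<..<u}) = ennreal (u - l)"
proof (rule antisym)
  show "hausdorff_outer ((\<lambda>r. r *\<^sub>R e) ` {l<..<u}) \<le> ennreal (u - l)"
  proof -
    have "hausdorff_outer ((\<lambda>r. r *\<^sub>R e) ` {l<..<u}) \<le> hausdorff_outer ((\<lambda>r. r *\<^sub>R e) ` {l..<u})"
      by (intro hausdorff_outer_mono image_mono) auto
    also have "\<dots> \<le> ennreal (1 * (u - l))"
      by (rule hausdorff_outer_lipschitz_curve[OF assms]) (simp, simp only: dist_line mult_1)
    finally show ?thesis by simp
  qed
  show "ennreal (u - l) \<le> hausdorff_outer ((\<lambda>r. r *\<^sub>R e) ` {l<..<u})"
    by (rule order_trans[OF hausdorff_pre_segment_ge[OF assms] hausdorff_pre_le_outer[of 1]]) simp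
qed

lemma line_mem: "x \<in> range (\<lambda>r. r *\<^sub>R e) \<longleftrightarrow> (x \<bullet> e) *\<^sub>R e = x"
proof
  assume "x \<in> range (\<lambda>r. r *\<^sub>R e)"
  then show "(x \<bullet> e) *\<^sub>R e = x" using e by (auto simp: power2_norm_eq_inner[symmetric] norm_eq_1)
qed (metis rangeI)

lemma borel_line: "range (\<lambda>r. r *\<^sub>R e) \<in> sets borel"
proof -
  have "range (\<lambda>r. r *\<^sub>R e) = {x. (x \<bullet> e) *\<^sub>R e = x}" using line_mem by blast
  also have "closed \<dots>" by (intro closed_Collect_eq continuous_intros)
  finally show ?thesis by (simp add: borel_closed)
qed

text \<open>Lebesgue measure is determined by its values on intervals, and segments have the right
  Hausdorff measure. Boundary integrals over straight edges thereby become ordinary one-dimensional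
  integrals.\<close>

lemma lborel_eq_distr_hausdorff1:
  "lborel = distr (restrict_space hausdorff1 (range (\<lambda>r. r *\<^sub>R e))) borel (\<lambda>x. x \<bullet> e)"
proof (rule lborel_eqI)
  let ?L = "range (\<lambda>r. r *\<^sub>R e)"
  fix l u :: real assume "\<And>b. b \<in> Basis \<Longrightarrow> l \<bullet> b \<le> u \<bullet> b"
  then have lu: "l \<le> u" by simp
  have m: "(\<lambda>x. x \<bullet> e) \<in> borel_measurable (restrict_space hausdorff1 ?L)"
    by (intro measurable_restrict_space1) simp
  have eq: "(\<lambda>x. x \<bullet> e) -` box l u \<inter> space (restrict_space hausdorff1 ?L) = (\<lambda>r. r *\<^sub>R e) ` {l<..<u}"
    using e by (auto simp: space_restrict_space box_real power2_norm_eq_inner[symmetric] norm_eq_1)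
  have "(\<lambda>r. r *\<^sub>R e) ` {l<..<u} \<in> sets (restrict_space hausdorff1 ?L)"
    unfolding eq[symmetric] by (rule measurable_sets[OF m]) simp
  then have b: "(\<lambda>r. r *\<^sub>R e) ` {l<..<u} \<in> sets borel"
    using borel_line by (simp add: sets_restrict_space_iff)
  have "emeasure (distr (restrict_space hausdorff1 ?L) borel (\<lambda>x. x \<bullet> e)) (box l u) =
      emeasure (restrict_space hausdorff1 ?L) ((\<lambda>r. r *\<^sub>R e) ` {l<..<u})"
    by (subst emeasure_distr[OF m]) (simp_all only: eq, simp)
  also have "\<dots> = hausdorff_outer ((\<lambda>r. r *\<^sub>R e) ` {l<..<u})"
    using borel_line b by (subst emeasure_restrict_space) (auto simp: emeasure_hausdorff1)
  also have "\<dots> = ennreal (u - l)" by (rule hausdorff_outer_segment[OF lu])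
  finally show "emeasure (distr (restrict_space hausdorff1 ?L) borel (\<lambda>x. x \<bullet> e)) (box l u) = (\<Prod>b\<in>Basis. (u - l) \<bullet> b)"
    by simp
qed simp

lemma hausdorff1_line:
  fixes F :: "'a \<Rightarrow> 'b::{banach, second_countable_topology}"
  assumes F: "F \<in> borel_measurable borel"
  shows "integral\<^sup>L hausdorff1 (\<lambda>x. indicator (range (\<lambda>r. r *\<^sub>R e)) x *\<^sub>R F x) = (LINT r|lborel. F (r *\<^sub>R e))"
    and "integrable hausdorff1 (\<lambda>x. indicator (range (\<lambda>r. r *\<^sub>R e)) x *\<^sub>R F x) \<longleftrightarrow> integrable lborel (\<lambda>r. F (r *\<^sub>R e))"
proof -
  let ?L = "range (\<lambda>r. r *\<^sub>R e)" and ?M = "restrict_space hausdorff1 (range (\<lambda>r. r *\<^sub>R e))"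
  have L: "?L \<inter> space hausdorff1 \<in> sets hausdorff1" using borel_line by simp
  have m: "(\<lambda>x. x \<bullet> e) \<in> borel_measurable ?M" by (intro measurable_restrict_space1) simp
  have Fe: "(\<lambda>r. F (r *\<^sub>R e)) \<in> borel_measurable borel" using F by measurable
  have c: "F ((x \<bullet> e) *\<^sub>R e) = F x" if "x \<in> space ?M" for x
    using that line_mem[of x] by (simp add: space_restrict_space)
  have "(LINT r|lborel. F (r *\<^sub>R e)) = (LINT r|distr ?M borel (\<lambda>x. x \<bullet> e). F (r *\<^sub>R e))"
    by (simp only: lborel_eq_distr_hausdorff1[symmetric])
  also have "\<dots> = (LINT x|?M. F ((x \<bullet> e) *\<^sub>R e))" by (rule integral_distr[OF m Fe])
  also have "\<dots> = (LINT x|?M. F x)" by (rule Bochner_Integration.integral_cong[OF refl c])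
  also have "\<dots> = integral\<^sup>L hausdorff1 (\<lambda>x. indicator ?L x *\<^sub>R F x)" by (rule integral_restrict_space[OF L])
  finally show "integral\<^sup>L hausdorff1 (\<lambda>x. indicator ?L x *\<^sub>R F x) = (LINT r|lborel. F (r *\<^sub>R e))" by simp
  have "integrable lborel (\<lambda>r. F (r *\<^sub>R e)) \<longleftrightarrow> integrable (distr ?M borel (\<lambda>x. x \<bullet> e)) (\<lambda>r. F (r *\<^sub>R e))"
    by (simp only: lborel_eq_distr_hausdorff1[symmetric])
  also have "\<dots> \<longleftrightarrow> integrable ?M (\<lambda>x. F ((x \<bullet> e) *\<^sub>R e))" by (rule integrable_distr_eq[OF m Fe])
  also have "\<dots> \<longleftrightarrow> integrable ?M F" by (rule Bochner_Integration.integrable_cong[OF refl c])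
  also have "\<dots> \<longleftrightarrow> integrable hausdorff1 (\<lambda>x. indicator ?L x *\<^sub>R F x)" by (rule integrable_restrict_space[OF L])
  finally show "integrable hausdorff1 (\<lambda>x. indicator ?L x *\<^sub>R F x) \<longleftrightarrow> integrable lborel (\<lambda>r. F (r *\<^sub>R e))" by simp
qed

end

section \<open>Oblique coordinates and the divergence theorem in a quadrant\<close>

lemma Basis_real2: "(Basis :: (real^2) set) = {axis 1 1, axis 2 1}" "axis 1 (1::real) \<noteq> (axis 2 1 :: real^2)"
proof -
  show "(Basis :: (real^2) set) = {axis 1 1, axis 2 1}"
    by (auto simp: Basis_vec_def UNIV_2)
  show "axis 1 (1::real) \<noteq> (axis 2 1 :: real^2)" by (simp add: axis_eq_axis)
qed

lemma sum_Basis_real2: "(\<Sum>b\<in>(Basis::(real^2) set). f b) = f (axis 1 1) + f (axis 2 1)"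
  unfolding Basis_real2(1) by (simp add: Basis_real2(2))

lemma prod_Basis_real2: "(\<Prod>b\<in>(Basis::(real^2) set). f b) = f (axis 1 1) * f (axis 2 1)"
  unfolding Basis_real2(1) by (simp add: Basis_real2(2))

lemma real2_eqI: "x $ 1 = y $ 1 \<Longrightarrow> x $ 2 = y $ 2 \<Longrightarrow> x = (y :: real^2)"
  by (simp add: vec_eq_iff forall_2)

lemma norm_real2: "norm (x :: real^2) = sqrt ((x$1)\<^sup>2 + (x$2)\<^sup>2)"
  by (simp add: norm_vec_def L2_set_def sum_2)

text \<open>The planar cross product, that is, the determinant with columns x and y.\<close>

definition cr :: "real^2 \<Rightarrow> real^2 \<Rightarrow> real" where
  "cr x y = x$1 * y$2 - x$2 * y$1"

text \<open>Transfers plane Lebesgue measure to the product type, where Fubini's theorem is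
  formulated.\<close>

lemma lborel_real2_pair: "(lborel :: (real^2) measure) = distr lborel borel (\<lambda>(x, y). vector [x, y])"
proof (rule lborel_eqI)
  let ?f = "\<lambda>(x, y). vector [x, y] :: real^2"
  have m: "?f \<in> borel_measurable borel"
  proof -
    have c: "continuous_on UNIV (\<lambda>z. fst z *\<^sub>R axis 1 1 + snd z *\<^sub>R axis 2 1 :: real^2)" by (intro continuous_intros)
    have eq: "(\<lambda>z. fst z *\<^sub>R axis 1 1 + snd z *\<^sub>R axis 2 1) = ?f"
      by (intro ext real2_eqI) (auto simp: axis_def)
    show ?thesis using borel_measurable_continuous_onI[OF c] unfolding eq .
  qed
  fix l u :: "real^2" assume lub: "\<And>b. b \<in> Basis \<Longrightarrow> l \<bullet> b \<le> u \<bullet> b"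
  have lu: "l$1 \<le> u$1" "l$2 \<le> u$2" using lub[of "axis 1 1"] lub[of "axis 2 1"] by (auto simp: Basis_real2 inner_axis)
  have "?f -` box l u = {l$1<..<u$1} \<times> {l$2<..<u$2}"
    by (auto simp: mem_box Basis_real2 inner_axis)
  then have "emeasure (distr lborel borel ?f) (box l u) = emeasure (lborel \<Otimes>\<^sub>M lborel) ({l$1<..<u$1} \<times> {l$2<..<u$2})"
    using m by (subst emeasure_distr) (auto simp: lborel_prod)
  also have "\<dots> = ennreal (\<Prod>b\<in>Basis. (u - l) \<bullet> b)"
    using lu by (subst lborel.emeasure_pair_measure_Times)
      (auto simp: prod_Basis_real2 inner_axis ennreal_mult)
  finally show "emeasure (distr lborel borel ?f) (box l u) = ennreal (\<Prod>b\<in>Basis. (u - l) \<bullet> b)" .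
qed simp

section \<open>Coordinates with respect to two independent vectors\<close>

context fixes a b :: "real^2" assumes cr: "cr a b \<noteq> 0" begin

text \<open>Cramer's rule for the coordinates with respect to a and b.\<close>

definition co1 :: "real^2 \<Rightarrow> real" where "co1 x = cr x b / cr a b"
definition co2 :: "real^2 \<Rightarrow> real" where "co2 x = cr a x / cr a b"

lemma co_rep: "x = co1 x *\<^sub>R a + co2 x *\<^sub>R b"
proof (rule real2_eqI)
  have "cr x b * a$1 + cr a x * b$1 = cr a b * x$1" "cr x b * a$2 + cr a x * b$2 = cr a b * x$2"
    by (simp_all add: cr_def algebra_simps)
  then show "x$1 = (co1 x *\<^sub>R a + co2 x *\<^sub>R b)$1" "x$2 = (co1 x *\<^sub>R a + co2 x *\<^sub>R b)$2"
    using cr by (simp_all add: co1_def co2_def flip: add_divide_distrib)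
qed

lemma co_lin [simp]: "co1 (s *\<^sub>R a + t *\<^sub>R b) = s" "co2 (s *\<^sub>R a + t *\<^sub>R b) = t"
  using cr by (auto simp: co1_def co2_def field_simps cr_def)

lemma linear_co: "linear co1" "linear co2"
  by (intro linearI; simp add: co1_def co2_def cr_def add_divide_distrib diff_divide_distrib algebra_simps)+

lemma continuous_co: "continuous_on S co1" "continuous_on S co2"
  using linear_co by (auto intro: linear_continuous_on linear_conv_bounded_linear[THEN iffD1])

text \<open>Linear change of variables, checked on boxes: the coordinate map \<open>?K\<close> has a
  determinant of modulus 1 / |\<open>cr a b\<close>|, which the constant density
  compensates.\<close>

lemma lborel_oblique: "(lborel :: (real^2) measure) =
   distr (density lborel (\<lambda>_. ennreal \<bar>cr a b\<bar>)) borel (\<lambda>y::real^2. y$1 *\<^sub>R a + y$2 *\<^sub>R b)"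
proof (rule lborel_eqI)
  let ?L = "\<lambda>y::real^2. y$1 *\<^sub>R a + y$2 *\<^sub>R b" and ?K = "\<lambda>x. vector [co1 x, co2 x] :: real^2"
  have cL: "continuous_on UNIV ?L" by (intro continuous_intros)
  have m: "?L \<in> borel_measurable borel" by (rule borel_measurable_continuous_onI[OF cL])
  fix l u :: "real^2" assume lub: "\<And>b. b \<in> Basis \<Longrightarrow> l \<bullet> b \<le> u \<bullet> b"
  have lu: "l$1 \<le> u$1" "l$2 \<le> u$2" using lub[of "axis 1 1"] lub[of "axis 2 1"] by (auto simp: Basis_real2 inner_axis)
  have linK: "linear ?K"
    by (rule linearI; rule real2_eqI; simp add: linear_add[OF linear_co(1)] linear_add[OF linear_co(2)]
         linear_scale[OF linear_co(1)] linear_scale[OF linear_co(2)])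
  have KL: "?K (?L y) = y" for y by (rule real2_eqI) auto
  have LK: "?L (?K x) = x" for x using co_rep[of x] by simp
  have pre: "?L -` box l u = ?K ` box l u" using KL LK by (auto simp: image_iff) (metis KL)+
  have e: "cr (axis 1 1) b = b$2" "cr (axis 2 1) b = - (b$1)" "cr a (axis 1 1) = - (a$2)" "cr a (axis 2 1) = a$1"
    by (simp_all add: cr_def axis_def)
  have "det (matrix ?K) = (a$1 * b$2 - a$2 * b$1) / (cr a b * cr a b)"
    by (simp add: det_2 matrix_def co1_def co2_def e diff_divide_distrib mult.commute)
  also have "\<dots> = 1 / cr a b" using cr by (simp flip: cr_def)
  finally have det: "\<bar>det (matrix ?K)\<bar> = 1 / \<bar>cr a b\<bar>" by (simp add: abs_divide)
  have ll: "box l u \<in> lmeasurable" by simp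
  have meas: "measure lebesgue (?K ` box l u) = 1 / \<bar>cr a b\<bar> * measure lebesgue (box l u)"
    using measure_linear_image[OF linK ll] det by simp
  have lm: "?K ` box l u \<in> lmeasurable" by (rule measurable_linear_image[OF linK ll])
  have "open (?L -` box l u)" by (rule open_vimage[OF open_box cL])
  then have bK: "?K ` box l u \<in> sets borel" by (simp add: pre)
  have "emeasure (distr (density lborel (\<lambda>_. ennreal \<bar>cr a b\<bar>)) borel ?L) (box l u)
      = ennreal \<bar>cr a b\<bar> * emeasure lborel (?K ` box l u)"
    using m bK by (subst emeasure_distr) (auto simp: pre emeasure_density_const)
  also have "emeasure lborel (?K ` box l u) = ennreal (measure lebesgue (?K ` box l u))"
    using lm bK emeasure_eq_measure2[OF lm] by simp
  also have "ennreal \<bar>cr a b\<bar> * \<dots> = ennreal (measure lebesgue (box l u))"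
    unfolding meas using cr by (simp flip: ennreal_mult')
  also have "\<dots> = ennreal (\<Prod>b\<in>Basis. (u - l) \<bullet> b)"
    using lu by (simp add: measure_lborel_box_eq prod_Basis_real2 Basis_real2 inner_axis)
  finally show "emeasure (distr (density lborel (\<lambda>_. ennreal \<bar>cr a b\<bar>)) borel ?L) (box l u) = ennreal (\<Prod>b\<in>Basis. (u - l) \<bullet> b)" .
qed simp

lemma lborel_oblique_pair: "(lborel :: (real^2) measure) =
   distr (density lborel (\<lambda>_. ennreal \<bar>cr a b\<bar>)) borel (\<lambda>(s,t). s *\<^sub>R a + t *\<^sub>R b)"
proof -
  have m: "(\<lambda>y::real^2. y$1 *\<^sub>R a + y$2 *\<^sub>R b) \<in> borel_measurable borel"
    by (rule borel_measurable_continuous_onI) (intro continuous_intros)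
  have m2: "(\<lambda>(x, y). vector [x, y] :: real^2) \<in> borel_measurable borel"
  proof -
    have c: "continuous_on UNIV (\<lambda>z. fst z *\<^sub>R axis 1 1 + snd z *\<^sub>R axis 2 1 :: real^2)" by (intro continuous_intros)
    have eq: "(\<lambda>z. fst z *\<^sub>R axis 1 1 + snd z *\<^sub>R axis 2 1) = (\<lambda>(x, y). vector [x, y] :: real^2)"
      by (intro ext real2_eqI) (auto simp: axis_def)
    show ?thesis using borel_measurable_continuous_onI[OF c] unfolding eq .
  qed
  have "density (lborel :: (real^2) measure) (\<lambda>_. ennreal \<bar>cr a b\<bar>) =
      distr (density lborel (\<lambda>_. ennreal \<bar>cr a b\<bar>)) borel (\<lambda>(x, y). vector [x, y])"
    by (subst lborel_real2_pair, subst density_distr) (use m2 in auto)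
  then have "(lborel :: (real^2) measure) = distr (distr (density lborel (\<lambda>_. ennreal \<bar>cr a b\<bar>)) borel (\<lambda>(x, y). vector [x, y] :: real^2)) borel (\<lambda>y::real^2. y$1 *\<^sub>R a + y$2 *\<^sub>R b)"
    using lborel_oblique by simp
  also have "\<dots> = distr (density lborel (\<lambda>_. ennreal \<bar>cr a b\<bar>)) borel (\<lambda>(s,t). s *\<^sub>R a + t *\<^sub>R b)"
    by (subst distr_distr) (use m m2 in \<open>auto simp: comp_def case_prod_unfold\<close>)
  finally show ?thesis .
qed

lemma integral_oblique:
  fixes F :: "real^2 \<Rightarrow> complex"
  assumes F: "F \<in> borel_measurable borel"
  shows "(LINT x|lborel. F x) = \<bar>cr a b\<bar> *\<^sub>R (LINT z|lborel. F (fst z *\<^sub>R a + snd z *\<^sub>R b))"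
    and "integrable lborel F \<longleftrightarrow> integrable lborel (\<lambda>z. F (fst z *\<^sub>R a + snd z *\<^sub>R b))"
proof -
  let ?T = "\<lambda>z :: real \<times> real. fst z *\<^sub>R a + snd z *\<^sub>R b" and ?d = "density (lborel :: (real \<times> real) measure) (\<lambda>_. ennreal \<bar>cr a b\<bar>)"
  have T: "?T \<in> borel_measurable borel"
    by (rule borel_measurable_continuous_onI) (intro continuous_intros)
  have FT: "(\<lambda>z. F (?T z)) \<in> borel_measurable borel" using measurable_compose[OF T F] .
  have eq: "lborel = distr ?d borel ?T" using lborel_oblique_pair by (simp add: case_prod_unfold)
  have "(LINT x|lborel. F x) = (LINT z|?d. F (?T z))"
    by (subst eq, rule integral_distr) (use T F in auto)
  also have "\<dots> = (LINT z|lborel. \<bar>cr a b\<bar> *\<^sub>R F (?T z))"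
    by (rule integral_density) (use FT in auto)
  finally show "(LINT x|lborel. F x) = \<bar>cr a b\<bar> *\<^sub>R (LINT z|lborel. F (?T z))" by simp
  have "integrable lborel F \<longleftrightarrow> integrable ?d (\<lambda>z. F (?T z))"
    by (subst eq, rule integrable_distr_eq) (use T F in auto)
  also have "\<dots> \<longleftrightarrow> integrable lborel (\<lambda>z. \<bar>cr a b\<bar> *\<^sub>R F (?T z))"
    by (rule integrable_density) (use FT in auto)
  also have "\<dots> \<longleftrightarrow> integrable lborel (\<lambda>z. F (?T z))"
  proof
    assume "integrable lborel (\<lambda>z. \<bar>cr a b\<bar> *\<^sub>R F (?T z))"
    then have "integrable lborel (\<lambda>z. inverse \<bar>cr a b\<bar> *\<^sub>R (\<bar>cr a b\<bar> *\<^sub>R F (?T z)))" by (rule integrable_scaleR_right)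
    then show "integrable lborel (\<lambda>z. F (?T z))" using cr by simp
  qed (rule integrable_scaleR_right)
  finally show "integrable lborel F \<longleftrightarrow> integrable lborel (\<lambda>z. F (?T z))" .
qed

text \<open>The endpoint is a null set, so open and closed half-lines can be treated together. Both
  occur: a sector of opening below pi is an open quadrant, a reentrant one is the complement of a
  closed quadrant.\<close>

lemma integral_half_line_deriv:
  fixes g :: "real \<Rightarrow> complex"
  assumes d: "\<And>s. (g has_vector_derivative g' s) (at s)" and c: "continuous_on UNIV g'" 
    and R: "\<And>s. R \<le> \<bar>s\<bar> \<Longrightarrow> g s = 0" and P: "P = {0<..} \<or> P = {0..}"
  shows "(LINT s|lborel. indicator P s *\<^sub>R g' s) = - g 0"
proof -
  \<comment> \<open>At least 1, so that {0..R'} is a nondegenerate interval at whose right end g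
    vanishes.\<close>
  define R' where "R' = max 1 R"
  have z: "g s = 0" if "R' \<le> \<bar>s\<bar>" for s using R that by (auto simp: R'_def)
  have g'0: "g' s = 0" if "R' < s" for s
  proof -
    have "((\<lambda>_. 0) has_vector_derivative g' s) (at s)"
      by (rule has_vector_derivative_transform_within_open[OF d[of s], of "{R'<..}"]) (use that z in auto)
    then show ?thesis using vector_derivative_unique_at has_vector_derivative_const by blast
  qed
  have "(LINT s|lborel. indicator P s *\<^sub>R g' s) = (LINT s|lborel. indicator {0..R'} s *\<^sub>R g' s)"
  proof (rule integral_cong_AE)
    show "(\<lambda>s. indicator P s *\<^sub>R g' s) \<in> borel_measurable lborel" "(\<lambda>s. indicator {0..R'} s *\<^sub>R g' s) \<in> borel_measurable lborel"
      using borel_measurable_continuous_onI[OF c] P by auto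
    have "AE s in lborel. s \<noteq> (0::real)" by (rule AE_lborel_singleton)
    then show "AE s in lborel. indicator P s *\<^sub>R g' s = indicator {0..R'} s *\<^sub>R g' s"
      by eventually_elim (use P g'0 in \<open>auto simp: indicator_def\<close>)
  qed
  also have "\<dots> = g R' - g 0"
    by (rule integral_FTC_atLeastAtMost) (auto simp: R'_def intro: has_vector_derivative_at_within d continuous_on_subset[OF c])
  finally show ?thesis using z[of R'] by (simp add: R'_def)
qed

text \<open>In the oblique coordinates (s, t) the derivative along a is the s-derivative, so the
  inner integral collapses to the boundary value at s = 0; |\<open>cr a b\<close>| enters as the
  Jacobian.\<close>

lemma quadrant_divergence:
  fixes G :: "real^2 \<Rightarrow> complex"
  assumes G: "C_diff (Suc 0) G" and supp: "bounded {x. G x \<noteq> 0}"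
    and P: "P = {0<..} \<or> P = {0..}" and Q: "Q = {0<..} \<or> Q = {0..}"
  shows "(LINT x|lborel. indicator {x. co1 x \<in> P \<and> co2 x \<in> Q} x *\<^sub>R dir_deriv a G x)
       = - (\<bar>cr a b\<bar> *\<^sub>R (LINT r|lborel. indicator {0<..} r *\<^sub>R G (r *\<^sub>R b)))"
proof -
  have diff: "G differentiable (at x)" for x using G by simp
  have lin: "dir_deriv v G x = v$1 * dir_deriv (axis 1 1) G x + v$2 * dir_deriv (axis 2 1) G x" for v x
  proof -
    have l: "linear (\<lambda>v. dir_deriv v G x)"
      using has_derivative_bounded_linear[OF has_derivative_dir_deriv[OF diff]] by (rule bounded_linear.linear)
    have "v = v$1 *\<^sub>R axis 1 1 + v$2 *\<^sub>R axis 2 1" by (rule real2_eqI) (auto simp: axis_def)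
    then have "dir_deriv v G x = dir_deriv (v$1 *\<^sub>R axis 1 1 + v$2 *\<^sub>R axis 2 1) G x" by simp
    also have "\<dots> = v$1 * dir_deriv (axis 1 1) G x + v$2 * dir_deriv (axis 2 1) G x"
      unfolding linear_add[OF l] linear_scale[OF l] by (simp add: scaleR_conv_of_real)
    finally show ?thesis .
  qed
  have cD: "continuous_on UNIV (dir_deriv a G)"
  proof -
    have "continuous_on UNIV (dir_deriv (axis 1 1) G)" "continuous_on UNIV (dir_deriv (axis 2 1) G)"
      using G by (simp_all add: Basis_real2(1))
    then have "continuous_on UNIV (\<lambda>x. a$1 * dir_deriv (axis 1 1) G x + a$2 * dir_deriv (axis 2 1) G x)"
      by (intro continuous_intros)
    then show ?thesis unfolding lin[of a, abs_def] .
  qed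
  have contG: "continuous_on UNIV G" using G C_diff_on_Suc_D[of UNIV 0 G] by (simp add: C_diff_on_UNIV)
  have bd: "bounded {x. dir_deriv a G x \<noteq> 0}"
  proof -
    have "{x. dir_deriv a G x \<noteq> 0} \<subseteq> {x. dir_deriv (axis 1 1) G x \<noteq> 0} \<union> {x. dir_deriv (axis 2 1) G x \<noteq> 0}"
      using lin[of a] by auto
    moreover have "bounded ({x. dir_deriv (axis 1 1) G x \<noteq> 0} \<union> {x. dir_deriv (axis 2 1) G x \<noteq> 0})"
      using integral_dir_deriv_compact_support(2)[OF G supp] by (simp add: Basis_real2)
    ultimately show ?thesis by (rule bounded_subset[rotated])
  qed
  obtain R0 where R0: "{x. G x \<noteq> 0} \<subseteq> ball 0 R0" using bounded_subset_ballD[OF supp] by blast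
  let ?S = "{x. co1 x \<in> P \<and> co2 x \<in> Q}"
  have S: "?S \<in> sets borel"
  proof -
    have "co1 \<in> borel_measurable borel" "co2 \<in> borel_measurable borel"
      by (auto intro!: borel_measurable_continuous_onI continuous_co)
    moreover have "?S = (co1 -` P \<inter> space borel) \<inter> (co2 -` Q \<inter> space borel)" by auto
    ultimately show ?thesis using P Q by (metis (no_types, lifting) measurable_sets sets.Int borel_closed borel_open closed_real_atLeast open_real_greaterThan)
  qed
  let ?F = "\<lambda>x. indicator ?S x *\<^sub>R dir_deriv a G x"
  have mF: "?F \<in> borel_measurable borel" using S borel_measurable_continuous_onI[OF cD] by measurable
  have iF: "integrable lborel ?F"
    using S by (intro integrable_mult_indicator integrable_lborel_compact_support cD bd) auto
  have iF2: "integrable lborel (\<lambda>z. ?F (fst z *\<^sub>R a + snd z *\<^sub>R b))" using iF integral_oblique(2)[OF mF] by simp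
  have inner: "(LINT s|lborel. ?F (s *\<^sub>R a + t *\<^sub>R b)) = - (indicator Q t *\<^sub>R G (t *\<^sub>R b))" for t
  proof -
    have "((\<lambda>s. G (s *\<^sub>R a + t *\<^sub>R b)) has_vector_derivative dir_deriv a G (s *\<^sub>R a + t *\<^sub>R b)) (at s)" for s
    proof -
      have "((\<lambda>s. s *\<^sub>R a + t *\<^sub>R b) has_vector_derivative a) (at s)"
        by (auto intro!: derivative_eq_intros)
      from vector_derivative_diff_chain_within[OF this has_derivative_at_withinI[OF has_derivative_dir_deriv[OF diff]]]
      show ?thesis by (simp add: comp_def)
    qed
    moreover have "continuous_on UNIV (\<lambda>s. dir_deriv a G (s *\<^sub>R a + t *\<^sub>R b))"
      by (rule continuous_on_compose2[OF cD]) (auto intro!: continuous_intros)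
    moreover have "G (s *\<^sub>R a + t *\<^sub>R b) = 0" if s: "(R0 + norm (t *\<^sub>R b)) / norm a \<le> \<bar>s\<bar>" for s
    proof -
      have "a \<noteq> 0" using cr by (auto simp: cr_def)
      then have "R0 + norm (t *\<^sub>R b) \<le> norm (s *\<^sub>R a)" using s by (simp add: field_simps)
      moreover have "norm (s *\<^sub>R a) \<le> norm (s *\<^sub>R a + t *\<^sub>R b) + norm (t *\<^sub>R b)"
        using norm_triangle_ineq4[of "s *\<^sub>R a + t *\<^sub>R b" "t *\<^sub>R b"] by simp
      ultimately have "s *\<^sub>R a + t *\<^sub>R b \<notin> ball 0 R0" by simp
      then show ?thesis using R0 by blast
    qed
    ultimately have I: "(LINT s|lborel. indicator P s *\<^sub>R dir_deriv a G (s *\<^sub>R a + t *\<^sub>R b)) = - G (0 *\<^sub>R a + t *\<^sub>R b)"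
      using P by (rule integral_half_line_deriv)
    have E: "?F (s *\<^sub>R a + t *\<^sub>R b) = indicator Q t *\<^sub>R (indicator P s *\<^sub>R dir_deriv a G (s *\<^sub>R a + t *\<^sub>R b))" for s
      by (auto simp: indicator_def)
    show ?thesis unfolding E using I by (simp del: scaleR_scaleR)
  qed
  have "(LINT x|lborel. ?F x) = \<bar>cr a b\<bar> *\<^sub>R (LINT z|lborel. ?F (fst z *\<^sub>R a + snd z *\<^sub>R b))"
    by (rule integral_oblique(1)[OF mF])
  also have "(LINT z|lborel. ?F (fst z *\<^sub>R a + snd z *\<^sub>R b)) = (LINT t|lborel. LINT s|lborel. ?F (s *\<^sub>R a + t *\<^sub>R b))"
    using lborel_pair.integral_snd[of "\<lambda>s t. ?F (s *\<^sub>R a + t *\<^sub>R b)"] iF2 by (simp add: lborel_prod case_prod_unfold)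
  also have "\<dots> = - (LINT t|lborel. indicator Q t *\<^sub>R G (t *\<^sub>R b))" unfolding inner by simp
  also have "(LINT t|lborel. indicator Q t *\<^sub>R G (t *\<^sub>R b)) = (LINT t|lborel. indicator {0<..} t *\<^sub>R G (t *\<^sub>R b))"
  proof (rule integral_cong_AE)
    have "(\<lambda>t. G (t *\<^sub>R b)) \<in> borel_measurable borel"
      by (rule borel_measurable_continuous_onI, rule continuous_on_compose2[OF contG]) (auto intro!: continuous_intros)
    then show "(\<lambda>t. indicator Q t *\<^sub>R G (t *\<^sub>R b)) \<in> borel_measurable lborel" "(\<lambda>t. indicator {0<..} t *\<^sub>R G (t *\<^sub>R b)) \<in> borel_measurable lborel"
      using Q by auto
    have "AE t in lborel. t \<noteq> (0::real)" by (rule AE_lborel_singleton)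
    then show "AE t in lborel. indicator Q t *\<^sub>R G (t *\<^sub>R b) = indicator {0<..} t *\<^sub>R G (t *\<^sub>R b)"
      by eventually_elim (use Q in \<open>auto simp: indicator_def\<close>)
  qed
  finally show ?thesis by simp
qed

end

section \<open>Plane sectors\<close>

text \<open>The range is that of a difference of two polar angles in (-pi, pi]. Below -pi the sine
  is positive again; this covers angles lying on different sides of the branch cut.\<close>

lemma sin_pos_iff:
  assumes "-2*pi < u" "u < 2*pi"
  shows "sin u > 0 \<longleftrightarrow> (0 < u \<and> u < pi) \<or> u < -pi"
proof -
  consider "u < -pi" | "-pi \<le> u" "u \<le> 0" | "0 < u" "u < pi" | "pi \<le> u" by linarith
  then show ?thesis
  proof cases
    case 1
    have "sin (u + 2 * pi) > 0" by (rule sin_gt_zero) (use 1 assms in auto)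
    then show ?thesis using 1 by (simp add: sin_periodic)
  next
    case 2
    then have "sin (- u) \<ge> 0" by (intro sin_ge_zero) auto
    then show ?thesis using 2 by auto
  next
    case 3 then show ?thesis by (auto intro: sin_gt_zero)
  next
    case 4
    have "sin (u - pi) \<ge> 0" using 4 assms by (intro sin_ge_zero) auto
    then have "\<not> sin u > 0" by (simp add: sin_diff)
    moreover have "\<not> u < - pi" using 4 pi_gt_zero by linarith
    ultimately show ?thesis using 4 by auto
  qed
qed

lemma polar_nth [simp]: "polar r t $ 1 = r * cos t" "polar r t $ 2 = r * sin t"
  by (simp_all add: polar_def)

lemma polar_scale: "polar r t = r *\<^sub>R polar 1 t"
  by (rule real2_eqI) auto

lemma norm_polar [simp]: "norm (polar r t) = \<bar>r\<bar>"
proof -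
  have "(r * cos t)\<^sup>2 + (r * sin t)\<^sup>2 = r\<^sup>2"
    using sin_cos_squared_add2[of t] by (simp add: power_mult_distrib flip: distrib_left)
  then show ?thesis by (simp add: norm_real2)
qed

lemma real2_polar:
  assumes "x \<noteq> 0"
  shows "x = polar (norm x) (Arg (Complex (x$1) (x$2)))"
proof -
  let ?z = "Complex (x$1) (x$2)"
  have n: "cmod ?z = norm x" by (simp add: cmod_def norm_real2)
  have "?z \<noteq> 0" using assms n by (metis norm_eq_zero)
  then have "Re ?z = cmod ?z * cos (Arg ?z)" "Im ?z = cmod ?z * sin (Arg ?z)"
    by (simp_all add: cos_Arg sin_Arg)
  then show ?thesis unfolding n by (intro real2_eqI) auto
qed

lemma dir_deriv_linear: "G differentiable (at x) \<Longrightarrow> linear (\<lambda>v. dir_deriv v G x)"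
  by (rule bounded_linear.linear[OF has_derivative_bounded_linear[OF has_derivative_dir_deriv]])

lemma dir_deriv_real2:
  fixes G :: "real^2 \<Rightarrow> complex"
  assumes "G differentiable (at x)"
  shows "dir_deriv v G x = v$1 *\<^sub>R dir_deriv (axis 1 1) G x + v$2 *\<^sub>R dir_deriv (axis 2 1) G x"
proof -
  have "v = v$1 *\<^sub>R axis 1 1 + v$2 *\<^sub>R axis 2 1" by (rule real2_eqI) (auto simp: axis_def)
  then have "dir_deriv v G x = dir_deriv (v$1 *\<^sub>R axis 1 1 + v$2 *\<^sub>R axis 2 1) G x" by simp
  also have "\<dots> = v$1 *\<^sub>R dir_deriv (axis 1 1) G x + v$2 *\<^sub>R dir_deriv (axis 2 1) G x"
    unfolding linear_add[OF dir_deriv_linear[OF assms]] linear_scale[OF dir_deriv_linear[OF assms]] ..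
  finally show ?thesis .
qed

lemma integral_dir_deriv_real2:
  fixes G :: "real^2 \<Rightarrow> complex"
  assumes G: "C_diff (Suc 0) G" and supp: "bounded {x. G x \<noteq> 0}"
  shows "integrable lborel (dir_deriv v G)" "(LINT x|lborel. dir_deriv v G x) = 0"
proof -
  have eq: "dir_deriv v G = (\<lambda>x. v$1 *\<^sub>R dir_deriv (axis 1 1) G x + v$2 *\<^sub>R dir_deriv (axis 2 1) G x)"
    using G by (intro ext dir_deriv_real2) simp
  have i: "integrable lborel (dir_deriv (axis 1 1) G)" "integrable lborel (dir_deriv (axis 2 1) G)"
    and z: "(LINT x|lborel. dir_deriv (axis 1 1) G x) = 0" "(LINT x|lborel. dir_deriv (axis 2 1) G x) = 0"
    using integral_dir_deriv_compact_support[OF G supp] by (simp_all add: Basis_real2(1))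
  show "integrable lborel (dir_deriv v G)" "(LINT x|lborel. dir_deriv v G x) = 0"
    unfolding eq using i z by simp_all
qed

section \<open>The sector in the coordinates of its two edges\<close>

locale corner =
  fixes \<theta>m \<theta>M :: real
  assumes th: "-pi < \<theta>m" "\<theta>m < \<theta>M" "\<theta>M < pi" "\<theta>M - \<theta>m \<noteq> pi"
begin

definition "va = polar 1 \<theta>M"
definition "vb = polar 1 \<theta>m"
definition "W = sector \<theta>m \<theta>M"

abbreviation "p \<equiv> co1 va vb"
abbreviation "q \<equiv> co2 va vb"

lemma norm_ab [simp]: "norm va = 1" "norm vb = 1" by (simp_all add: va_def vb_def)

lemma cr_va_vb: "cr va vb = - sin (\<theta>M - \<theta>m)"
  by (simp add: cr_def va_def vb_def sin_diff)

lemma sin_sign: "\<theta>M - \<theta>m < pi \<Longrightarrow> sin (\<theta>M - \<theta>m) > 0" "pi < \<theta>M - \<theta>m \<Longrightarrow> sin (\<theta>M - \<theta>m) < 0"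
proof -
  show "\<theta>M - \<theta>m < pi \<Longrightarrow> sin (\<theta>M - \<theta>m) > 0" using th by (intro sin_gt_zero) auto
  assume "pi < \<theta>M - \<theta>m"
  then have "sin (\<theta>M - \<theta>m - pi) > 0" using th by (intro sin_gt_zero) auto
  then show "sin (\<theta>M - \<theta>m) < 0" by (simp add: sin_diff)
qed

lemma cr_nz: "cr va vb \<noteq> 0"
  using sin_sign th(4) unfolding cr_va_vb by (cases "\<theta>M - \<theta>m < pi") auto

lemmas rep = co_rep[OF cr_nz] and co_comb [simp] = co_lin[OF cr_nz]
  and cont_p = continuous_co(1)[OF cr_nz] and cont_q = continuous_co(2)[OF cr_nz]

lemma co_scale [simp]: "p (r *\<^sub>R va) = r" "q (r *\<^sub>R va) = 0" "p (r *\<^sub>R vb) = 0" "q (r *\<^sub>R vb) = r"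
  using co_comb[of r 0] co_comb[of 0 r] by simp_all

lemma co_polar: "p (polar r t) = r * sin (t - \<theta>m) / sin (\<theta>M - \<theta>m)" "q (polar r t) = r * sin (\<theta>M - t) / sin (\<theta>M - \<theta>m)"
proof -
  have "cr (polar r t) vb = - (r * sin (t - \<theta>m))" "cr va (polar r t) = - (r * sin (\<theta>M - t))"
    by (simp_all add: cr_def va_def vb_def sin_diff algebra_simps)
  then show "p (polar r t) = r * sin (t - \<theta>m) / sin (\<theta>M - \<theta>m)" "q (polar r t) = r * sin (\<theta>M - t) / sin (\<theta>M - \<theta>m)"
    by (simp_all add: co1_def[OF cr_nz] co2_def[OF cr_nz] cr_va_vb)
qed

text \<open>Both edge coordinates of a point at angle t are sines divided by sin(\<theta>M -
  \<theta>m). For an opening below pi the sector is an open quadrant. Above pi the denominator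
  changes sign, and the sector becomes the complement of a closed quadrant with the same
  edges.\<close>

lemma W_iff: "x \<in> W \<longleftrightarrow> (if \<theta>M - \<theta>m < pi then 0 < p x \<and> 0 < q x else p x < 0 \<or> q x < 0)"
proof (cases "x = 0")
  case True
  have "p 0 = 0" "q 0 = 0" using co_scale[of 0] by simp_all
  then show ?thesis using True by (simp add: W_def sector_def)
next
  case False
  define t where "t = Arg (Complex (x$1) (x$2))"
  have x: "x = polar (norm x) t" using real2_polar[OF False] by (simp add: t_def)
  have t: "-pi < t" "t \<le> pi" unfolding t_def by (simp_all add: mpi_less_Arg Arg_le_pi)
  have r: "norm x > 0" using False by simp
  have px: "p x = norm x * sin (t - \<theta>m) / sin (\<theta>M - \<theta>m)" and qx: "q x = norm x * sin (\<theta>M - t) / sin (\<theta>M - \<theta>m)"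
    using co_polar[of "norm x" t] x by auto
  have s1: "sin (t - \<theta>m) > 0 \<longleftrightarrow> (0 < t - \<theta>m \<and> t - \<theta>m < pi) \<or> t - \<theta>m < -pi"
    by (rule sin_pos_iff) (use th t in auto)
  have s2: "sin (\<theta>M - t) > 0 \<longleftrightarrow> (0 < \<theta>M - t \<and> \<theta>M - t < pi) \<or> \<theta>M - t < -pi"
    by (rule sin_pos_iff) (use th t in auto)
  have W: "x \<in> W \<longleftrightarrow> \<theta>m < t \<and> t < \<theta>M" using False by (simp add: W_def sector_def t_def)
  show ?thesis
  proof (cases "\<theta>M - \<theta>m < pi")
    case True
    have "0 < p x \<longleftrightarrow> sin (t - \<theta>m) > 0" "0 < q x \<longleftrightarrow> sin (\<theta>M - t) > 0"
      unfolding px qx using r sin_sign(1)[OF True] by (simp_all add: zero_less_divide_iff zero_less_mult_iff)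
    then show ?thesis unfolding W using True s1 s2 th t by auto
  next
    case False
    then have "pi < \<theta>M - \<theta>m" using th by auto
    then have "p x < 0 \<longleftrightarrow> sin (t - \<theta>m) > 0" "q x < 0 \<longleftrightarrow> sin (\<theta>M - t) > 0"
      unfolding px qx using r sin_sign(2) by (simp_all add: divide_less_0_iff zero_less_mult_iff mult_less_0_iff)
    then show ?thesis unfolding W using False s1 s2 th t by auto
  qed
qed

lemma open_W: "open W"
proof (cases "\<theta>M - \<theta>m < pi")
  case True
  then have "W = {x. 0 < p x} \<inter> {x. 0 < q x}" using W_iff by auto
  also have "open \<dots>" by (intro open_Int open_Collect_less cont_p cont_q continuous_on_const)
  finally show ?thesis .
next
  case False
  then have "W = {x. p x < 0} \<union> {x. q x < 0}" using W_iff by auto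
  also have "open \<dots>" by (intro open_Un open_Collect_less cont_p cont_q continuous_on_const)
  finally show ?thesis .
qed

lemma W_scale: "0 < s \<Longrightarrow> s *\<^sub>R x \<in> W \<longleftrightarrow> x \<in> W"
  by (auto simp: W_iff linear_scale[OF linear_co(1)[OF cr_nz]] linear_scale[OF linear_co(2)[OF cr_nz]]
      zero_less_mult_iff mult_less_0_iff)

text \<open>Both coordinates of the shift \<open>dv\<close>: for a reentrant corner the complement of the closed
  sector is the open quadrant \<open>p > 0, q > 0\<close>, so that the sign has to be reversed.\<close>

definition corner_sign :: real where "corner_sign = (if \<theta>M - \<theta>m < pi then 1 else -1)"

text \<open>A point satisfying the weak inequalities enters W after an arbitrarily small step along
  \<open>corner_sign *\<^sub>R (va + vb)\<close>, which changes both coordinates in the favourable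
  direction.\<close>

lemma closure_W: "x \<in> closure W \<longleftrightarrow> (if \<theta>M - \<theta>m < pi then 0 \<le> p x \<and> 0 \<le> q x else p x \<le> 0 \<or> q x \<le> 0)"
  (is "_ \<longleftrightarrow> ?R x")
proof
  have "closed ({x. 0 \<le> p x} \<inter> {x. 0 \<le> q x})" "closed ({x. p x \<le> 0} \<union> {x. q x \<le> 0})"
    by (intro closed_Int closed_Un closed_Collect_le cont_p cont_q continuous_on_const)+
  moreover have "{x. ?R x} = (if \<theta>M - \<theta>m < pi then {x. 0 \<le> p x} \<inter> {x. 0 \<le> q x} else {x. p x \<le> 0} \<union> {x. q x \<le> 0})" by auto
  ultimately have "closed {x. ?R x}" by presburger
  moreover have "W \<subseteq> {x. ?R x}" by (auto simp: W_iff)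
  ultimately show "x \<in> closure W \<Longrightarrow> ?R x" using closure_minimal by blast
  assume R: "?R x"
  have stepW: "x + \<epsilon> *\<^sub>R (corner_sign *\<^sub>R (va + vb)) \<in> W" if "0 < \<epsilon>" for \<epsilon>
  proof -
    have e: "x + \<epsilon> *\<^sub>R (corner_sign *\<^sub>R (va + vb)) = (p x + corner_sign * \<epsilon>) *\<^sub>R va + (q x + corner_sign * \<epsilon>) *\<^sub>R vb"
      by (subst rep[of x]) (simp add: algebra_simps)
    show ?thesis unfolding e W_iff co_comb using R that by (auto simp: corner_sign_def split: if_splits)
  qed
  have "x + (1 / real (Suc n)) *\<^sub>R (corner_sign *\<^sub>R (va + vb)) \<in> W" for n by (intro stepW) simp
  moreover have "(\<lambda>n. x + (1 / real (Suc n)) *\<^sub>R (corner_sign *\<^sub>R (va + vb))) \<longlonglongrightarrow> x + 0 *\<^sub>R (corner_sign *\<^sub>R (va + vb))"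
    by (intro tendsto_intros LIMSEQ_Suc[OF lim_1_over_n])
  ultimately show "x \<in> closure W" unfolding closure_sequential by (intro exI conjI allI) (assumption, simp)
qed

lemma frontier_W: "x \<in> frontier W \<longleftrightarrow> 0 \<le> p x \<and> 0 \<le> q x \<and> (p x = 0 \<or> q x = 0)"
  unfolding frontier_def interior_open[OF open_W] using closure_W[of x] W_iff[of x] by (auto split: if_splits)

text \<open>The vertex is counted with the first edge only, so that the two cases are disjoint and
  integrals over them may be added.\<close>

lemma frontier_W_rays:
  "x \<in> frontier W \<longleftrightarrow> (\<exists>r\<ge>0. x = r *\<^sub>R va) \<or> (\<exists>r>0. x = r *\<^sub>R vb)"
proof
  assume "x \<in> frontier W"
  then have "0 \<le> p x" "0 \<le> q x" "p x = 0 \<or> q x = 0" by (auto simp: frontier_W)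
  then show "(\<exists>r\<ge>0. x = r *\<^sub>R va) \<or> (\<exists>r>0. x = r *\<^sub>R vb)"
    using rep[of x] by (cases "q x = 0") (force, force)
qed (auto simp: frontier_W)

text \<open>For a reentrant sector the closed quadrant is subtracted from the plane, over which the
  derivative integrates to 0. The resulting change of sign is the sign of \<open>cr va vb\<close>,
  and so one formula covers both kinds of corner. A derivative along one edge produces the integral
  over the other edge.\<close>

lemma sector_divergence:
  fixes G :: "real^2 \<Rightarrow> complex"
  assumes G: "C_diff (Suc 0) G" and supp: "bounded {x. G x \<noteq> 0}"
  shows "(LINT x|lborel. indicator W x *\<^sub>R dir_deriv va G x) = cr va vb *\<^sub>R (LINT r|lborel. indicator {0<..} r *\<^sub>R G (r *\<^sub>R vb))"
    and "(LINT x|lborel. indicator W x *\<^sub>R dir_deriv vb G x) = cr va vb *\<^sub>R (LINT r|lborel. indicator {0<..} r *\<^sub>R G (r *\<^sub>R va))"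
    and "integrable lborel (dir_deriv v G)"
    and "dir_deriv v G x = p v *\<^sub>R dir_deriv va G x + q v *\<^sub>R dir_deriv vb G x"
proof -
  have diff: "G differentiable (at x)" for x using G by simp
  have cs: "cr x y = - cr y x" for x y by (simp add: cr_def)
  have crba: "cr vb va \<noteq> 0" "\<bar>cr vb va\<bar> = \<bar>cr va vb\<bar>" using cr_nz cs[of vb va] by auto
  \<comment> \<open>Exchanging the basis vectors exchanges the two coordinates, since the cross
    product changes sign in numerator and denominator alike.\<close>
  have sw: "co1 vb va = q" "co2 vb va = p"
    unfolding co1_def[OF crba(1)] co2_def[OF crba(1)] co1_def[OF cr_nz] co2_def[OF cr_nz] cs[of vb]
    by (intro ext; simp add: cs[of _ va])+
  have "dir_deriv v G x = dir_deriv (p v *\<^sub>R va + q v *\<^sub>R vb) G x" using rep[of v] by simp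
  then show "dir_deriv v G x = p v *\<^sub>R dir_deriv va G x + q v *\<^sub>R dir_deriv vb G x"
    unfolding linear_add[OF dir_deriv_linear[OF diff]] linear_scale[OF dir_deriv_linear[OF diff]] .
  note int = integral_dir_deriv_real2[OF G supp]
  show "integrable lborel (dir_deriv v G)" by (rule int)
  let ?O = "{x. p x \<in> {0<..} \<and> q x \<in> {0<..}}" and ?C = "{x. p x \<in> {0..} \<and> q x \<in> {0..}}"
  have C: "?C \<in> sets borel"
  proof -
    have "?C = {x. 0 \<le> p x} \<inter> {x. 0 \<le> q x}" by auto
    also have "closed \<dots>" by (intro closed_Int closed_Collect_le cont_p cont_q continuous_on_const)
    finally show ?thesis by (rule borel_closed)
  qed
  have key: "(LINT x|lborel. indicator W x *\<^sub>R dir_deriv v G x) =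
      (if \<theta>M - \<theta>m < pi then (LINT x|lborel. indicator ?O x *\<^sub>R dir_deriv v G x)
       else - (LINT x|lborel. indicator ?C x *\<^sub>R dir_deriv v G x))" for v
  proof (cases "\<theta>M - \<theta>m < pi")
    case True
    then have "W = ?O" by (auto simp: W_iff)
    then show ?thesis using True by simp
  next
    case False
    then have "indicator W x *\<^sub>R dir_deriv v G x = dir_deriv v G x - indicator ?C x *\<^sub>R dir_deriv v G x" for x
      by (auto simp: W_iff indicator_def not_le)
    moreover have "integrable lborel (\<lambda>x. indicator ?C x *\<^sub>R dir_deriv v G x)"
      using C by (intro integrable_mult_indicator int(1)) simp
    ultimately show ?thesis using False int[of v] by simp
  qed
  have sgn: "cr va vb = (if \<theta>M - \<theta>m < pi then - \<bar>cr va vb\<bar> else \<bar>cr va vb\<bar>)"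
    using sin_sign th(4) by (auto simp: cr_va_vb)
  show "(LINT x|lborel. indicator W x *\<^sub>R dir_deriv va G x) = cr va vb *\<^sub>R (LINT r|lborel. indicator {0<..} r *\<^sub>R G (r *\<^sub>R vb))"
    unfolding key
    using quadrant_divergence[OF cr_nz G supp, of "{0<..}" "{0<..}"] quadrant_divergence[OF cr_nz G supp, of "{0..}" "{0..}"]
    by (subst sgn) simp
  have swO: "{x. q x \<in> P \<and> p x \<in> P} = {x. p x \<in> P \<and> q x \<in> P}" for P by auto
  show "(LINT x|lborel. indicator W x *\<^sub>R dir_deriv vb G x) = cr va vb *\<^sub>R (LINT r|lborel. indicator {0<..} r *\<^sub>R G (r *\<^sub>R va))"
    unfolding key
    using quadrant_divergence[OF crba(1) G supp, of "{0<..}" "{0<..}"] quadrant_divergence[OF crba(1) G supp, of "{0..}" "{0..}"]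
    unfolding sw crba(2) swO by (subst sgn) simp
qed

section \<open>Boundary integrals near the vertex\<close>

lemma frontier_corner:
  assumes \<Omega>: "open \<Omega>" "\<Omega> \<inter> ball 0 h = W \<inter> ball 0 h" and x: "x \<in> ball 0 h"
  shows "x \<in> frontier \<Omega> \<longleftrightarrow> x \<in> frontier W"
proof -
  have "x \<in> closure \<Omega> \<longleftrightarrow> x \<in> closure (\<Omega> \<inter> ball 0 h)" if "x \<in> ball 0 h" for \<Omega> :: "(real^2) set"
    using open_Int_closure_subset[OF open_ball[of 0 h], of \<Omega>] closure_mono[of "\<Omega> \<inter> ball 0 h" \<Omega>] that by (auto simp: Int_commute)
  then have "x \<in> closure \<Omega> \<longleftrightarrow> x \<in> closure W" using \<Omega>(2) x by metis
  moreover have "x \<in> \<Omega> \<longleftrightarrow> x \<in> W" using \<Omega>(2) x by blast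
  ultimately show ?thesis using \<Omega>(1) open_W by (simp add: frontier_def interior_open)
qed

text \<open>Inside the ball the boundary is the union of the two edges, and F vanishes elsewhere, so
  the Hausdorff integral splits into two integrals along half-lines.\<close>

lemma boundary_measure_integral:
  fixes F :: "real^2 \<Rightarrow> 'b::{banach, second_countable_topology}"
  assumes \<Omega>: "open \<Omega>" "\<Omega> \<inter> ball 0 h = W \<inter> ball 0 h" and F: "continuous_on UNIV F"
    and supp: "\<And>x. x \<notin> ball 0 h \<Longrightarrow> F x = 0"
  shows "integral\<^sup>L (boundary_measure \<Omega>) F =
      (LINT r|lborel. indicator {0<..} r *\<^sub>R F (r *\<^sub>R va)) + (LINT r|lborel. indicator {0<..} r *\<^sub>R F (r *\<^sub>R vb))"
    and "integrable (boundary_measure \<Omega>) F"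
proof -
  have mF: "F \<in> borel_measurable borel" by (rule borel_measurable_continuous_onI[OF F])
  have fr: "frontier \<Omega> \<inter> space hausdorff1 \<in> sets hausdorff1" by (simp add: borel_closed)
  have int: "integrable lborel (\<lambda>r. F (r *\<^sub>R e))" if e: "norm e = 1" for e
  proof -
    have c: "continuous_on UNIV (\<lambda>r. F (r *\<^sub>R e))"
      by (rule continuous_on_compose2[OF F]) (auto intro!: continuous_intros)
    have "integrable lborel (\<lambda>r. indicator {-h..h} r *\<^sub>R F (r *\<^sub>R e))"
      by (intro borel_integrable_compact continuous_on_subset[OF c]) auto
    also have "(\<lambda>r. indicator {-h..h} r *\<^sub>R F (r *\<^sub>R e)) = (\<lambda>r. F (r *\<^sub>R e))"
      using supp[of "r *\<^sub>R e" for r] e by (intro ext) (auto simp: indicator_def)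
    finally show ?thesis .
  qed
  \<comment> \<open>The integral formula is available for full lines, so F is set to 0 on the
    half-lines opposite to the edges; the weak and the strict inequality give the vertex to exactly
    one edge.\<close>
  define Fa where "Fa x = (if x \<bullet> va \<ge> 0 then F x else 0)" for x
  define Fb where "Fb x = (if x \<bullet> vb > 0 then F x else 0)" for x
  have mab: "Fa \<in> borel_measurable borel" "Fb \<in> borel_measurable borel"
    unfolding Fa_def Fb_def using mF by measurable
  have ie: "(r *\<^sub>R va) \<bullet> va = r" "(r *\<^sub>R vb) \<bullet> vb = r" for r
    by (simp_all add: dot_square_norm)
  have ea: "Fa (r *\<^sub>R va) = indicator {0..} r *\<^sub>R F (r *\<^sub>R va)" and eb: "Fb (r *\<^sub>R vb) = indicator {0<..} r *\<^sub>R F (r *\<^sub>R vb)" for r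
    unfolding Fa_def Fb_def ie by (auto simp: indicator_def)
  have ia: "integrable lborel (\<lambda>r. Fa (r *\<^sub>R va))" and ib: "integrable lborel (\<lambda>r. Fb (r *\<^sub>R vb))"
    unfolding ea eb by (intro integrable_mult_indicator int; simp)+
  let ?La = "range (\<lambda>r. r *\<^sub>R va)" and ?Lb = "range (\<lambda>r. r *\<^sub>R vb)"
  have split: "indicator (frontier \<Omega>) x *\<^sub>R F x = indicator ?La x *\<^sub>R Fa x + indicator ?Lb x *\<^sub>R Fb x" for x
  proof (cases "x \<in> ball 0 h")
    case True
    have A: "(\<exists>r\<ge>0. x = r *\<^sub>R va) \<longleftrightarrow> x \<in> ?La \<and> x \<bullet> va \<ge> 0" and B: "(\<exists>r>0. x = r *\<^sub>R vb) \<longleftrightarrow> x \<in> ?Lb \<and> x \<bullet> vb > 0"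
      using ie by (auto simp: dot_square_norm)
    have "x \<in> frontier \<Omega> \<longleftrightarrow> (x \<in> ?La \<and> x \<bullet> va \<ge> 0) \<or> (x \<in> ?Lb \<and> x \<bullet> vb > 0)"
      using frontier_corner[OF \<Omega> True] frontier_W_rays[of x] A B by simp
    moreover have "\<not> ((x \<in> ?La \<and> x \<bullet> va \<ge> 0) \<and> (x \<in> ?Lb \<and> x \<bullet> vb > 0))"
    proof
      assume "(x \<in> ?La \<and> x \<bullet> va \<ge> 0) \<and> (x \<in> ?Lb \<and> x \<bullet> vb > 0)"
      then obtain r s where "x = r *\<^sub>R va" "x = s *\<^sub>R vb" "s > 0" using B by blast
      then show False using co_scale(2)[of r] co_scale(4)[of s] by simp
    qed
    ultimately show ?thesis by (auto simp: indicator_def Fa_def Fb_def)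
  qed (use supp in \<open>simp add: Fa_def Fb_def\<close>)
  have a: "integral\<^sup>L hausdorff1 (\<lambda>x. indicator ?La x *\<^sub>R Fa x) = (LINT r|lborel. Fa (r *\<^sub>R va))"
    "integrable hausdorff1 (\<lambda>x. indicator ?La x *\<^sub>R Fa x)"
    and b: "integral\<^sup>L hausdorff1 (\<lambda>x. indicator ?Lb x *\<^sub>R Fb x) = (LINT r|lborel. Fb (r *\<^sub>R vb))"
    "integrable hausdorff1 (\<lambda>x. indicator ?Lb x *\<^sub>R Fb x)"
    using hausdorff1_line[OF norm_ab(1) mab(1)] hausdorff1_line[OF norm_ab(2) mab(2)] ia ib by simp_all
  have mr: "F \<in> borel_measurable (restrict_space hausdorff1 (frontier \<Omega>))"
    using mF by (intro measurable_restrict_space1) simp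
  have ir: "integrable (restrict_space hausdorff1 (frontier \<Omega>)) F"
    unfolding integrable_restrict_space[OF fr] split using a(2) b(2) by (rule Bochner_Integration.integrable_add)
  then show "integrable (boundary_measure \<Omega>) F"
    unfolding boundary_measure_def using mr by (simp add: integrable_completion)
  have "integral\<^sup>L (boundary_measure \<Omega>) F = integral\<^sup>L (restrict_space hausdorff1 (frontier \<Omega>)) F"
    unfolding boundary_measure_def by (rule integral_completion[OF mr])
  also have "\<dots> = (LINT r|lborel. Fa (r *\<^sub>R va)) + (LINT r|lborel. Fb (r *\<^sub>R vb))"
    unfolding integral_restrict_space[OF fr] split Bochner_Integration.integral_add[OF a(2) b(2)] a(1) b(1) ..
  also have "(LINT r|lborel. Fa (r *\<^sub>R va)) = (LINT r|lborel. indicator {0<..} r *\<^sub>R F (r *\<^sub>R va))"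
  proof (rule integral_cong_AE)
    have m: "(\<lambda>r. F (r *\<^sub>R va)) \<in> borel_measurable lborel" using int[of va] by (intro borel_measurable_integrable) simp
    show "(\<lambda>r. Fa (r *\<^sub>R va)) \<in> borel_measurable lborel" using ia by (rule borel_measurable_integrable)
    show "(\<lambda>r. indicator {0<..} r *\<^sub>R F (r *\<^sub>R va)) \<in> borel_measurable lborel" using m by (intro borel_measurable_scaleR borel_measurable_indicator) auto
    have "AE t in lborel. t \<noteq> (0::real)" by (rule AE_lborel_singleton)
    then show "AE r in lborel. Fa (r *\<^sub>R va) = indicator {0<..} r *\<^sub>R F (r *\<^sub>R va)"
      unfolding ea by eventually_elim (auto simp: indicator_def)
  qed
  finally show "integral\<^sup>L (boundary_measure \<Omega>) F =
      (LINT r|lborel. indicator {0<..} r *\<^sub>R F (r *\<^sub>R va)) + (LINT r|lborel. indicator {0<..} r *\<^sub>R F (r *\<^sub>R vb))"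
    unfolding eb .
qed

end

section \<open>Herglotz waves\<close>

lemma exp_i_has_derivative:
  "((\<lambda>t. exp (\<i> * complex_of_real t)) has_derivative (\<lambda>h. of_real h * (\<i> * exp (\<i> * complex_of_real t)))) (at t within S)"
proof -
  have "((\<lambda>z. exp (\<i> * z)) has_field_derivative (\<i> * exp (\<i> * complex_of_real t))) (at (complex_of_real t))"
    by (auto intro!: derivative_eq_intros)
  then have "((\<lambda>z. exp (\<i> * z)) has_derivative (\<lambda>h. h * (\<i> * exp (\<i> * complex_of_real t)))) (at (complex_of_real t))"
    unfolding has_field_derivative_def by (simp only: mult.commute[of _ "\<i> * exp (\<i> * complex_of_real t)"])
  from has_derivative_compose[OF bounded_linear_imp_has_derivative[OF bounded_linear_of_real] this]
  show ?thesis by simp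
qed

lemma cmod_cis_minus_1: "cmod (exp (\<i> * complex_of_real t) - 1) \<le> \<bar>t\<bar>"
proof -
  have "((\<lambda>t. exp (\<i> * complex_of_real t)) has_derivative (\<lambda>h. of_real h * (\<i> * exp (\<i> * complex_of_real t)))) (at t within UNIV)" for t
    by (rule exp_i_has_derivative)
  moreover have "onorm (\<lambda>h. of_real h * (\<i> * exp (\<i> * complex_of_real t))) \<le> 1" for t
    by (rule onorm_le) (simp add: norm_mult)
  ultimately have "norm (exp (\<i> * complex_of_real t) - exp (\<i> * complex_of_real 0)) \<le> 1 * norm (t - 0)"
    by (intro differentiable_bound[of UNIV]) auto
  then show ?thesis by simp
qed

text \<open>The remainder has derivative i (exp(is) - 1), of modulus at most |t| on the segment from
  0 to t, whence the bound |t| * |t|. The quadratic order is what differentiation under the circle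
  integral requires.\<close>

lemma cmod_cis_taylor: "cmod (exp (\<i> * complex_of_real t) - 1 - \<i> * complex_of_real t) \<le> t\<^sup>2"
proof -
  have "((\<lambda>t. exp (\<i> * complex_of_real t) - 1 - \<i> * complex_of_real t) has_derivative
      (\<lambda>h. of_real h * (\<i> * (exp (\<i> * complex_of_real s) - 1)))) (at s within closed_segment 0 t)" for s
    by (auto intro!: derivative_eq_intros exp_i_has_derivative simp: algebra_simps)
  moreover have "onorm (\<lambda>h. of_real h * (\<i> * (exp (\<i> * complex_of_real s) - 1))) \<le> \<bar>t\<bar>" if "s \<in> closed_segment 0 t" for s
  proof (rule onorm_le)
    fix h
    have "\<bar>s\<bar> \<le> \<bar>t\<bar>" using that by (auto simp: closed_segment_eq_real_ivl split: if_splits)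
    then have "cmod (exp (\<i> * complex_of_real s) - 1) \<le> \<bar>t\<bar>" using cmod_cis_minus_1[of s] by linarith
    then show "norm (complex_of_real h * (\<i> * (exp (\<i> * complex_of_real s) - 1))) \<le> \<bar>t\<bar> * norm h"
      by (simp add: norm_mult mult.commute[of "\<bar>h\<bar>"] mult_right_mono)
  qed
  ultimately have "norm ((exp (\<i> * complex_of_real t) - 1 - \<i> * complex_of_real t) - (exp (\<i> * complex_of_real 0) - 1 - \<i> * complex_of_real 0)) \<le> \<bar>t\<bar> * norm (t - 0)"
    by (intro differentiable_bound[of "closed_segment 0 t"]) auto
  then show ?thesis by (simp add: power2_eq_square flip: abs_mult)
qed

lemma circle_measurable: "f \<in> borel_measurable borel \<Longrightarrow> f \<in> borel_measurable circle_measure"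
  unfolding circle_measure_def by (intro measurable_completion) simp

lemma polar_measurable: "polar 1 \<in> borel_measurable (restrict_space lborel S)"
proof -
  have "polar 1 = (\<lambda>t. cos t *\<^sub>R axis 1 1 + sin t *\<^sub>R axis 2 1)"
    by (intro ext real2_eqI) (auto simp: axis_def)
  moreover have "continuous_on UNIV (\<lambda>t::real. cos t *\<^sub>R axis 1 1 + sin t *\<^sub>R axis 2 (1::real) :: real^2)"
    by (intro continuous_intros)
  ultimately have "polar 1 \<in> borel_measurable borel" using borel_measurable_continuous_onI by metis
  then show ?thesis by (intro measurable_restrict_space1) simp
qed

lemma finite_circle_measure: "finite_measure circle_measure"
proof
  have "emeasure circle_measure (space circle_measure) = emeasure lborel {0..<2*pi}"
    unfolding circle_measure_def using polar_measurable
    by (simp add: emeasure_distr emeasure_restrict_space space_restrict_space)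
  then show "emeasure circle_measure (space circle_measure) \<noteq> \<infinity>" by simp
qed

text \<open>\<open>circle_measure\<close> is formally a measure on the whole plane; the bounds on
  the kernels hold only for unit vectors, that is, almost everywhere.\<close>

lemma AE_circle_norm: "AE \<xi> in circle_measure. norm \<xi> = 1"
  unfolding circle_measure_def
  by (intro AE_completion, subst AE_distr_iff[OF polar_measurable]) auto

lemma circle_square_integrable_const: "square_integrable circle_measure (\<lambda>_. c)"
proof -
  interpret finite_measure circle_measure by (rule finite_circle_measure)
  show ?thesis by (simp add: square_integrable_def)
qed

lemma circle_L2_imp_L1:
  assumes "square_integrable circle_measure g"
  shows "integrable circle_measure g"
    "(LINT \<xi>|circle_measure. cmod (g \<xi>)) \<le> L2_norm circle_measure (\<lambda>_. 1) * L2_norm circle_measure g"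
proof -
  show "integrable circle_measure g"
    using square_integrable_imp_integrable_mult[OF circle_square_integrable_const[of 1] assms] by simp
  show "(LINT \<xi>|circle_measure. cmod (g \<xi>)) \<le> L2_norm circle_measure (\<lambda>_. 1) * L2_norm circle_measure g"
    using Cauchy_Schwarz_L2(1)[OF circle_square_integrable_const[of 1] assms] by simp
qed

section \<open>Regularity of Herglotz waves\<close>

context fixes k :: real assumes k: "k > 0" begin

lemma circle_integrable_bounded:
  assumes g: "integrable circle_measure g" and e: "e \<in> borel_measurable borel" and b: "\<And>\<xi>. norm \<xi> = 1 \<Longrightarrow> cmod (e \<xi>) \<le> B"
  shows "integrable circle_measure (\<lambda>\<xi>. e \<xi> * g \<xi>)"
    "cmod (LINT \<xi>|circle_measure. e \<xi> * g \<xi>) \<le> B * (LINT \<xi>|circle_measure. cmod (g \<xi>))"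
proof -
  have m: "(\<lambda>\<xi>. e \<xi> * g \<xi>) \<in> borel_measurable circle_measure"
    using circle_measurable[OF e] g by auto
  have le: "AE \<xi> in circle_measure. norm (e \<xi> * g \<xi>) \<le> B * cmod (g \<xi>)"
    using AE_circle_norm by eventually_elim (auto simp: norm_mult intro!: mult_right_mono b)
  then have le': "AE \<xi> in circle_measure. norm (e \<xi> * g \<xi>) \<le> norm (B * cmod (g \<xi>))"
    by eventually_elim auto
  show i: "integrable circle_measure (\<lambda>\<xi>. e \<xi> * g \<xi>)"
    by (rule Bochner_Integration.integrable_bound[OF _ m le']) (use g in auto)
  have "cmod (LINT \<xi>|circle_measure. e \<xi> * g \<xi>) \<le> (LINT \<xi>|circle_measure. norm (e \<xi> * g \<xi>))"
    by (rule integral_norm_bound)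
  also have "\<dots> \<le> (LINT \<xi>|circle_measure. B * cmod (g \<xi>))"
    by (rule integral_mono_AE) (use i g le in auto)
  finally show "cmod (LINT \<xi>|circle_measure. e \<xi> * g \<xi>) \<le> B * (LINT \<xi>|circle_measure. cmod (g \<xi>))" by simp
qed

lemma herglotz_kernel_measurable: "(\<lambda>\<xi>. exp (\<i> * complex_of_real (k * (\<xi> \<bullet> x)))) \<in> borel_measurable borel"
  by (intro borel_measurable_continuous_onI continuous_intros)

lemma inner_sphere: "norm \<xi> = 1 \<Longrightarrow> \<bar>\<xi> \<bullet> y\<bar> \<le> norm y"
  using Cauchy_Schwarz_ineq2[of \<xi> y] by simp

lemma herglotz_integrable:
  "integrable circle_measure g \<Longrightarrow> integrable circle_measure (\<lambda>\<xi>. exp (\<i> * complex_of_real (k * (\<xi> \<bullet> x))) * g \<xi>)"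
  by (rule circle_integrable_bounded(1)[where B=1]) (auto intro: herglotz_kernel_measurable)

lemma exp_i_diff: "exp (\<i> * complex_of_real (a + t)) - exp (\<i> * complex_of_real a) = exp (\<i> * complex_of_real a) * (exp (\<i> * complex_of_real t) - 1)"
  by (simp add: algebra_simps exp_add)

text \<open>The Lipschitz constant is k times the L^1 norm of the kernel; through it the growth of
  the kernels enters the final estimate.\<close>

lemma herglotz_lipschitz:
  assumes g: "integrable circle_measure g"
  shows "cmod (herglotz k g x - herglotz k g y) \<le> k * norm (x - y) * (LINT \<xi>|circle_measure. cmod (g \<xi>))"
proof -
  let ?E = "\<lambda>x \<xi>. exp (\<i> * complex_of_real (k * (\<xi> \<bullet> x)))"
  have "herglotz k g x - herglotz k g y = (LINT \<xi>|circle_measure. (?E x \<xi> - ?E y \<xi>) * g \<xi>)"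
    unfolding herglotz_def left_diff_distrib
    by (rule Bochner_Integration.integral_diff[symmetric]) (intro herglotz_integrable g)+
  also have "cmod \<dots> \<le> (k * norm (x - y)) * (LINT \<xi>|circle_measure. cmod (g \<xi>))"
  proof (rule circle_integrable_bounded(2)[OF g])
    show "(\<lambda>\<xi>. ?E x \<xi> - ?E y \<xi>) \<in> borel_measurable borel"
      by (intro borel_measurable_diff herglotz_kernel_measurable)
    fix \<xi> :: "real^2" assume "norm \<xi> = 1"
    have "?E x \<xi> - ?E y \<xi> = ?E y \<xi> * (exp (\<i> * complex_of_real (k * (\<xi> \<bullet> (x - y)))) - 1)"
      using exp_i_diff[of "k * (\<xi> \<bullet> y)" "k * (\<xi> \<bullet> (x - y))"] by (simp add: inner_diff_right algebra_simps)
    then have "cmod (?E x \<xi> - ?E y \<xi>) \<le> \<bar>k * (\<xi> \<bullet> (x - y))\<bar>"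
      using cmod_cis_minus_1[of "k * (\<xi> \<bullet> (x - y))"] by (simp add: norm_mult)
    also have "\<dots> \<le> k * norm (x - y)" using k inner_sphere[OF \<open>norm \<xi> = 1\<close>, of "x - y"] by (simp add: abs_mult)
    finally show "cmod (?E x \<xi> - ?E y \<xi>) \<le> k * norm (x - y)" .
  qed
  finally show ?thesis .
qed

lemma herglotz_continuous:
  assumes g: "integrable circle_measure g"
  shows "continuous_on UNIV (herglotz k g)"
proof -
  define L where "L = k * (LINT \<xi>|circle_measure. cmod (g \<xi>))"
  have "L \<ge> 0" using k by (simp add: L_def)
  then have "L-lipschitz_on UNIV (herglotz k g)"
    using herglotz_lipschitz[OF g] by (intro lipschitz_onI) (auto simp: dist_norm L_def algebra_simps)
  then show ?thesis by (rule lipschitz_on_continuous_on)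
qed

text \<open>The second-order remainder of the exponential is bounded by (k |y|)^2 uniformly on the
  circle. The derivative is again a Herglotz wave, with a kernel multiplied by a bounded factor, so
  its continuity follows from \<open>herglotz_continuous\<close>.\<close>

lemma herglotz_has_derivative:
  assumes g: "integrable circle_measure g"
  shows "(herglotz k g has_derivative (\<lambda>y. herglotz k (\<lambda>\<xi>. \<i> * complex_of_real (k * (\<xi> \<bullet> y)) * g \<xi>) x)) (at x)"
proof -
  let ?E = "\<lambda>x \<xi>. exp (\<i> * complex_of_real (k * (\<xi> \<bullet> x)))"
  define I where "I = (LINT \<xi>|circle_measure. cmod (g \<xi>))"
  define D where "D y = herglotz k (\<lambda>\<xi>. \<i> * complex_of_real (k * (\<xi> \<bullet> y)) * g \<xi>) x" for y
  have mi: "(\<lambda>\<xi>. \<i> * complex_of_real (k * (\<xi> \<bullet> y))) \<in> borel_measurable borel" for y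
    by (intro borel_measurable_continuous_onI continuous_intros)
  have ig: "integrable circle_measure (\<lambda>\<xi>. \<i> * complex_of_real (k * (\<xi> \<bullet> y)) * g \<xi>)" for y
    using inner_sphere[of _ y] k by (intro circle_integrable_bounded(1)[OF g mi, where B="k * norm y"]) (auto simp: norm_mult abs_mult)
  have lin: "linear D"
  proof (rule linearI)
    show "D (y + z) = D y + D z" for y z
      unfolding D_def herglotz_def
      by (subst Bochner_Integration.integral_add[symmetric])
         (intro herglotz_integrable ig, intro herglotz_integrable ig, simp add: inner_add_right algebra_simps)
    show "D (c *\<^sub>R y) = c *\<^sub>R D y" for c y
    proof -
      have "D (c *\<^sub>R y) = (LINT \<xi>|circle_measure. c *\<^sub>R (?E x \<xi> * (\<i> * complex_of_real (k * (\<xi> \<bullet> y)) * g \<xi>)))"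
        unfolding D_def herglotz_def by (intro Bochner_Integration.integral_cong) (simp_all add: scaleR_conv_of_real[where 'a=complex] mult_ac)
      also have "\<dots> = c *\<^sub>R D y" unfolding D_def herglotz_def by (rule integral_scaleR_right)
      finally show ?thesis .
    qed
  qed
  have rem: "cmod (herglotz k g (x + y) - herglotz k g x - D y) \<le> (k * norm y)\<^sup>2 * I" for y
  proof -
    let ?R = "\<lambda>\<xi>. ?E (x + y) \<xi> - ?E x \<xi> - ?E x \<xi> * (\<i> * complex_of_real (k * (\<xi> \<bullet> y)))"
    have "herglotz k g (x + y) - herglotz k g x - D y = (LINT \<xi>|circle_measure. ?R \<xi> * g \<xi>)"
      unfolding D_def herglotz_def left_diff_distrib mult.assoc[of "exp _"]
      by (subst Bochner_Integration.integral_diff Bochner_Integration.integral_diff,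
          (intro Bochner_Integration.integrable_diff herglotz_integrable g ig)+)+ simp
    also have "cmod \<dots> \<le> (k * norm y)\<^sup>2 * I"
      unfolding I_def
    proof (rule circle_integrable_bounded(2)[OF g])
      show "?R \<in> borel_measurable borel"
        by (intro borel_measurable_diff borel_measurable_times herglotz_kernel_measurable mi)
      fix \<xi> :: "real^2" assume n: "norm \<xi> = 1"
      let ?t = "k * (\<xi> \<bullet> y)"
      have "?R \<xi> = ?E x \<xi> * (exp (\<i> * complex_of_real ?t) - 1 - \<i> * complex_of_real ?t)"
        using exp_i_diff[of "k * (\<xi> \<bullet> x)" ?t] by (simp add: inner_add_right algebra_simps)
      then have "cmod (?R \<xi>) \<le> ?t\<^sup>2" using cmod_cis_taylor[of ?t] by (simp add: norm_mult)
      also have "\<dots> = \<bar>?t\<bar>\<^sup>2" by simp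
      also have "\<dots> \<le> (k * norm y)\<^sup>2"
        using k inner_sphere[OF n, of y] by (intro power_mono) (auto simp: abs_mult)
      finally show "cmod (?R \<xi>) \<le> (k * norm y)\<^sup>2" .
    qed
    finally show ?thesis .
  qed
  have "((\<lambda>y. norm (herglotz k g (x + y) - herglotz k g x - D y) / norm y) \<longlongrightarrow> 0) (at 0)"
  proof (rule tendsto_sandwich[OF _ _ tendsto_const])
    show "((\<lambda>y::real^2. k\<^sup>2 * I * norm y) \<longlongrightarrow> 0) (at 0)" by (auto intro!: tendsto_eq_intros)
    show "\<forall>\<^sub>F y in at 0. norm (herglotz k g (x + y) - herglotz k g x - D y) / norm y \<le> k\<^sup>2 * I * norm y"
      using rem by (auto simp: eventually_at_filter pos_divide_le_eq power_mult_distrib power2_eq_square mult_ac)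
  qed auto
  then have "(herglotz k g has_derivative D) (at x)"
    using lin by (simp add: has_derivative_at linear_conv_bounded_linear)
  then show ?thesis unfolding D_def .
qed

lemma C_diff_herglotz:
  assumes g: "integrable circle_measure g"
  shows "C_diff (Suc 0) (herglotz k g)"
proof -
  have "continuous_on UNIV (dir_deriv b (herglotz k g))" for b
  proof -
    have "(\<lambda>\<xi>. \<i> * complex_of_real (k * (\<xi> \<bullet> b))) \<in> borel_measurable borel"
      by (intro borel_measurable_continuous_onI continuous_intros)
    then have "integrable circle_measure (\<lambda>\<xi>. \<i> * complex_of_real (k * (\<xi> \<bullet> b)) * g \<xi>)"
      using inner_sphere[of _ b] k by (intro circle_integrable_bounded(1)[OF g, where B="k * norm b"]) (auto simp: norm_mult abs_mult)
    then have "continuous_on UNIV (herglotz k (\<lambda>\<xi>. \<i> * complex_of_real (k * (\<xi> \<bullet> b)) * g \<xi>))"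
      by (rule herglotz_continuous)
    then show ?thesis using dir_deriv_eq[OF herglotz_has_derivative[OF g]] by simp
  qed
  then show ?thesis using herglotz_has_derivative[OF g] by (auto simp: differentiable_def)
qed

end

section \<open>The harmonic test function\<close>

definition zc :: "real^2 \<Rightarrow> complex" where "zc x = Complex (x$1) (x$2)"

lemma zc_simps [simp]: "zc (x + y) = zc x + zc y" "zc (r *\<^sub>R x) = r *\<^sub>R zc x" "cmod (zc x) = norm x" "zc 0 = 0"
  by (auto simp: zc_def complex_eq_iff cmod_def norm_real2)

lemma bounded_linear_zc: "bounded_linear zc"
  by (rule bounded_linear_intro[where K=1]) auto

lemma zc_axis [simp]: "zc (axis 1 1) = 1" "zc (axis 2 1) = \<i>"
  by (auto simp: zc_def axis_def complex_eq_iff)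

lemma zc_eq_0 [simp]: "zc x = 0 \<longleftrightarrow> x = 0"
  by (metis norm_eq_zero zc_simps(3))

definition laplace :: "('a::euclidean_space \<Rightarrow> complex) \<Rightarrow> 'a \<Rightarrow> complex" where
  "laplace f x = (\<Sum>b\<in>Basis. dir_deriv b (dir_deriv b f) x)"

locale corner_disc = corner +
  fixes h :: real assumes h: "0 < h"
begin

text \<open>The pole of the test function is at -dv / s. The edge coordinates of -dv are both -1 for
  an opening below pi and both 1 for a larger one, which is outside the closed sector in either
  case.\<close>

definition "dv = corner_sign *\<^sub>R (va + vb)"
definition zeta :: "real \<Rightarrow> real^2 \<Rightarrow> complex" where "zeta s x = zc (s *\<^sub>R x + dv)"

lemma pq_dv [simp]: "p dv = corner_sign" "q dv = corner_sign"
  using co_comb[of corner_sign corner_sign] by (simp_all add: dv_def scaleR_add_right)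

text \<open>For x in the closed sector the coordinates that decide membership are moved away from 0
  by the shift, so s x and dv cannot cancel. The constant must not depend on s, the concentration
  parameter.\<close>

lemma zeta_lower: "\<exists>c>0. \<forall>s\<ge>0. \<forall>x\<in>closure W. c * (1 + s * norm x) \<le> cmod (zeta s x)"
proof -
  obtain M1 where M1: "\<And>x. \<bar>p x\<bar> \<le> norm x * M1" "M1 > 0"
    using linear_conv_bounded_linear[THEN iffD1, OF linear_co(1)[OF cr_nz], THEN bounded_linear.pos_bounded] by auto
  obtain M2 where M2: "\<And>x. \<bar>q x\<bar> \<le> norm x * M2" "M2 > 0"
    using linear_conv_bounded_linear[THEN iffD1, OF linear_co(2)[OF cr_nz], THEN bounded_linear.pos_bounded] by auto
  define M where "M = max M1 M2"
  have M: "\<bar>p x\<bar> \<le> M * norm x" "\<bar>q x\<bar> \<le> M * norm x" "M > 0" for x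
  proof -
    have "norm x * M1 \<le> M * norm x" "norm x * M2 \<le> M * norm x"
      unfolding M_def by (subst mult.commute, intro mult_right_mono; simp)+
    then show "\<bar>p x\<bar> \<le> M * norm x" "\<bar>q x\<bar> \<le> M * norm x" using M1(1)[of x] M2(1)[of x] by linarith+
  qed (use M1 in \<open>simp add: M_def less_max_iff_disj\<close>)
  have "1 + s * norm x \<le> 3 * M * cmod (zeta s x)" if s: "s \<ge> 0" and x: "x \<in> closure W" for s x
  proof -
    let ?y = "s *\<^sub>R x + dv"
    have py: "p ?y = s * p x + corner_sign" and qy: "q ?y = s * q x + corner_sign"
      by (simp_all add: linear_add[OF linear_co(1)[OF cr_nz]] linear_add[OF linear_co(2)[OF cr_nz]]
           linear_scale[OF linear_co(1)[OF cr_nz]] linear_scale[OF linear_co(2)[OF cr_nz]])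
    have "norm x = norm (p x *\<^sub>R va + q x *\<^sub>R vb)" using rep[of x] by simp
    also have "\<dots> \<le> norm (p x *\<^sub>R va) + norm (q x *\<^sub>R vb)" by (rule norm_triangle_ineq)
    finally have "norm x \<le> \<bar>p x\<bar> + \<bar>q x\<bar>" by simp
    then have nx: "s * norm x \<le> s * \<bar>p x\<bar> + s * \<bar>q x\<bar>" using s by (metis distrib_left mult_left_mono)
    \<comment> \<open>In the reentrant case only one coordinate is sure to gain 1 in modulus, while
      the other may lose 1; counting the larger one twice restores the balance. This is the source
      of the factor 3.\<close>
    have "1 + (s * \<bar>p x\<bar> + s * \<bar>q x\<bar>) \<le> \<bar>p ?y\<bar> + \<bar>q ?y\<bar> + max \<bar>p ?y\<bar> \<bar>q ?y\<bar>"
    proof (cases "\<theta>M - \<theta>m < pi")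
      case True
      then have "0 \<le> s * p x" "0 \<le> s * q x" "s * \<bar>p x\<bar> = s * p x" "s * \<bar>q x\<bar> = s * q x"
        using x s by (auto simp: closure_W)
      then show ?thesis unfolding py qy using True by (auto simp: corner_sign_def)
    next
      case False
      have a: "s * \<bar>p x\<bar> = \<bar>s * p x\<bar>" "s * \<bar>q x\<bar> = \<bar>s * q x\<bar>" using s by (simp_all add: abs_mult)
      have "s * p x \<le> 0 \<or> s * q x \<le> 0" using x s False by (auto simp: closure_W mult_nonneg_nonpos)
      then show ?thesis unfolding py qy a using False by (auto simp: corner_sign_def)
    qed
    also have "\<dots> \<le> 3 * M * norm ?y" using M(1,2)[of ?y] by linarith
    finally show ?thesis using nx by (simp add: zeta_def del: zc_simps(1,2))
  qed
  then show ?thesis using M(3) by (intro exI[of _ "1 / (3 * M)"]) (auto simp: pos_divide_le_eq mult.commute)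
qed

text \<open>A constant of the sector alone, the same for all s; it fixes the radii in P and all
  decay constants below.\<close>

definition "c0 = (SOME c. c > 0 \<and> (\<forall>s\<ge>0. \<forall>x\<in>closure W. c * (1 + s * norm x) \<le> cmod (zeta s x)))"

lemma c0: "c0 > 0" "s \<ge> 0 \<Longrightarrow> x \<in> closure W \<Longrightarrow> c0 * (1 + s * norm x) \<le> cmod (zeta s x)"
  unfolding c0_def using someI_ex[OF zeta_lower[unfolded Bex_def, simplified]] by auto

text \<open>Equal to 1 up to radius h/2, so that derivatives of X are felt only where the test
  function is already small, and 0 from 3h/4 on, so that the closed support stays inside the open
  disc of radius h.\<close>

definition X :: "real^2 \<Rightarrow> real" where "X x = cutoff ((h/2)\<^sup>2) ((3*h/4)\<^sup>2) ((norm x)\<^sup>2)"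
text \<open>\<open>P s\<close> is \<open>1\<close> on the closed sector and vanishes near the pole of \<open>f s\<close>, which makes
  \<open>phi s\<close> smooth on the whole plane.\<close>

definition P :: "real \<Rightarrow> real^2 \<Rightarrow> real" where "P s x = 1 - cutoff (c0\<^sup>2/4) (c0\<^sup>2/2) ((cmod (zeta s x))\<^sup>2)"
text \<open>A holomorphic function of z away from its pole, hence harmonic. Eight powers of decay
  leave room for every use: two make \<open>weight\<close> integrable along an edge, with one more
  to absorb |x|; six are consumed by \<open>area_bound\<close>, again with one more to absorb
  |x|.\<close>

definition f :: "real \<Rightarrow> real^2 \<Rightarrow> complex" where "f s x = inverse (zeta s x) ^ 8"
definition phi :: "real \<Rightarrow> real^2 \<Rightarrow> complex" where "phi s x = of_real (X x) * (of_real (P s x) * f s x)"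

lemma cutoff_params: "(h/2)\<^sup>2 < (3*h/4)\<^sup>2" "c0\<^sup>2/4 < c0\<^sup>2/2"
  using h c0(1) by (auto simp: power2_eq_square)

lemma X_range: "0 \<le> X x" "X x \<le> 1" unfolding X_def by (rule cutoff_range[OF cutoff_params(1)])+

lemma X_1: "norm x \<le> h/2 \<Longrightarrow> X x = 1"
  unfolding X_def by (rule cutoff_eq_1[OF cutoff_params(1)]) (auto intro: power_mono)

lemma X_0: "3*h/4 \<le> norm x \<Longrightarrow> X x = 0"
  unfolding X_def by (rule cutoff_eq_0[OF cutoff_params(1)]) (use h in \<open>auto intro: power_mono\<close>)

lemma smooth_X: "smooth (\<lambda>x. complex_of_real (X x))"
  unfolding smooth_iff X_def by (intro allI C_diff_on_cutoff cutoff_params C_diff_on_norm_sq open_UNIV)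

lemma C_diff_on_zeta: "open U \<Longrightarrow> C_diff_on n U (zeta s)"
proof -
  assume U: "open U"
  have "C_diff_on n U (\<lambda>x. zc (s *\<^sub>R x) + zc dv)"
    by (intro C_diff_on_add[OF U] C_diff_on_const C_diff_on_bounded_linear
        bounded_linear_compose[OF bounded_linear_zc] bounded_linear_scaleR_right)
  then show ?thesis by (simp add: zeta_def[abs_def])
qed

lemma smooth_P: "smooth (\<lambda>x. complex_of_real (P s x))"
proof -
  have "C_diff_on n UNIV (\<lambda>x. complex_of_real ((cmod (zeta s x))\<^sup>2))" for n
  proof -
    have lin: "C_diff_on n UNIV (\<lambda>x. complex_of_real (x \<bullet> dv))"
      by (intro C_diff_on_bounded_linear bounded_linear_compose[OF bounded_linear_of_real] bounded_linear_inner_left)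
    have e: "complex_of_real ((cmod (zeta s x))\<^sup>2) = of_real (s\<^sup>2) * of_real ((norm x)\<^sup>2) + (of_real (2 * s) * of_real (x \<bullet> dv) + of_real ((norm dv)\<^sup>2))" for x
    proof -
      have "(norm (s *\<^sub>R x + dv))\<^sup>2 = s\<^sup>2 * (norm x)\<^sup>2 + (2 * s * (x \<bullet> dv) + (norm dv)\<^sup>2)"
      proof -
        have "(s *\<^sub>R x + dv) \<bullet> (s *\<^sub>R x + dv) = s\<^sup>2 * (x \<bullet> x) + (2 * s * (x \<bullet> dv) + dv \<bullet> dv)"
          unfolding inner_add_left inner_add_right inner_scaleR_left inner_scaleR_right inner_commute[of dv x]
          by (simp add: power2_eq_square algebra_simps)
        then show ?thesis by (simp only: power2_norm_eq_inner)
      qed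
      then show ?thesis unfolding zeta_def zc_simps(3) by (simp only: of_real_add of_real_mult)
    qed
    show ?thesis unfolding e
      by (intro C_diff_on_add C_diff_on_mult C_diff_on_const C_diff_on_norm_sq lin open_UNIV)
  qed
  then show ?thesis unfolding smooth_iff P_def of_real_diff
    by (intro allI C_diff_on_diff C_diff_on_const C_diff_on_cutoff[OF cutoff_params(2)] open_UNIV)
qed

lemma C_diff_on_f: "open U \<Longrightarrow> (\<And>x. x \<in> U \<Longrightarrow> zeta s x \<noteq> 0) \<Longrightarrow> C_diff_on n U (f s)"
  unfolding f_def[abs_def] by (intro C_diff_on_power C_diff_on_inverse C_diff_on_zeta)

lemma smooth_phi: "smooth (phi s)"
proof -
  have cz: "continuous_on UNIV (zeta s)" using C_diff_on_zeta[of UNIV 0 s] by simp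
  \<comment> \<open>P vanishes on ?V, a neighbourhood of the pole, and f is smooth on ?U; these two
    open sets cover the plane.\<close>
  let ?U = "{x. zeta s x \<noteq> 0}" and ?V = "{x. cmod (zeta s x) < c0/2}"
  have U: "open ?U" by (intro open_Collect_neq cz continuous_on_const)
  have V: "open ?V" by (intro open_Collect_less continuous_on_norm cz continuous_on_const)
  have "C_diff_on n UNIV (\<lambda>x. of_real (P s x) * f s x)" for n
  proof -
    have 1: "C_diff_on n ?U (\<lambda>x. of_real (P s x) * f s x)"
      using smooth_P[of s] by (intro C_diff_on_mult C_diff_on_f U) (auto simp: smooth_iff intro: C_diff_on_subset)
    have 2: "C_diff_on n ?V (\<lambda>x. of_real (P s x) * f s x)"
    proof (rule C_diff_on_cong[OF V _ C_diff_on_const[of n ?V 0]])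
      fix x assume "x \<in> ?V"
      then have "(cmod (zeta s x))\<^sup>2 \<le> (c0/2)\<^sup>2" by (intro power_mono) auto
      then have "P s x = 0" by (simp add: P_def cutoff_eq_1[OF cutoff_params(2)] power_divide)
      then show "0 = complex_of_real (P s x) * f s x" by simp
    qed
    have "?U \<union> ?V = UNIV" using c0(1) by auto
    then show ?thesis using C_diff_on_Un[OF U V 1 2] by simp
  qed
  then have "smooth (\<lambda>x. of_real (P s x) * f s x)" by (simp add: smooth_iff)
  then show ?thesis unfolding phi_def[abs_def] by (rule smooth_mult[OF smooth_X])
qed

lemma phi_0: "3*h/4 \<le> norm x \<Longrightarrow> phi s x = 0"
  by (simp add: phi_def X_0)

lemma zeta_nz: "s \<ge> 0 \<Longrightarrow> x \<in> closure W \<Longrightarrow> zeta s x \<noteq> 0"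
  using c0(2)[of s x] c0(1) by (smt (verit) mult_nonneg_nonneg mult_pos_pos norm_ge_zero norm_zero)

text \<open>On the closed sector |zeta| is at least c0, beyond the range in which P differs from 1,
  so estimates on the sector never see P.\<close>

lemma phi_closure: 
  assumes "s \<ge> 0" "x \<in> closure W" shows "phi s x = of_real (X x) * f s x"
proof -
  have "c0 * 1 \<le> c0 * (1 + s * norm x)" using c0(1) assms by (intro mult_left_mono) auto
  then have "c0 \<le> cmod (zeta s x)" using c0(2)[OF assms] by simp
  then have "c0\<^sup>2 \<le> (cmod (zeta s x))\<^sup>2" using c0(1) by (intro power_mono) auto
  then have "c0\<^sup>2/2 \<le> (cmod (zeta s x))\<^sup>2" using zero_le_power2[of c0] by linarith
  then have "P s x = 1" by (simp add: P_def cutoff_eq_0[OF cutoff_params(2)])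
  then show ?thesis by (simp add: phi_def)
qed

lemma inverse_zeta_bound:
  assumes "s \<ge> 0" "x \<in> closure W"
  shows "cmod (inverse (zeta s x) ^ n) \<le> inverse c0 ^ n * inverse (1 + s * norm x) ^ n"
proof -
  have "0 < c0 * (1 + s * norm x)" using c0(1) assms by (intro mult_pos_pos) (auto intro: add_pos_nonneg)
  then have "inverse (cmod (zeta s x)) \<le> inverse (c0 * (1 + s * norm x))"
    using c0(2)[OF assms] by (intro le_imp_inverse_le)
  then have "inverse (cmod (zeta s x)) ^ n \<le> inverse (c0 * (1 + s * norm x)) ^ n" by (intro power_mono) auto
  then show ?thesis by (simp add: norm_power norm_inverse power_mult_distrib)
qed

lemma phi_bound:
  assumes "s \<ge> 0" "x \<in> closure W"
  shows "cmod (phi s x) \<le> X x * (inverse c0 ^ 8 * inverse (1 + s * norm x) ^ 8)"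
  unfolding phi_closure[OF assms] norm_mult f_def
  using inverse_zeta_bound[OF assms, of 8] X_range[of x] by (auto intro!: mult_left_mono)

lemma zeta_has_derivative: "(zeta s has_derivative (\<lambda>v. s *\<^sub>R zc v)) (at x)"
proof -
  have "((\<lambda>x. zc (s *\<^sub>R x + dv)) has_derivative (\<lambda>v. zc (s *\<^sub>R v))) (at x)"
    by (rule bounded_linear.has_derivative[OF bounded_linear_zc]) (auto intro!: derivative_eq_intros)
  then show ?thesis by (simp add: zeta_def[abs_def] del: zc_simps(1))
qed

lemma inverse_zeta_has_derivative:
  assumes "zeta s x \<noteq> 0"
  shows "((\<lambda>x. inverse (zeta s x) ^ Suc n) has_derivative (\<lambda>v. - of_nat (Suc n) * inverse (zeta s x) ^ (n + 2) * (s *\<^sub>R zc v))) (at x)"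
proof -
  have "((\<lambda>z. inverse z ^ Suc n) has_field_derivative - of_nat (Suc n) * inverse (zeta s x) ^ (n + 2)) (at (zeta s x))"
  proof -
    have "(inverse has_field_derivative - (inverse (zeta s x) ^ Suc (Suc 0))) (at (zeta s x))"
      using assms by (rule DERIV_inverse)
    from DERIV_power_Suc[OF this, of n] show ?thesis by (simp add: algebra_simps)
  qed
  then have "((\<lambda>z. inverse z ^ Suc n) has_derivative (\<lambda>w. - of_nat (Suc n) * inverse (zeta s x) ^ (n + 2) * w)) (at (zeta s x))"
    by (simp only: has_field_derivative_def)
  from has_derivative_compose[OF zeta_has_derivative this] show ?thesis .
qed

text \<open>Computed in the open sector, where P = 1. The term with second derivatives of f drops
  out because \<open>zc\<close> maps the two basis vectors to 1 and i, whose squares sum to 0; every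
  remaining term carries a derivative of X.\<close>

lemma laplace_phi:
  assumes s: "s \<ge> 0" and x: "x \<in> W"
  shows "laplace (phi s) x = (\<Sum>b\<in>Basis. 2 * (dir_deriv b (\<lambda>x. of_real (X x)) x * (- 8 * inverse (zeta s x) ^ 9 * (s *\<^sub>R zc b)))
      + dir_deriv b (dir_deriv b (\<lambda>x. of_real (X x))) x * f s x)"
proof -
  let ?X = "\<lambda>x. complex_of_real (X x)" and ?g = "\<lambda>b x. - 8 * inverse (zeta s x) ^ 9 * (s *\<^sub>R zc b)"
  have cl: "y \<in> closure W" if "y \<in> W" for y using that closure_subset[of W] by blast
  have nz: "zeta s y \<noteq> 0" if "y \<in> W" for y using zeta_nz[OF s cl[OF that]] .
  have eqW: "?X y * f s y = phi s y" if "y \<in> W" for y using phi_closure[OF s cl[OF that]] by simp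
  have fh: "(f s has_derivative (\<lambda>v. ?g v y)) (at y)" if "y \<in> W" for y
    using inverse_zeta_has_derivative[OF nz[OF that], of 7] by (simp add: f_def[abs_def])
  have fd: "f s differentiable (at y)" if "y \<in> W" for y using fh[OF that] by (auto simp: differentiable_def)
  have df: "dir_deriv b (f s) y = ?g b y" if "y \<in> W" for b y by (rule dir_deriv_eq[OF fh[OF that]])
  have gh: "(?g b has_derivative (\<lambda>v. - 8 * (- of_nat 9 * inverse (zeta s y) ^ 10 * (s *\<^sub>R zc v)) * (s *\<^sub>R zc b))) (at y)" if "y \<in> W" for b y
    using inverse_zeta_has_derivative[OF nz[OF that], of 8]
    by (intro has_derivative_mult_left has_derivative_mult_right) simp
  have gd: "?g b differentiable (at y)" if "y \<in> W" for b y using gh[OF that] by (auto simp: differentiable_def)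
  have dg: "dir_deriv b (?g b) y = 72 * inverse (zeta s y) ^ 10 * (s *\<^sub>R zc b)\<^sup>2" if "y \<in> W" for b y
    using dir_deriv_eq[OF gh[OF that]] by (simp add: power2_eq_square)
  have Xd: "?X differentiable (at y)" "b \<in> Basis \<Longrightarrow> dir_deriv b ?X differentiable (at y)" for y b
    using smooth_X smooth_dir_deriv smooth_differentiable by blast+
  have d1: "?X y * ?g b y + dir_deriv b ?X y * f s y = dir_deriv b (phi s) y" if "y \<in> W" for b y
  proof -
    have "dir_deriv b (\<lambda>y. ?X y * f s y) y = dir_deriv b (phi s) y"
      by (rule dir_deriv_cong_open[OF open_W that eqW]) (auto intro!: differentiable_mult Xd fd that)
    then show ?thesis using dir_deriv_mult[OF Xd(1) fd[OF that], of b] df[OF that] by simp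
  qed
  have d2: "dir_deriv b (dir_deriv b (phi s)) x = (?X x * dir_deriv b (?g b) x + dir_deriv b ?X x * ?g b x)
      + (dir_deriv b ?X x * ?g b x + dir_deriv b (dir_deriv b ?X) x * f s x)" if b: "b \<in> Basis" for b
  proof -
    have "dir_deriv b (\<lambda>y. ?X y * ?g b y + dir_deriv b ?X y * f s y) x = dir_deriv b (dir_deriv b (phi s)) x"
      by (rule dir_deriv_cong_open[OF open_W x _ differentiable_add[OF differentiable_mult[OF Xd(1) gd[OF x]] differentiable_mult[OF Xd(2)[OF b] fd[OF x]]]]) (erule d1)
    moreover have "dir_deriv b (\<lambda>y. ?X y * ?g b y + dir_deriv b ?X y * f s y) x =
        dir_deriv b (\<lambda>y. ?X y * ?g b y) x + dir_deriv b (\<lambda>y. dir_deriv b ?X y * f s y) x"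
      by (rule dir_deriv_add[OF differentiable_mult[OF Xd(1) gd[OF x]] differentiable_mult[OF Xd(2)[OF b] fd[OF x]]])
    ultimately show ?thesis
      using dir_deriv_mult[OF Xd(1) gd[OF x], of b b] dir_deriv_mult[OF Xd(2)[OF b] fd[OF x], of b] df[OF x, of b] by simp
  qed
  have "laplace (phi s) x = (\<Sum>b\<in>Basis. ?X x * (72 * inverse (zeta s x) ^ 10 * (s *\<^sub>R zc b)\<^sup>2))
     + (\<Sum>b\<in>Basis. 2 * (dir_deriv b ?X x * ?g b x) + dir_deriv b (dir_deriv b ?X) x * f s x)"
    unfolding laplace_def sum.distrib[symmetric] by (intro sum.cong refl) (simp only: d2 dg[OF x], simp add: algebra_simps)
  moreover have "(\<Sum>b\<in>Basis. ?X x * (72 * inverse (zeta s x) ^ 10 * (s *\<^sub>R zc b)\<^sup>2)) = 0"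
    unfolding sum_Basis_real2 by (simp add: power2_eq_square scaleR_conv_of_real algebra_simps)
  ultimately show ?thesis by simp
qed

end

lemma bounded_of_compact_support:
  fixes F :: "'a::euclidean_space \<Rightarrow> complex"
  assumes F: "continuous_on UNIV F" and K: "bounded {x. F x \<noteq> 0}"
  obtains B where "0 \<le> B" "\<And>x. cmod (F x) \<le> B"
proof -
  have "compact (closure {x. F x \<noteq> 0})" using K by (simp add: compact_closure)
  then have "bounded (F ` closure {x. F x \<noteq> 0})"
    by (intro compact_imp_bounded compact_continuous_image continuous_on_subset[OF F]) auto
  then obtain B where B: "\<And>x. x \<in> closure {x. F x \<noteq> 0} \<Longrightarrow> cmod (F x) \<le> B" unfolding bounded_iff by blast
  have "cmod (F x) \<le> max 0 B" for x
  proof (cases "F x = 0")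
    case False
    then have "x \<in> closure {x. F x \<noteq> 0}" using subsetD[OF closure_subset, of x "{x. F x \<noteq> 0}"] by simp
    then show ?thesis using B[of x] by simp
  qed simp
  then show ?thesis by (intro that[of "max 0 B"]) auto
qed

section \<open>Bounds for the cutoff and the test function\<close>

context corner_disc begin

abbreviation "XC \<equiv> (\<lambda>x. complex_of_real (X x))"

lemma test_function_of_smooth:
  assumes "smooth F" "\<And>x. 3*h/4 \<le> norm x \<Longrightarrow> F x = 0"
  shows "test_function (ball 0 h) F"
proof -
  have "{x. F x \<noteq> 0} \<subseteq> cball 0 (3*h/4)" using assms(2) by (force simp: not_le)
  then have sub: "closure {x. F x \<noteq> 0} \<subseteq> cball 0 (3*h/4)" by (intro closure_minimal) auto
  then have "compact (closure {x. F x \<noteq> 0})"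
    using bounded_subset[OF bounded_cball sub] by (simp add: compact_eq_bounded_closed)
  moreover have "closure {x. F x \<noteq> 0} \<subseteq> ball 0 h"
    using h by (intro order_trans[OF sub]) (auto simp: cball_subset_ball_iff)
  ultimately show ?thesis unfolding test_function_def using assms(1) by simp
qed

lemma test_function_X: "test_function (ball 0 h) XC"
  by (rule test_function_of_smooth[OF smooth_X]) (simp add: X_0)

lemma test_function_phi: "test_function (ball 0 h) (phi s)"
  by (rule test_function_of_smooth[OF smooth_phi]) (rule phi_0)

lemma dir_deriv_X_eq_0:
  assumes x: "norm x < h/2"
  shows "dir_deriv b XC x = 0" "dir_deriv b (dir_deriv b XC) x = 0"
proof -
  have 1: "dir_deriv b XC y = 0" if "y \<in> ball 0 (h/2)" for y
  proof -
    have "dir_deriv b (\<lambda>_. 1) y = dir_deriv b XC y"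
      by (rule dir_deriv_cong_open[OF open_ball that]) (auto simp: X_1)
    then show ?thesis by simp
  qed
  then show "dir_deriv b XC x = 0" using x by simp
  have "dir_deriv b (\<lambda>_. 0) x = dir_deriv b (dir_deriv b XC) x"
    by (rule dir_deriv_cong_open[OF open_ball[of 0 "h/2"]]) (use x 1 in auto)
  then show "dir_deriv b (dir_deriv b XC) x = 0" by simp
qed

lemma dir_deriv_X_bound:
  "\<exists>B\<ge>0. \<forall>x. \<forall>b\<in>Basis. cmod (dir_deriv b XC x) \<le> B \<and> cmod (dir_deriv b (dir_deriv b XC) x) \<le> B"
proof -
  note t1 = test_function_dir_deriv[OF test_function_X] 
  have "\<exists>B. 0 \<le> B \<and> (\<forall>x. cmod (dir_deriv b XC x) \<le> B) \<and> (\<forall>x. cmod (dir_deriv b (dir_deriv b XC) x) \<le> B)"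
    if b: "b \<in> Basis" for b
  proof -
    note t2 = test_function_dir_deriv[OF t1[OF b] b]
    obtain B1 where "0 \<le> B1" "\<And>x. cmod (dir_deriv b XC x) \<le> B1"
      using bounded_of_compact_support[OF test_functionD(2,4)[OF t1[OF b]]] by blast
    moreover obtain B2 where "0 \<le> B2" "\<And>x. cmod (dir_deriv b (dir_deriv b XC) x) \<le> B2"
      using bounded_of_compact_support[OF test_functionD(2,4)[OF t2]] by blast
    ultimately show ?thesis by (intro exI[of _ "max B1 B2"]) (auto simp: le_max_iff_disj)
  qed
  then obtain B where B: "\<And>b. b \<in> Basis \<Longrightarrow> 0 \<le> B b \<and> (\<forall>x. cmod (dir_deriv b XC x) \<le> B b) \<and> (\<forall>x. cmod (dir_deriv b (dir_deriv b XC) x) \<le> B b)"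
    by metis
  have "B b \<le> (\<Sum>b\<in>Basis. B b)" if "b \<in> Basis" for b using B that by (intro member_le_sum) auto
  then have "cmod (dir_deriv b XC x) \<le> (\<Sum>b\<in>Basis. B b) \<and> cmod (dir_deriv b (dir_deriv b XC) x) \<le> (\<Sum>b\<in>Basis. B b)"
    if "b \<in> Basis" for x b using B[OF that] that by (meson order_trans)
  moreover have "0 \<le> (\<Sum>b\<in>Basis. B b)" using B by (intro sum_nonneg) auto
  ultimately show ?thesis by blast
qed

definition "K = 2 / (c0 * h)"

lemma K_pos: "K > 0" using c0(1) h by (simp add: K_def)

lemma inverse_zeta_far:
  assumes s: "s \<ge> 1" and x: "x \<in> closure W" "h/2 \<le> norm x"
  shows "cmod (inverse (zeta s x)) \<le> K / s"
proof -
  have "s * (h/2) \<le> s * norm x" using s x by (intro mult_left_mono) auto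
  then have "c0 * (s * (h/2)) \<le> c0 * (1 + s * norm x)" using c0(1) by (intro mult_left_mono) auto
  then have "c0 * (s * (h/2)) \<le> cmod (zeta s x)" using c0(2)[of s x] s x(1) by linarith
  then have "inverse (cmod (zeta s x)) \<le> inverse (c0 * (s * (h/2)))"
    using c0(1) s h by (intro le_imp_inverse_le) auto
  also have "\<dots> = K / s" by (simp add: K_def field_simps)
  finally show ?thesis by (simp add: norm_inverse)
qed

text \<open>Orders beyond s^-2 are discarded, since all quantities are compared with the leading
  order 1/s.\<close>

lemma power_over_le:
  assumes s: "s \<ge> (1::real)" and n: "2 \<le> n"
  shows "(K / s) ^ n \<le> K ^ n / s\<^sup>2"
proof -
  have "s\<^sup>2 \<le> s ^ n" using s n by (intro power_increasing) auto
  then have "K ^ n / s ^ n \<le> K ^ n / s\<^sup>2" using s K_pos by (intro divide_left_mono) auto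
  then show ?thesis by (simp add: power_divide)
qed

text \<open>Derivatives of X vanish for |x| < h/2, and beyond that radius |1/zeta| is at most K /
  s.\<close>

lemma laplace_phi_bound: "\<exists>C\<ge>0. \<forall>s\<ge>1. \<forall>x\<in>W. cmod (laplace (phi s) x) \<le> C / s\<^sup>2"
proof -
  obtain B where B: "0 \<le> B" "\<And>x b. b \<in> Basis \<Longrightarrow> cmod (dir_deriv b XC x) \<le> B"
    "\<And>x b. b \<in> Basis \<Longrightarrow> cmod (dir_deriv b (dir_deriv b XC) x) \<le> B" using dir_deriv_X_bound by blast
  define C where "C = 16 * (B * K ^ 9) + B * K ^ 8"
  have C: "0 \<le> C" using B(1) K_pos by (simp add: C_def)
  have "cmod (laplace (phi s) x) \<le> (2 * C) / s\<^sup>2" if s: "s \<ge> 1" and x: "x \<in> W" for s x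
  proof -
    let ?t = "\<lambda>b. 2 * (dir_deriv b XC x * (- 8 * inverse (zeta s x) ^ 9 * (s *\<^sub>R zc b))) + dir_deriv b (dir_deriv b XC) x * f s x"
    have s0: "s \<ge> 0" using s by simp
    have xc: "x \<in> closure W" using x closure_subset[of W] by blast
    have bt: "cmod (?t b) \<le> C / s\<^sup>2" if b: "b \<in> Basis" for b
    proof (cases "norm x < h/2")
      case True
      then show ?thesis using dir_deriv_X_eq_0[OF True, of b] C by simp
    next
      case False
      then have z: "cmod (inverse (zeta s x)) \<le> K / s" using inverse_zeta_far[OF s xc] by simp
      \<comment> \<open>Differentiating \<open>zeta s\<close> produces a factor s, which uses up one
        of the nine inverse powers.\<close>
      have z9: "cmod (inverse (zeta s x)) ^ 9 * s \<le> K ^ 9 / s\<^sup>2"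
      proof -
        have "cmod (inverse (zeta s x)) ^ 9 * s \<le> (K / s) ^ 9 * s" using z s by (intro mult_right_mono power_mono) auto
        also have "\<dots> = K * (K / s) ^ 8" using s by (simp add: power_divide eval_nat_numeral)
        also have "\<dots> \<le> K * (K ^ 8 / s\<^sup>2)" using K_pos power_over_le[OF s, of 8] by (intro mult_left_mono) auto
        finally show ?thesis by (simp add: eval_nat_numeral)
      qed
      have z8: "cmod (inverse (zeta s x)) ^ 8 \<le> K ^ 8 / s\<^sup>2"
        using power_mono[OF z, of 8] power_over_le[OF s, of 8] by simp
      have nb: "norm b = 1" using b by simp
      have "cmod (?t b) \<le> 16 * (cmod (dir_deriv b XC x) * (cmod (inverse (zeta s x)) ^ 9 * s)) + cmod (dir_deriv b (dir_deriv b XC) x) * cmod (inverse (zeta s x)) ^ 8"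
        using s by (intro norm_triangle_le) (simp add: norm_mult norm_power f_def nb)
      also have "\<dots> \<le> 16 * (B * (K ^ 9 / s\<^sup>2)) + B * (K ^ 8 / s\<^sup>2)"
        using B b z9 z8 s by (intro add_mono mult_left_mono mult_mono) auto
      also have "\<dots> = C / s\<^sup>2" by (simp add: C_def add_divide_distrib)
      finally show ?thesis .
    qed
    then have "cmod (\<Sum>b\<in>Basis. ?t b) \<le> C / s\<^sup>2 + C / s\<^sup>2"
      unfolding sum_Basis_real2 by (intro norm_triangle_mono bt; simp only: Basis_real2(1) insert_iff simp_thms)
    then show ?thesis unfolding laplace_phi[OF s0 x] by (simp add: add_divide_distrib[symmetric])
  qed
  then show ?thesis using C by (intro exI[of _ "2 * C"]) auto
qed

lemma ray_closure: "0 \<le> r \<Longrightarrow> r *\<^sub>R va \<in> closure W" "0 \<le> r \<Longrightarrow> r *\<^sub>R vb \<in> closure W"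
  by (auto simp: closure_W)

text \<open>Along the ray \<open>f s\<close> has the primitive -zeta^(-7) / (7 s zc e). Its value at
  the vertex is the main term, while the endpoint h/2 and the rest of the ray lie where |1/zeta|
  \<le> K / s.\<close>

lemma ray_integral_phi:
  assumes e: "norm e = 1" "\<And>r. 0 \<le> r \<Longrightarrow> r *\<^sub>R e \<in> closure W"
  shows "\<exists>C\<ge>0. \<forall>s\<ge>1. cmod ((LINT r|lborel. indicator {0<..} r *\<^sub>R phi s (r *\<^sub>R e)) - inverse (zc dv) ^ 7 / (7 * of_real s * zc e)) \<le> C / s\<^sup>2"
proof -
  \<comment> \<open>First summand: the primitive at h/2. Second: the piece of the ray from h/2 to h,
    on which |phi| is at most K^8 / s^2.\<close>
  define C where "C = K ^ 7 / 7 + (h/2) * K ^ 8"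
  have C0: "C \<ge> 0" using K_pos h by (simp add: C_def)
  have zce: "zc e \<noteq> 0" using e(1) by auto
  have "cmod ((LINT r|lborel. indicator {0<..} r *\<^sub>R phi s (r *\<^sub>R e)) - inverse (zc dv) ^ 7 / (7 * of_real s * zc e)) \<le> C / s\<^sup>2"
    if s: "s \<ge> 1" for s
  proof -
    have s0: "s \<ge> 0" using s by simp
    let ?A = "\<lambda>r. - inverse (7 * of_real s * zc e) * inverse (zeta s (r *\<^sub>R e)) ^ 7"
    have nz: "zeta s (r *\<^sub>R e) \<noteq> 0" if "0 \<le> r" for r using zeta_nz[OF s0 e(2)[OF that]] .
    have cz: "continuous_on S (\<lambda>r. zeta s (r *\<^sub>R e))" for S
    proof -
      have "continuous_on UNIV (zeta s)" using C_diff_on_zeta[of UNIV 0 s] by simp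
      then show ?thesis by (rule continuous_on_compose2) (auto intro!: continuous_intros)
    qed
    have cphi: "continuous_on UNIV (\<lambda>r. phi s (r *\<^sub>R e))"
      by (rule continuous_on_compose2[OF smooth_continuous[OF smooth_phi[of s]]]) (auto intro!: continuous_intros)
    have der: "(?A has_vector_derivative f s (r *\<^sub>R e)) (at r within {0..h/2})" if "0 \<le> r" for r
    proof -
      have "((\<lambda>r. r *\<^sub>R e) has_derivative (\<lambda>t. t *\<^sub>R e)) (at r within {0..h/2})"
        by (auto intro!: derivative_eq_intros)
      from has_derivative_compose[OF this inverse_zeta_has_derivative[OF nz[OF that], of 6]]
      have "((\<lambda>r. inverse (zeta s (r *\<^sub>R e)) ^ 7) has_derivative (\<lambda>t. - of_nat 7 * inverse (zeta s (r *\<^sub>R e)) ^ 8 * (s *\<^sub>R zc (t *\<^sub>R e)))) (at r within {0..h/2})"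
        by simp
      then have "((\<lambda>r. inverse (zeta s (r *\<^sub>R e)) ^ 7) has_vector_derivative - of_nat 7 * inverse (zeta s (r *\<^sub>R e)) ^ 8 * (s *\<^sub>R zc e)) (at r within {0..h/2})"
        unfolding has_vector_derivative_def by (simp add: algebra_simps)
      from has_vector_derivative_mult_right[OF this, of "- inverse (7 * of_real s * zc e)"]
      have "((\<lambda>r. - inverse (7 * of_real s * zc e) * inverse (zeta s (r *\<^sub>R e)) ^ 7) has_vector_derivative
          - inverse (7 * of_real s * zc e) * (- of_nat 7 * inverse (zeta s (r *\<^sub>R e)) ^ 8 * (s *\<^sub>R zc e))) (at r within {0..h/2})" .
      moreover have "- inverse (7 * of_real s * zc e) * (- of_nat 7 * inverse (zeta s (r *\<^sub>R e)) ^ 8 * (s *\<^sub>R zc e)) = f s (r *\<^sub>R e)"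
      proof -
        have "- inverse c * (- of_nat 7 * i * (s *\<^sub>R e')) = i" if "c = 7 * of_real s * e'" "e' \<noteq> 0" for c i e' :: complex
          using that s by (simp add: scaleR_conv_of_real field_simps)
        from this[OF refl zce] show ?thesis unfolding f_def .
      qed
      ultimately show ?thesis by (simp only:)
    qed
    have I1: "(LINT r|lborel. indicator {0..h/2} r *\<^sub>R f s (r *\<^sub>R e)) = ?A (h/2) - ?A 0"
    proof (rule integral_FTC_atLeastAtMost)
      show "continuous_on {0..h/2} (\<lambda>r. f s (r *\<^sub>R e))"
        unfolding f_def using nz by (intro continuous_on_power continuous_on_inverse cz) auto
      show "0 \<le> h/2" using h by simp
    qed (rule der)
    have I1i: "integrable lborel (\<lambda>r. indicator {0..h/2} r *\<^sub>R f s (r *\<^sub>R e))"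
      unfolding f_def using nz by (intro borel_integrable_compact continuous_on_power continuous_on_inverse cz) auto
    let ?J = "\<lambda>r. indicator {h/2<..h} r *\<^sub>R phi s (r *\<^sub>R e)"
    have I2i: "integrable lborel ?J"
    proof -
      have "integrable lborel (\<lambda>r. indicator {h/2<..h} r *\<^sub>R (indicator {h/2..h} r *\<^sub>R phi s (r *\<^sub>R e)))"
        by (intro integrable_mult_indicator borel_integrable_compact continuous_on_subset[OF cphi]) auto
      also have "(\<lambda>r. indicator {h/2<..h} r *\<^sub>R (indicator {h/2..h} r *\<^sub>R phi s (r *\<^sub>R e))) = ?J"
        by (auto simp: indicator_def)
      finally show ?thesis .
    qed
    have "(LINT r|lborel. indicator {0<..} r *\<^sub>R phi s (r *\<^sub>R e)) = (LINT r|lborel. indicator {0..h/2} r *\<^sub>R f s (r *\<^sub>R e) + ?J r)"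
    proof (rule integral_cong_AE)
      show "(\<lambda>r. indicator {0<..} r *\<^sub>R phi s (r *\<^sub>R e)) \<in> borel_measurable lborel"
        using borel_measurable_continuous_onI[OF cphi] by simp
      show "(\<lambda>r. indicator {0..h/2} r *\<^sub>R f s (r *\<^sub>R e) + ?J r) \<in> borel_measurable lborel"
        using I1i I2i by (intro borel_measurable_add) auto
      have "AE t in lborel. t \<noteq> (0::real)" by (rule AE_lborel_singleton)
      then show "AE r in lborel. indicator {0<..} r *\<^sub>R phi s (r *\<^sub>R e) = indicator {0..h/2} r *\<^sub>R f s (r *\<^sub>R e) + ?J r"
      proof eventually_elim
        case (elim r)
        consider "r < 0" | "0 < r" "r \<le> h/2" | "h/2 < r" "r \<le> h" | "h < r" using elim by linarith
        then show ?case
        proof cases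
          case 2
          then have "phi s (r *\<^sub>R e) = f s (r *\<^sub>R e)"
            using phi_closure[OF s0 e(2), of r] X_1[of "r *\<^sub>R e"] e(1) by simp
          then show ?thesis using 2 by simp
        next
          case 4
          then have "phi s (r *\<^sub>R e) = 0" using e(1) h by (intro phi_0) simp
          then show ?thesis using 4 by simp
        qed (use h in auto)
      qed
    qed
    also have "\<dots> = (?A (h/2) - ?A 0) + (LINT r|lborel. ?J r)"
      using I1 Bochner_Integration.integral_add[OF I1i I2i] by simp
    finally have eq0: "(LINT r|lborel. indicator {0<..} r *\<^sub>R phi s (r *\<^sub>R e)) = (?A (h/2) - ?A 0) + (LINT r|lborel. ?J r)" .
    have eq: "(LINT r|lborel. indicator {0<..} r *\<^sub>R phi s (r *\<^sub>R e)) - inverse (zc dv) ^ 7 / (7 * of_real s * zc e) = ?A (h/2) + (LINT r|lborel. ?J r)"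
    proof -
      have z0: "zeta s (0 *\<^sub>R e) = zc dv" by (simp add: zeta_def)
      have "- ?A 0 = inverse (zc dv) ^ 7 / (7 * of_real s * zc e)"
        unfolding z0 divide_inverse by (simp only: mult_minus_left mult_minus_right minus_minus mult.commute)
      moreover have "a = (b - c) + d \<Longrightarrow> - c = k \<Longrightarrow> a - k = b + d" for a b c d k :: complex by simp
      ultimately show ?thesis using eq0 by blast
    qed
    have far: "cmod (inverse (zeta s (r *\<^sub>R e))) \<le> K / s" if "h/2 \<le> r" for r
      using that h e by (intro inverse_zeta_far[OF s e(2)]) auto
    have "cmod (?A (h/2)) = cmod (inverse (zeta s ((h/2) *\<^sub>R e))) ^ 7 / (7 * s)"
    proof -
      have nc: "cmod (7 * of_real s * zc e) = 7 * s" using s e(1) by (simp add: norm_mult)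
      show ?thesis
        unfolding norm_mult[of "- inverse (7 * of_real s * zc e)"] norm_minus_cancel norm_inverse[of "7 * of_real s * zc e"] nc norm_power divide_inverse
        by (rule mult.commute)
    qed
    also have "\<dots> \<le> (K ^ 7 / s\<^sup>2) / 7"
    proof -
      have "cmod (inverse (zeta s ((h/2) *\<^sub>R e))) ^ 7 \<le> K ^ 7 / s\<^sup>2"
        using power_mono[OF far[of "h/2"], of 7] power_over_le[OF s, of 7] by simp
      then show ?thesis using s K_pos by (intro frac_le) auto
    qed
    finally have b1: "cmod (?A (h/2)) \<le> (K ^ 7 / 7) / s\<^sup>2" by (simp add: field_simps)
    have "cmod (LINT r|lborel. ?J r) \<le> (LINT r|lborel. norm (?J r))" by (rule integral_norm_bound)
    also have "\<dots> \<le> (LINT r|lborel. indicator {h/2<..h} r * (K ^ 8 / s\<^sup>2))"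
    proof (rule integral_mono)
      show "integrable lborel (\<lambda>r. norm (?J r))" using I2i by (rule integrable_norm)
      show "integrable lborel (\<lambda>r::real. indicator {h/2<..h} r * (K ^ 8 / s\<^sup>2))"
        using h by (intro integrable_mult_left integrable_real_indicator) auto
      fix r
      show "norm (?J r) \<le> indicator {h/2<..h} r * (K ^ 8 / s\<^sup>2)"
      proof (cases "r \<in> {h/2<..h}")
        case True
        then have r: "0 \<le> r" "h/2 \<le> r" using h by auto
        have "cmod (phi s (r *\<^sub>R e)) = X (r *\<^sub>R e) * cmod (inverse (zeta s (r *\<^sub>R e))) ^ 8"
          unfolding phi_closure[OF s0 e(2)[OF r(1)]] f_def using X_range by (simp add: norm_mult norm_power)
        also have "\<dots> \<le> 1 * (K / s) ^ 8" using X_range far[OF r(2)] by (intro mult_mono power_mono) auto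
        also have "\<dots> \<le> K ^ 8 / s\<^sup>2" using power_over_le[OF s, of 8] by simp
        finally show ?thesis using True by simp
      qed simp
    qed
    also have "\<dots> = (h/2) * K ^ 8 / s\<^sup>2" using h by simp
    finally have b2: "cmod (LINT r|lborel. ?J r) \<le> (h/2) * K ^ 8 / s\<^sup>2" .
    have "cmod (?A (h/2) + (LINT r|lborel. ?J r)) \<le> (K ^ 7 / 7) / s\<^sup>2 + (h/2) * K ^ 8 / s\<^sup>2"
      by (rule norm_triangle_mono[OF b1 b2])
    then show ?thesis unfolding eq by (simp add: C_def add_divide_distrib)
  qed
  then show ?thesis using C0 by blast
qed

text \<open>1/a + 1/b = (a + b) / (a b), and unit vectors a, b along the edges have sum 0 only if
  the edges are opposite, which the opening excludes.\<close>

lemma ray_coeff_nz: "inverse (zc dv) ^ 7 / 7 * (1 / zc va + 1 / zc vb) \<noteq> 0"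
proof -
  have "va + vb \<noteq> 0" using co_comb(1)[of 1 1] co_scale(1)[of 0] by auto
  then have s: "zc va + zc vb \<noteq> 0" by (simp flip: zc_simps(1))
  have "p dv \<noteq> 0" by (simp add: corner_sign_def)
  moreover have "p 0 = 0" using co_scale(1)[of 0] by simp
  ultimately have "dv \<noteq> 0" by metis
  moreover have "va \<noteq> 0" "vb \<noteq> 0" using norm_ab by (metis norm_zero zero_neq_one)+
  ultimately show ?thesis using s by (simp add: field_simps add.commute)
qed

text \<open>Dominates \<open>phi s\<close> on the edges up to a constant. It is the square of sqrt X
  / (1 + s |x|), the factor that Cauchy-Schwarz pairs with the trace error.\<close>

definition weight :: "real \<Rightarrow> real^2 \<Rightarrow> real" where "weight s x = X x * inverse (1 + s * norm x) ^ 2"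

lemma weight_nonneg: "s \<ge> 0 \<Longrightarrow> 0 \<le> weight s x"
  using X_range[of x] by (simp add: weight_def)

lemma continuous_weight: "s \<ge> 0 \<Longrightarrow> continuous_on UNIV (weight s)"
proof -
  assume s: "s \<ge> 0"
  have "continuous_on UNIV XC" using smooth_continuous[OF smooth_X] .
  from continuous_on_Re[OF this] have "continuous_on UNIV X" by simp
  moreover have "1 + s * norm x \<noteq> 0" for x :: "real^2" using s mult_nonneg_nonneg[OF s norm_ge_zero[of x]] by linarith
  ultimately show ?thesis unfolding weight_def by (intro continuous_intros) auto
qed

text \<open>Since X \<le> 1, it suffices to integrate 1 / (1 + s r)^2, whose primitive is -1 / (s (1
  + s r)).\<close>

lemma weight_ray:
  assumes s: "s > 0" and e: "norm e = 1"
  shows "(LINT r|lborel. indicator {0<..} r *\<^sub>R weight s (r *\<^sub>R e)) \<le> 1 / s"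
proof -
  have pos: "1 + s * r > 0" if "0 \<le> r" for r using s that by (simp add: add_pos_nonneg)
  have c: "continuous_on {0..h} (\<lambda>r. inverse (1 + s * r) ^ 2)"
    using pos by (intro continuous_intros) (auto simp: less_imp_neq[symmetric])
  have cw: "continuous_on UNIV (\<lambda>r. weight s (r *\<^sub>R e))"
    by (rule continuous_on_compose2[OF continuous_weight]) (use s in \<open>auto intro!: continuous_intros\<close>)
  have iw: "integrable lborel (\<lambda>r. indicator {0<..} r *\<^sub>R weight s (r *\<^sub>R e))"
  proof -
    have "integrable lborel (\<lambda>r. indicator {0<..} r *\<^sub>R (indicator {0..h} r *\<^sub>R weight s (r *\<^sub>R e)))"
      by (intro integrable_mult_indicator borel_integrable_compact continuous_on_subset[OF cw]) auto
    also have "(\<lambda>r. indicator {0<..} r *\<^sub>R (indicator {0..h} r *\<^sub>R weight s (r *\<^sub>R e))) = (\<lambda>r. indicator {0<..} r *\<^sub>R weight s (r *\<^sub>R e))"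
      using X_0[of "r *\<^sub>R e" for r] h e by (intro ext) (auto simp: indicator_def weight_def)
    finally show ?thesis .
  qed
  have "(LINT r|lborel. indicator {0<..} r *\<^sub>R weight s (r *\<^sub>R e)) \<le> (LINT r|lborel. indicator {0..h} r *\<^sub>R inverse (1 + s * r) ^ 2)"
  proof (rule integral_mono[OF iw])
    show "integrable lborel (\<lambda>r. indicator {0..h} r *\<^sub>R inverse (1 + s * r) ^ 2)"
      by (intro borel_integrable_compact c) auto
    fix r
    consider "r \<le> 0" | "0 < r" "r \<le> h" | "h < r" by linarith
    then show "indicator {0<..} r *\<^sub>R weight s (r *\<^sub>R e) \<le> indicator {0..h} r *\<^sub>R inverse (1 + s * r) ^ 2"
    proof cases
      case 2
      have "X (r *\<^sub>R e) * inverse (1 + s * r) ^ 2 \<le> 1 * inverse (1 + s * r) ^ 2"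
        using X_range by (intro mult_right_mono) auto
      then show ?thesis using 2 e by (simp add: weight_def)
    next
      case 3
      then show ?thesis using X_0[of "r *\<^sub>R e"] h e by (simp add: weight_def)
    qed (auto simp: indicator_def)
  qed
  also have "\<dots> = - (inverse (1 + s * h) / s) - (- (inverse (1 + s * 0) / s))"
  proof (rule integral_FTC_atLeastAtMost[OF _ _ c])
    show "((\<lambda>r. - (inverse (1 + s * r) / s)) has_vector_derivative inverse (1 + s * r) ^ 2) (at r within {0..h})" if "0 \<le> r" for r
      unfolding has_real_derivative_iff_has_vector_derivative[symmetric]
      using pos[OF that] s by (auto intro!: derivative_eq_intros simp: power2_eq_square)
  qed (use h in simp)
  also have "\<dots> \<le> 1 / s" using s pos[of h] h by simp
  finally show ?thesis .
qed

text \<open>The disc is split at r0 = s^(-3/4), which balances two crude bounds: the area is of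
  order r0^2 = s^(-3/2) inside, and the integrand is at most (s r0)^(-6) = s^(-3/2) outside. This
  order is already small compared with 1/s.\<close>

lemma area_bound: "\<exists>C\<ge>0. \<forall>s\<ge>1. integrable lborel (\<lambda>x::real^2. indicator (ball 0 h) x * inverse (1 + s * norm x) ^ 6) \<and>
   (LINT x::real^2|lborel. indicator (ball 0 h) x * inverse (1 + s * norm x) ^ 6) \<le> C * s powr (-3/2)"
proof -
  have mb: "measure lborel (ball (0::real^2) r) \<le> 4 * r\<^sup>2" if "0 \<le> r" for r
  proof -
    have "ball (0::real^2) r \<subseteq> cbox (vector [-r, -r]) (vector [r, r])"
    proof
      fix x :: "real^2" assume "x \<in> ball 0 r"
      then have "norm x \<le> r" by simp
      then have "\<bar>x $ i\<bar> \<le> r" for i using component_le_norm_cart[of x i] by linarith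
      then show "x \<in> cbox (vector [-r, -r]) (vector [r, r])"
        by (auto simp: mem_box Basis_real2(1) inner_axis abs_le_iff minus_le_iff)
    qed
    then have "measure lborel (ball (0::real^2) r) \<le> measure lborel (cbox (vector [-r, -r]) (vector [r, r] :: real^2))"
      by (intro measure_mono_fmeasurable) auto
    also have "\<dots> = (\<Prod>b\<in>Basis. (vector [r, r] - vector [-r, -r] :: real^2) \<bullet> b)"
      by (rule measure_lborel_cbox) (use that in \<open>auto simp: Basis_real2(1) inner_axis\<close>)
    also have "\<dots> = 4 * r\<^sup>2" unfolding prod_Basis_real2 by (simp add: inner_axis power2_eq_square)
    finally show ?thesis .
  qed
  define C where "C = 4 + 4 * h\<^sup>2"
  have "integrable lborel (\<lambda>x::real^2. indicator (ball 0 h) x * inverse (1 + s * norm x) ^ 6) \<and>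
     (LINT x::real^2|lborel. indicator (ball 0 h) x * inverse (1 + s * norm x) ^ 6) \<le> C * s powr (-3/2)" if s: "s \<ge> 1" for s
  proof -
    define r0 where "r0 = s powr (-3/4)"
    have r0: "r0 > 0" using s by (simp add: r0_def)
    have r02: "r0\<^sup>2 = s powr (-3/2)" using s by (simp add: r0_def powr_powr flip: powr_realpow)
    let ?g = "\<lambda>x::real^2. indicator (ball 0 h) x * inverse (1 + s * norm x) ^ 6"
    let ?u = "\<lambda>x::real^2. indicator (ball 0 r0) x + indicator (ball 0 h) x * s powr (-3/2)"
    have iu: "integrable lborel ?u"
      using emeasure_bounded_finite[OF bounded_ball, of "0::real^2" r0] emeasure_bounded_finite[OF bounded_ball, of "0::real^2" h]
      by (intro Bochner_Integration.integrable_add integrable_mult_left integrable_real_indicator) auto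
    have le: "?g x \<le> ?u x" for x
    proof (cases "norm x < r0")
      case True
      have "inverse (1 + s * norm x) ^ 6 \<le> 1 ^ 6" using s by (intro power_mono) (auto simp: inverse_le_1_iff)
      then have "?g x \<le> 1" by (auto simp: indicator_def)
      then show ?thesis using True by (simp add: add_increasing2)
    next
      case False
      have p: "s powr (1/4) \<le> 1 + s * norm x"
      proof -
        have "s powr (1/4) = s * r0" using s powr_add[of s 1 "-3/4"] by (simp add: r0_def)
        also have "\<dots> \<le> s * norm x" using s False by (intro mult_left_mono) auto
        finally show ?thesis by simp
      qed
      have "inverse (1 + s * norm x) ^ 6 \<le> inverse (s powr (1/4)) ^ 6"
        using s p by (intro power_mono le_imp_inverse_le) auto
      also have "\<dots> = s powr (-3/2)" using s by (simp add: powr_powr powr_minus[symmetric] flip: powr_realpow)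
      finally show ?thesis using False by (auto simp: indicator_def)
    qed
    have g0: "0 \<le> ?g x" for x using s by simp
    have "(\<lambda>x::real^2. inverse (1 + s * norm x) ^ 6) \<in> borel_measurable borel" by measurable
    then have mg: "?g \<in> borel_measurable lborel" by (intro borel_measurable_times borel_measurable_indicator) auto
    have ig: "integrable lborel ?g"
      by (rule Bochner_Integration.integrable_bound[OF iu mg]) (use le g0 in \<open>auto intro!: AE_I2 order_trans[OF le]\<close>)
    have "(LINT x|lborel. ?g x) \<le> (LINT x|lborel. ?u x)" by (rule integral_mono[OF ig iu le])
    also have "\<dots> = measure lborel (ball (0::real^2) r0) + measure lborel (ball (0::real^2) h) * s powr (-3/2)"
      using emeasure_bounded_finite[OF bounded_ball, of "0::real^2" r0] emeasure_bounded_finite[OF bounded_ball, of "0::real^2" h]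
      by (subst Bochner_Integration.integral_add) (auto intro!: integrable_mult_left integrable_real_indicator)
    also have "\<dots> \<le> 4 * r0\<^sup>2 + 4 * h\<^sup>2 * s powr (-3/2)"
      using mb[of r0] mb[of h] r0 h by (intro add_mono mult_right_mono) auto
    also have "\<dots> = C * s powr (-3/2)" by (simp add: r02 C_def algebra_simps)
    finally show ?thesis using ig by simp
  qed
  moreover have "C \<ge> 0" by (simp add: C_def)
  ultimately show ?thesis by blast
qed

end

section \<open>Green's formula and traces at a corner\<close>

lemma H1_norm_zero: "open U \<Longrightarrow> H1_norm U (\<lambda>x. 0) = 0"
proof -
  assume U: "open U"
  have z: "(LINT x|lebesgue_on U. (cmod (weak_deriv U b (\<lambda>x. 0) x))\<^sup>2) = 0" if b: "b \<in> Basis" for b :: 'a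
  proof -
    have "has_weak_deriv U b (\<lambda>x. 0) (dir_deriv b (\<lambda>x. 0))"
      by (rule has_weak_deriv_C1[OF U _ b]) simp
    from weak_deriv_AE_eq[OF U b this]
    have "AE x in lebesgue_on U. (cmod (weak_deriv U b (\<lambda>x. 0) x))\<^sup>2 = 0" by eventually_elim simp
    then show ?thesis by (rule integral_eq_zero_AE)
  qed
  have "(H1_norm U (\<lambda>x. 0))\<^sup>2 = 0" unfolding H1_norm_sq using z by simp
  then show ?thesis by simp
qed

lemma H1_norm_nonneg: "0 \<le> H1_norm U u"
  unfolding H1_norm_def by (intro real_sqrt_ge_zero add_nonneg_nonneg sum_nonneg) auto

lemma L2_le_H1:
  shows "L2_norm (lebesgue_on U) u \<le> H1_norm U u"
    and "b \<in> Basis \<Longrightarrow> L2_norm (lebesgue_on U) (weak_deriv U b u) \<le> H1_norm U u"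
proof -
  have s: "0 \<le> (\<Sum>b\<in>Basis. (L2_norm (lebesgue_on U) (weak_deriv U b u))\<^sup>2)" by (intro sum_nonneg) auto
  show "L2_norm (lebesgue_on U) u \<le> H1_norm U u"
    unfolding H1_norm_def using s by (intro real_le_rsqrt) simp
  assume b: "b \<in> Basis"
  have "(L2_norm (lebesgue_on U) (weak_deriv U b u))\<^sup>2 \<le> (\<Sum>b\<in>Basis. (L2_norm (lebesgue_on U) (weak_deriv U b u))\<^sup>2)"
    using b by (intro member_le_sum) auto
  then show "L2_norm (lebesgue_on U) (weak_deriv U b u) \<le> H1_norm U u"
    unfolding H1_norm_def by (intro real_le_rsqrt) (simp add: add_increasing)
qed

lemma L2_norm_cong_AE:
  assumes "AE x in M. f x = g x" "f \<in> borel_measurable M" "g \<in> borel_measurable M"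
  shows "L2_norm M f = L2_norm M g"
proof -
  have "(LINT x|M. (cmod (f x))\<^sup>2) = (LINT x|M. (cmod (g x))\<^sup>2)"
    by (rule integral_cong_AE) (use assms in \<open>auto elim: eventually_mono\<close>)
  then show ?thesis by (simp add: L2_norm_def)
qed

lemma C_diff_continuous: "C_diff (Suc 0) f \<Longrightarrow> continuous_on UNIV f"
  using C_diff_on_Suc_D[of UNIV 0 f] by (simp add: C_diff_on_UNIV)

lemma smooth_C1: "smooth f \<Longrightarrow> C_diff (Suc 0) f"
  by (simp only: smooth_def)

text \<open>Formally the boundary integral of u times the normal derivative of \<phi>. In this form
  it makes sense for u in H^1 and is continuous there, yet it depends on u only through the
  trace.\<close>

definition weak_pairing :: "'a::euclidean_space set \<Rightarrow> ('a \<Rightarrow> complex) \<Rightarrow> ('a \<Rightarrow> complex) \<Rightarrow> complex" where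
  "weak_pairing U u \<phi> = (\<Sum>b\<in>Basis. LINT x|lebesgue_on U. weak_deriv U b u x * dir_deriv b \<phi> x)
     + (LINT x|lebesgue_on U. u x * laplace \<phi> x)"

section \<open>Pairing with test functions supported near the corner\<close>

locale corner_domain = corner_disc +
  fixes \<Omega> :: "(real^2) set"
  assumes open_\<Omega>: "open \<Omega>" and bounded_\<Omega>: "bounded \<Omega>" and \<Omega>_ball: "\<Omega> \<inter> ball 0 h = W \<inter> ball 0 h"
begin

abbreviation "M \<equiv> boundary_measure \<Omega>"
definition "S = W \<inter> ball 0 h"

lemma S_simps: "open S" "S \<subseteq> \<Omega>" "S \<subseteq> W" "S \<subseteq> ball 0 h" "S \<in> sets lebesgue" "\<Omega> \<in> sets lebesgue" "bounded S"
  using open_W open_\<Omega> \<Omega>_ball by (auto simp: S_def intro: bounded_subset[OF bounded_ball])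

lemma integral_\<Omega>_S:
  fixes F :: "real^2 \<Rightarrow> complex"
  assumes "\<And>x. x \<notin> ball 0 h \<Longrightarrow> F x = 0"
  shows "integral\<^sup>L (lebesgue_on \<Omega>) F = integral\<^sup>L (lebesgue_on S) F"
    "integrable (lebesgue_on \<Omega>) F \<longleftrightarrow> integrable (lebesgue_on S) F"
proof -
  have "F x = 0" if "x \<in> \<Omega> - S" for x
  proof (rule assms)
    show "x \<notin> ball 0 h" using that \<Omega>_ball unfolding S_def by blast
  qed
  from integral_lebesgue_on_subset[OF S_simps(5,6,2) this]
  show "integral\<^sup>L (lebesgue_on \<Omega>) F = integral\<^sup>L (lebesgue_on S) F"
    "integrable (lebesgue_on \<Omega>) F \<longleftrightarrow> integrable (lebesgue_on S) F" by simp_all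
qed

lemma borel_measurable_M: "F \<in> borel_measurable borel \<Longrightarrow> F \<in> borel_measurable M"
  unfolding boundary_measure_def by (intro measurable_completion measurable_restrict_space1) simp

lemma square_integrable_M:
  assumes F: "continuous_on UNIV F" and supp: "\<And>x. x \<notin> ball 0 h \<Longrightarrow> F x = 0"
  shows "square_integrable M F"
proof -
  have "integrable M (\<lambda>x. (cmod (F x))\<^sup>2)"
    by (rule boundary_measure_integral(2)[OF open_\<Omega> \<Omega>_ball]) (use supp in \<open>auto intro!: continuous_intros F\<close>)
  then show ?thesis using borel_measurable_M[OF borel_measurable_continuous_onI[OF F]] by (simp add: square_integrable_def)
qed

text \<open>A smooth function approximates itself, so test functions are admissible in the
  conductive condition with their own boundary values.\<close>

lemma has_trace_test_function:
  assumes \<phi>: "test_function (ball 0 h) \<phi>"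
  shows "has_trace \<Omega> \<phi> \<phi>"
  unfolding has_trace_def
proof (intro conjI exI[of _ "\<lambda>_. \<phi>"] allI)
  show "in_H1 \<Omega> \<phi>" by (rule in_H1_C1[OF open_\<Omega> bounded_\<Omega> test_functionD(3)[OF \<phi>]])
  show "square_integrable M \<phi>" by (rule square_integrable_M[OF test_functionD(2,5)[OF \<phi>]])
  show "smooth \<phi>" by (rule test_functionD(1)[OF \<phi>])
qed (simp_all add: H1_norm_zero[OF open_\<Omega>] L2_norm_def)

lemma square_integrable_test:
  assumes "test_function (ball 0 h) \<phi>"
  shows "square_integrable (lebesgue_on \<Omega>) \<phi>"
  by (rule square_integrable_continuous[OF test_functionD(2)[OF assms] bounded_\<Omega> S_simps(6)])

lemma continuous_laplace:
  assumes "test_function U \<phi>" shows "continuous_on UNIV (laplace \<phi>)" "x \<notin> U \<Longrightarrow> laplace \<phi> x = 0"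
proof -
  note t = test_function_dir_deriv[OF test_function_dir_deriv[OF assms]]
  show "continuous_on UNIV (laplace \<phi>)" unfolding laplace_def[abs_def]
    by (intro continuous_on_sum test_functionD(2)[OF t])
  show "x \<notin> U \<Longrightarrow> laplace \<phi> x = 0" unfolding laplace_def
    by (intro sum.neutral ballI test_functionD(5)[OF t])
qed

text \<open>Cauchy-Schwarz in each summand. The difference of the weak gradients equals the weak
  gradient of the difference only almost everywhere, since \<open>weak_deriv\<close> is a
  choice.\<close>

lemma weak_pairing_tendsto:
  assumes u: "in_H1 \<Omega> u" and z: "\<And>n. smooth (z n)" and conv: "(\<lambda>n. H1_norm \<Omega> (\<lambda>x. u x - z n x)) \<longlonglongrightarrow> 0"
    and \<phi>: "test_function (ball 0 h) \<phi>"
  shows "(\<lambda>n. weak_pairing \<Omega> (z n) \<phi>) \<longlonglongrightarrow> weak_pairing \<Omega> u \<phi>"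
proof -
  define H where "H n = H1_norm \<Omega> (\<lambda>x. u x - z n x)" for n
  note d = test_function_dir_deriv[OF \<phi>]
  have zH: "in_H1 \<Omega> (z n)" for n by (rule in_H1_C1[OF open_\<Omega> bounded_\<Omega> smooth_C1[OF z]])
  have sqL: "square_integrable (lebesgue_on \<Omega>) (laplace \<phi>)"
    by (rule square_integrable_continuous[OF continuous_laplace(1)[OF \<phi>] bounded_\<Omega> S_simps(6)])
  have uz: "square_integrable (lebesgue_on \<Omega>) u" "square_integrable (lebesgue_on \<Omega>) (z n)" for n
    using u zH by (auto simp: in_H1_def)
  have t0: "(\<lambda>n. LINT x|lebesgue_on \<Omega>. z n x * laplace \<phi> x) \<longlonglongrightarrow> (LINT x|lebesgue_on \<Omega>. u x * laplace \<phi> x)"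
  proof (rule Lim_null[THEN iffD2, OF Lim_null_comparison])
    show "\<forall>\<^sub>F n in sequentially. norm ((LINT x|lebesgue_on \<Omega>. z n x * laplace \<phi> x) - (LINT x|lebesgue_on \<Omega>. u x * laplace \<phi> x)) \<le> H n * L2_norm (lebesgue_on \<Omega>) (laplace \<phi>)"
    proof (rule always_eventually, rule allI)
      fix n
      have "(LINT x|lebesgue_on \<Omega>. z n x * laplace \<phi> x) - (LINT x|lebesgue_on \<Omega>. u x * laplace \<phi> x) = - (LINT x|lebesgue_on \<Omega>. (u x - z n x) * laplace \<phi> x)"
        unfolding left_diff_distrib
        using square_integrable_imp_integrable_mult[OF uz(1) sqL] square_integrable_imp_integrable_mult[OF uz(2) sqL] by simp
      also have "norm \<dots> \<le> (LINT x|lebesgue_on \<Omega>. norm ((u x - z n x) * laplace \<phi> x))"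
        unfolding norm_minus_cancel by (rule integral_norm_bound)
      also have "\<dots> \<le> L2_norm (lebesgue_on \<Omega>) (\<lambda>x. u x - z n x) * L2_norm (lebesgue_on \<Omega>) (laplace \<phi>)"
        unfolding norm_mult by (rule Cauchy_Schwarz_L2(1)[OF square_integrable_diff(1)[OF uz(1) uz(2)] sqL])
      also have "\<dots> \<le> H n * L2_norm (lebesgue_on \<Omega>) (laplace \<phi>)"
        unfolding H_def by (intro mult_right_mono L2_le_H1 L2_norm_nonneg)
      finally show "norm ((LINT x|lebesgue_on \<Omega>. z n x * laplace \<phi> x) - (LINT x|lebesgue_on \<Omega>. u x * laplace \<phi> x)) \<le> H n * L2_norm (lebesgue_on \<Omega>) (laplace \<phi>)" .
    qed
    show "(\<lambda>n. H n * L2_norm (lebesgue_on \<Omega>) (laplace \<phi>)) \<longlonglongrightarrow> 0"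
      using tendsto_mult_left_zero[OF conv] by (simp add: H_def)
  qed
  have t1: "(\<lambda>n. LINT x|lebesgue_on \<Omega>. weak_deriv \<Omega> b (z n) x * dir_deriv b \<phi> x) \<longlonglongrightarrow> (LINT x|lebesgue_on \<Omega>. weak_deriv \<Omega> b u x * dir_deriv b \<phi> x)"
    if b: "b \<in> Basis" for b
  proof (rule Lim_null[THEN iffD2, OF Lim_null_comparison])
    have sqd: "square_integrable (lebesgue_on \<Omega>) (dir_deriv b \<phi>)" by (rule square_integrable_test[OF d[OF b]])
    note wu = in_H1_weak_deriv(2)[OF open_\<Omega> u b] and wz = in_H1_weak_deriv(2)[OF open_\<Omega> zH b]
    show "\<forall>\<^sub>F n in sequentially. norm ((LINT x|lebesgue_on \<Omega>. weak_deriv \<Omega> b (z n) x * dir_deriv b \<phi> x) - (LINT x|lebesgue_on \<Omega>. weak_deriv \<Omega> b u x * dir_deriv b \<phi> x)) \<le> H n * L2_norm (lebesgue_on \<Omega>) (dir_deriv b \<phi>)"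
    proof (rule always_eventually, rule allI)
      fix n
      have e1: "AE x in lebesgue_on \<Omega>. weak_deriv \<Omega> b (\<lambda>x. u x - z n x) x = weak_deriv \<Omega> b u x - weak_deriv \<Omega> b (z n) x"
        by (rule weak_deriv_AE_eq[OF open_\<Omega> b has_weak_deriv_diff[OF open_\<Omega> b in_H1_weak_deriv(1)[OF open_\<Omega> u b] in_H1_weak_deriv(1)[OF open_\<Omega> zH b]]])
      have sd: "square_integrable (lebesgue_on \<Omega>) (\<lambda>x. weak_deriv \<Omega> b u x - weak_deriv \<Omega> b (z n) x)"
        by (rule square_integrable_diff(1)[OF wu wz])
      have sd': "square_integrable (lebesgue_on \<Omega>) (weak_deriv \<Omega> b (\<lambda>x. u x - z n x))"
        by (rule square_integrable_AE_cong[OF sd S_simps(6)]) (use e1 in eventually_elim, simp)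
      have "(LINT x|lebesgue_on \<Omega>. weak_deriv \<Omega> b (z n) x * dir_deriv b \<phi> x) - (LINT x|lebesgue_on \<Omega>. weak_deriv \<Omega> b u x * dir_deriv b \<phi> x) = - (LINT x|lebesgue_on \<Omega>. (weak_deriv \<Omega> b u x - weak_deriv \<Omega> b (z n) x) * dir_deriv b \<phi> x)"
        unfolding left_diff_distrib
        using square_integrable_imp_integrable_mult[OF wu sqd] square_integrable_imp_integrable_mult[OF wz sqd] by simp
      also have "norm \<dots> \<le> (LINT x|lebesgue_on \<Omega>. norm ((weak_deriv \<Omega> b u x - weak_deriv \<Omega> b (z n) x) * dir_deriv b \<phi> x))"
        unfolding norm_minus_cancel by (rule integral_norm_bound)
      also have "\<dots> \<le> L2_norm (lebesgue_on \<Omega>) (\<lambda>x. weak_deriv \<Omega> b u x - weak_deriv \<Omega> b (z n) x) * L2_norm (lebesgue_on \<Omega>) (dir_deriv b \<phi>)"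
        unfolding norm_mult by (rule Cauchy_Schwarz_L2(1)[OF sd sqd])
      also have "L2_norm (lebesgue_on \<Omega>) (\<lambda>x. weak_deriv \<Omega> b u x - weak_deriv \<Omega> b (z n) x) = L2_norm (lebesgue_on \<Omega>) (weak_deriv \<Omega> b (\<lambda>x. u x - z n x))"
        by (rule L2_norm_cong_AE) (use e1 sd sd' in \<open>auto simp: square_integrable_def elim: eventually_mono\<close>)
      also have "\<dots> * L2_norm (lebesgue_on \<Omega>) (dir_deriv b \<phi>) \<le> H n * L2_norm (lebesgue_on \<Omega>) (dir_deriv b \<phi>)"
        unfolding H_def by (intro mult_right_mono L2_le_H1 L2_norm_nonneg b)
      finally show "norm ((LINT x|lebesgue_on \<Omega>. weak_deriv \<Omega> b (z n) x * dir_deriv b \<phi> x) - (LINT x|lebesgue_on \<Omega>. weak_deriv \<Omega> b u x * dir_deriv b \<phi> x)) \<le> H n * L2_norm (lebesgue_on \<Omega>) (dir_deriv b \<phi>)" .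
    qed
    show "(\<lambda>n. H n * L2_norm (lebesgue_on \<Omega>) (dir_deriv b \<phi>)) \<longlonglongrightarrow> 0"
      using tendsto_mult_left_zero[OF conv] by (simp add: H_def)
  qed
  show ?thesis unfolding weak_pairing_def by (intro tendsto_add tendsto_sum t0 t1)
qed

text \<open>The edge coordinates of e resolve the derivative into the two directions for which
  \<open>sector_divergence\<close> is stated.\<close>

lemma sector_integral_bound:
  fixes G :: "real^2 \<Rightarrow> complex"
  assumes G: "C_diff (Suc 0) G" and supp: "\<And>x. x \<notin> ball 0 h \<Longrightarrow> G x = 0"
  shows "cmod (LINT x|lborel. indicator W x *\<^sub>R dir_deriv e G x) \<le> \<bar>cr va vb\<bar> * (\<bar>p e\<bar> + \<bar>q e\<bar>) * (LINT x|M. cmod (G x))"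
proof -
  have bs: "bounded {x. G x \<noteq> 0}" by (rule bounded_subset[OF bounded_ball[of 0 h]]) (use supp in blast)
  note sd = sector_divergence[OF G bs]
  have cG: "continuous_on UNIV (\<lambda>x. cmod (G x))" by (intro continuous_on_norm C_diff_continuous G)
  let ?A = "LINT r|lborel. indicator {0<..} r *\<^sub>R cmod (G (r *\<^sub>R va))" and ?B = "LINT r|lborel. indicator {0<..} r *\<^sub>R cmod (G (r *\<^sub>R vb))"
  have MI: "(LINT x|M. cmod (G x)) = ?A + ?B"
    by (rule boundary_measure_integral(1)[OF open_\<Omega> \<Omega>_ball cG]) (simp add: supp)
  have nn: "?A \<ge> 0" "?B \<ge> 0" by (intro Bochner_Integration.integral_nonneg; simp)+
  have nb: "cmod (LINT r|lborel. indicator {0<..} r *\<^sub>R G (r *\<^sub>R y)) \<le> (LINT r|lborel. indicator {0<..} r *\<^sub>R cmod (G (r *\<^sub>R y)))" for y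
    using integral_norm_bound[of lborel "\<lambda>r. indicator {0<..} r *\<^sub>R G (r *\<^sub>R y)"] by simp
  have i: "integrable lborel (\<lambda>x. indicator W x *\<^sub>R dir_deriv y G x)" for y
    using open_W by (intro integrable_mult_indicator sd(3)) simp
  have "(LINT x|lborel. indicator W x *\<^sub>R dir_deriv e G x) = (LINT x|lborel. p e *\<^sub>R (indicator W x *\<^sub>R dir_deriv va G x) + q e *\<^sub>R (indicator W x *\<^sub>R dir_deriv vb G x))"
    by (intro Bochner_Integration.integral_cong refl, subst sd(4)) (simp add: scaleR_add_right mult.commute)
  also have "\<dots> = p e *\<^sub>R (LINT x|lborel. indicator W x *\<^sub>R dir_deriv va G x) + q e *\<^sub>R (LINT x|lborel. indicator W x *\<^sub>R dir_deriv vb G x)"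
    using i by (subst Bochner_Integration.integral_add) (auto simp del: scaleR_scaleR)
  also have "cmod \<dots> \<le> \<bar>p e\<bar> * (\<bar>cr va vb\<bar> * ?B) + \<bar>q e\<bar> * (\<bar>cr va vb\<bar> * ?A)"
    unfolding sd(1,2) by (intro norm_triangle_mono; simp only: norm_scaleR real_norm_def; intro mult_left_mono nb; simp)
  also have "\<dots> \<le> \<bar>p e\<bar> * (\<bar>cr va vb\<bar> * (?A + ?B)) + \<bar>q e\<bar> * (\<bar>cr va vb\<bar> * (?A + ?B))"
    using nn by (intro add_mono mult_left_mono) auto
  finally show ?thesis unfolding MI by (simp add: algebra_simps)
qed

text \<open>For smooth z the pairing is the integral of the divergence of z grad \<phi>, hence a
  boundary integral, to which Cauchy-Schwarz applies. The constant depends on \<phi> only, which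
  allows a limit in z.\<close>

lemma weak_pairing_smooth_bound:
  assumes \<phi>: "test_function (ball 0 h) \<phi>"
  shows "\<exists>C. \<forall>z. smooth z \<longrightarrow> square_integrable M z \<longrightarrow> cmod (weak_pairing \<Omega> z \<phi>) \<le> C * L2_norm M z"
proof (intro exI allI impI)
  fix z assume z: "smooth z" and zM: "square_integrable M z"
  note d = test_function_dir_deriv[OF \<phi>]
  have zd: "z differentiable (at x)" for x by (rule smooth_differentiable[OF z])
  let ?H = "\<lambda>b x. z x * dir_deriv b \<phi> x"
  have H: "C_diff (Suc 0) (?H b)" "\<And>x. x \<notin> ball 0 h \<Longrightarrow> ?H b x = 0" if "b \<in> Basis" for b
    using C_diff_mult[OF smooth_C1[OF z] test_functionD(3)[OF d[OF that]]] test_functionD(5)[OF d[OF that]] by auto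
  have dH: "dir_deriv b (?H b) x = z x * dir_deriv b (dir_deriv b \<phi>) x + dir_deriv b z x * dir_deriv b \<phi> x" if "b \<in> Basis" for b x
    by (rule dir_deriv_mult[OF zd test_functionD(6)[OF d[OF that]]])
  have cont: "continuous_on UNIV (\<lambda>x. z x * dir_deriv b (dir_deriv b \<phi>) x)" "continuous_on UNIV (\<lambda>x. dir_deriv b z x * dir_deriv b \<phi> x)"
    if b: "b \<in> Basis" for b
    by (intro continuous_on_mult smooth_continuous z smooth_dir_deriv b test_functionD(2)[OF d[OF b]] test_functionD(2)[OF test_function_dir_deriv[OF d[OF b] b]])+
  have intc: "integrable (lebesgue_on \<Omega>) F" if "continuous_on UNIV F" for F :: "real^2 \<Rightarrow> complex"
    using square_integrable_imp_integrable_mult[OF square_integrable_continuous[OF that bounded_\<Omega> S_simps(6)]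
        square_integrable_continuous[OF continuous_on_const[of UNIV 1] bounded_\<Omega> S_simps(6)]] by simp
  have "weak_pairing \<Omega> z \<phi> = (\<Sum>b\<in>Basis. (LINT x|lebesgue_on \<Omega>. dir_deriv b z x * dir_deriv b \<phi> x)) + (LINT x|lebesgue_on \<Omega>. z x * laplace \<phi> x)"
  proof -
    have "(LINT x|lebesgue_on \<Omega>. weak_deriv \<Omega> b z x * dir_deriv b \<phi> x) = (LINT x|lebesgue_on \<Omega>. dir_deriv b z x * dir_deriv b \<phi> x)"
      if b: "b \<in> Basis" for b
    proof (rule integral_cong_AE)
      have hw: "has_weak_deriv \<Omega> b z (dir_deriv b z)" by (rule has_weak_deriv_C1[OF open_\<Omega> smooth_C1[OF z] b])
      show "AE x in lebesgue_on \<Omega>. weak_deriv \<Omega> b z x * dir_deriv b \<phi> x = dir_deriv b z x * dir_deriv b \<phi> x"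
        using weak_deriv_AE_eq[OF open_\<Omega> b hw] by eventually_elim simp
      show "(\<lambda>x. dir_deriv b z x * dir_deriv b \<phi> x) \<in> borel_measurable (lebesgue_on \<Omega>)"
        by (rule borel_measurable_lebesgue_on_continuous[OF cont(2)[OF b]])
      have "weak_deriv \<Omega> b z \<in> borel_measurable (lebesgue_on \<Omega>)"
        using in_H1_weak_deriv(2)[OF open_\<Omega> in_H1_C1[OF open_\<Omega> bounded_\<Omega> smooth_C1[OF z]] b] by (simp add: square_integrable_def)
      then show "(\<lambda>x. weak_deriv \<Omega> b z x * dir_deriv b \<phi> x) \<in> borel_measurable (lebesgue_on \<Omega>)"
        using borel_measurable_lebesgue_on_continuous[OF test_functionD(2)[OF d[OF b]]] by (intro borel_measurable_times)
    qed
    then show ?thesis by (simp add: weak_pairing_def)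
  qed
  also have "(LINT x|lebesgue_on \<Omega>. z x * laplace \<phi> x) = (\<Sum>b\<in>Basis. LINT x|lebesgue_on \<Omega>. z x * dir_deriv b (dir_deriv b \<phi>) x)"
    unfolding laplace_def sum_distrib_left by (rule Bochner_Integration.integral_sum) (intro intc cont)
  also have "(\<Sum>b\<in>Basis. (LINT x|lebesgue_on \<Omega>. dir_deriv b z x * dir_deriv b \<phi> x)) + \<dots> = (\<Sum>b\<in>Basis. LINT x|lborel. indicator W x *\<^sub>R dir_deriv b (?H b) x)"
    unfolding sum.distrib[symmetric]
  proof (rule sum.cong[OF refl])
    fix b :: "real^2" assume b: "b \<in> Basis"
    have c: "continuous_on UNIV (dir_deriv b (?H b))" using H(1)[OF b] b by simp
    have z0: "dir_deriv b (?H b) x = 0" if "x \<notin> ball 0 h" for x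
      using that test_functionD(5)[OF d[OF b] that] test_functionD(5)[OF test_function_dir_deriv[OF d[OF b] b] that]
      by (simp add: dH[OF b])
    have "(LINT x|lebesgue_on \<Omega>. dir_deriv b z x * dir_deriv b \<phi> x) + (LINT x|lebesgue_on \<Omega>. z x * dir_deriv b (dir_deriv b \<phi>) x) = (LINT x|lebesgue_on \<Omega>. dir_deriv b (?H b) x)"
      unfolding dH[OF b] using intc[OF cont(1)[OF b]] intc[OF cont(2)[OF b]] by simp
    also have "\<dots> = (LINT x|lborel. indicator \<Omega> x *\<^sub>R dir_deriv b (?H b) x)"
      by (rule integral_lebesgue_on_continuous(1)[OF c]) (use open_\<Omega> in simp)
    also have "\<dots> = (LINT x|lborel. indicator W x *\<^sub>R dir_deriv b (?H b) x)"
    proof (intro Bochner_Integration.integral_cong refl)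
      fix x
      have "x \<in> ball 0 h \<Longrightarrow> x \<in> \<Omega> \<longleftrightarrow> x \<in> W" using \<Omega>_ball by blast
      then show "indicator \<Omega> x *\<^sub>R dir_deriv b (?H b) x = indicator W x *\<^sub>R dir_deriv b (?H b) x"
        using z0[of x] by (cases "x \<in> ball 0 h") (simp_all add: indicator_def)
    qed
    finally show "(LINT x|lebesgue_on \<Omega>. dir_deriv b z x * dir_deriv b \<phi> x) + (LINT x|lebesgue_on \<Omega>. z x * dir_deriv b (dir_deriv b \<phi>) x) = (LINT x|lborel. indicator W x *\<^sub>R dir_deriv b (?H b) x)" .
  qed
  finally have eq: "weak_pairing \<Omega> z \<phi> = (\<Sum>b\<in>Basis. LINT x|lborel. indicator W x *\<^sub>R dir_deriv b (?H b) x)" .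
  have "cmod (LINT x|lborel. indicator W x *\<^sub>R dir_deriv b (?H b) x) \<le> \<bar>cr va vb\<bar> * (\<bar>p b\<bar> + \<bar>q b\<bar>) * L2_norm M (dir_deriv b \<phi>) * L2_norm M z"
    if b: "b \<in> Basis" for b
  proof -
    have "(LINT x|M. cmod (?H b x)) \<le> L2_norm M z * L2_norm M (dir_deriv b \<phi>)"
      unfolding norm_mult by (rule Cauchy_Schwarz_L2(1)[OF zM square_integrable_M[OF test_functionD(2,5)[OF d[OF b]]]])
    then have "\<bar>cr va vb\<bar> * (\<bar>p b\<bar> + \<bar>q b\<bar>) * (LINT x|M. cmod (?H b x)) \<le> \<bar>cr va vb\<bar> * (\<bar>p b\<bar> + \<bar>q b\<bar>) * (L2_norm M z * L2_norm M (dir_deriv b \<phi>))"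
      by (intro mult_left_mono) auto
    then show ?thesis using sector_integral_bound[OF H[OF b], of b] by (simp add: mult_ac)
  qed
  then have "cmod (weak_pairing \<Omega> z \<phi>) \<le> (\<Sum>b\<in>Basis. \<bar>cr va vb\<bar> * (\<bar>p b\<bar> + \<bar>q b\<bar>) * L2_norm M (dir_deriv b \<phi>) * L2_norm M z)"
    unfolding eq by (rule sum_norm_le)
  then show "cmod (weak_pairing \<Omega> z \<phi>) \<le> (\<Sum>b\<in>Basis. \<bar>cr va vb\<bar> * (\<bar>p b\<bar> + \<bar>q b\<bar>) * L2_norm M (dir_deriv b \<phi>)) * L2_norm M z"
    by (simp only: sum_distrib_right)
qed

end

section \<open>Finiteness of the boundary measure of a Lipschitz domain\<close>

lemma orthonormal_expansion:
  fixes e1 e2 x :: "real^2"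
  assumes "norm e1 = 1" "norm e2 = 1" "e1 \<bullet> e2 = 0"
  shows "x = (x \<bullet> e1) *\<^sub>R e1 + (x \<bullet> e2) *\<^sub>R e2"
proof -
  \<comment> \<open>Lagrange's identity; it shows that e1 and e2 are linearly independent.\<close>
  have "(cr e1 e2)\<^sup>2 + (e1 \<bullet> e2)\<^sup>2 = (e1 \<bullet> e1) * (e2 \<bullet> e2)"
    by (simp add: cr_def inner_vec_def sum_2 power2_eq_square algebra_simps)
  then have nz: "cr e1 e2 \<noteq> 0" using assms by (auto simp: dot_square_norm)
  have "x \<bullet> e1 = co1 e1 e2 x" "x \<bullet> e2 = co2 e1 e2 x"
    using assms by (subst co_rep[OF nz, of x], simp add: inner_add_left inner_commute[of e2] dot_square_norm)+
  then show ?thesis using co_rep[OF nz, of x] by simp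
qed

text \<open>Near each of its points the boundary lies on a Lipschitz graph, a bounded piece of which
  has finite length; by compactness finitely many pieces suffice. Finiteness makes continuous
  functions square-integrable on the whole boundary.\<close>

lemma finite_boundary_measure:
  assumes "bounded_Lipschitz_domain \<Omega>"
  shows "finite_measure (boundary_measure \<Omega>)"
proof -
  have \<Omega>: "open \<Omega>" "bounded \<Omega>" using assms by (auto simp: bounded_Lipschitz_domain_def)
  have cp: "compact (frontier \<Omega>)" using \<Omega>(2) by (rule compact_frontier_bounded)
  have loc: "\<exists>r>0. hausdorff_outer (frontier \<Omega> \<inter> ball p r) < top" if p: "p \<in> frontier \<Omega>" for p
  proof -
    obtain U e1 e2 L f where U: "open U" "p \<in> U" and e: "norm e1 = 1" "norm e2 = 1" "e1 \<bullet> e2 = 0"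
      and L: "L-lipschitz_on UNIV (f :: real \<Rightarrow> real)" and gr: "\<Omega> \<inter> U = {x \<in> U. f (x \<bullet> e1) < x \<bullet> e2}"
      using assms p unfolding bounded_Lipschitz_domain_def by meson
    obtain r where r: "r > 0" "ball p r \<subseteq> U" using U open_contains_ball by meson
    have cf: "continuous_on UNIV f" by (rule lipschitz_on_continuous_on[OF L])
    \<comment> \<open>Points above the graph belong to the open set \<Omega>, and points below it
      form an open set disjoint from \<Omega>; a frontier point can be in neither.\<close>
    have graph: "x \<bullet> e2 = f (x \<bullet> e1)" if x: "x \<in> frontier \<Omega>" "x \<in> U" for x
    proof (rule ccontr)
      assume ne: "x \<bullet> e2 \<noteq> f (x \<bullet> e1)"
      have "x \<notin> \<Omega>" using x(1) \<Omega>(1) by (auto simp: frontier_def interior_open)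
      then have "x \<bullet> e2 < f (x \<bullet> e1)" using x(2) gr ne by force
      let ?V = "U \<inter> {x. x \<bullet> e2 < f (x \<bullet> e1)}"
      have "open ?V"
        by (intro open_Int U open_Collect_less continuous_intros continuous_on_compose2[OF cf]) auto
      moreover have "?V \<inter> \<Omega> = {}" using gr by force
      ultimately have "?V \<inter> closure \<Omega> = {}" by (simp add: open_Int_closure_eq_empty)
      moreover have "x \<in> closure \<Omega>" using x(1) by (simp add: frontier_def)
      ultimately show False using x(2) \<open>x \<bullet> e2 < f (x \<bullet> e1)\<close> by blast
    qed
    define \<gamma> where "\<gamma> t = t *\<^sub>R e1 + f t *\<^sub>R e2" for t
    have lip: "dist (\<gamma> s) (\<gamma> t) \<le> (1 + L) * \<bar>s - t\<bar>" for s t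
    proof -
      have "\<gamma> s - \<gamma> t = (s - t) *\<^sub>R e1 + (f s - f t) *\<^sub>R e2" by (simp add: \<gamma>_def algebra_simps)
      then have "dist (\<gamma> s) (\<gamma> t) \<le> \<bar>s - t\<bar> + \<bar>f s - f t\<bar>"
        using norm_triangle_ineq[of "(s - t) *\<^sub>R e1" "(f s - f t) *\<^sub>R e2"] e by (simp add: dist_norm)
      also have "\<bar>f s - f t\<bar> \<le> L * \<bar>s - t\<bar>" using lipschitz_onD[OF L, of s t] by (simp add: dist_real_def)
      finally show ?thesis by (simp add: algebra_simps)
    qed
    let ?l = "p \<bullet> e1 - r" and ?u = "p \<bullet> e1 + r"
    have "frontier \<Omega> \<inter> ball p r \<subseteq> \<gamma> ` {?l..<?u}"
    proof
      fix x assume x: "x \<in> frontier \<Omega> \<inter> ball p r"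
      then have "x = \<gamma> (x \<bullet> e1)" using orthonormal_expansion[OF e, of x] graph[of x] r(2) by (auto simp: \<gamma>_def)
      moreover have "\<bar>(x - p) \<bullet> e1\<bar> \<le> norm (x - p) * norm e1" by (rule Cauchy_Schwarz_ineq2)
      then have "\<bar>(x - p) \<bullet> e1\<bar> < r" using x e by (simp add: dist_norm norm_minus_commute)
      then have "x \<bullet> e1 \<in> {?l..<?u}" by (auto simp: inner_diff_left)
      ultimately show "x \<in> \<gamma> ` {?l..<?u}" by blast
    qed
    then have "hausdorff_outer (frontier \<Omega> \<inter> ball p r) \<le> hausdorff_outer (\<gamma> ` {?l..<?u})" by (rule hausdorff_outer_mono)
    also have "\<dots> \<le> ennreal ((1 + L) * (?u - ?l))"
      by (rule hausdorff_outer_lipschitz_curve[OF _ _ lip]) (use r lipschitz_on_nonneg[OF L] in auto)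
    also have "\<dots> < top" by simp
    finally show ?thesis using r(1) by blast
  qed
  then obtain r where r: "\<And>p. p \<in> frontier \<Omega> \<Longrightarrow> r p > 0" "\<And>p. p \<in> frontier \<Omega> \<Longrightarrow> hausdorff_outer (frontier \<Omega> \<inter> ball p (r p)) < top"
    by metis
  obtain C where C: "C \<subseteq> frontier \<Omega>" "finite C" "frontier \<Omega> \<subseteq> (\<Union>p\<in>C. ball p (r p))"
    by (rule compactE_image[OF cp, of "frontier \<Omega>" "\<lambda>p. ball p (r p)"]) (use r(1) in auto)
  have "hausdorff_outer (\<Union>p\<in>D. frontier \<Omega> \<inter> ball p (r p)) < top" if "finite D" "D \<subseteq> frontier \<Omega>" for D
    using that
  proof (induction D rule: finite_induct)
    case (insert p D)
    have "hausdorff_outer (\<Union>p\<in>insert p D. frontier \<Omega> \<inter> ball p (r p)) \<le> hausdorff_outer (frontier \<Omega> \<inter> ball p (r p)) + hausdorff_outer (\<Union>p\<in>D. frontier \<Omega> \<inter> ball p (r p))"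
      by (simp add: hausdorff_outer_Un)
    also have "\<dots> < top" using insert r(2)[of p] by simp
    finally show ?case .
  qed simp
  from this[OF C(2,1)] have "hausdorff_outer (\<Union>p\<in>C. frontier \<Omega> \<inter> ball p (r p)) < top" .
  moreover have "frontier \<Omega> \<subseteq> (\<Union>p\<in>C. frontier \<Omega> \<inter> ball p (r p))" using C(3) by blast
  ultimately have "hausdorff_outer (frontier \<Omega>) < top" using hausdorff_outer_mono order_le_less_trans by blast
  moreover have "emeasure (boundary_measure \<Omega>) (space (boundary_measure \<Omega>)) = hausdorff_outer (frontier \<Omega>)"
  proof -
    have "frontier \<Omega> \<in> sets (restrict_space hausdorff1 (frontier \<Omega>))"
      by (simp add: sets_restrict_space_iff borel_closed)
    then show ?thesis
      unfolding boundary_measure_def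
      by (simp add: space_restrict_space emeasure_restrict_space borel_closed emeasure_hausdorff1)
  qed
  ultimately show ?thesis by (intro finite_measureI) auto
qed

section \<open>Traces near the corner\<close>

locale corner_Lipschitz = corner_domain +
  assumes finM: "finite_measure (boundary_measure \<Omega>)"
begin

lemma square_integrable_M_continuous:
  assumes F: "continuous_on UNIV F" shows "square_integrable M F"
proof -
  interpret finite_measure M by (rule finM)
  have "bounded (F ` frontier \<Omega>)"
    by (intro compact_imp_bounded compact_continuous_image continuous_on_subset[OF F] compact_frontier_bounded bounded_\<Omega>) auto
  then obtain B where B: "\<And>x. x \<in> frontier \<Omega> \<Longrightarrow> cmod (F x) \<le> B"
    unfolding bounded_iff by blast
  have m: "F \<in> borel_measurable M" by (rule borel_measurable_M[OF borel_measurable_continuous_onI[OF F]])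
  have "integrable M (\<lambda>x. (cmod (F x))\<^sup>2)"
  proof (rule integrable_const_bound[where B="B\<^sup>2"])
    show "AE x in M. norm ((cmod (F x))\<^sup>2) \<le> B\<^sup>2"
      using B by (intro AE_I2) (auto simp: boundary_measure_def space_restrict_space intro!: power_mono)
    show "(\<lambda>x. (cmod (F x))\<^sup>2) \<in> borel_measurable M" using m by measurable
  qed
  then show ?thesis using m by (simp add: square_integrable_def)
qed

text \<open>Not immediate from the definition, because \<open>weak_deriv\<close> is a choice;
  linearity is recovered almost everywhere.\<close>

lemma weak_pairing_diff:
  assumes u: "in_H1 \<Omega> u1" "in_H1 \<Omega> u2" and d: "in_H1 \<Omega> (\<lambda>x. u1 x - u2 x)" and \<phi>: "test_function (ball 0 h) \<phi>"
  shows "weak_pairing \<Omega> (\<lambda>x. u1 x - u2 x) \<phi> = weak_pairing \<Omega> u1 \<phi> - weak_pairing \<Omega> u2 \<phi>"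
proof -
  note dd = test_function_dir_deriv[OF \<phi>]
  have sqL: "square_integrable (lebesgue_on \<Omega>) (laplace \<phi>)"
    by (rule square_integrable_continuous[OF continuous_laplace(1)[OF \<phi>] bounded_\<Omega> S_simps(6)])
  have s: "square_integrable (lebesgue_on \<Omega>) u1" "square_integrable (lebesgue_on \<Omega>) u2" using u by (auto simp: in_H1_def)
  have 0: "(LINT x|lebesgue_on \<Omega>. (u1 x - u2 x) * laplace \<phi> x) = (LINT x|lebesgue_on \<Omega>. u1 x * laplace \<phi> x) - (LINT x|lebesgue_on \<Omega>. u2 x * laplace \<phi> x)"
    unfolding left_diff_distrib
    using square_integrable_imp_integrable_mult[OF s(1) sqL] square_integrable_imp_integrable_mult[OF s(2) sqL] by simp
  have 1: "(LINT x|lebesgue_on \<Omega>. weak_deriv \<Omega> b (\<lambda>x. u1 x - u2 x) x * dir_deriv b \<phi> x) =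
      (LINT x|lebesgue_on \<Omega>. weak_deriv \<Omega> b u1 x * dir_deriv b \<phi> x) - (LINT x|lebesgue_on \<Omega>. weak_deriv \<Omega> b u2 x * dir_deriv b \<phi> x)"
    if b: "b \<in> Basis" for b
  proof -
    note w1 = in_H1_weak_deriv[OF open_\<Omega> u(1) b] and w2 = in_H1_weak_deriv[OF open_\<Omega> u(2) b] and w = in_H1_weak_deriv[OF open_\<Omega> d b]
    note sq = square_integrable_test[OF dd[OF b]]
    have "(LINT x|lebesgue_on \<Omega>. weak_deriv \<Omega> b (\<lambda>x. u1 x - u2 x) x * dir_deriv b \<phi> x) =
        (LINT x|lebesgue_on \<Omega>. (weak_deriv \<Omega> b u1 x - weak_deriv \<Omega> b u2 x) * dir_deriv b \<phi> x)"
    proof (rule integral_cong_AE)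
      show "AE x in lebesgue_on \<Omega>. weak_deriv \<Omega> b (\<lambda>x. u1 x - u2 x) x * dir_deriv b \<phi> x = (weak_deriv \<Omega> b u1 x - weak_deriv \<Omega> b u2 x) * dir_deriv b \<phi> x"
        using weak_deriv_AE_eq[OF open_\<Omega> b has_weak_deriv_diff[OF open_\<Omega> b w1(1) w2(1)]] by eventually_elim simp
    qed (use w w1 w2 sq in \<open>auto simp: square_integrable_def\<close>)
    then show ?thesis unfolding left_diff_distrib
      using square_integrable_imp_integrable_mult[OF w1(2) sq] square_integrable_imp_integrable_mult[OF w2(2) sq] by simp
  qed
  show ?thesis unfolding weak_pairing_def using 0 1 by (simp add: sum_subtractf)
qed

text \<open>Only the difference of the two functions enters, and it is the limit of smooth functions
  whose boundary values tend to zero.\<close>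

lemma weak_pairing_eq:
  assumes v: "has_trace \<Omega> v \<tau>" and w: "has_trace \<Omega> w \<tau>" and \<phi>: "test_function (ball 0 h) \<phi>"
  shows "weak_pairing \<Omega> v \<phi> = weak_pairing \<Omega> w \<phi>"
proof -
  obtain zv where zv: "\<And>n. smooth (zv n)" "(\<lambda>n. H1_norm \<Omega> (\<lambda>x. v x - zv n x)) \<longlonglongrightarrow> 0" "(\<lambda>n. L2_norm M (\<lambda>x. \<tau> x - zv n x)) \<longlonglongrightarrow> 0"
    using v unfolding has_trace_def by blast
  obtain zw where zw: "\<And>n. smooth (zw n)" "(\<lambda>n. H1_norm \<Omega> (\<lambda>x. w x - zw n x)) \<longlonglongrightarrow> 0" "(\<lambda>n. L2_norm M (\<lambda>x. \<tau> x - zw n x)) \<longlonglongrightarrow> 0"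
    using w unfolding has_trace_def by blast
  have vw: "in_H1 \<Omega> v" "in_H1 \<Omega> w" "square_integrable M \<tau>" using v w by (auto simp: has_trace_def)
  have sz: "in_H1 \<Omega> z" "square_integrable M z" if "smooth z" for z
    using in_H1_C1[OF open_\<Omega> bounded_\<Omega> smooth_C1[OF that]] square_integrable_M_continuous[OF smooth_continuous[OF that]] by auto
  let ?D = "\<lambda>n x. zv n x - zw n x"
  have D: "smooth (?D n)" for n by (rule smooth_diff[OF zv(1) zw(1)])
  obtain C where C: "\<And>z. smooth z \<Longrightarrow> square_integrable M z \<Longrightarrow> cmod (weak_pairing \<Omega> z \<phi>) \<le> C * L2_norm M z"
    using weak_pairing_smooth_bound[OF \<phi>] by blast
  have L: "(\<lambda>n. (L2_norm M (?D n))\<^sup>2) \<longlonglongrightarrow> 0"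
  proof (rule tendsto_sandwich[OF _ _ tendsto_const])
    show "(\<lambda>n. 2 * (L2_norm M (\<lambda>x. \<tau> x - zw n x))\<^sup>2 + 2 * (L2_norm M (\<lambda>x. \<tau> x - zv n x))\<^sup>2) \<longlonglongrightarrow> 0"
      using zv(3) zw(3) by (auto intro!: tendsto_eq_intros)
    show "\<forall>\<^sub>F n in sequentially. (L2_norm M (?D n))\<^sup>2 \<le> 2 * (L2_norm M (\<lambda>x. \<tau> x - zw n x))\<^sup>2 + 2 * (L2_norm M (\<lambda>x. \<tau> x - zv n x))\<^sup>2"
    proof (rule always_eventually, rule allI)
      fix n
      \<comment> \<open>The common trace cancels, so the boundary values of the differences tend to
        0 in L^2.\<close>
      have "?D n = (\<lambda>x. (\<tau> x - zw n x) - (\<tau> x - zv n x))" by (intro ext) simp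
      then show "(L2_norm M (?D n))\<^sup>2 \<le> 2 * (L2_norm M (\<lambda>x. \<tau> x - zw n x))\<^sup>2 + 2 * (L2_norm M (\<lambda>x. \<tau> x - zv n x))\<^sup>2"
        unfolding L2_norm_sq
        using square_integrable_diff(2)[OF square_integrable_diff(1)[OF vw(3) sz(2)[OF zw(1)[of n]]] square_integrable_diff(1)[OF vw(3) sz(2)[OF zv(1)[of n]]]]
        by simp
    qed
  qed auto
  have "(\<lambda>n. L2_norm M (?D n)) \<longlonglongrightarrow> 0"
    using tendsto_real_sqrt[OF L] by (simp add: L2_norm_nonneg)
  then have "(\<lambda>n. C * L2_norm M (?D n)) \<longlonglongrightarrow> 0" by (rule tendsto_mult_right_zero)
  then have "(\<lambda>n. weak_pairing \<Omega> (?D n) \<phi>) \<longlonglongrightarrow> 0"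
    by (rule Lim_null_comparison[rotated]) (use C[OF D sz(2)[OF D]] in simp)
  moreover have "weak_pairing \<Omega> (?D n) \<phi> = weak_pairing \<Omega> (zv n) \<phi> - weak_pairing \<Omega> (zw n) \<phi>" for n
    by (rule weak_pairing_diff[OF sz(1)[OF zv(1)] sz(1)[OF zw(1)] sz(1)[OF D] \<phi>])
  ultimately have "(\<lambda>n. weak_pairing \<Omega> (zv n) \<phi> - weak_pairing \<Omega> (zw n) \<phi>) \<longlonglongrightarrow> 0" by simp
  moreover have "(\<lambda>n. weak_pairing \<Omega> (zv n) \<phi> - weak_pairing \<Omega> (zw n) \<phi>) \<longlonglongrightarrow> weak_pairing \<Omega> v \<phi> - weak_pairing \<Omega> w \<phi>"
    by (intro tendsto_diff weak_pairing_tendsto[OF vw(1) zv(1,2) \<phi>] weak_pairing_tendsto[OF vw(2) zw(1,2) \<phi>])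
  ultimately show ?thesis using LIMSEQ_unique by fastforce
qed

text \<open>The divergence formula for X |F|^2 in each edge direction yields the integral over the
  other edge, and the product rule with 2ab \<le> a^2 + b^2 bounds the area integral. The cutoff
  confines the right-hand side to S, where the approximation of v is controlled.\<close>

lemma trace_inequality:
  "\<exists>C\<ge>0. \<forall>F. C_diff (Suc 0) F \<longrightarrow> (LINT x|M. X x * (cmod (F x))\<^sup>2) \<le>
     C * ((LINT x|lebesgue_on S. (cmod (F x))\<^sup>2) + (\<Sum>b\<in>Basis. LINT x|lebesgue_on S. (cmod (dir_deriv b F x))\<^sup>2))"
proof -
  obtain B where B: "0 \<le> B" "\<And>x b. b \<in> Basis \<Longrightarrow> cmod (dir_deriv b XC x) \<le> B"
    using dir_deriv_X_bound by blast
  \<comment> \<open>The outer 2 counts the two edge directions, 2 * (1 + B) is the coefficient of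
    |F|^2 in the pointwise bound ?D, and the cross product is the factor in
    \<open>sector_divergence\<close>.\<close>
  define C where "C = 2 * (2 * (1 + B)) / \<bar>cr va vb\<bar>"
  have C: "C \<ge> 0" using B by (simp add: C_def)
  have "(LINT x|M. X x * (cmod (F x))\<^sup>2) \<le>
     C * ((LINT x|lebesgue_on S. (cmod (F x))\<^sup>2) + (\<Sum>b\<in>Basis. LINT x|lebesgue_on S. (cmod (dir_deriv b F x))\<^sup>2))"
    if F: "C_diff (Suc 0) F" for F
  proof -
    let ?G = "\<lambda>x. XC x * (F x * cnj (F x))" and ?R = "\<lambda>x. X x * (cmod (F x))\<^sup>2"
    have G: "C_diff (Suc 0) ?G" by (intro C_diff_mult smooth_C1[OF smooth_X] F C_diff_cnj)
    have GR: "?G x = complex_of_real (?R x)" for x by (simp only: complex_norm_square[symmetric] of_real_mult of_real_power)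
    have G0: "?G x = 0" if "3*h/4 \<le> norm x" for x using X_0[OF that] by simp
    have Gb: "?G x = 0" if "x \<notin> ball 0 h" for x using that h by (intro G0) simp
    have bs: "bounded {x. ?G x \<noteq> 0}" by (rule bounded_subset[OF bounded_ball[of 0 h]]) (use Gb in blast)
    note sd = sector_divergence[OF G bs]
    have Fd: "F differentiable (at x)" for x using F by simp
    have cF: "continuous_on UNIV F" by (rule C_diff_continuous[OF F])
    have cdF: "continuous_on UNIV (dir_deriv b F)" if "b \<in> Basis" for b using F that by simp
    have dc: "dir_deriv b (\<lambda>x. cnj (F x)) x = cnj (dir_deriv b F x)" and cd: "(\<lambda>x. cnj (F x)) differentiable (at x)" for b x
    proof -
      have hd: "((\<lambda>x. cnj (F x)) has_derivative (\<lambda>b. cnj (dir_deriv b F x))) (at x)"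
        by (intro has_derivative_cnj has_derivative_dir_deriv Fd)
      show "dir_deriv b (\<lambda>x. cnj (F x)) x = cnj (dir_deriv b F x)" by (rule dir_deriv_eq[OF hd])
      show "(\<lambda>x. cnj (F x)) differentiable (at x)" using hd by (auto simp: differentiable_def)
    qed
    let ?D = "\<lambda>x. 2 * (1 + B) * (cmod (F x))\<^sup>2 + (\<Sum>b\<in>Basis. (cmod (dir_deriv b F x))\<^sup>2)"
    have bnd: "cmod (dir_deriv b ?G x) \<le> (1 + B) * (cmod (F x))\<^sup>2 + (cmod (dir_deriv b F x))\<^sup>2" if b: "b \<in> Basis" for b x
    proof -
      have "dir_deriv b ?G x = XC x * (F x * cnj (dir_deriv b F x) + dir_deriv b F x * cnj (F x)) + dir_deriv b XC x * (F x * cnj (F x))"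
        using dir_deriv_mult[OF smooth_differentiable[OF smooth_X] differentiable_mult[OF Fd cd], of b x] dir_deriv_mult[OF Fd cd, of b x] dc by simp
      also have "cmod \<dots> \<le> 1 * (cmod (F x) * cmod (dir_deriv b F x) + cmod (dir_deriv b F x) * cmod (F x)) + B * (cmod (F x) * cmod (F x))"
        using X_range[of x] B(1) B(2)[OF b, of x]
        by (intro norm_triangle_mono; simp only: norm_mult[of "XC x"] norm_mult[of "dir_deriv b XC x"]; intro mult_mono norm_triangle_le; simp add: norm_mult)
      also have "\<dots> \<le> (1 + B) * (cmod (F x))\<^sup>2 + (cmod (dir_deriv b F x))\<^sup>2"
        using sum_squares_bound[of "cmod (F x)" "cmod (dir_deriv b F x)"] by (simp add: power2_eq_square algebra_simps)
      finally show ?thesis .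
    qed
    have bndv: "cmod (dir_deriv e ?G x) \<le> ?D x" if e: "norm e = 1" for e x
    proof -
      have "cmod (dir_deriv e ?G x) \<le> \<bar>e$1\<bar> * cmod (dir_deriv (axis 1 1) ?G x) + \<bar>e$2\<bar> * cmod (dir_deriv (axis 2 1) ?G x)"
      proof -
        have "dir_deriv e ?G x = e$1 *\<^sub>R dir_deriv (axis 1 1) ?G x + e$2 *\<^sub>R dir_deriv (axis 2 1) ?G x"
          using G by (intro dir_deriv_real2) simp
        then have "cmod (dir_deriv e ?G x) = cmod (e$1 *\<^sub>R dir_deriv (axis 1 1) ?G x + e$2 *\<^sub>R dir_deriv (axis 2 1) ?G x)" by (rule arg_cong)
        also have "\<dots> \<le> cmod (e$1 *\<^sub>R dir_deriv (axis 1 1) ?G x) + cmod (e$2 *\<^sub>R dir_deriv (axis 2 1) ?G x)" by (rule norm_triangle_ineq)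
        finally show ?thesis unfolding norm_scaleR .
      qed
      also have "\<dots> \<le> 1 * ((1 + B) * (cmod (F x))\<^sup>2 + (cmod (dir_deriv (axis 1 1) F x))\<^sup>2) + 1 * ((1 + B) * (cmod (F x))\<^sup>2 + (cmod (dir_deriv (axis 2 1) F x))\<^sup>2)"
        using component_le_norm_cart[of e 1] component_le_norm_cart[of e 2] e
        by (intro add_mono mult_mono bnd) (simp_all add: Basis_real2(1))
      finally show ?thesis unfolding sum_Basis_real2 by (simp add: algebra_simps)
    qed
    have int: "integrable (lebesgue_on S) (\<lambda>x. (cmod (H x))\<^sup>2)" if "continuous_on UNIV H" for H
      using square_integrable_continuous[OF that S_simps(7,5)] by (simp add: square_integrable_def)
    have iD: "integrable (lebesgue_on S) ?D" using int[OF cF] int[OF cdF] by auto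
    have Wb: "cmod (LINT x|lborel. indicator W x *\<^sub>R dir_deriv e ?G x) \<le> (LINT x|lebesgue_on S. ?D x)" if e: "norm e = 1" for e
    proof -
      have c: "continuous_on UNIV (dir_deriv e ?G)"
      proof -
        have "dir_deriv e ?G = (\<lambda>x. e$1 *\<^sub>R dir_deriv (axis 1 1) ?G x + e$2 *\<^sub>R dir_deriv (axis 2 1) ?G x)"
          using G by (intro ext dir_deriv_real2) simp
        moreover have "continuous_on UNIV (dir_deriv (axis 1 1) ?G)" "continuous_on UNIV (dir_deriv (axis 2 1) ?G)"
          using G by (simp_all add: Basis_real2(1))
        ultimately show ?thesis by (simp only: continuous_on_add continuous_on_scaleR continuous_on_const)
      qed
      have z: "dir_deriv e ?G x = 0" if "x \<notin> ball 0 h" for x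
      proof -
        have "dir_deriv e (\<lambda>_. 0) x = dir_deriv e ?G x"
          by (rule dir_deriv_cong_open[of "- cball 0 (3*h/4)"]) (use that h G0 in auto)
        then show ?thesis by simp
      qed
      have "(LINT x|lborel. indicator W x *\<^sub>R dir_deriv e ?G x) = (LINT x|lborel. indicator S x *\<^sub>R dir_deriv e ?G x)"
      proof (intro Bochner_Integration.integral_cong refl)
        fix x show "indicator W x *\<^sub>R dir_deriv e ?G x = indicator S x *\<^sub>R dir_deriv e ?G x"
          using z[of x] by (cases "x \<in> ball 0 h") (simp_all add: S_def indicator_def)
      qed
      also have "\<dots> = (LINT x|lebesgue_on S. dir_deriv e ?G x)"
        by (rule integral_lebesgue_on_continuous(1)[OF c, symmetric]) (use S_simps(1) in simp)
      also have "cmod \<dots> \<le> (LINT x|lebesgue_on S. cmod (dir_deriv e ?G x))" by (rule integral_norm_bound)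
      also have "\<dots> \<le> (LINT x|lebesgue_on S. ?D x)"
      proof (rule integral_mono[OF _ iD bndv[OF e]])
        have "integrable (lebesgue_on S) (dir_deriv e ?G)"
          using square_integrable_imp_integrable_mult[OF square_integrable_continuous[OF c S_simps(7,5)]
              square_integrable_continuous[OF continuous_on_const[of UNIV 1] S_simps(7,5)]] by simp
        then show "integrable (lebesgue_on S) (\<lambda>x. cmod (dir_deriv e ?G x))" by (rule integrable_norm)
      qed
      finally show ?thesis .
    qed
    \<comment> \<open>The integrand is real and nonnegative, so the modulus of the integral is the
      integral itself and the divergence formula can be read from right to left.\<close>
    have ray: "cmod (LINT r|lborel. indicator {0<..} r *\<^sub>R ?G (r *\<^sub>R e)) = (LINT r|lborel. indicator {0<..} r *\<^sub>R ?R (r *\<^sub>R e))" for e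
    proof -
      have "(LINT r|lborel. indicator {0<..} r *\<^sub>R ?G (r *\<^sub>R e)) = (LINT r|lborel. complex_of_real (indicator {0<..} r *\<^sub>R ?R (r *\<^sub>R e)))"
        unfolding GR by (simp add: scaleR_conv_of_real)
      also have "\<dots> = complex_of_real (LINT r|lborel. indicator {0<..} r *\<^sub>R ?R (r *\<^sub>R e))" by (rule integral_complex_of_real)
      finally show ?thesis
        using X_range by (simp only: norm_of_real) (intro abs_of_nonneg Bochner_Integration.integral_nonneg, simp)
    qed
    have cR: "continuous_on UNIV ?R"
    proof -
      have "continuous_on UNIV X" using continuous_on_Re[OF smooth_continuous[OF smooth_X]] by simp
      then show ?thesis by (intro continuous_intros cF)
    qed
    have "(LINT x|M. ?R x) = (LINT r|lborel. indicator {0<..} r *\<^sub>R ?R (r *\<^sub>R va)) + (LINT r|lborel. indicator {0<..} r *\<^sub>R ?R (r *\<^sub>R vb))"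
      by (rule boundary_measure_integral(1)[OF open_\<Omega> \<Omega>_ball cR]) (use X_0 h in auto)
    then have "\<bar>cr va vb\<bar> * (LINT x|M. ?R x) = cmod (LINT x|lborel. indicator W x *\<^sub>R dir_deriv vb ?G x) + cmod (LINT x|lborel. indicator W x *\<^sub>R dir_deriv va ?G x)"
      unfolding sd(1,2) norm_scaleR ray by (simp add: algebra_simps)
    also have "\<dots> \<le> (LINT x|lebesgue_on S. ?D x) + (LINT x|lebesgue_on S. ?D x)"
      by (intro add_mono Wb) simp_all
    also have "(LINT x|lebesgue_on S. ?D x) = 2 * (1 + B) * (LINT x|lebesgue_on S. (cmod (F x))\<^sup>2) + (\<Sum>b\<in>Basis. LINT x|lebesgue_on S. (cmod (dir_deriv b F x))\<^sup>2)"
      using int[OF cF] int[OF cdF] by simp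
    also have "\<dots> \<le> 2 * (1 + B) * (LINT x|lebesgue_on S. (cmod (F x))\<^sup>2) + 2 * (1 + B) * (\<Sum>b\<in>Basis. LINT x|lebesgue_on S. (cmod (dir_deriv b F x))\<^sup>2)"
    proof -
      have "0 \<le> (\<Sum>b\<in>Basis. LINT x|lebesgue_on S. (cmod (dir_deriv b F x))\<^sup>2)" by (intro sum_nonneg Bochner_Integration.integral_nonneg) simp
      then show ?thesis using B(1) mult_right_mono[of 1 "2 * (1 + B)"] by simp
    qed
    finally have "\<bar>cr va vb\<bar> * (LINT x|M. ?R x) \<le> 2 * (2 * (1 + B)) * ((LINT x|lebesgue_on S. (cmod (F x))\<^sup>2) + (\<Sum>b\<in>Basis. LINT x|lebesgue_on S. (cmod (dir_deriv b F x))\<^sup>2))"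
      by (simp add: algebra_simps)
    then show ?thesis using cr_nz by (simp add: C_def pos_le_divide_eq mult.commute)
  qed
  then show ?thesis using C by blast
qed

lemma set_integral_mono_S_\<Omega>:
  assumes "square_integrable (lebesgue_on \<Omega>) F"
  shows "square_integrable (lebesgue_on S) F"
    "(LINT x|lebesgue_on S. (cmod (F x))\<^sup>2) \<le> (LINT x|lebesgue_on \<Omega>. (cmod (F x))\<^sup>2)"
proof -
  have i: "integrable (lebesgue_on \<Omega>) (\<lambda>x. (cmod (F x))\<^sup>2)" using assms by (simp add: square_integrable_def)
  have iS: "integrable (lebesgue_on S) (\<lambda>x. (cmod (F x))\<^sup>2)"
    by (rule integrable_lebesgue_on_mono[OF i S_simps(5,6,2)])
  have "F \<in> borel_measurable (lebesgue_on S)"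
    using assms by (intro measurable_restrict_mono[OF _ S_simps(2)]) (simp add: square_integrable_def)
  then show "square_integrable (lebesgue_on S) F" using iS by (simp add: square_integrable_def)
  note i1 = integrable_lebesgue_on_iff[OF S_simps(5), THEN iffD1, OF iS]
    and i2 = integrable_lebesgue_on_iff[OF S_simps(6), THEN iffD1, OF i]
  show "(LINT x|lebesgue_on S. (cmod (F x))\<^sup>2) \<le> (LINT x|lebesgue_on \<Omega>. (cmod (F x))\<^sup>2)"
    unfolding integral_lebesgue_on_eq[OF S_simps(5)] integral_lebesgue_on_eq[OF S_simps(6)]
  proof (rule integral_mono[OF i1 i2])
    show "indicator S x *\<^sub>R (cmod (F x))\<^sup>2 \<le> indicator \<Omega> x *\<^sub>R (cmod (F x))\<^sup>2" for x
      using S_simps(2) by (auto simp: indicator_def)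
  qed
qed

text \<open>The trace is a limit of smooth functions on \<Omega>, whereas g is compared with v only
  on S. The trace inequality is applied to z - g for each smooth approximant z of v; as z tends to
  v, the contribution of \<Omega> disappears and the norm over S remains.\<close>

lemma trace_error:
  "\<exists>C\<ge>0. \<forall>v \<tau> g. has_trace \<Omega> v \<tau> \<longrightarrow> C_diff (Suc 0) g \<longrightarrow>
     (LINT x|M. X x * (cmod (\<tau> x - g x))\<^sup>2) \<le> C * (H1_norm S (\<lambda>x. v x - g x))\<^sup>2"
proof -
  obtain C where C: "C \<ge> 0" "\<And>F. C_diff (Suc 0) F \<Longrightarrow> (LINT x|M. X x * (cmod (F x))\<^sup>2) \<le>
     C * ((LINT x|lebesgue_on S. (cmod (F x))\<^sup>2) + (\<Sum>b\<in>Basis. LINT x|lebesgue_on S. (cmod (dir_deriv b F x))\<^sup>2))"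
    using trace_inequality by blast
  have "(LINT x|M. X x * (cmod (\<tau> x - g x))\<^sup>2) \<le> 4 * C * (H1_norm S (\<lambda>x. v x - g x))\<^sup>2"
    if tr: "has_trace \<Omega> v \<tau>" and g: "C_diff (Suc 0) g" for v \<tau> g
  proof -
    obtain z where z: "\<And>n. smooth (z n)" "(\<lambda>n. H1_norm \<Omega> (\<lambda>x. v x - z n x)) \<longlonglongrightarrow> 0" "(\<lambda>n. L2_norm M (\<lambda>x. \<tau> x - z n x)) \<longlonglongrightarrow> 0"
      using tr unfolding has_trace_def by blast
    have v: "in_H1 \<Omega> v" and \<tau>: "square_integrable M \<tau>" using tr by (auto simp: has_trace_def)
    have cg: "continuous_on UNIV g" by (rule C_diff_continuous[OF g])
    have cdg: "continuous_on UNIV (dir_deriv b g)" if "b \<in> Basis" for b using g that by simp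
    have zM: "square_integrable M (z n)" for n by (rule square_integrable_M_continuous[OF smooth_continuous[OF z(1)]])
    have gM: "square_integrable M g" by (rule square_integrable_M_continuous[OF cg])
    have mX: "X \<in> borel_measurable M"
      using continuous_on_Re[OF smooth_continuous[OF smooth_X]] by (intro borel_measurable_M borel_measurable_continuous_onI) simp
    have iX: "integrable M (\<lambda>x. X x * (cmod (F x))\<^sup>2)" if F: "square_integrable M F" for F
    proof (rule Bochner_Integration.integrable_bound)
      show "integrable M (\<lambda>x. (cmod (F x))\<^sup>2)" using F by (simp add: square_integrable_def)
      have "F \<in> borel_measurable M" using F by (simp add: square_integrable_def)
      then show "(\<lambda>x. X x * (cmod (F x))\<^sup>2) \<in> borel_measurable M" using mX by measurable
      show "AE x in M. norm (X x * (cmod (F x))\<^sup>2) \<le> norm ((cmod (F x))\<^sup>2)"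
        using X_range by (auto simp: abs_mult intro!: mult_left_le_one_le AE_I2)
    qed
    have sqS: "square_integrable (lebesgue_on S) H" if "continuous_on UNIV H" for H
      by (rule square_integrable_continuous[OF that S_simps(7,5)])
    have sq\<Omega>: "square_integrable (lebesgue_on \<Omega>) H" if "continuous_on UNIV H" for H
      by (rule square_integrable_continuous[OF that bounded_\<Omega> S_simps(6)])
    have v\<Omega>: "square_integrable (lebesgue_on \<Omega>) v" using v by (simp add: in_H1_def)
    have bound: "(LINT x|M. X x * (cmod (\<tau> x - g x))\<^sup>2) \<le> 2 * (L2_norm M (\<lambda>x. \<tau> x - z n x))\<^sup>2
        + 4 * C * ((H1_norm S (\<lambda>x. v x - g x))\<^sup>2 + (H1_norm \<Omega> (\<lambda>x. v x - z n x))\<^sup>2)" for n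
    proof -
      have F: "C_diff (Suc 0) (\<lambda>x. z n x - g x)" by (rule C_diff_diff[OF smooth_C1[OF z(1)] g])
      have s1: "square_integrable M (\<lambda>x. \<tau> x - z n x)" and s2: "square_integrable M (\<lambda>x. z n x - g x)" and s3: "square_integrable M (\<lambda>x. \<tau> x - g x)"
        by (intro square_integrable_diff(1) \<tau> zM gM)+
      have "(LINT x|M. X x * (cmod (\<tau> x - g x))\<^sup>2) \<le> (LINT x|M. 2 * (cmod (\<tau> x - z n x))\<^sup>2 + 2 * (X x * (cmod (z n x - g x))\<^sup>2))"
      proof (rule integral_mono)
        show "integrable M (\<lambda>x. X x * (cmod (\<tau> x - g x))\<^sup>2)" by (rule iX[OF s3])
        show "integrable M (\<lambda>x. 2 * (cmod (\<tau> x - z n x))\<^sup>2 + 2 * (X x * (cmod (z n x - g x))\<^sup>2))"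
          using iX[OF s2] s1 by (auto simp: square_integrable_def)
        fix x
        have "(cmod (\<tau> x - g x))\<^sup>2 \<le> (cmod (\<tau> x - z n x) + cmod (z n x - g x))\<^sup>2"
          using norm_triangle_ineq[of "\<tau> x - z n x" "z n x - g x"] by (intro power_mono) auto
        also have "\<dots> \<le> 2 * (cmod (\<tau> x - z n x))\<^sup>2 + 2 * (cmod (z n x - g x))\<^sup>2"
          using sum_squares_bound[of "cmod (\<tau> x - z n x)" "cmod (z n x - g x)"] by (simp add: power2_sum)
        finally have "X x * (cmod (\<tau> x - g x))\<^sup>2 \<le> X x * (2 * (cmod (\<tau> x - z n x))\<^sup>2 + 2 * (cmod (z n x - g x))\<^sup>2)"
          using X_range by (intro mult_left_mono)
        \<comment> \<open>X is dropped on the part that is small on the whole boundary and kept on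
          the part to which the trace inequality will be applied.\<close>
        also have "\<dots> \<le> 2 * (cmod (\<tau> x - z n x))\<^sup>2 + 2 * (X x * (cmod (z n x - g x))\<^sup>2)"
          using X_range[of x] mult_right_mono[of "X x" 1 "(cmod (\<tau> x - z n x))\<^sup>2"] by (simp add: algebra_simps)
        finally show "X x * (cmod (\<tau> x - g x))\<^sup>2 \<le> 2 * (cmod (\<tau> x - z n x))\<^sup>2 + 2 * (X x * (cmod (z n x - g x))\<^sup>2)" .
      qed
      also have "\<dots> = 2 * (L2_norm M (\<lambda>x. \<tau> x - z n x))\<^sup>2 + 2 * (LINT x|M. X x * (cmod (z n x - g x))\<^sup>2)"
        using iX[OF s2] s1 by (simp add: L2_norm_sq square_integrable_def)
      also have "(LINT x|M. X x * (cmod (z n x - g x))\<^sup>2) \<le> C * (2 * (H1_norm S (\<lambda>x. v x - g x))\<^sup>2 + 2 * (H1_norm \<Omega> (\<lambda>x. v x - z n x))\<^sup>2)"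
      proof (rule order_trans[OF C(2)[OF F] mult_left_mono[OF _ C(1)]])
        have vg: "square_integrable (lebesgue_on S) (\<lambda>x. v x - g x)"
          by (rule square_integrable_diff(1)[OF set_integral_mono_S_\<Omega>(1)[OF v\<Omega>] sqS[OF cg]])
        have vz\<Omega>: "square_integrable (lebesgue_on \<Omega>) (\<lambda>x. v x - z n x)"
          by (rule square_integrable_diff(1)[OF v\<Omega> sq\<Omega>[OF smooth_continuous[OF z(1)]]])
        have f: "(LINT x|lebesgue_on S. (cmod (z n x - g x))\<^sup>2) \<le> 2 * (LINT x|lebesgue_on S. (cmod (v x - g x))\<^sup>2) + 2 * (LINT x|lebesgue_on \<Omega>. (cmod (v x - z n x))\<^sup>2)"
          using square_integrable_diff(2)[OF vg set_integral_mono_S_\<Omega>(1)[OF vz\<Omega>]] set_integral_mono_S_\<Omega>(2)[OF vz\<Omega>] by simp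
        have d: "(LINT x|lebesgue_on S. (cmod (dir_deriv b (\<lambda>x. z n x - g x) x))\<^sup>2) \<le>
            2 * (LINT x|lebesgue_on S. (cmod (weak_deriv S b (\<lambda>x. v x - g x) x))\<^sup>2) + 2 * (LINT x|lebesgue_on \<Omega>. (cmod (weak_deriv \<Omega> b (\<lambda>x. v x - z n x) x))\<^sup>2)"
          if b: "b \<in> Basis" for b
        proof -
          have dd: "dir_deriv b (\<lambda>x. z n x - g x) x = dir_deriv b (z n) x - dir_deriv b g x" for x
            using g by (intro dir_deriv_diff smooth_differentiable[OF z(1)]) simp
          have w: "square_integrable (lebesgue_on \<Omega>) (weak_deriv \<Omega> b v)" by (rule in_H1_weak_deriv(2)[OF open_\<Omega> v b])
          have cz: "continuous_on UNIV (dir_deriv b (z n))" by (rule smooth_continuous[OF smooth_dir_deriv[OF z(1) b]])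
          have wg: "square_integrable (lebesgue_on S) (\<lambda>x. weak_deriv \<Omega> b v x - dir_deriv b g x)"
            by (rule square_integrable_diff(1)[OF set_integral_mono_S_\<Omega>(1)[OF w] sqS[OF cdg[OF b]]])
          have wz: "square_integrable (lebesgue_on \<Omega>) (\<lambda>x. weak_deriv \<Omega> b v x - dir_deriv b (z n) x)"
            by (rule square_integrable_diff(1)[OF w sq\<Omega>[OF cz]])
          have AS: "AE x in lebesgue_on S. weak_deriv S b (\<lambda>x. v x - g x) x = weak_deriv \<Omega> b v x - dir_deriv b g x"
            by (rule weak_deriv_subset_diff_C1[OF open_\<Omega> S_simps(1,2) b v g])
          have A\<Omega>: "AE x in lebesgue_on \<Omega>. weak_deriv \<Omega> b (\<lambda>x. v x - z n x) x = weak_deriv \<Omega> b v x - dir_deriv b (z n) x"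
            by (rule weak_deriv_subset_diff_C1[OF open_\<Omega> open_\<Omega> subset_refl b v smooth_C1[OF z(1)]])
          have mS: "weak_deriv S b (\<lambda>x. v x - g x) \<in> borel_measurable (lebesgue_on S)"
            by (rule borel_measurable_lebesgue_on_AE[of "\<lambda>x. weak_deriv \<Omega> b v x - dir_deriv b g x"])
               (use wg AS S_simps(5) in \<open>auto simp: square_integrable_def elim!: eventually_mono\<close>)
          have m\<Omega>: "weak_deriv \<Omega> b (\<lambda>x. v x - z n x) \<in> borel_measurable (lebesgue_on \<Omega>)"
            by (rule borel_measurable_lebesgue_on_AE[of "\<lambda>x. weak_deriv \<Omega> b v x - dir_deriv b (z n) x"])
               (use wz A\<Omega> S_simps(6) in \<open>auto simp: square_integrable_def elim!: eventually_mono\<close>)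
          have eS: "(LINT x|lebesgue_on S. (cmod (weak_deriv S b (\<lambda>x. v x - g x) x))\<^sup>2) = (LINT x|lebesgue_on S. (cmod (weak_deriv \<Omega> b v x - dir_deriv b g x))\<^sup>2)"
            by (rule integral_cong_AE) (use wg mS AS in \<open>auto simp: square_integrable_def elim!: eventually_mono\<close>)
          have e\<Omega>: "(LINT x|lebesgue_on \<Omega>. (cmod (weak_deriv \<Omega> b (\<lambda>x. v x - z n x) x))\<^sup>2) = (LINT x|lebesgue_on \<Omega>. (cmod (weak_deriv \<Omega> b v x - dir_deriv b (z n) x))\<^sup>2)"
            by (rule integral_cong_AE) (use wz m\<Omega> A\<Omega> in \<open>auto simp: square_integrable_def elim!: eventually_mono\<close>)
          have "(LINT x|lebesgue_on S. (cmod (dir_deriv b (z n) x - dir_deriv b g x))\<^sup>2) \<le>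
             2 * (LINT x|lebesgue_on S. (cmod (weak_deriv \<Omega> b v x - dir_deriv b g x))\<^sup>2) + 2 * (LINT x|lebesgue_on S. (cmod (weak_deriv \<Omega> b v x - dir_deriv b (z n) x))\<^sup>2)"
            using square_integrable_diff(2)[OF wg set_integral_mono_S_\<Omega>(1)[OF wz]] by simp
          then show ?thesis unfolding dd eS e\<Omega> using set_integral_mono_S_\<Omega>(2)[OF wz] by linarith
        qed
        have "(\<Sum>b\<in>Basis. LINT x|lebesgue_on S. (cmod (dir_deriv b (\<lambda>x. z n x - g x) x))\<^sup>2) \<le>
            (\<Sum>b\<in>Basis. 2 * (LINT x|lebesgue_on S. (cmod (weak_deriv S b (\<lambda>x. v x - g x) x))\<^sup>2) + 2 * (LINT x|lebesgue_on \<Omega>. (cmod (weak_deriv \<Omega> b (\<lambda>x. v x - z n x) x))\<^sup>2))"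
          by (rule sum_mono[OF d])
        then show "(LINT x|lebesgue_on S. (cmod (z n x - g x))\<^sup>2) + (\<Sum>b\<in>Basis. LINT x|lebesgue_on S. (cmod (dir_deriv b (\<lambda>x. z n x - g x) x))\<^sup>2)
            \<le> 2 * (H1_norm S (\<lambda>x. v x - g x))\<^sup>2 + 2 * (H1_norm \<Omega> (\<lambda>x. v x - z n x))\<^sup>2"
          using f unfolding H1_norm_sq by (simp add: sum.distrib sum_distrib_left)
      qed
      finally show ?thesis by (simp add: algebra_simps)
    qed
    have "(\<lambda>n. 2 * (L2_norm M (\<lambda>x. \<tau> x - z n x))\<^sup>2 + 4 * C * ((H1_norm S (\<lambda>x. v x - g x))\<^sup>2 + (H1_norm \<Omega> (\<lambda>x. v x - z n x))\<^sup>2))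
        \<longlonglongrightarrow> 2 * 0\<^sup>2 + 4 * C * ((H1_norm S (\<lambda>x. v x - g x))\<^sup>2 + 0\<^sup>2)"
      by (intro tendsto_intros z(2,3))
    then have "(LINT x|M. X x * (cmod (\<tau> x - g x))\<^sup>2) \<le> 2 * 0\<^sup>2 + 4 * C * ((H1_norm S (\<lambda>x. v x - g x))\<^sup>2 + 0\<^sup>2)"
      by (rule LIMSEQ_le_const) (use bound in blast)
    then show ?thesis by simp
  qed
  then show ?thesis using C(1) by (intro exI[of _ "4 * C"]) simp
qed

end

section \<open>Green's formula for the pair of eigenfunctions\<close>

locale corner_eigenfunctions = corner_Lipschitz +
  fixes V \<eta> v w \<tau> :: "real^2 \<Rightarrow> complex" and k :: real
  assumes k: "k > 0"
    and lap_w: "has_weak_laplacian \<Omega> w (\<lambda>x. - (complex_of_real (k\<^sup>2) * (1 + V x) * w x))"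
    and lap_v: "has_weak_laplacian \<Omega> v (\<lambda>x. - (complex_of_real (k\<^sup>2) * v x))"
    and trace_v: "has_trace \<Omega> v \<tau>" and trace_w: "has_trace \<Omega> w \<tau>"
    and conductive: "\<And>\<phi> \<psi>. has_trace \<Omega> \<phi> \<psi> \<Longrightarrow>
           normal_deriv_pairing \<Omega> v \<phi> + (LINT x|boundary_measure \<Omega>. \<eta> x * \<tau> x * \<psi> x) = normal_deriv_pairing \<Omega> w \<phi>"
begin

text \<open>Adding and subtracting the integral of u against \<open>laplace \<phi>\<close> isolates
  the part that depends on the trace only.\<close>

lemma normal_deriv_pairing_eq:
  assumes lap: "has_weak_laplacian \<Omega> u F" and \<phi>: "test_function (ball 0 h) \<phi>"
  shows "normal_deriv_pairing \<Omega> u \<phi> = weak_pairing \<Omega> u \<phi> - (LINT x|lebesgue_on \<Omega>. u x * laplace \<phi> x) + (LINT x|lebesgue_on \<Omega>. F x * \<phi> x)"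
proof -
  have u: "in_H1 \<Omega> u" and F: "square_integrable (lebesgue_on \<Omega>) F" using lap by (auto simp: has_weak_laplacian_def)
  have sq: "square_integrable (lebesgue_on \<Omega>) \<phi>" by (rule square_integrable_test[OF \<phi>])
  have 1: "(LINT x|lebesgue_on \<Omega>. weak_laplacian \<Omega> u x * \<phi> x) = (LINT x|lebesgue_on \<Omega>. F x * \<phi> x)"
  proof (rule integral_cong_AE)
    have A: "AE x in lebesgue_on \<Omega>. weak_laplacian \<Omega> u x = F x" by (rule weak_laplacian_AE_eq[OF open_\<Omega> lap])
    then show "AE x in lebesgue_on \<Omega>. weak_laplacian \<Omega> u x * \<phi> x = F x * \<phi> x" by eventually_elim simp
    have "weak_laplacian \<Omega> u \<in> borel_measurable (lebesgue_on \<Omega>)"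
      by (rule borel_measurable_lebesgue_on_AE[of F]) (use A F S_simps(6) in \<open>auto simp: square_integrable_def elim!: eventually_mono\<close>)
    then show "(\<lambda>x. weak_laplacian \<Omega> u x * \<phi> x) \<in> borel_measurable (lebesgue_on \<Omega>)" using sq by (auto simp: square_integrable_def)
    show "(\<lambda>x. F x * \<phi> x) \<in> borel_measurable (lebesgue_on \<Omega>)" using sq F by (auto simp: square_integrable_def)
  qed
  have 2: "(LINT x|lebesgue_on \<Omega>. weak_deriv \<Omega> b u x * weak_deriv \<Omega> b \<phi> x) = (LINT x|lebesgue_on \<Omega>. weak_deriv \<Omega> b u x * dir_deriv b \<phi> x)"
    if b: "b \<in> Basis" for b
  proof (rule integral_cong_AE)
    have A: "AE x in lebesgue_on \<Omega>. weak_deriv \<Omega> b \<phi> x = dir_deriv b \<phi> x"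
      by (rule weak_deriv_AE_eq[OF open_\<Omega> b has_weak_deriv_C1[OF open_\<Omega> test_functionD(3)[OF \<phi>] b]])
    then show "AE x in lebesgue_on \<Omega>. weak_deriv \<Omega> b u x * weak_deriv \<Omega> b \<phi> x = weak_deriv \<Omega> b u x * dir_deriv b \<phi> x" by eventually_elim simp
    have p: "in_H1 \<Omega> \<phi>" by (rule in_H1_C1[OF open_\<Omega> bounded_\<Omega> test_functionD(3)[OF \<phi>]])
    show "(\<lambda>x. weak_deriv \<Omega> b u x * weak_deriv \<Omega> b \<phi> x) \<in> borel_measurable (lebesgue_on \<Omega>)"
      using in_H1_weak_deriv(2)[OF open_\<Omega> u b] in_H1_weak_deriv(2)[OF open_\<Omega> p b] by (auto simp: square_integrable_def)
    show "(\<lambda>x. weak_deriv \<Omega> b u x * dir_deriv b \<phi> x) \<in> borel_measurable (lebesgue_on \<Omega>)"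
      using in_H1_weak_deriv(2)[OF open_\<Omega> u b] square_integrable_test[OF test_function_dir_deriv[OF \<phi> b]] by (auto simp: square_integrable_def)
  qed
  show ?thesis unfolding normal_deriv_pairing_def weak_pairing_def using 1 2 by simp
qed

text \<open>The weak pairings of v and w coincide and cancel, which leaves no boundary term other
  than the one with \<eta>; the Laplacians are eliminated by the two equations.\<close>

lemma boundary_identity:
  assumes \<phi>: "test_function (ball 0 h) \<phi>"
  shows "(LINT x|M. \<eta> x * \<tau> x * \<phi> x) = (LINT x|lebesgue_on \<Omega>. (v x - w x) * laplace \<phi> x)
     + of_real (k\<^sup>2) * (LINT x|lebesgue_on \<Omega>. v x * \<phi> x) - of_real (k\<^sup>2) * (LINT x|lebesgue_on \<Omega>. (1 + V x) * w x * \<phi> x)"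
proof -
  note c = conductive[OF has_trace_test_function[OF \<phi>]]
  have sqL: "square_integrable (lebesgue_on \<Omega>) (laplace \<phi>)"
    by (rule square_integrable_continuous[OF continuous_laplace(1)[OF \<phi>] bounded_\<Omega> S_simps(6)])
  have s: "square_integrable (lebesgue_on \<Omega>) v" "square_integrable (lebesgue_on \<Omega>) w"
    using trace_v trace_w by (auto simp: has_trace_def in_H1_def)
  have d: "(LINT x|lebesgue_on \<Omega>. (v x - w x) * laplace \<phi> x) = (LINT x|lebesgue_on \<Omega>. v x * laplace \<phi> x) - (LINT x|lebesgue_on \<Omega>. w x * laplace \<phi> x)"
    unfolding left_diff_distrib
    using square_integrable_imp_integrable_mult[OF s(1) sqL] square_integrable_imp_integrable_mult[OF s(2) sqL] by simp
  have e1: "(LINT x|lebesgue_on \<Omega>. - (complex_of_real (k\<^sup>2) * v x) * \<phi> x) = - (of_real (k\<^sup>2) * (LINT x|lebesgue_on \<Omega>. v x * \<phi> x))"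
    by (simp add: mult.assoc)
  have e2: "(LINT x|lebesgue_on \<Omega>. - (complex_of_real (k\<^sup>2) * (1 + V x) * w x) * \<phi> x) = - (of_real (k\<^sup>2) * (LINT x|lebesgue_on \<Omega>. (1 + V x) * w x * \<phi> x))"
    by (simp add: mult.assoc)
  show ?thesis
    using c unfolding normal_deriv_pairing_eq[OF lap_v \<phi>] normal_deriv_pairing_eq[OF lap_w \<phi>] e1 e2 d weak_pairing_eq[OF trace_v trace_w \<phi>]
    by (simp add: algebra_simps)
qed

end

section \<open>Asymptotics as the test function concentrates\<close>

text \<open>F carries no integrability assumption: where integrability fails, the Bochner integral
  is 0 by convention, and B is nonnegative almost everywhere.\<close>

lemma norm_integral_le:
  fixes F :: "'a \<Rightarrow> 'b::{banach, second_countable_topology}"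
  assumes "integrable N B" "AE x in N. norm (F x) \<le> B x"
  shows "norm (integral\<^sup>L N F) \<le> integral\<^sup>L N B"
proof -
  have "AE x in N. 0 \<le> B x" using assms(2) by eventually_elim (use norm_ge_zero order_trans in blast)
  then have "(LINT x|N. norm (F x)) \<le> integral\<^sup>L N B" using integral_mono_AE'[OF assms] by simp
  then show ?thesis using integral_norm_bound[of N F] by linarith
qed

text \<open>With y = r / t^2 the second bound is y / (1 + y) \<le> 1. For the first, the damping
  factor is at most 1 and may be replaced by its power \<alpha>. Smallness near the vertex thus
  turns into powers of the length scale t^2 = 1/s.\<close>

lemma power_damping:
  assumes r: "0 \<le> r" and t: "0 < (t::real)" and a: "0 < \<alpha>" "\<alpha> \<le> 1"
  shows "r powr \<alpha> * inverse (1 + inverse (t\<^sup>2) * r) \<le> (t\<^sup>2) powr \<alpha>"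
    and "r * inverse (1 + inverse (t\<^sup>2) * r) \<le> t\<^sup>2"
proof -
  define D where "D = inverse (1 + inverse (t\<^sup>2) * r)"
  define y where "y = inverse (t\<^sup>2) * r"
  have y: "0 \<le> y" "r = t\<^sup>2 * y" using r t by (auto simp: y_def)
  have De: "D = inverse (1 + y)" by (simp only: D_def y_def)
  have D: "0 < D" "D \<le> 1" using y(1) by (auto simp: De inverse_le_1_iff)
  have "y * D \<le> 1" using y(1) by (simp add: De field_simps)
  then have rD: "r * D \<le> t\<^sup>2" using mult_left_mono[of "y * D" 1 "t\<^sup>2"] by (simp add: y(2) mult_ac)
  then show "r * inverse (1 + inverse (t\<^sup>2) * r) \<le> t\<^sup>2" by (simp add: D_def)
  have "D powr 1 \<le> D powr \<alpha>" using D a by (intro powr_mono') auto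
  then have "r powr \<alpha> * D \<le> r powr \<alpha> * D powr \<alpha>" using D by (intro mult_left_mono) auto
  also have "\<dots> = (r * D) powr \<alpha>" using r D by (simp add: powr_mult)
  also have "\<dots> \<le> (t\<^sup>2) powr \<alpha>" using rD r D a by (intro powr_mono2) auto
  finally show "r powr \<alpha> * inverse (1 + inverse (t\<^sup>2) * r) \<le> (t\<^sup>2) powr \<alpha>" by (simp add: D_def)
qed

context corner_domain begin

definition "phi_const = inverse c0 ^ 8"
definition "ray_coeff = inverse (zc dv) ^ 7 / 7 * (1 / zc va + 1 / zc vb)"

lemma phi_const_pos: "0 < phi_const" using c0(1) by (simp add: phi_const_def)

lemma damping_range: "0 < s \<Longrightarrow> 0 < inverse (1 + s * norm (x::real^2))" "0 < s \<Longrightarrow> inverse (1 + s * norm (x::real^2)) \<le> 1"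
  by (auto simp: inverse_le_1_iff add_pos_nonneg)

lemma space_M: "space M = frontier \<Omega>"
  by (simp add: boundary_measure_def space_restrict_space hausdorff1_def space_measure_of_conv)

lemma M_closure:
  assumes "x \<in> space M" "x \<in> ball 0 h"
  shows "x \<in> frontier W" "x \<in> closure W"
  using assms frontier_corner[OF open_\<Omega> \<Omega>_ball assms(2)] by (auto simp: space_M frontier_def)

lemma weight_0: "x \<notin> ball 0 h \<Longrightarrow> weight s x = 0"
  using h by (simp add: weight_def X_0)

lemma weight_M:
  assumes s: "s > 0"
  shows "integrable M (weight s)" "integral\<^sup>L M (weight s) \<le> 2 / s"
proof -
  have c: "continuous_on UNIV (weight s)" using s by (intro continuous_weight) simp
  note b = boundary_measure_integral[OF open_\<Omega> \<Omega>_ball c weight_0]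
  show "integrable M (weight s)" by (rule b(2))
  have "integral\<^sup>L M (weight s) = (LINT r|lborel. indicator {0<..} r *\<^sub>R weight s (r *\<^sub>R va)) + (LINT r|lborel. indicator {0<..} r *\<^sub>R weight s (r *\<^sub>R vb))"
    by (rule b(1))
  also have "\<dots> \<le> 1 / s + 1 / s" by (rule add_mono[OF weight_ray[OF s norm_ab(1)] weight_ray[OF s norm_ab(2)]])
  finally show "integral\<^sup>L M (weight s) \<le> 2 / s" by simp
qed

lemma phi_M:
  assumes "x \<in> space M" "s > 0"
  shows "cmod (phi s x) \<le> phi_const * (weight s x * inverse (1 + s * norm x) ^ 6)"
proof (cases "x \<in> ball 0 h")
  case True
  then show ?thesis using phi_bound[of s x] M_closure(2)[OF assms(1)] assms(2)
    by (simp add: weight_def phi_const_def power_add[symmetric] mult_ac)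
next
  case False
  then show ?thesis using h by (simp add: phi_0 weight_0)
qed

lemma phi_M_integral: "\<exists>C\<ge>0. \<forall>s\<ge>1. cmod ((LINT x|M. phi s x) - ray_coeff / of_real s) \<le> C / s\<^sup>2"
proof -
  obtain C1 C2 where C: "C1 \<ge> 0" "C2 \<ge> 0" and
    1: "\<And>s. s \<ge> 1 \<Longrightarrow> cmod ((LINT r|lborel. indicator {0<..} r *\<^sub>R phi s (r *\<^sub>R va)) - inverse (zc dv) ^ 7 / (7 * of_real s * zc va)) \<le> C1 / s\<^sup>2" and
    2: "\<And>s. s \<ge> 1 \<Longrightarrow> cmod ((LINT r|lborel. indicator {0<..} r *\<^sub>R phi s (r *\<^sub>R vb)) - inverse (zc dv) ^ 7 / (7 * of_real s * zc vb)) \<le> C2 / s\<^sup>2"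
    using ray_integral_phi[OF norm_ab(1) ray_closure(1)] ray_integral_phi[OF norm_ab(2) ray_closure(2)] by blast
  have "cmod ((LINT x|M. phi s x) - ray_coeff / of_real s) \<le> (C1 + C2) / s\<^sup>2" if s: "s \<ge> 1" for s
  proof -
    have z: "phi s x = 0" if "x \<notin> ball 0 h" for x using that h by (simp add: phi_0)
    define A where "A = (LINT r|lborel. indicator {0<..} r *\<^sub>R phi s (r *\<^sub>R va))"
    define B where "B = (LINT r|lborel. indicator {0<..} r *\<^sub>R phi s (r *\<^sub>R vb))"
    have i: "(LINT x|M. phi s x) = A + B"
      unfolding A_def B_def by (rule boundary_measure_integral(1)[OF open_\<Omega> \<Omega>_ball smooth_continuous[OF smooth_phi] z])
    have "ray_coeff / of_real s = inverse (zc dv) ^ 7 / (7 * of_real s * zc va) + inverse (zc dv) ^ 7 / (7 * of_real s * zc vb)"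
      unfolding ray_coeff_def using s by (simp add: divide_simps ring_distribs)
    then have "(LINT x|M. phi s x) - ray_coeff / of_real s = (A - inverse (zc dv) ^ 7 / (7 * of_real s * zc va)) + (B - inverse (zc dv) ^ 7 / (7 * of_real s * zc vb))"
      unfolding i by simp
    also have "cmod \<dots> \<le> C1 / s\<^sup>2 + C2 / s\<^sup>2"
      using 1[OF s] 2[OF s] unfolding A_def B_def by (rule norm_triangle_mono)
    finally show ?thesis by (simp add: add_divide_distrib)
  qed
  then show ?thesis using C by (intro exI[of _ "C1 + C2"]) simp
qed

text \<open>The parametrisation s = t^-2 avoids fractional powers: s^(-3/2) becomes t^3.\<close>

lemma damping_S: "\<exists>C\<ge>0. \<forall>t. 0 < t \<longrightarrow> t \<le> 1 \<longrightarrow>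
    integrable (lebesgue_on S) (\<lambda>x. inverse (1 + inverse (t\<^sup>2) * norm x) ^ 6) \<and>
    (LINT x|lebesgue_on S. inverse (1 + inverse (t\<^sup>2) * norm x) ^ 6) \<le> C * t ^ 3"
proof -
  obtain C where C: "C \<ge> 0" "\<And>s. s \<ge> 1 \<Longrightarrow> integrable lborel (\<lambda>x::real^2. indicator (ball 0 h) x * inverse (1 + s * norm x) ^ 6)"
    "\<And>s. s \<ge> 1 \<Longrightarrow> (LINT x::real^2|lborel. indicator (ball 0 h) x * inverse (1 + s * norm x) ^ 6) \<le> C * s powr (-3/2)"
    using area_bound by blast
  have "integrable (lebesgue_on S) (\<lambda>x. inverse (1 + inverse (t\<^sup>2) * norm x) ^ 6) \<and>
    (LINT x|lebesgue_on S. inverse (1 + inverse (t\<^sup>2) * norm x) ^ 6) \<le> C * t ^ 3" if t: "0 < t" "t \<le> 1" for t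
  proof -
    define D where "D x = inverse (1 + inverse (t\<^sup>2) * norm x) ^ 6" for x :: "real^2"
    have s: "inverse (t\<^sup>2) \<ge> 1" using t by (simp add: one_le_inverse power_le_one)
    have i: "integrable lborel (\<lambda>x. indicator (ball 0 h) x * D x)" and l: "(LINT x|lborel. indicator (ball 0 h) x * D x) \<le> C * inverse (t\<^sup>2) powr (-3/2)"
      using C(2,3)[OF s] by (simp_all add: D_def)
    have il: "integrable lebesgue (\<lambda>x. indicator (ball 0 h) x * D x)" using i by (simp add: integrable_completion)
    have "integrable (lebesgue_on (ball 0 h)) D" using integrable_lebesgue_on_iff[of "ball 0 h" D] il by simp
    from integrable_lebesgue_on_mono[OF this S_simps(5) _ S_simps(4)] have iS: "integrable (lebesgue_on S) D" by simp
    have "integral\<^sup>L (lebesgue_on S) D = (LINT x|lebesgue. indicator S x *\<^sub>R D x)" by (rule integral_lebesgue_on_eq[OF S_simps(5)])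
    also have "\<dots> \<le> (LINT x|lebesgue. indicator (ball 0 h) x * D x)"
    proof (rule integral_mono[OF _ il])
      show "integrable lebesgue (\<lambda>x. indicator S x *\<^sub>R D x)" using integrable_lebesgue_on_iff[OF S_simps(5), of D] iS by simp
      show "indicator S x *\<^sub>R D x \<le> indicator (ball 0 h) x * D x" for x
        using S_simps(4) by (auto simp: indicator_def D_def)
    qed
    also have "\<dots> = (LINT x|lborel. indicator (ball 0 h) x * D x)"
      using borel_measurable_integrable[OF i] by (rule integral_completion)
    also note l
    also have "inverse (t\<^sup>2) powr (-3/2) = t ^ 3"
    proof -
      have "inverse (t\<^sup>2) = t powr (-2)" using t by (simp add: powr_minus powr_numeral)
      then have "inverse (t\<^sup>2) powr (-3/2) = t powr 3" by (simp add: powr_powr)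
      then show ?thesis using t by (simp add: powr_numeral)
    qed
    finally show ?thesis using iS by (simp add: D_def[abs_def])
  qed
  then show ?thesis using C(1) by blast
qed

lemma phi_S:
  assumes x: "x \<in> S" and s: "s > 0"
  shows "cmod (phi s x) \<le> phi_const * inverse (1 + s * norm x) ^ 7" "cmod (phi s x) \<le> phi_const * inverse (1 + s * norm x) ^ 6"
    "(cmod (phi s x))\<^sup>2 \<le> phi_const\<^sup>2 * inverse (1 + s * norm x) ^ 6"
proof -
  define D where "D = inverse (1 + s * norm x)"
  have D: "0 < D" "D \<le> 1" unfolding D_def using damping_range[OF s] by blast+
  have xW: "x \<in> closure W" using x S_simps(3) closure_subset by blast
  have "cmod (phi s x) \<le> X x * (phi_const * D ^ 8)" using phi_bound[OF _ xW, of s] s by (simp add: phi_const_def D_def)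
  also have "\<dots> \<le> 1 * (phi_const * D ^ 8)" using X_range(2) phi_const_pos D by (intro mult_right_mono) auto
  finally have b: "cmod (phi s x) \<le> phi_const * D ^ 8" by simp
  have p: "phi_const * D ^ 8 \<le> phi_const * D ^ 7" "phi_const * D ^ 8 \<le> phi_const * D ^ 6" using phi_const_pos D by (auto intro!: mult_left_mono power_decreasing)
  show "cmod (phi s x) \<le> phi_const * inverse (1 + s * norm x) ^ 7" "cmod (phi s x) \<le> phi_const * inverse (1 + s * norm x) ^ 6"
    using b p by (auto simp: D_def)
  have "(cmod (phi s x))\<^sup>2 \<le> (phi_const * D ^ 8)\<^sup>2" using b by (intro power_mono) auto
  also have "\<dots> = phi_const\<^sup>2 * D ^ 16" by (simp add: power_mult_distrib)
  also have "\<dots> \<le> phi_const\<^sup>2 * D ^ 6" using D by (intro mult_left_mono power_decreasing) auto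
  finally show "(cmod (phi s x))\<^sup>2 \<le> phi_const\<^sup>2 * inverse (1 + s * norm x) ^ 6" by (simp add: D_def)
qed

lemma phi_S_integrals: "\<exists>C\<ge>0. \<forall>t. 0 < t \<longrightarrow> t \<le> 1 \<longrightarrow>
    (LINT x|lebesgue_on S. cmod (phi (inverse (t\<^sup>2)) x)) \<le> C * t ^ 3 \<and>
    (LINT x|lebesgue_on S. norm x * cmod (phi (inverse (t\<^sup>2)) x)) \<le> C * t ^ 4 \<and>
    L2_norm (lebesgue_on S) (phi (inverse (t\<^sup>2))) \<le> C * t"
proof -
  obtain C where C: "C \<ge> 0" "\<And>t. 0 < t \<Longrightarrow> t \<le> 1 \<Longrightarrow> integrable (lebesgue_on S) (\<lambda>x. inverse (1 + inverse (t\<^sup>2) * norm x) ^ 6)"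
    "\<And>t. 0 < t \<Longrightarrow> t \<le> 1 \<Longrightarrow> (LINT x|lebesgue_on S. inverse (1 + inverse (t\<^sup>2) * norm x) ^ 6) \<le> C * t ^ 3" using damping_S by blast
  \<comment> \<open>C serves the two L^1 bounds, sqrt C the L^2 bound.\<close>
  define B where "B = phi_const * (C + sqrt C)"
  have B0: "0 \<le> B" using phi_const_pos C(1) by (simp add: B_def)
  have "(LINT x|lebesgue_on S. cmod (phi (inverse (t\<^sup>2)) x)) \<le> B * t ^ 3 \<and>
    (LINT x|lebesgue_on S. norm x * cmod (phi (inverse (t\<^sup>2)) x)) \<le> B * t ^ 4 \<and>
    L2_norm (lebesgue_on S) (phi (inverse (t\<^sup>2))) \<le> B * t" if t: "0 < t" "t \<le> 1" for t
  proof -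
    define s where "s = inverse (t\<^sup>2)"
    define D where "D x = inverse (1 + s * norm x)" for x :: "real^2"
    have s: "s > 0" using t by (simp add: s_def)
    have i: "integrable (lebesgue_on S) (\<lambda>x. D x ^ 6)" and l: "(LINT x|lebesgue_on S. D x ^ 6) \<le> C * t ^ 3"
      using C(2,3)[OF t] by (simp_all add: D_def s_def)
    have D0: "0 \<le> D x" for x using damping_range[OF s, of x] by (simp add: D_def)
    \<comment> \<open>The order t^5 is rounded to t^4 = s^-2, the order at which the Lipschitz
      constant enters on the boundary as well.\<close>
    have t34: "t ^ 3 * t\<^sup>2 \<le> t ^ 4" using t by (simp add: power_add[symmetric] power_decreasing)
    have le: "integral\<^sup>L (lebesgue_on S) F \<le> K * (C * t ^ 3)"
      if "\<And>x. x \<in> S \<Longrightarrow> F x \<le> K * D x ^ 6" "0 \<le> K" for F K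
    proof -
      have "integral\<^sup>L (lebesgue_on S) F \<le> (LINT x|lebesgue_on S. K * D x ^ 6)"
        by (rule integral_mono_AE') (use i that D0 in \<open>auto intro!: AE_I2 mult_nonneg_nonneg\<close>)
      also have "\<dots> \<le> K * (C * t ^ 3)" using l that(2) by (auto intro!: mult_left_mono)
      finally show ?thesis .
    qed
    have cB: "phi_const * C \<le> B" "phi_const * sqrt C \<le> B" using phi_const_pos C(1) by (auto simp: B_def distrib_left)
    have "(LINT x|lebesgue_on S. cmod (phi s x)) \<le> phi_const * (C * t ^ 3)"
      by (rule le) (use phi_S(2)[OF _ s] phi_const_pos in \<open>auto simp: D_def\<close>)
    also have "\<dots> \<le> B * t ^ 3" using mult_right_mono[OF cB(1), of "t ^ 3"] t by simp
    finally have 1: "(LINT x|lebesgue_on S. cmod (phi s x)) \<le> B * t ^ 3" .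
    have "(LINT x|lebesgue_on S. norm x * cmod (phi s x)) \<le> (phi_const * t\<^sup>2) * (C * t ^ 3)"
    proof (rule le)
      fix x assume x: "x \<in> S"
      have "norm x * cmod (phi s x) \<le> norm x * (phi_const * D x ^ 7)" using phi_S(1)[OF x s] by (intro mult_left_mono) (auto simp: D_def)
      also have "\<dots> = (norm x * D x) * (phi_const * D x ^ 6)" by (simp add: eval_nat_numeral mult_ac)
      also have "\<dots> \<le> t\<^sup>2 * (phi_const * D x ^ 6)"
        using power_damping(2)[of "norm x" t 1] t phi_const_pos D0[of x] by (intro mult_right_mono) (auto simp: D_def s_def)
      finally show "norm x * cmod (phi s x) \<le> phi_const * t\<^sup>2 * D x ^ 6" by (simp add: mult_ac)
    qed (use phi_const_pos in simp)
    also have "\<dots> = (phi_const * C) * (t ^ 3 * t\<^sup>2)" by simp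
    also have "\<dots> \<le> B * t ^ 4" using cB(1) t34 B0 t by (intro mult_mono) auto
    finally have 2: "(LINT x|lebesgue_on S. norm x * cmod (phi s x)) \<le> B * t ^ 4" .
    have "(LINT x|lebesgue_on S. (cmod (phi s x))\<^sup>2) \<le> phi_const\<^sup>2 * (C * t ^ 3)"
      by (rule le) (use phi_S(3)[OF _ s] in \<open>auto simp: D_def\<close>)
    \<comment> \<open>One power of t is given away so that the square root produces an integer power
      of t.\<close>
    also have "\<dots> \<le> phi_const\<^sup>2 * (C * t\<^sup>2)" using t C(1) by (intro mult_left_mono power_decreasing) auto
    finally have "L2_norm (lebesgue_on S) (phi s) \<le> sqrt (phi_const\<^sup>2 * (C * t\<^sup>2))" unfolding L2_norm_def by (rule real_sqrt_le_mono)
    also have "\<dots> = (phi_const * sqrt C) * t" using phi_const_pos t by (simp add: real_sqrt_mult)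
    also have "\<dots> \<le> B * t" using mult_right_mono[OF cB(2), of t] t by simp
    finally show ?thesis using 1 2 by (simp add: s_def)
  qed
  then show ?thesis using B0 by blast
qed

end

section \<open>Error terms in the boundary identity\<close>

locale corner_vanishing = corner_eigenfunctions +
  fixes \<alpha> B C\<eta> BF :: real
  assumes \<alpha>: "0 < \<alpha>" "\<alpha> \<le> 1" and B: "0 \<le> B" and C\<eta>: "0 \<le> C\<eta>" and BF: "0 \<le> BF"
    and \<eta>_meas: "\<eta> \<in> borel_measurable M" and \<eta>_bound: "AE x in M. cmod (\<eta> x) \<le> B"
    and \<eta>_holder: "\<And>x. x \<in> frontier W \<Longrightarrow> x \<in> ball 0 h \<Longrightarrow> cmod (\<eta> x - \<eta> 0) \<le> C\<eta> * norm x powr \<alpha>"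
    and w_bound: "AE x in lebesgue_on S. cmod ((1 + V x) * w x) \<le> BF"
begin

lemma square_integrable_v: "square_integrable (lebesgue_on \<Omega>) v" "square_integrable (lebesgue_on \<Omega>) w" "square_integrable M \<tau>"
  using trace_v trace_w by (auto simp: has_trace_def in_H1_def)

lemma square_integrable_S: "continuous_on UNIV F \<Longrightarrow> square_integrable (lebesgue_on S) F"
  by (rule square_integrable_continuous[OF _ S_simps(7,5)])

lemma integrable_S: "square_integrable (lebesgue_on S) F \<Longrightarrow> integrable (lebesgue_on S) F"
  using square_integrable_imp_integrable_mult[OF _ square_integrable_S[of "\<lambda>x. 1"], of F] by simp

lemma continuous_phi: "continuous_on UNIV (phi s)"
  by (rule smooth_continuous[OF smooth_phi])

lemma phi_outside: "x \<notin> ball 0 h \<Longrightarrow> phi s x = 0"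
  using h by (simp add: phi_0)

lemma inverse_sq_ge_1: "0 < t \<Longrightarrow> t \<le> 1 \<Longrightarrow> 1 \<le> inverse ((t::real)\<^sup>2)"
  by (simp add: one_le_inverse power_le_one)

lemma laplace_term: "\<exists>C\<ge>0. \<forall>t. 0 < t \<longrightarrow> t \<le> 1 \<longrightarrow>
    cmod (LINT x|lebesgue_on \<Omega>. (v x - w x) * laplace (phi (inverse (t\<^sup>2))) x) \<le> C * t ^ 4"
proof -
  obtain C where C: "C \<ge> 0" "\<And>s x. s \<ge> 1 \<Longrightarrow> x \<in> W \<Longrightarrow> cmod (laplace (phi s) x) \<le> C / s\<^sup>2"
    using laplace_phi_bound by blast
  have vw: "square_integrable (lebesgue_on S) (\<lambda>x. v x - w x)"
    by (rule set_integral_mono_S_\<Omega>(1)[OF square_integrable_diff(1)[OF square_integrable_v(1,2)]])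
  define A where "A = (LINT x|lebesgue_on S. cmod (v x - w x))"
  have "cmod (LINT x|lebesgue_on \<Omega>. (v x - w x) * laplace (phi (inverse (t\<^sup>2))) x) \<le> C * A * t ^ 4" if t: "0 < t" "t \<le> 1" for t
  proof -
    define s where "s = inverse (t\<^sup>2)"
    have s: "s \<ge> 1" using inverse_sq_ge_1[OF t] by (simp add: s_def)
    have z: "(v x - w x) * laplace (phi s) x = 0" if "x \<notin> ball 0 h" for x
      using continuous_laplace(2)[OF test_function_phi that] by simp
    have eq: "(LINT x|lebesgue_on \<Omega>. (v x - w x) * laplace (phi s) x) = (LINT x|lebesgue_on S. (v x - w x) * laplace (phi s) x)" by (rule integral_\<Omega>_S) (rule z)
    have "cmod (LINT x|lebesgue_on S. (v x - w x) * laplace (phi s) x) \<le> (LINT x|lebesgue_on S. C / s\<^sup>2 * cmod (v x - w x))"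
    proof (rule norm_integral_le)
      show "integrable (lebesgue_on S) (\<lambda>x. C / s\<^sup>2 * cmod (v x - w x))"
        using integrable_S[OF vw] by simp
      have "norm ((v x - w x) * laplace (phi s) x) \<le> C / s\<^sup>2 * cmod (v x - w x)" if "x \<in> S" for x
        using mult_right_mono[OF C(2)[OF s, of x], of "cmod (v x - w x)"] that S_simps(3) by (auto simp: norm_mult mult_ac)
      then show "AE x in lebesgue_on S. norm ((v x - w x) * laplace (phi s) x) \<le> C / s\<^sup>2 * cmod (v x - w x)"
        by (intro AE_I2) simp
    qed
    also have "\<dots> = C * A * t ^ 4" by (simp add: A_def s_def field_simps flip: power_mult)
    finally show ?thesis unfolding s_def[symmetric] eq .
  qed
  moreover have "0 \<le> C * A" using C(1) by (simp add: A_def)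
  ultimately show ?thesis by blast
qed

lemma source_term: "\<exists>C\<ge>0. \<forall>t. 0 < t \<longrightarrow> t \<le> 1 \<longrightarrow>
    cmod (LINT x|lebesgue_on \<Omega>. (1 + V x) * w x * phi (inverse (t\<^sup>2)) x) \<le> C * t ^ 3"
proof -
  obtain C where C: "C \<ge> 0" "\<And>t. 0 < t \<Longrightarrow> t \<le> 1 \<Longrightarrow> (LINT x|lebesgue_on S. cmod (phi (inverse (t\<^sup>2)) x)) \<le> C * t ^ 3"
    using phi_S_integrals by blast
  have "cmod (LINT x|lebesgue_on \<Omega>. (1 + V x) * w x * phi (inverse (t\<^sup>2)) x) \<le> BF * C * t ^ 3" if t: "0 < t" "t \<le> 1" for t
  proof -
    define s where "s = inverse (t\<^sup>2)"
    have z: "(1 + V x) * w x * phi s x = 0" if "x \<notin> ball 0 h" for x using phi_outside[OF that] by simp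
    have eq: "(LINT x|lebesgue_on \<Omega>. (1 + V x) * w x * phi s x) = (LINT x|lebesgue_on S. (1 + V x) * w x * phi s x)" by (rule integral_\<Omega>_S) (rule z)
    have "cmod (LINT x|lebesgue_on S. (1 + V x) * w x * phi s x) \<le> (LINT x|lebesgue_on S. BF * cmod (phi s x))"
    proof (rule norm_integral_le)
      show "integrable (lebesgue_on S) (\<lambda>x. BF * cmod (phi s x))"
        using integrable_S[OF square_integrable_S[OF continuous_phi]] by simp
      show "AE x in lebesgue_on S. norm ((1 + V x) * w x * phi s x) \<le> BF * cmod (phi s x)"
        using w_bound by eventually_elim (simp add: norm_mult mult_right_mono)
    qed
    also have "\<dots> \<le> BF * (C * t ^ 3)" using mult_left_mono[OF C(2)[OF t] BF] by (simp add: s_def)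
    finally show ?thesis unfolding s_def[symmetric] eq by (simp add: mult.assoc)
  qed
  moreover have "0 \<le> BF * C" using C(1) BF by simp
  ultimately show ?thesis by blast
qed

text \<open>v = (v - u) + (u - u 0) + u 0: the first part is paired with the L^2 norm of the test
  function, the second with the integral of |x| times its modulus, the third with its L^1
  norm.\<close>

lemma volume_term: "\<exists>C\<ge>0. \<forall>t u e G. 0 < t \<longrightarrow> t \<le> 1 \<longrightarrow> C_diff (Suc 0) u \<longrightarrow> H1_norm S (\<lambda>x. v x - u x) \<le> e \<longrightarrow>
    0 \<le> G \<longrightarrow> (\<forall>x. cmod (u x - u 0) \<le> G * norm x) \<longrightarrow>
    cmod (LINT x|lebesgue_on \<Omega>. v x * phi (inverse (t\<^sup>2)) x) \<le> C * (e * t + G * t ^ 4 + cmod (u 0) * t ^ 3)"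
proof -
  obtain C where C: "C \<ge> 0" and
    C1: "\<And>t. 0 < t \<Longrightarrow> t \<le> 1 \<Longrightarrow> (LINT x|lebesgue_on S. cmod (phi (inverse (t\<^sup>2)) x)) \<le> C * t ^ 3" and
    C2: "\<And>t. 0 < t \<Longrightarrow> t \<le> 1 \<Longrightarrow> (LINT x|lebesgue_on S. norm x * cmod (phi (inverse (t\<^sup>2)) x)) \<le> C * t ^ 4" and
    C3: "\<And>t. 0 < t \<Longrightarrow> t \<le> 1 \<Longrightarrow> L2_norm (lebesgue_on S) (phi (inverse (t\<^sup>2))) \<le> C * t"
    using phi_S_integrals by blast
  have "cmod (LINT x|lebesgue_on \<Omega>. v x * phi (inverse (t\<^sup>2)) x) \<le> C * (e * t + G * t ^ 4 + cmod (u 0) * t ^ 3)"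
    if t: "0 < t" "t \<le> 1" and u: "C_diff (Suc 0) u" and e: "H1_norm S (\<lambda>x. v x - u x) \<le> e" and G: "0 \<le> G" "\<And>x. cmod (u x - u 0) \<le> G * norm x" for t u e G
  proof -
    define s where "s = inverse (t\<^sup>2)"
    have z: "v x * phi s x = 0" if "x \<notin> ball 0 h" for x using phi_outside[OF that] by simp
    have vu: "square_integrable (lebesgue_on S) (\<lambda>x. v x - u x)"
      by (rule square_integrable_diff(1)[OF set_integral_mono_S_\<Omega>(1)[OF square_integrable_v(1)] square_integrable_S[OF C_diff_continuous[OF u]]])
    have p: "square_integrable (lebesgue_on S) (phi s)" by (rule square_integrable_S[OF continuous_phi])
    have "continuous_on UNIV (\<lambda>x::real^2. complex_of_real (norm x))" by (intro continuous_intros)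
    from integrable_norm[OF square_integrable_imp_integrable_mult[OF square_integrable_S[OF this] p]]
    have i2: "integrable (lebesgue_on S) (\<lambda>x. norm x * cmod (phi s x))" by (simp add: norm_mult)
    have i3: "integrable (lebesgue_on S) (\<lambda>x. cmod (phi s x))" using integrable_S[OF p] by simp
    have eq: "(LINT x|lebesgue_on \<Omega>. v x * phi s x) = (LINT x|lebesgue_on S. v x * phi s x)" by (rule integral_\<Omega>_S) (rule z)
    have "cmod (LINT x|lebesgue_on S. v x * phi s x) \<le>
      (LINT x|lebesgue_on S. cmod (v x - u x) * cmod (phi s x) + (G * (norm x * cmod (phi s x)) + cmod (u 0) * cmod (phi s x)))"
    proof (rule norm_integral_le)
      show "integrable (lebesgue_on S) (\<lambda>x. cmod (v x - u x) * cmod (phi s x) + (G * (norm x * cmod (phi s x)) + cmod (u 0) * cmod (phi s x)))"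
        using Cauchy_Schwarz_L2(2)[OF vu p] i2 i3 by simp
      have "norm (v x * phi s x) \<le> cmod (v x - u x) * cmod (phi s x) + (G * (norm x * cmod (phi s x)) + cmod (u 0) * cmod (phi s x))" for x
      proof -
        have "cmod (v x) \<le> cmod (v x - u x) + (cmod (u x - u 0) + cmod (u 0))"
          using norm_triangle_ineq[of "v x - u x" "u x"] norm_triangle_ineq[of "u x - u 0" "u 0"] by simp
        then have "cmod (v x) \<le> cmod (v x - u x) + (G * norm x + cmod (u 0))" using G(2)[of x] by linarith
        from mult_right_mono[OF this norm_ge_zero[of "phi s x"]] show ?thesis by (simp add: norm_mult algebra_simps)
      qed
      then show "AE x in lebesgue_on S. norm (v x * phi s x) \<le> cmod (v x - u x) * cmod (phi s x) + (G * (norm x * cmod (phi s x)) + cmod (u 0) * cmod (phi s x))" by simp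
    qed
    also have "\<dots> = (LINT x|lebesgue_on S. cmod (v x - u x) * cmod (phi s x)) + (G * (LINT x|lebesgue_on S. norm x * cmod (phi s x)) + cmod (u 0) * (LINT x|lebesgue_on S. cmod (phi s x)))"
      using Cauchy_Schwarz_L2(2)[OF vu p] i2 i3 by simp
    also have "\<dots> \<le> e * (C * t) + (G * (C * t ^ 4) + cmod (u 0) * (C * t ^ 3))"
    proof (intro add_mono mult_left_mono)
      have "L2_norm (lebesgue_on S) (\<lambda>x. v x - u x) \<le> e" by (rule order_trans[OF L2_le_H1(1) e])
      then show "(LINT x|lebesgue_on S. cmod (v x - u x) * cmod (phi s x)) \<le> e * (C * t)"
        using C3[OF t] H1_norm_nonneg e unfolding s_def[symmetric]
        by (intro order_trans[OF Cauchy_Schwarz_L2(1)[OF vu p]] mult_mono L2_norm_nonneg) (auto intro: order_trans)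
    qed (use C1[OF t] C2[OF t] G in \<open>auto simp: s_def\<close>)
    also have "\<dots> = C * (e * t + G * t ^ 4 + cmod (u 0) * t ^ 3)" by (simp add: algebra_simps)
    finally show ?thesis unfolding s_def[symmetric] eq .
  qed
  then show ?thesis using C by blast
qed

text \<open>\<eta> \<tau> - \<eta> 0 u 0 is split into \<eta> (\<tau> - u), \<eta> (u - u 0) and
  (\<eta> - \<eta> 0) u 0. The last two are small near the vertex, and one factor of decay beyond
  the weight converts |x| and |x|^\<alpha> into t^2 and t^(2 \<alpha>). The first is kept as a
  product, ready for Cauchy-Schwarz.\<close>

lemma boundary_term_bound:
  assumes x: "x \<in> space M" and \<eta>x: "cmod (\<eta> x) \<le> B" and t: "0 < t" and G: "0 \<le> G" and u: "cmod (u x - u 0) \<le> G * norm x"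
  defines "s \<equiv> inverse (t\<^sup>2)"
  shows "cmod (\<eta> x * \<tau> x * phi s x - \<eta> 0 * u 0 * phi s x) \<le>
     phi_const * B * (cmod (of_real (sqrt (X x)) * (\<tau> x - u x)) * cmod (of_real (sqrt (X x) * inverse (1 + s * norm x))))
      + (phi_const * B * G * t\<^sup>2 + phi_const * C\<eta> * cmod (u 0) * (t\<^sup>2) powr \<alpha>) * weight s x"
proof (cases "x \<in> ball 0 h")
  case False
  then show ?thesis using B phi_const_pos X_range(1) t by (auto simp: phi_outside weight_0 s_def intro!: mult_nonneg_nonneg)
next
  case True
  define D where "D = inverse (1 + s * norm x)"
  have s: "s > 0" using t by (simp add: s_def)
  have D: "0 < D" "D \<le> 1" unfolding D_def using damping_range[OF s] by blast+
  have w: "weight s x = X x * D\<^sup>2" by (simp add: weight_def D_def)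
  have weight: "0 \<le> weight s x" using weight_nonneg s by simp
  have p: "cmod (phi s x) \<le> phi_const * (weight s x * D ^ 6)" using phi_M[OF x s] by (simp add: D_def)
  have "D ^ 6 \<le> D ^ 1" using D by (intro power_decreasing) auto
  then have D6: "D ^ 6 \<le> D" by simp
  have p1: "cmod (phi s x) \<le> phi_const * weight s x * D"
    using order_trans[OF p mult_left_mono[OF mult_left_mono[OF D6 weight], of phi_const]] phi_const_pos by (simp add: mult.assoc)
  have "cmod (phi s x) \<le> phi_const * (X x * (D\<^sup>2 * D ^ 6))" using p by (simp add: w mult_ac)
  also have "\<dots> \<le> phi_const * (X x * D)"
  proof -
    have "D\<^sup>2 * D ^ 6 \<le> 1 * D" using D D6 by (intro mult_mono power_le_one) auto
    then show ?thesis using phi_const_pos X_range(1) by (intro mult_left_mono) auto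
  qed
  finally have p2: "cmod (phi s x) \<le> phi_const * (X x * D)" .
  have "\<eta> x * \<tau> x * phi s x - \<eta> 0 * u 0 * phi s x = \<eta> x * (\<tau> x - u x) * phi s x + \<eta> x * (u x - u 0) * phi s x + (\<eta> x - \<eta> 0) * u 0 * phi s x"
    by (simp add: algebra_simps)
  also have "cmod \<dots> \<le> B * cmod (\<tau> x - u x) * (phi_const * (X x * D)) + B * (G * norm x) * (phi_const * weight s x * D) + C\<eta> * norm x powr \<alpha> * cmod (u 0) * (phi_const * weight s x * D)"
  proof (intro norm_triangle_mono)
    show "cmod (\<eta> x * (\<tau> x - u x) * phi s x) \<le> B * cmod (\<tau> x - u x) * (phi_const * (X x * D))"
      unfolding norm_mult using B \<eta>x p2 by (intro mult_mono) auto
    show "cmod (\<eta> x * (u x - u 0) * phi s x) \<le> B * (G * norm x) * (phi_const * weight s x * D)"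
      unfolding norm_mult using B \<eta>x p1 u G by (intro mult_mono) auto
    show "cmod ((\<eta> x - \<eta> 0) * u 0 * phi s x) \<le> C\<eta> * norm x powr \<alpha> * cmod (u 0) * (phi_const * weight s x * D)"
      unfolding norm_mult using C\<eta> p1 \<eta>_holder[OF M_closure(1)[OF x True] True] by (intro mult_mono) auto
  qed
  also have "B * (G * norm x) * (phi_const * weight s x * D) = (B * G * phi_const * weight s x) * (norm x * D)" by (simp add: mult_ac)
  also have "(B * G * phi_const * weight s x) * (norm x * D) \<le> (B * G * phi_const * weight s x) * t\<^sup>2"
    using G B phi_const_pos weight power_damping(2)[of "norm x" t 1] t by (intro mult_left_mono) (auto simp: D_def s_def)
  also have "C\<eta> * norm x powr \<alpha> * cmod (u 0) * (phi_const * weight s x * D) = (C\<eta> * cmod (u 0) * phi_const * weight s x) * (norm x powr \<alpha> * D)" by (simp add: mult_ac)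
  also have "(C\<eta> * cmod (u 0) * phi_const * weight s x) * (norm x powr \<alpha> * D) \<le> (C\<eta> * cmod (u 0) * phi_const * weight s x) * (t\<^sup>2) powr \<alpha>"
    using C\<eta> phi_const_pos weight power_damping(1)[OF _ t \<alpha>, of "norm x"] by (intro mult_left_mono) (auto simp: D_def s_def)
  finally have "cmod (\<eta> x * \<tau> x * phi s x - \<eta> 0 * u 0 * phi s x) \<le> phi_const * B * (X x * D * cmod (\<tau> x - u x))
      + (phi_const * B * G * t\<^sup>2 + phi_const * C\<eta> * cmod (u 0) * (t\<^sup>2) powr \<alpha>) * weight s x" by (simp add: algebra_simps)
  moreover have "cmod (of_real (sqrt (X x)) * (\<tau> x - u x)) * cmod (of_real (sqrt (X x) * D)) = X x * D * cmod (\<tau> x - u x)"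
    using X_range(1)[of x] D(1) unfolding norm_mult norm_of_real by (simp add: abs_mult)
  ultimately show ?thesis unfolding D_def[symmetric] by (simp only:)
qed

lemma boundary_term: "\<exists>C\<ge>0. \<forall>t u e G. 0 < t \<longrightarrow> t \<le> 1 \<longrightarrow> C_diff (Suc 0) u \<longrightarrow> H1_norm S (\<lambda>x. v x - u x) \<le> e \<longrightarrow>
    0 \<le> G \<longrightarrow> (\<forall>x. cmod (u x - u 0) \<le> G * norm x) \<longrightarrow>
    cmod ((LINT x|M. \<eta> x * \<tau> x * phi (inverse (t\<^sup>2)) x) - \<eta> 0 * u 0 * (LINT x|M. phi (inverse (t\<^sup>2)) x)) \<le>
      C * (e * t + G * t ^ 4 + cmod (u 0) * (t\<^sup>2 * (t\<^sup>2) powr \<alpha>))"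
proof -
  obtain C0 where C0: "C0 \<ge> 0" "\<And>v \<tau> g. has_trace \<Omega> v \<tau> \<Longrightarrow> C_diff (Suc 0) g \<Longrightarrow>
     (LINT x|M. X x * (cmod (\<tau> x - g x))\<^sup>2) \<le> C0 * (H1_norm S (\<lambda>x. v x - g x))\<^sup>2" using trace_error by blast
  define C where "C = phi_const * B * sqrt C0 * sqrt 2 + phi_const * B * 2 + phi_const * C\<eta> * 2"
  have CC: "phi_const * B * sqrt C0 * sqrt 2 \<le> C" "phi_const * B * 2 \<le> C" "phi_const * C\<eta> * 2 \<le> C" "0 \<le> C"
    using phi_const_pos B C\<eta> C0(1) by (auto simp: C_def intro!: add_nonneg_nonneg mult_nonneg_nonneg)
  have "cmod ((LINT x|M. \<eta> x * \<tau> x * phi (inverse (t\<^sup>2)) x) - \<eta> 0 * u 0 * (LINT x|M. phi (inverse (t\<^sup>2)) x)) \<le>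
      C * (e * t + G * t ^ 4 + cmod (u 0) * (t\<^sup>2 * (t\<^sup>2) powr \<alpha>))"
    if t: "0 < t" "t \<le> 1" and u: "C_diff (Suc 0) u" and e: "H1_norm S (\<lambda>x. v x - u x) \<le> e" and G: "0 \<le> G" "\<And>x. cmod (u x - u 0) \<le> G * norm x" for t u e G
  proof -
    define s where "s = inverse (t\<^sup>2)"
    have s: "s > 0" using t by (simp add: s_def)
    \<comment> \<open>The cutoff is split into two square roots: |f1|^2 = X |\<tau> - u|^2 is the
      integrand of \<open>trace_error\<close>, and |f2|^2 is \<open>weight\<close>, of integral at
      most 2 t^2. Together they give the order e t.\<close>
    define f1 where "f1 x = complex_of_real (sqrt (X x)) * (\<tau> x - u x)" for x
    define f2 where "f2 x = complex_of_real (sqrt (X x) * inverse (1 + s * norm x))" for x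
    have e0: "0 \<le> e" using H1_norm_nonneg e order_trans by blast
    have sp: "square_integrable M (phi s)" by (rule square_integrable_M_continuous[OF continuous_phi])
    have s\<tau>u: "square_integrable M (\<lambda>x. \<tau> x - u x)"
      by (rule square_integrable_diff(1)[OF square_integrable_v(3) square_integrable_M_continuous[OF C_diff_continuous[OF u]]])
    have cX: "continuous_on UNIV (\<lambda>x. sqrt (X x))"
      using continuous_on_Re[OF smooth_continuous[OF smooth_X]] by (intro continuous_intros) simp
    have mX: "(\<lambda>x. sqrt (X x)) \<in> borel_measurable M"
      by (rule borel_measurable_M[OF borel_measurable_continuous_onI[OF cX]])
    have m\<tau>: "(\<lambda>x. \<tau> x - u x) \<in> borel_measurable M" using s\<tau>u by (simp add: square_integrable_def)
    have mf1: "f1 \<in> borel_measurable M" unfolding f1_def using mX m\<tau> by measurable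
    have f1: "square_integrable M f1" unfolding square_integrable_def
    proof (intro conjI mf1, rule Bochner_Integration.integrable_bound)
      show "integrable M (\<lambda>x. (cmod (\<tau> x - u x))\<^sup>2)" using s\<tau>u by (simp add: square_integrable_def)
      show "(\<lambda>x. (cmod (f1 x))\<^sup>2) \<in> borel_measurable M" using mf1 by measurable
      show "AE x in M. norm ((cmod (f1 x))\<^sup>2) \<le> norm ((cmod (\<tau> x - u x))\<^sup>2)"
        using X_range by (auto simp: f1_def norm_mult power_mult_distrib intro!: mult_left_le_one_le AE_I2)
    qed
    have "1 + s * norm x \<noteq> 0" for x :: "real^2" using s mult_nonneg_nonneg[OF less_imp_le[OF s] norm_ge_zero[of x]] by linarith
    then have "continuous_on UNIV f2" unfolding f2_def by (intro continuous_intros cX) auto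
    then have f2: "square_integrable M f2" by (rule square_integrable_M_continuous)
    have "L2_norm M f1 \<le> sqrt (C0 * e\<^sup>2)" unfolding L2_norm_def
    proof (rule real_sqrt_le_mono)
      have "(LINT x|M. (cmod (f1 x))\<^sup>2) = (LINT x|M. X x * (cmod (\<tau> x - u x))\<^sup>2)"
        using X_range by (simp add: f1_def norm_mult power_mult_distrib)
      also note C0(2)[OF trace_v u]
      also have "C0 * (H1_norm S (\<lambda>x. v x - u x))\<^sup>2 \<le> C0 * e\<^sup>2" using C0(1) e H1_norm_nonneg by (intro mult_left_mono power_mono)
      finally show "(LINT x|M. (cmod (f1 x))\<^sup>2) \<le> C0 * e\<^sup>2" .
    qed
    then have L1: "L2_norm M f1 \<le> sqrt C0 * e" using e0 by (simp add: real_sqrt_mult)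
    have "L2_norm M f2 \<le> sqrt (2 * t\<^sup>2)" unfolding L2_norm_def
    proof (rule real_sqrt_le_mono)
      have "(cmod (f2 x))\<^sup>2 = weight s x" for x
        using X_range by (simp add: f2_def weight_def norm_mult power_mult_distrib power_divide flip: of_real_mult)
      then show "(LINT x|M. (cmod (f2 x))\<^sup>2) \<le> 2 * t\<^sup>2" using weight_M(2)[OF s] by (simp add: s_def divide_inverse)
    qed
    then have L2: "L2_norm M f2 \<le> sqrt 2 * t" using t by (simp add: real_sqrt_mult)
    define K where "K = phi_const * B * G * t\<^sup>2 + phi_const * C\<eta> * cmod (u 0) * (t\<^sup>2) powr \<alpha>"
    have K0: "0 \<le> K" using phi_const_pos B C\<eta> G(1) by (simp add: K_def)
    have ib: "integrable M (\<lambda>x. phi_const * B * (cmod (f1 x) * cmod (f2 x)) + K * weight s x)"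
      using Cauchy_Schwarz_L2(2)[OF f1 f2] weight_M(1)[OF s] by simp
    have i\<tau>\<phi>: "integrable M (\<lambda>x. \<tau> x * phi s x)" by (rule square_integrable_imp_integrable_mult[OF square_integrable_v(3) sp])
    have i1: "integrable M (\<lambda>x. \<eta> x * \<tau> x * phi s x)"
    proof (rule Bochner_Integration.integrable_bound)
      show "integrable M (\<lambda>x. of_real B * (\<tau> x * phi s x))" using i\<tau>\<phi> by simp
      have "(\<lambda>x. \<eta> x * (\<tau> x * phi s x)) \<in> borel_measurable M"
        using \<eta>_meas borel_measurable_integrable[OF i\<tau>\<phi>] by (rule borel_measurable_times)
      then show "(\<lambda>x. \<eta> x * \<tau> x * phi s x) \<in> borel_measurable M" by (simp add: mult.assoc)
      show "AE x in M. norm (\<eta> x * \<tau> x * phi s x) \<le> norm (of_real B * (\<tau> x * phi s x))"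
        using \<eta>_bound by eventually_elim (use B in \<open>simp add: norm_mult mult.assoc mult_right_mono\<close>)
    qed
    have i2: "integrable M (\<lambda>x. \<eta> 0 * u 0 * phi s x)"
      using square_integrable_imp_integrable_mult[OF sp square_integrable_M_continuous[of "\<lambda>x. 1"]] by simp
    have "(LINT x|M. \<eta> x * \<tau> x * phi s x) - \<eta> 0 * u 0 * (LINT x|M. phi s x) = (LINT x|M. \<eta> x * \<tau> x * phi s x - \<eta> 0 * u 0 * phi s x)"
      using i1 i2 by simp
    also have "cmod \<dots> \<le> (LINT x|M. phi_const * B * (cmod (f1 x) * cmod (f2 x)) + K * weight s x)"
    proof (rule norm_integral_le[OF ib])
      show "AE x in M. cmod (\<eta> x * \<tau> x * phi s x - \<eta> 0 * u 0 * phi s x) \<le> phi_const * B * (cmod (f1 x) * cmod (f2 x)) + K * weight s x"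
        using \<eta>_bound AE_space
      proof eventually_elim
        case (elim x)
        show ?case using boundary_term_bound[OF elim(2,1) t(1) G(1), of u] G(2) unfolding f1_def f2_def K_def s_def by blast
      qed
    qed
    also have "\<dots> = phi_const * B * (LINT x|M. cmod (f1 x) * cmod (f2 x)) + K * integral\<^sup>L M (weight s)"
      using Cauchy_Schwarz_L2(2)[OF f1 f2] weight_M(1)[OF s] by simp
    also have "\<dots> \<le> phi_const * B * ((sqrt C0 * e) * (sqrt 2 * t)) + K * (2 * t\<^sup>2)"
    proof (intro add_mono mult_left_mono)
      have "L2_norm M f1 * L2_norm M f2 \<le> (sqrt C0 * e) * (sqrt 2 * t)"
        using L1 L2 L2_norm_nonneg e0 C0(1) by (intro mult_mono) auto
      with Cauchy_Schwarz_L2(1)[OF f1 f2] show "(LINT x|M. cmod (f1 x) * cmod (f2 x)) \<le> (sqrt C0 * e) * (sqrt 2 * t)" by linarith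
      show "integral\<^sup>L M (weight s) \<le> 2 * t\<^sup>2" using weight_M(2)[OF s] by (simp add: s_def divide_inverse)
    qed (use phi_const_pos B K0 in auto)
    also have "\<dots> = (phi_const * B * sqrt C0 * sqrt 2) * (e * t) + (phi_const * B * 2) * (G * t ^ 4) + (phi_const * C\<eta> * 2) * (cmod (u 0) * (t\<^sup>2 * (t\<^sup>2) powr \<alpha>))"
      by (simp add: K_def algebra_simps eval_nat_numeral)
    also have "\<dots> \<le> C * (e * t) + C * (G * t ^ 4) + C * (cmod (u 0) * (t\<^sup>2 * (t\<^sup>2) powr \<alpha>))"
      using CC e0 t G(1) by (intro add_mono mult_right_mono) auto
    finally show ?thesis unfolding s_def by (simp add: distrib_left)
  qed
  then show ?thesis using CC(4) by blast
qed

text \<open>Here \<open>t = s\<^bsup>-1/2\<^esup>\<close>; \<open>a\<close>, \<open>e\<close> and \<open>G\<close> stand for \<open>|u(0)|\<close>, the distance of \<open>u\<close> to \<open>v\<close> and the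
  Lipschitz constant of \<open>u\<close>.\<close>

definition "total_error t a e G = a * ((t\<^sup>2) powr \<alpha> + t) + e / t + G * t\<^sup>2 + t"

text \<open>The main term is of order t^2 = 1/s, and every other term is at most a constant times
  t^2 times \<open>total_error\<close>, so t^2 can be divided out at the end. The constant is
  uniform in u, e and G, because u will run through the Herglotz waves.\<close>

lemma corner_estimate: "\<exists>C\<ge>0. \<forall>t u e G. 0 < t \<longrightarrow> t \<le> 1 \<longrightarrow> C_diff (Suc 0) u \<longrightarrow> H1_norm S (\<lambda>x. v x - u x) \<le> e \<longrightarrow>
    0 \<le> G \<longrightarrow> (\<forall>x. cmod (u x - u 0) \<le> G * norm x) \<longrightarrow>
    cmod (\<eta> 0) * cmod ray_coeff * cmod (u 0) \<le> C * total_error t (cmod (u 0)) e G"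
proof -
  obtain C1 where C1: "C1 \<ge> 0" "\<And>t. 0 < t \<Longrightarrow> t \<le> 1 \<Longrightarrow> cmod (LINT x|lebesgue_on \<Omega>. (v x - w x) * laplace (phi (inverse (t\<^sup>2))) x) \<le> C1 * t ^ 4"
    using laplace_term by blast
  obtain C2 where C2: "C2 \<ge> 0" "\<And>t. 0 < t \<Longrightarrow> t \<le> 1 \<Longrightarrow> cmod (LINT x|lebesgue_on \<Omega>. (1 + V x) * w x * phi (inverse (t\<^sup>2)) x) \<le> C2 * t ^ 3"
    using source_term by blast
  obtain C3 where C3: "C3 \<ge> 0" "\<And>t u e G. 0 < t \<Longrightarrow> t \<le> 1 \<Longrightarrow> C_diff (Suc 0) u \<Longrightarrow> H1_norm S (\<lambda>x. v x - u x) \<le> e \<Longrightarrow> 0 \<le> G \<Longrightarrow> \<forall>x. cmod (u x - u 0) \<le> G * norm x \<Longrightarrow>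
    cmod (LINT x|lebesgue_on \<Omega>. v x * phi (inverse (t\<^sup>2)) x) \<le> C3 * (e * t + G * t ^ 4 + cmod (u 0) * t ^ 3)"
    using volume_term by blast
  obtain C4 where C4: "C4 \<ge> 0" "\<And>t u e G. 0 < t \<Longrightarrow> t \<le> 1 \<Longrightarrow> C_diff (Suc 0) u \<Longrightarrow> H1_norm S (\<lambda>x. v x - u x) \<le> e \<Longrightarrow> 0 \<le> G \<Longrightarrow> \<forall>x. cmod (u x - u 0) \<le> G * norm x \<Longrightarrow>
    cmod ((LINT x|M. \<eta> x * \<tau> x * phi (inverse (t\<^sup>2)) x) - \<eta> 0 * u 0 * (LINT x|M. phi (inverse (t\<^sup>2)) x)) \<le>
      C4 * (e * t + G * t ^ 4 + cmod (u 0) * (t\<^sup>2 * (t\<^sup>2) powr \<alpha>))"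
    using boundary_term by blast
  obtain C5 where C5: "C5 \<ge> 0" "\<And>s. s \<ge> 1 \<Longrightarrow> cmod ((LINT x|M. phi s x) - ray_coeff / of_real s) \<le> C5 / s\<^sup>2"
    using phi_M_integral by blast
  define C where "C = C1 + k\<^sup>2 * C2 + k\<^sup>2 * C3 + C4 + cmod (\<eta> 0) * C5"
  have "cmod (\<eta> 0) * cmod ray_coeff * cmod (u 0) \<le> C * total_error t (cmod (u 0)) e G"
    if t: "0 < t" "t \<le> 1" and u: "C_diff (Suc 0) u" and e: "H1_norm S (\<lambda>x. v x - u x) \<le> e" and G: "0 \<le> G" "\<forall>x. cmod (u x - u 0) \<le> G * norm x" for t u e G
  proof -
    define s where "s = inverse (t\<^sup>2)"
    define Q where "Q = (LINT x|M. phi s x)"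
    define N where "N = (LINT x|M. \<eta> x * \<tau> x * phi s x)"
    define I1 where "I1 = (LINT x|lebesgue_on \<Omega>. (v x - w x) * laplace (phi s) x)"
    define I2 where "I2 = (LINT x|lebesgue_on \<Omega>. (1 + V x) * w x * phi s x)"
    define I3 where "I3 = (LINT x|lebesgue_on \<Omega>. v x * phi s x)"
    define E where "E = total_error t (cmod (u 0)) e G"
    have s: "s \<ge> 1" using inverse_sq_ge_1[OF t] by (simp add: s_def)
    have e0: "0 \<le> e" using H1_norm_nonneg e order_trans by blast
    have nn: "0 \<le> cmod (u 0) * (t\<^sup>2) powr \<alpha>" "0 \<le> cmod (u 0) * t" "0 \<le> e / t" "0 \<le> G * t\<^sup>2" "0 \<le> t"
      using t e0 G(1) by auto
    have E: "E = cmod (u 0) * (t\<^sup>2) powr \<alpha> + cmod (u 0) * t + e / t + G * t\<^sup>2 + t" by (simp add: E_def total_error_def distrib_left)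
    have q: "t ^ 3 = t\<^sup>2 * t" "t ^ 4 = t\<^sup>2 * t\<^sup>2" "e * t = t\<^sup>2 * (e / t)" using t by (simp_all add: eval_nat_numeral)
    have t21: "t\<^sup>2 \<le> t" using t power_decreasing[of 1 2 t] by simp
    have b1: "cmod I1 \<le> C1 * (t\<^sup>2 * E)"
    proof -
      have "t ^ 4 \<le> t\<^sup>2 * E" unfolding q using nn t21 E by (intro mult_left_mono) (linarith, simp)
      then show ?thesis using C1(2)[OF t] C1(1) unfolding I1_def s_def by (meson mult_left_mono order_trans)
    qed
    have b2: "cmod I2 \<le> C2 * (t\<^sup>2 * E)"
    proof -
      have "t ^ 3 \<le> t\<^sup>2 * E" unfolding q using nn E by (intro mult_left_mono) (linarith, simp)
      then show ?thesis using C2(2)[OF t] C2(1) unfolding I2_def s_def by (meson mult_left_mono order_trans)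
    qed
    have b3: "cmod I3 \<le> C3 * (t\<^sup>2 * E)"
    proof -
      have "e * t + G * t ^ 4 + cmod (u 0) * t ^ 3 = t\<^sup>2 * (e / t + G * t\<^sup>2 + cmod (u 0) * t)" unfolding q by (simp add: algebra_simps)
      also have "\<dots> \<le> t\<^sup>2 * E" using nn E by (intro mult_left_mono) (linarith, simp)
      finally show ?thesis using C3(2)[OF t u e G] C3(1) unfolding I3_def s_def by (meson mult_left_mono order_trans)
    qed
    have b4: "cmod (N - \<eta> 0 * u 0 * Q) \<le> C4 * (t\<^sup>2 * E)"
    proof -
      have "e * t + G * t ^ 4 + cmod (u 0) * (t\<^sup>2 * (t\<^sup>2) powr \<alpha>) = t\<^sup>2 * (e / t + G * t\<^sup>2 + cmod (u 0) * (t\<^sup>2) powr \<alpha>)"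
        unfolding q by (simp add: algebra_simps)
      also have "\<dots> \<le> t\<^sup>2 * E" using nn E by (intro mult_left_mono) (linarith, simp)
      finally show ?thesis using C4(2)[OF t u e G] C4(1) unfolding N_def Q_def s_def by (meson mult_left_mono order_trans)
    qed
    have b5: "cmod (\<eta> 0 * u 0 * (Q - ray_coeff * of_real (t\<^sup>2))) \<le> cmod (\<eta> 0) * C5 * (t\<^sup>2 * E)"
    proof -
      have "C5 / s\<^sup>2 = C5 * t ^ 4" by (simp add: s_def divide_inverse power_inverse flip: power_mult)
      then have c: "cmod (Q - ray_coeff * of_real (t\<^sup>2)) \<le> C5 * t ^ 4"
        using C5(2)[OF s] unfolding \<open>C5 / s\<^sup>2 = C5 * t ^ 4\<close> by (simp add: Q_def s_def divide_inverse)
      have "cmod (u 0) * t ^ 4 \<le> t\<^sup>2 * E"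
      proof -
        have "cmod (u 0) * t ^ 4 = t\<^sup>2 * (cmod (u 0) * t\<^sup>2)" unfolding q by simp
        also have "\<dots> \<le> t\<^sup>2 * E" using nn E mult_left_mono[OF t21 norm_ge_zero[of "u 0"]] by (intro mult_left_mono) (linarith, simp)
        finally show ?thesis .
      qed
      then have "cmod (\<eta> 0) * C5 * (cmod (u 0) * t ^ 4) \<le> cmod (\<eta> 0) * C5 * (t\<^sup>2 * E)" using C5(1) by (intro mult_left_mono) auto
      moreover have "cmod (\<eta> 0) * cmod (u 0) * cmod (Q - ray_coeff * of_real (t\<^sup>2)) \<le> cmod (\<eta> 0) * cmod (u 0) * (C5 * t ^ 4)"
        by (rule mult_left_mono[OF c]) simp
      ultimately show ?thesis by (simp add: norm_mult mult_ac)
    qed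
    have "N = I1 + of_real (k\<^sup>2) * I3 - of_real (k\<^sup>2) * I2"
      unfolding N_def I1_def I2_def I3_def by (rule boundary_identity[OF test_function_phi])
    then have "\<eta> 0 * u 0 * (ray_coeff * of_real (t\<^sup>2)) = I1 + of_real (k\<^sup>2) * I3 - of_real (k\<^sup>2) * I2 - (N - \<eta> 0 * u 0 * Q) - \<eta> 0 * u 0 * (Q - ray_coeff * of_real (t\<^sup>2))"
      by (simp add: algebra_simps)
    also have "cmod \<dots> \<le> C1 * (t\<^sup>2 * E) + k\<^sup>2 * (C3 * (t\<^sup>2 * E)) + k\<^sup>2 * (C2 * (t\<^sup>2 * E)) + C4 * (t\<^sup>2 * E) + cmod (\<eta> 0) * C5 * (t\<^sup>2 * E)"
    proof -
      have "cmod (of_real (k\<^sup>2) * I3) \<le> k\<^sup>2 * (C3 * (t\<^sup>2 * E))" "cmod (of_real (k\<^sup>2) * I2) \<le> k\<^sup>2 * (C2 * (t\<^sup>2 * E))"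
        using b3 b2 by (auto simp: norm_mult norm_power intro!: mult_left_mono)
      then show ?thesis
        by (intro norm_triangle_le_diff norm_triangle_le add_mono b1 b4 b5 order_trans[OF norm_triangle_ineq4] order_trans[OF norm_triangle_ineq])
    qed
    also have "\<dots> = t\<^sup>2 * (C * E)" by (simp add: C_def algebra_simps)
    also have "cmod (\<eta> 0 * u 0 * (ray_coeff * of_real (t\<^sup>2))) = t\<^sup>2 * (cmod (\<eta> 0) * cmod ray_coeff * cmod (u 0))"
      by (simp add: norm_mult norm_power mult_ac)
    finally show ?thesis using t by (simp add: E_def)
  qed
  moreover have "0 \<le> C" using C1(1) C2(1) C3(1) C4(1) C5(1) by (simp add: C_def)
  ultimately show ?thesis by blast
qed

end

section \<open>Mean values over small discs\<close>

context corner_domain begin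

text \<open>The shift \<open>dv\<close> is a point of the open sector; a cone contains its
  multiples, so it can be scaled into the unit disc.\<close>

lemma W_nonempty: "ball 0 1 \<inter> W \<noteq> {}"
proof -
  have dv: "dv \<in> W" using W_iff[of dv] by (auto simp: corner_sign_def split: if_splits)
  define r where "r = inverse (2 * (1 + norm dv))"
  have r: "0 < r" by (simp add: r_def add_pos_nonneg)
  have "norm (r *\<^sub>R dv) < 1" by (simp add: r_def field_simps add_pos_nonneg)
  moreover have "r *\<^sub>R dv \<in> W" using dv W_scale[OF r] by simp
  ultimately show ?thesis by (auto simp del: norm_scaleR)
qed

text \<open>The sector is a cone, so its area in a disc scales like \<rho>^2. The constant is
  squared because Cauchy-Schwarz takes the root of the area.\<close>

lemma area_W: "\<exists>c>0. \<forall>\<rho>>0. measure lebesgue (ball 0 \<rho> \<inter> W) = (c * \<rho>)\<^sup>2"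
proof -
  define m where "m = measure lebesgue (ball 0 1 \<inter> W)"
  have o: "open (ball 0 1 \<inter> W)" using open_W by auto
  have "ball 0 1 \<inter> W \<in> lmeasurable"
    using o by (intro bounded_set_imp_lmeasurable bounded_Int) (auto simp: lborelD)
  then have "m \<noteq> 0" using open_not_negligible[OF o W_nonempty] negligible_iff_measure0 unfolding m_def by blast
  then have m: "m > 0" unfolding m_def using measure_nonneg[of lebesgue "ball 0 1 \<inter> W"] by linarith
  have "measure lebesgue (ball 0 \<rho> \<inter> W) = (sqrt m * \<rho>)\<^sup>2" if \<rho>: "\<rho> > 0" for \<rho>
  proof -
    have "ball 0 \<rho> \<inter> W = (\<lambda>x. \<rho> *\<^sub>R x + 0) ` (ball 0 1 \<inter> W)" (is "?A = ?B")
    proof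
      show "?A \<subseteq> ?B"
      proof
        fix x assume x: "x \<in> ?A"
        then have "inverse \<rho> *\<^sub>R x \<in> ball 0 1 \<inter> W" using \<rho> W_scale[of "inverse \<rho>" x] by (auto simp: field_simps)
        moreover have "x = \<rho> *\<^sub>R (inverse \<rho> *\<^sub>R x) + 0" using \<rho> by simp
        ultimately show "x \<in> ?B" by (rule rev_image_eqI)
      qed
      show "?B \<subseteq> ?A" using \<rho> W_scale[OF \<rho>] by (auto simp: mult_less_cancel_left1)
    qed
    then have "measure lebesgue (ball 0 \<rho> \<inter> W) = \<bar>\<rho>\<bar> ^ DIM(real^2) * m"
      unfolding m_def by (simp only: measure_lebesgue_affine)
    then show ?thesis using m by (simp add: power_mult_distrib)
  qed
  then show ?thesis using m by (intro exI[of _ "sqrt m"]) simp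
qed

end

context corner_eigenfunctions begin

text \<open>Cauchy-Schwarz on the small sector bounds the integral of |v - u| by e times the root of
  the area; dividing by the area leaves e / (c \<rho>).\<close>

lemma mean_bound:
  assumes c: "c > 0" "\<And>\<rho>. \<rho> > 0 \<Longrightarrow> measure lebesgue (ball 0 \<rho> \<inter> W) = (c * \<rho>)\<^sup>2" and \<rho>: "0 < \<rho>" "\<rho> \<le> h"
    and u: "C_diff (Suc 0) u" and e: "H1_norm S (\<lambda>x. v x - u x) \<le> e" and G: "0 \<le> G" "\<And>x. cmod (u x - u 0) \<le> G * norm x"
  shows "(1 / measure lebesgue (ball 0 \<rho> \<inter> \<Omega>)) * (LINT x|lebesgue_on (ball 0 \<rho> \<inter> \<Omega>). cmod (v x)) \<le> e / (c * \<rho>) + G * \<rho> + cmod (u 0)"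
proof -
  define A where "A = ball 0 \<rho> \<inter> \<Omega>"
  have b: "ball 0 \<rho> \<subseteq> ball (0::real^2) h" by (rule subset_ball[OF \<rho>(2)])
  have "A = ball 0 \<rho> \<inter> (\<Omega> \<inter> ball 0 h)" unfolding A_def using b by blast
  then have A: "A = ball 0 \<rho> \<inter> W" unfolding \<Omega>_ball using b by blast
  have AS: "A \<subseteq> S" unfolding A S_def using b by blast
  have Am: "A \<in> sets lebesgue" using open_W by (auto simp: A lborelD)
  have Ab: "bounded A" by (simp add: A bounded_Int)
  have Al: "A \<in> lmeasurable" by (rule bounded_set_imp_lmeasurable[OF Ab Am])
  have mA: "measure lebesgue A = (c * \<rho>)\<^sup>2" unfolding A by (rule c(2)[OF \<rho>(1)])
  have vS: "square_integrable (lebesgue_on S) (\<lambda>x. v x - u x)"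
  proof (rule square_integrable_diff(1))
    show "square_integrable (lebesgue_on S) v" using trace_v by (intro set_integral_mono_S_\<Omega>(1)) (simp add: has_trace_def in_H1_def)
    show "square_integrable (lebesgue_on S) u" by (rule square_integrable_continuous[OF C_diff_continuous[OF u] S_simps(7,5)])
  qed
  have iS: "integrable (lebesgue_on S) (\<lambda>x. (cmod (v x - u x))\<^sup>2)" using vS by (simp add: square_integrable_def)
  have iA: "integrable (lebesgue_on A) (\<lambda>x. (cmod (v x - u x))\<^sup>2)" by (rule integrable_lebesgue_on_mono[OF iS Am S_simps(5) AS])
  have vA: "square_integrable (lebesgue_on A) (\<lambda>x. v x - u x)"
    unfolding square_integrable_def
  proof (intro conjI iA)
    show "(\<lambda>x. v x - u x) \<in> borel_measurable (lebesgue_on A)"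
      using vS by (intro measurable_restrict_mono[OF _ AS]) (simp add: square_integrable_def)
  qed
  have oA: "square_integrable (lebesgue_on A) (\<lambda>x. 1)" by (rule square_integrable_continuous[OF _ Ab Am]) simp
  have "(LINT x|lebesgue_on A. (cmod (v x - u x))\<^sup>2) \<le> (LINT x|lebesgue_on S. (cmod (v x - u x))\<^sup>2)"
    unfolding integral_lebesgue_on_eq[OF Am] integral_lebesgue_on_eq[OF S_simps(5)]
  proof (rule integral_mono[OF integrable_lebesgue_on_iff[OF Am, THEN iffD1, OF iA] integrable_lebesgue_on_iff[OF S_simps(5), THEN iffD1, OF iS]])
    show "indicator A x *\<^sub>R (cmod (v x - u x))\<^sup>2 \<le> indicator S x *\<^sub>R (cmod (v x - u x))\<^sup>2" for x
      using AS by (auto simp: indicator_def)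
  qed
  then have "L2_norm (lebesgue_on A) (\<lambda>x. v x - u x) \<le> L2_norm (lebesgue_on S) (\<lambda>x. v x - u x)"
    unfolding L2_norm_def by (rule real_sqrt_le_mono)
  also have "\<dots> \<le> e" by (rule order_trans[OF L2_le_H1(1) e])
  finally have L: "L2_norm (lebesgue_on A) (\<lambda>x. v x - u x) \<le> e" .
  have c1: "integral\<^sup>L (lebesgue_on A) (\<lambda>x. r) = r * (c * \<rho>)\<^sup>2" for r :: real
    using Am by (simp add: measure_restrict_space mA space_restrict_space mult.commute)
  have L1: "L2_norm (lebesgue_on A) (\<lambda>x. 1) = c * \<rho>" unfolding L2_norm_def using c1[of 1] c \<rho> by simp
  have i1: "integrable (lebesgue_on A) (\<lambda>x. cmod (v x - u x))" using Cauchy_Schwarz_L2(2)[OF vA oA] by simp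
  have "(LINT x|lebesgue_on A. cmod (v x - u x)) \<le> L2_norm (lebesgue_on A) (\<lambda>x. v x - u x) * (c * \<rho>)"
    using Cauchy_Schwarz_L2(1)[OF vA oA] by (simp add: L1)
  also have "\<dots> \<le> e * (c * \<rho>)" using L c \<rho> by (intro mult_right_mono) auto
  finally have I1: "(LINT x|lebesgue_on A. cmod (v x - u x)) \<le> e * (c * \<rho>)" .
  have ic: "integrable (lebesgue_on A) (\<lambda>x. r)" for r :: real
    using integrable_lebesgue_on_iff[OF Am, of "\<lambda>x. r"] Al by (simp add: lmeasurable_iff_integrable)
  have "(LINT x|lebesgue_on A. cmod (v x)) \<le> (LINT x|lebesgue_on A. cmod (v x - u x) + (G * \<rho> + cmod (u 0)))"
  proof (rule integral_mono_AE')
    show "integrable (lebesgue_on A) (\<lambda>x. cmod (v x - u x) + (G * \<rho> + cmod (u 0)))"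
      by (rule Bochner_Integration.integrable_add[OF i1 ic])
    have "cmod (v x) \<le> cmod (v x - u x) + (G * \<rho> + cmod (u 0))" if x: "x \<in> A" for x
    proof -
      have "cmod (v x) \<le> cmod (v x - u x) + (cmod (u x - u 0) + cmod (u 0))"
        using norm_triangle_ineq[of "v x - u x" "u x"] norm_triangle_ineq[of "u x - u 0" "u 0"] by simp
      moreover have "cmod (u x - u 0) \<le> G * \<rho>"
        using G(2)[of x] mult_left_mono[of "norm x" \<rho> G] G(1) x by (auto simp: A)
      ultimately show ?thesis by linarith
    qed
    then show "AE x in lebesgue_on A. cmod (v x) \<le> cmod (v x - u x) + (G * \<rho> + cmod (u 0))" by (intro AE_I2) simp
    show "AE x in lebesgue_on A. 0 \<le> cmod (v x - u x) + (G * \<rho> + cmod (u 0))"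
      using G(1) \<rho> by (intro AE_I2) simp
  qed
  also have "\<dots> = (LINT x|lebesgue_on A. cmod (v x - u x)) + (G * \<rho> + cmod (u 0)) * (c * \<rho>)\<^sup>2"
    unfolding Bochner_Integration.integral_add[OF i1 ic] c1 ..
  also have "\<dots> \<le> e * (c * \<rho>) + (G * \<rho> + cmod (u 0)) * (c * \<rho>)\<^sup>2" using I1 by simp
  finally have "1 / (c * \<rho>)\<^sup>2 * (LINT x|lebesgue_on A. cmod (v x)) \<le> 1 / (c * \<rho>)\<^sup>2 * (e * (c * \<rho>) + (G * \<rho> + cmod (u 0)) * (c * \<rho>)\<^sup>2)"
    by (intro mult_left_mono) auto
  also have "\<dots> = e / (c * \<rho>) + G * \<rho> + cmod (u 0)"
    using c(1) \<rho>(1) by (simp add: distrib_left power2_eq_square)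
  finally show ?thesis unfolding A_def[symmetric] mA .
qed

end

lemma powr_tendsto_0: "c < 0 \<Longrightarrow> (\<lambda>j. real j powr c) \<longlonglongrightarrow> 0"
  by (rule tendsto_neg_powr[OF _ filterlim_real_sequentially])

section \<open>Passage to the limit\<close>

context corner_vanishing begin

lemma mean_tendsto_0:
  fixes g :: "nat \<Rightarrow> real^2 \<Rightarrow> complex" and C \<Upsilon> \<kappa> :: real
  assumes C: "C > 0" "\<Upsilon> > 0" "\<kappa> < 1" and g: "\<And>j. j \<ge> 1 \<Longrightarrow> square_integrable circle_measure (g j)"
    and e: "\<And>j. j \<ge> 1 \<Longrightarrow> H1_norm S (\<lambda>x. v x - herglotz k (g j) x) \<le> real j powr (-1 - \<Upsilon>)"
    and gj: "\<And>j. j \<ge> 1 \<Longrightarrow> L2_norm circle_measure (g j) \<le> C * real j powr \<kappa>" and \<eta>0: "\<eta> 0 \<noteq> 0"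
  shows "((\<lambda>\<rho>. (1 / measure lebesgue (ball 0 \<rho> \<inter> \<Omega>)) *
                (LINT x|lebesgue_on (ball 0 \<rho> \<inter> \<Omega>). cmod (v x))) \<longlongrightarrow> 0) (at_right 0)"
proof -
  define D where "D = k * (L2_norm circle_measure (\<lambda>_. 1) * C)"
  have D0: "0 \<le> D" unfolding D_def using k C(1) L2_norm_nonneg by (intro mult_nonneg_nonneg) auto
  define u where "u j = herglotz k (g j)" for j
  define a where "a j = cmod (u j 0)" for j
  have ig: "integrable circle_measure (g j)" if "j \<ge> 1" for j by (rule circle_L2_imp_L1(1)[OF g[OF that]])
  have u: "C_diff (Suc 0) (u j)" if "j \<ge> 1" for j unfolding u_def by (rule C_diff_herglotz[OF k ig[OF that]])
  have e': "H1_norm S (\<lambda>x. v x - u j x) \<le> real j powr (-1 - \<Upsilon>)" if "j \<ge> 1" for j using e[OF that] by (simp add: u_def)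
  have G: "cmod (u j x - u j 0) \<le> D * real j powr \<kappa> * norm x" if j: "j \<ge> 1" for j x
  proof -
    have "cmod (u j x - u j 0) \<le> k * norm (x - 0) * (LINT \<xi>|circle_measure. cmod (g j \<xi>))"
      unfolding u_def by (rule herglotz_lipschitz[OF k ig[OF j]])
    also have "\<dots> \<le> k * norm (x - 0) * (L2_norm circle_measure (\<lambda>_. 1) * (C * real j powr \<kappa>))"
      using k gj[OF j] by (intro mult_left_mono order_trans[OF circle_L2_imp_L1(2)[OF g[OF j]]] L2_norm_nonneg) auto
    finally show ?thesis by (simp add: D_def mult_ac)
  qed
  have Gj: "0 \<le> D * real j powr \<kappa>" for j using D0 by simp
  obtain K where K: "K \<ge> 0" "\<And>t u e G. 0 < t \<Longrightarrow> t \<le> 1 \<Longrightarrow> C_diff (Suc 0) u \<Longrightarrow> H1_norm S (\<lambda>x. v x - u x) \<le> e \<Longrightarrow>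
    0 \<le> G \<Longrightarrow> \<forall>x. cmod (u x - u 0) \<le> G * norm x \<Longrightarrow> cmod (\<eta> 0) * cmod ray_coeff * cmod (u 0) \<le> K * total_error t (cmod (u 0)) e G"
    using corner_estimate by blast
  define k0 where "k0 = cmod (\<eta> 0) * cmod ray_coeff"
  have k0: "k0 > 0" using \<eta>0 ray_coeff_nz by (simp add: k0_def ray_coeff_def)
  \<comment> \<open>\<delta> collects the coefficient of \<open>a j\<close> in the error and
    \<gamma> everything else; the exponents are those of \<open>total_error\<close> at t = j^(-1/2),
    that is, s = j.\<close>
  define \<delta> where "\<delta> j = K * (real j powr (-\<alpha>) + real j powr (-1/2))" for j :: nat
  define \<gamma> where "\<gamma> j = K * (real j powr (-1/2 - \<Upsilon>) + D * real j powr (\<kappa> - 1) + real j powr (-1/2))" for j :: nat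
  have main: "k0 * a j \<le> \<delta> j * a j + \<gamma> j" if j: "j \<ge> 1" for j
  proof -
    define t where "t = real j powr (-1/2)"
    have t: "0 < t" "t \<le> 1" using j powr_mono[of "-1/2" 0 "real j"] by (auto simp: t_def)
    have t2: "t\<^sup>2 = real j powr (-1)" by (simp add: t_def power2_eq_square flip: powr_add)
    have ta: "(t\<^sup>2) powr \<alpha> = real j powr (-\<alpha>)" unfolding t2 powr_powr by simp
    have et: "real j powr (-1 - \<Upsilon>) / t = real j powr (-1/2 - \<Upsilon>)" unfolding t_def by (simp flip: powr_diff)
    have Gt: "D * real j powr \<kappa> * t\<^sup>2 = D * real j powr (\<kappa> - 1)" unfolding t2 by (simp add: powr_diff powr_minus divide_inverse)
    have "\<forall>x. cmod (u j x - u j 0) \<le> D * real j powr \<kappa> * norm x" using G[OF j] by blast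
    from K(2)[OF t u[OF j] e'[OF j] Gj this]
    have "k0 * a j \<le> K * total_error t (a j) (real j powr (-1 - \<Upsilon>)) (D * real j powr \<kappa>)" by (simp add: k0_def a_def)
    also have "\<dots> = \<delta> j * a j + \<gamma> j" unfolding total_error_def ta et Gt by (simp add: \<delta>_def \<gamma>_def t_def algebra_simps)
    finally show ?thesis .
  qed
  have \<delta>: "\<delta> \<longlonglongrightarrow> 0"
  proof -
    have "\<delta> \<longlonglongrightarrow> K * (0 + 0)" unfolding \<delta>_def using \<alpha> by (intro tendsto_intros powr_tendsto_0) auto
    then show ?thesis by simp
  qed
  have \<gamma>: "\<gamma> \<longlonglongrightarrow> 0"
  proof -
    have "\<gamma> \<longlonglongrightarrow> K * (0 + D * 0 + 0)" unfolding \<gamma>_def using C by (intro tendsto_intros powr_tendsto_0) auto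
    then show ?thesis by simp
  qed
  have a: "a \<longlonglongrightarrow> 0"
  proof (rule tendsto_sandwich[OF _ _ tendsto_const])
    show "\<forall>\<^sub>F j in sequentially. 0 \<le> a j" by (simp add: a_def)
    have "\<forall>\<^sub>F j in sequentially. \<delta> j < k0 / 2" by (rule order_tendstoD(2)[OF \<delta>]) (use k0 in simp)
    then show "\<forall>\<^sub>F j in sequentially. a j \<le> 2 / k0 * \<gamma> j" using eventually_ge_at_top[of 1]
    proof eventually_elim
      case (elim j)
      \<comment> \<open>Absorption: although \<open>a j\<close> is not known to be bounded, its
        coefficient on the right is eventually below half of k0.\<close>
      have "\<delta> j * a j \<le> k0 / 2 * a j" using elim(1) by (intro mult_right_mono) (auto simp: a_def)
      then have "k0 * a j \<le> 2 * \<gamma> j" using main[OF elim(2)] by linarith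
      then show ?case using k0 by (simp add: field_simps)
    qed
    show "(\<lambda>j. 2 / k0 * \<gamma> j) \<longlonglongrightarrow> 0" using tendsto_mult_left[OF \<gamma>, of "2 / k0"] by simp
  qed
  obtain c where c: "c > 0" "\<And>\<rho>. \<rho> > 0 \<Longrightarrow> measure lebesgue (ball 0 \<rho> \<inter> W) = (c * \<rho>)\<^sup>2" using area_W by blast
  define b where "b j = real j powr (-\<Upsilon>) / c + 2 * D * real j powr (\<kappa> - 1) + a j" for j :: nat
  have "b \<longlonglongrightarrow> 0 / c + 2 * D * 0 + 0" unfolding b_def using C c(1) by (intro tendsto_intros powr_tendsto_0 a) auto
  then have b: "b \<longlonglongrightarrow> 0" by simp
  \<comment> \<open>The least index j with 1/\<rho> \<le> j; for \<rho> \<le> 1 also j \<le>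
    2/\<rho>. The first inequality controls the H^1 error divided by \<rho>, the second the
    Lipschitz constant times \<rho>.\<close>
  define n where "n \<rho> = nat \<lceil>1 / \<rho>\<rceil>" for \<rho> :: real
  have f: "filterlim (\<lambda>\<rho>::real. 1 / \<rho>) at_top (at_right 0)"
    using filterlim_inverse_at_top_right by (simp add: inverse_eq_divide)
  have "filterlim n at_top (at_right 0)" unfolding filterlim_at_top
  proof
    fix N
    have "\<forall>\<^sub>F \<rho>::real in at_right 0. real N \<le> 1 / \<rho>" using f unfolding filterlim_at_top by blast
    then show "\<forall>\<^sub>F \<rho> in at_right 0. N \<le> n \<rho>"
    proof eventually_elim
      case (elim \<rho>)
      then have "real N \<le> real (n \<rho>)" unfolding n_def using real_nat_ceiling_ge order_trans by blast
      then show ?case by simp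
    qed
  qed
  then have bn: "((\<lambda>\<rho>. b (n \<rho>)) \<longlongrightarrow> 0) (at_right 0)" by (rule filterlim_compose[OF b])
  have "\<forall>\<^sub>F \<rho> in at_right 0. (1 / measure lebesgue (ball 0 \<rho> \<inter> \<Omega>)) * (LINT x|lebesgue_on (ball 0 \<rho> \<inter> \<Omega>). cmod (v x)) \<le> b (n \<rho>)"
  proof (rule eventually_mono)
    show "\<forall>\<^sub>F \<rho> in at_right 0. \<rho> \<in> {0<..<min h 1}" by (rule eventually_at_right_real) (use h in simp)
    fix \<rho> :: real assume \<rho>: "\<rho> \<in> {0<..<min h 1}"
    define j where "j = n \<rho>"
    have \<rho>': "0 < \<rho>" "\<rho> \<le> h" "\<rho> \<le> 1" using \<rho> by auto
    have j1: "1 / \<rho> \<le> real j" unfolding j_def n_def by (rule real_nat_ceiling_ge)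
    have "1 \<le> 1 / \<rho>" using \<rho>' by simp
    then have jj: "j \<ge> 1" using j1 by (auto simp flip: of_nat_le_iff)
    have "real j \<le> 1 / \<rho> + 1" unfolding j_def n_def using \<open>1 \<le> 1 / \<rho>\<close> by linarith
    also have "\<dots> \<le> 2 / \<rho>" using \<rho>' by (simp add: field_simps)
    finally have j2: "\<rho> \<le> 2 / real j" using \<rho>' jj by (simp add: field_simps)
    have "(1 / measure lebesgue (ball 0 \<rho> \<inter> \<Omega>)) * (LINT x|lebesgue_on (ball 0 \<rho> \<inter> \<Omega>). cmod (v x))
        \<le> real j powr (-1 - \<Upsilon>) / (c * \<rho>) + D * real j powr \<kappa> * \<rho> + cmod (u j 0)"
      by (rule mean_bound[OF c \<rho>'(1,2) u[OF jj] e'[OF jj] Gj G[OF jj]])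
    also have "\<dots> \<le> b j" unfolding b_def a_def
    proof (intro add_mono order_refl)
      have "real j powr (-1 - \<Upsilon>) / (c * \<rho>) = real j powr (-1 - \<Upsilon>) / c * (1 / \<rho>)" by simp
      also have "\<dots> \<le> real j powr (-1 - \<Upsilon>) / c * real j" using j1 c(1) by (intro mult_left_mono) auto
      also have "\<dots> = real j powr (-\<Upsilon>) / c" using jj by (simp add: powr_diff powr_minus field_simps)
      finally show "real j powr (-1 - \<Upsilon>) / (c * \<rho>) \<le> real j powr (-\<Upsilon>) / c" .
      have "D * real j powr \<kappa> * \<rho> \<le> D * real j powr \<kappa> * (2 / real j)" by (rule mult_left_mono[OF j2 Gj])
      also have "\<dots> = 2 * D * real j powr (\<kappa> - 1)" using jj by (simp add: powr_diff)
      finally show "D * real j powr \<kappa> * \<rho> \<le> 2 * D * real j powr (\<kappa> - 1)" .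
    qed
    finally show "(1 / measure lebesgue (ball 0 \<rho> \<inter> \<Omega>)) * (LINT x|lebesgue_on (ball 0 \<rho> \<inter> \<Omega>). cmod (v x)) \<le> b (n \<rho>)" by (simp add: j_def)
  qed
  then show ?thesis by (intro tendsto_sandwich[OF _ _ tendsto_const bn]) simp_all
qed

end

text \<open>The vertex lies in the closure of both edges, so the two separate Hoelder conditions are
  anchored at the same value \<open>\<eta> 0\<close>.\<close>

lemma holder_corner:
  assumes cor: "corner \<theta>m \<theta>M" and h: "h > 0"
    and M: "holder_on \<alpha> (closure (ray \<theta>M \<inter> ball 0 h)) \<eta>" and m: "holder_on \<alpha> (closure (ray \<theta>m \<inter> ball 0 h)) \<eta>"
  shows "\<exists>C\<ge>0. \<forall>x. x \<in> frontier (corner.W \<theta>m \<theta>M) \<longrightarrow> x \<in> ball 0 h \<longrightarrow> cmod (\<eta> x - \<eta> 0) \<le> C * norm x powr \<alpha>"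
proof -
  interpret corner \<theta>m \<theta>M by (rule cor)
  have one: "\<exists>C\<ge>0. \<forall>r>0. r < h \<longrightarrow> cmod (\<eta> (r *\<^sub>R polar 1 t) - \<eta> 0) \<le> C * r powr \<alpha>"
    if H: "holder_on \<alpha> (closure (ray t \<inter> ball 0 h)) \<eta>" for t
  proof -
    obtain C where C: "\<And>x y. x \<in> closure (ray t \<inter> ball 0 h) \<Longrightarrow> y \<in> closure (ray t \<inter> ball 0 h) \<Longrightarrow> cmod (\<eta> x - \<eta> y) \<le> C * dist x y powr \<alpha>"
      using H unfolding holder_on_def by blast
    have m: "r *\<^sub>R polar 1 t \<in> ray t \<inter> ball 0 h" if "0 < r" "r < h" for r
      using that polar_scale[of r t, symmetric] by (auto simp: ray_def intro!: exI[of _ r])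
    \<comment> \<open>Points of the ray that shrink to the vertex; the factor h / 2 keeps them
      inside the disc.\<close>
    have "(\<lambda>n. (h / 2 * inverse (real (Suc n))) *\<^sub>R polar 1 t) \<longlonglongrightarrow> (h / 2 * 0) *\<^sub>R polar 1 t"
      by (intro tendsto_intros LIMSEQ_inverse_real_of_nat)
    then have l: "(\<lambda>n. (h / 2 * inverse (real (Suc n))) *\<^sub>R polar 1 t) \<longlonglongrightarrow> 0" by simp
    have c: "(h / 2 * inverse (real (Suc n))) *\<^sub>R polar 1 t \<in> closure (ray t \<inter> ball 0 h)" for n
    proof -
      have "h / 2 * inverse (real (Suc n)) \<le> h / 2 * 1" using h by (intro mult_left_mono) (auto simp: inverse_le_1_iff)
      then have "h / 2 * inverse (real (Suc n)) < h" using h by linarith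
      moreover have "0 < h / 2 * inverse (real (Suc n))" using h by simp
      ultimately show ?thesis by (intro subsetD[OF closure_subset] m)
    qed
    have z: "0 \<in> closure (ray t \<inter> ball 0 h)" by (rule closed_sequentially[OF closed_closure _ l]) (use c in blast)
    have "cmod (\<eta> (r *\<^sub>R polar 1 t) - \<eta> 0) \<le> max C 0 * r powr \<alpha>" if r: "0 < r" "r < h" for r
    proof -
      have "r *\<^sub>R polar 1 t \<in> closure (ray t \<inter> ball 0 h)" by (rule subsetD[OF closure_subset m[OF r]])
      from C[OF this z] have "cmod (\<eta> (r *\<^sub>R polar 1 t) - \<eta> 0) \<le> C * r powr \<alpha>" using r by simp
      also have "\<dots> \<le> max C 0 * r powr \<alpha>" by (intro mult_right_mono) auto
      finally show ?thesis .
    qed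
    then show ?thesis by (intro exI[of _ "max C 0"]) auto
  qed
  obtain C1 C2 where C: "C1 \<ge> 0" "C2 \<ge> 0" and
    1: "\<And>r. r > 0 \<Longrightarrow> r < h \<Longrightarrow> cmod (\<eta> (r *\<^sub>R va) - \<eta> 0) \<le> C1 * r powr \<alpha>" and
    2: "\<And>r. r > 0 \<Longrightarrow> r < h \<Longrightarrow> cmod (\<eta> (r *\<^sub>R vb) - \<eta> 0) \<le> C2 * r powr \<alpha>"
    using one[OF M] one[OF m] unfolding va_def vb_def by blast
  have le: "C1 * r powr \<alpha> \<le> (C1 + C2) * r powr \<alpha>" "C2 * r powr \<alpha> \<le> (C1 + C2) * r powr \<alpha>" for r
    using C by (auto intro!: mult_right_mono)
  have "cmod (\<eta> x - \<eta> 0) \<le> (C1 + C2) * norm x powr \<alpha>" if x: "x \<in> frontier W" "x \<in> ball 0 h" for x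
  proof (cases "x = 0")
    case False
    from x(1) consider r where "r \<ge> 0" "x = r *\<^sub>R va" | r where "r > 0" "x = r *\<^sub>R vb" unfolding frontier_W_rays by blast
    then show ?thesis
    proof cases
      case 1
      then have "0 < r" "r < h" using False x(2) by auto
      then show ?thesis using order_trans[OF \<open>\<And>r. r > 0 \<Longrightarrow> r < h \<Longrightarrow> cmod (\<eta> (r *\<^sub>R va) - \<eta> 0) \<le> C1 * r powr \<alpha>\<close> le(1)] 1 by simp
    next
      case 2
      then have "0 < r" "r < h" using x(2) by auto
      then show ?thesis using order_trans[OF \<open>\<And>r. r > 0 \<Longrightarrow> r < h \<Longrightarrow> cmod (\<eta> (r *\<^sub>R vb) - \<eta> 0) \<le> C2 * r powr \<alpha>\<close> le(2)] 2 by simp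
    qed
  qed simp
  then show ?thesis using C by (intro exI[of _ "C1 + C2"]) simp
qed

theorem theorem2p1:
  fixes \<Omega> :: "(real^2) set" and V \<eta> v w :: "real^2 \<Rightarrow> complex"
    and k h \<alpha> \<theta>m \<theta>M C \<Upsilon> \<kappa> :: real and g :: "nat \<Rightarrow> real^2 \<Rightarrow> complex"
  assumes "bounded_Lipschitz_domain \<Omega>"
    and "ess_bounded (lebesgue_on \<Omega>) V"
    and "ess_bounded (boundary_measure \<Omega>) \<eta>"
    and "k > 0"
    and "conductive_transmission_eigenfunctions \<Omega> V \<eta> k v w"
    and "0 \<in> frontier \<Omega>" and "h > 0" and "\<Omega> \<inter> ball 0 h = sector_disc \<theta>m \<theta>M h"
    and "0 < \<alpha>" and "\<alpha> < 1"
    and "\<exists>f. holder_on \<alpha> (closure (sector_disc \<theta>m \<theta>M h)) f \<and>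
             (AE x in lebesgue_on (sector_disc \<theta>m \<theta>M h). f x = (1 + V x) * w x)"
    and "holder_on \<alpha> (closure (ray \<theta>M \<inter> ball 0 h)) \<eta>"
    and "holder_on \<alpha> (closure (ray \<theta>m \<inter> ball 0 h)) \<eta>"
    and "in_H2 (interior (sector_disc \<theta>m \<theta>M h - sector_disc \<theta>m \<theta>M (h/2))) (\<lambda>x. v x - w x)"
    and "C > 0" and "\<Upsilon> > 0" and "0 < \<kappa>" and "\<kappa> < 1"
    and "\<And>j. j \<ge> 1 \<Longrightarrow> square_integrable circle_measure (g j)"
    and "\<And>j. j \<ge> 1 \<Longrightarrow> H1_norm (sector_disc \<theta>m \<theta>M h) (\<lambda>x. v x - herglotz k (g j) x) \<le> real j powr (-1 - \<Upsilon>)"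
    and "\<And>j. j \<ge> 1 \<Longrightarrow> L2_norm circle_measure (g j) \<le> C * real j powr \<kappa>"
    and "\<eta> 0 \<noteq> 0"
    and "-pi < \<theta>m" and "\<theta>m < \<theta>M" and "\<theta>M < pi" and "\<theta>M - \<theta>m \<noteq> pi"
  shows "((\<lambda>\<rho>. (1 / measure lebesgue (ball 0 \<rho> \<inter> \<Omega>)) *
                (LINT x|lebesgue_on (ball 0 \<rho> \<inter> \<Omega>). cmod (v x))) \<longlongrightarrow> 0) (at_right 0)"
proof -
  note Lip = assms(1) and eta = assms(3) and eig = assms(5) and h = assms(7) and corner_at_0 = assms(8)
    and \<alpha> = assms(9,10) and qw = assms(11)
  have cor: "corner \<theta>m \<theta>M" by unfold_locales fact+
  have W: "corner.W \<theta>m \<theta>M = sector \<theta>m \<theta>M" by (rule corner.W_def[OF cor])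
  obtain \<tau> where \<tau>: "has_trace \<Omega> v \<tau>" "has_trace \<Omega> w \<tau>" "\<And>\<phi> \<psi>. has_trace \<Omega> \<phi> \<psi> \<Longrightarrow>
           normal_deriv_pairing \<Omega> v \<phi> + (LINT x|boundary_measure \<Omega>. \<eta> x * \<tau> x * \<psi> x) = normal_deriv_pairing \<Omega> w \<phi>"
    using eig unfolding conductive_transmission_eigenfunctions_def by blast
  \<comment> \<open>Two stages: the set \<open>E.S\<close> has to be available before the bounds
    that parametrise the second locale can be obtained.\<close>
  interpret E: corner_eigenfunctions \<theta>m \<theta>M h \<Omega> V \<eta> v w \<tau> k
  proof (intro corner_eigenfunctions.intro corner_Lipschitz.intro corner_domain.intro corner_disc.intro
      corner_disc_axioms.intro corner_domain_axioms.intro corner_Lipschitz_axioms.intro corner_eigenfunctions_axioms.intro cor h \<tau>)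
    show "open \<Omega>" "bounded \<Omega>" using Lip by (auto simp: bounded_Lipschitz_domain_def)
    show "\<Omega> \<inter> ball 0 h = corner.W \<theta>m \<theta>M \<inter> ball 0 h" using corner_at_0 by (simp add: W sector_disc_def)
    show "finite_measure (boundary_measure \<Omega>)" by (rule finite_boundary_measure[OF Lip])
    show "k > 0" by fact
  qed (use eig in \<open>auto simp: conductive_transmission_eigenfunctions_def\<close>)
  have S: "E.S = sector_disc \<theta>m \<theta>M h" by (simp add: E.S_def W sector_disc_def)
  obtain B where B: "AE x in boundary_measure \<Omega>. cmod (\<eta> x) \<le> B" using eta by (auto simp: ess_bounded_def)
  obtain C\<eta> where C\<eta>: "C\<eta> \<ge> 0" "\<And>x. x \<in> frontier (corner.W \<theta>m \<theta>M) \<Longrightarrow> x \<in> ball 0 h \<Longrightarrow> cmod (\<eta> x - \<eta> 0) \<le> C\<eta> * norm x powr \<alpha>"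
    using holder_corner[OF cor h assms(12,13)] by blast
  \<comment> \<open>\<open>holder_on\<close> includes boundedness, which becomes an almost
    everywhere bound for (1 + V) w on the sector disc.\<close>
  obtain f where f: "bounded (f ` closure E.S)" "AE x in lebesgue_on E.S. f x = (1 + V x) * w x"
    using qw unfolding S[symmetric] holder_on_def by blast
  obtain BF where BF: "\<And>x. x \<in> closure E.S \<Longrightarrow> cmod (f x) \<le> BF" using f(1) unfolding bounded_iff by blast
  \<comment> \<open>The bounds B and BF are only known to exist; \<open>max\<close> with 0 makes
    them nonnegative, as the locale requires.\<close>
  interpret corner_vanishing \<theta>m \<theta>M h \<Omega> V \<eta> v w \<tau> k \<alpha> "max B 0" C\<eta> "max BF 0"
  proof unfold_locales
    show "0 < \<alpha>" "\<alpha> \<le> 1" using \<alpha> by auto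
    show "\<eta> \<in> borel_measurable (boundary_measure \<Omega>)" using eta by (simp add: ess_bounded_def)
    show "AE x in boundary_measure \<Omega>. cmod (\<eta> x) \<le> max B 0" using B by eventually_elim simp
    show "AE x in lebesgue_on E.S. cmod ((1 + V x) * w x) \<le> max BF 0" using f(2) AE_space
    proof eventually_elim
      case (elim x)
      have "x \<in> E.S" using elim(2) E.S_simps(5) by simp
      then have "cmod (f x) \<le> BF" using BF closure_subset by blast
      then show ?case using elim(1) by simp
    qed
  qed (use C\<eta> in auto)
  show ?thesis
    by (rule mean_tendsto_0[OF \<open>C > 0\<close> \<open>\<Upsilon> > 0\<close> \<open>\<kappa> < 1\<close>]) (use assms(19-22) in \<open>simp_all add: S\<close>)
qed

end
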